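(* Let $\bar u\in\mathcal{U}_{ad}$ be a feasible point of (P) and $\bar y:=S(\bar u)$, such that $G'(\bar y)\in L^{\bar p}(\Omega)$ for some $\bar p>N$ and $\Sigma(\bar y)<\infty$. Assume further that there exists $\bar\varphi\in H^1_0(\Omega)\cap W^{1,\infty}(\Omega)$ such that $$-\operatorname{div}\left[(b+a(\bar y))\nabla\bar\varphi\right]+\mathbb{1}_{\{\bar y\notin E_a\}}a'(\bar y)\nabla\bar y\cdot\nabla\bar\varphi=G'(\bar y)\ \text{ in }\Omega,\qquad \bar\varphi=0\ \text{ on }\partial\Omega,$$ $$\int_\Omega(\bar\varphi+\nu\bar u)(u-\bar u)\,\mathrm{d}x\ge 0\quad\text{for all }u\in\mathcal{U}_{ad}.$$ Then the condition $$Q_s(\bar u,\bar y,\bar\varphi;h,h)+Q_1(\bar u,\bar y,\bar\varphi;h,h)+Q_2(\bar u,\bar y,\bar\varphi;h)>0\quad\text{for all }h\in\mathcal{C}(\mathcal{U}_{ad};\bar u)\setminus\{0\}$$ holds if and only if there exist constants $c_0,\tau>0$ such that $$Q_s(\bar u,\bar y,\bar\varphi;h,h)+Q_1(\bar u,\bar y,\bar\varphi;h,h)+Q_2(\bar u,\bar y,\bar\varphi;h)\ge c_0\|h\|_{L^2(\Omega)}^2\quad\text{for all }h\in\mathcal{C}^\tau(\mathcal{U}_{ad};\bar u),$$ where, with $\bar d:=\bar\varphi+\nu\bar u$, $\mathcal{C}^\tau(\mathcal{U}_{ad};\bar u)$ is the set of all $h\in L^2(\Omega)$ such that for a.e. $x\in\Omega$: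 $h(x)\ge0$ if $\bar u(x)=\alpha(x)$; $h(x)\le0$ if $\bar u(x)=\beta(x)$; and $h(x)=0$ if $|\bar d(x)|>\tau$.
   Context: Data: $N\in\{2,3\}$; $\Omega\subset\mathbb{R}^N$ is an open, convex, bounded domain. $b:\overline\Omega\to\mathbb{R}$ is Lipschitz continuous with $b\ge\underline{b}>0$ for a constant $\underline b$. $a:\mathbb{R}\to\mathbb{R}$ is non-negative and finitely $PC^2$: continuous, locally equal at every point to one of finitely many $C^2$-functions, with finite set $E_a=\{t_1<\dots<t_K\}$ of non-differentiability points; with $t_0:=-\infty$, $t_{K+1}:=+\infty$, $a(t)=\sum_{i=0}^K\mathbb{1}_{(t_i,t_{i+1}]}(t)a_i(t)$ (convention $(t,\infty]:=(t,\infty)$), where $a_i:\mathbb{R}\to\mathbb{R}$ are non-negative $C^2$-functions with $a_{i-1}(t_i)=a_i(t_i)$, $1\le i\le K$. $a'(t;h)$ is the directional derivative of $a$ at $t$ in direction $h$. Expressions such as $\mathbb{1}_{\{y\notin E_a\}}a'(y)$, $\mathbb{1}_{\{y\notin E_a\}}a''(y)$ are $0$ where $y\in E_a$ (and $a'=a_i'$, $a''=a_i''$ on $(t_i,t_{i+1})$). $G:H^1_0(\Omega)\to\mathbb{R}$ is of class $C^2$; $\nu>0$; $\alpha,\beta\in L^\infty(\Omega)$ with $\beta-\alpha\ge\gamma$ a.e. for some $\gamma>0$. "$G'(\bar y)\in L^{\bar p}(\Omega)$" means that the functional $G'(\bar y)\in H^{-1}(\Omega)$ is represented by an $L^{\bar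 p}$-function. Control-to-state operator: for $p>N$ and $u\in W^{-1,p}(\Omega)$, $S(u):=y_u\in W^{1,p}_0(\Omega)$ is the unique weak solution of $-\operatorname{div}[(b+a(y))\nabla y]=u$ in $\Omega$, $y=0$ on $\partial\Omega$. $S:W^{-1,p}(\Omega)\to W_0^{1,p}(\Omega)$ is Fréchet differentiable, and $z=S'(u)v$ is the unique weak solution in $W^{1,p}_0(\Omega)$ of $-\operatorname{div}[(b+a(y_u))\nabla z+\mathbb{1}_{\{y_u\notin E_a\}}a'(y_u)z\nabla y_u]=v$, $z=0$ on $\partial\Omega$. For $L^2$-arguments use $L^2(\Omega)\hookrightarrow W^{-1,p}(\Omega)$, $p\in(N,6)$. Problem (P): minimize $j(u):=G(S(u))+\frac\nu2\|u\|_{L^2(\Omega)}^2$ over $\mathcal{U}_{ad}:=\{u\in L^\infty(\Omega):\alpha\le u\le\beta\text{ a.e.}\}$. Critical cone: with $\bar d:=\bar\varphi+\nu\bar u$, $\mathcal{C}(\mathcal{U}_{ad};\bar u):=\{h\in\mathcal{T}(\mathcal{U}_{ad};\bar u):\int_\Omega\bar d\,h\,\mathrm{d}x=0\}$, where $\mathcal{T}(\mathcal{U}_{ad};\bar u)$ is the set of $v\in L^2(\Omega)$ for which there are $s_n\to0^+$, $v_n\to v$ in $L^2(\Omega)$ with $\bar u+s_nv_n\in\mathcal{U}_{ad}$ for all $n$. Jump functional: $\sigma_i:=|a_{i-1}'(t_i)-a_i'(t_i)|$, and for $y\in W^{1,1}(\Omega)$ $$\Sigma(y):=\limsup_{r\to0^+}\frac1r\sum_{m=1}^N\sum_{i=1}^K\sigma_i\int_\Omega\mathbb{1}_{\{0<|y-t_i|\le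 r\}}|\partial_{x_m}y|\,\mathrm{d}x\in[0,\infty].$$ Curvature functionals, for $(u,y,\varphi)\in L^2(\Omega)\times H^1(\Omega)\times W^{1,\infty}(\Omega)$ and $h,h_1,h_2\in L^2(\Omega)$: $$Q_s(u,y,\varphi;h_1,h_2):=\tfrac12G''(y)(S'(u)h_1,S'(u)h_2)+\tfrac\nu2\int_\Omega h_1h_2\,\mathrm{d}x-\tfrac12\int_\Omega\mathbb{1}_{\{y\notin E_a\}}a''(y)(S'(u)h_1)(S'(u)h_2)\nabla y\cdot\nabla\varphi\,\mathrm{d}x,$$ $$Q_1(u,y,\varphi;h_1,h_2):=-\tfrac12\int_\Omega\left[a'(y;S'(u)h_1)\nabla(S'(u)h_2)+a'(y;S'(u)h_2)\nabla(S'(u)h_1)\right]\cdot\nabla\varphi\,\mathrm{d}x.$$ Fix $\delta>0$ with $\delta\le(t_{i+1}-t_i)/2$ for all $1\le i\le K-1$. For $0\le i\le K$, $s\in\mathbb{R}$, put $y^{s,h}:=S(u+sh)$ and $$\zeta_i(u,y;s,h):=[a_{i-1}'(t_i)-a_i'(t_i)]\,\mathbb{1}_{\{y\in(t_i,t_i+\delta),\,y^{s,h}\in(t_i-\delta,t_i]\}}(t_i-y^{s,h})+[a_{i+1}'(t_{i+1})-a_i'(t_{i+1})]\,\mathbb{1}_{\{y\in(t_{i+1}-\delta,t_{i+1}),\,y^{s,h}\in[t_{i+1},t_{i+1}+\delta)\}}(t_{i+1}-y^{s,h}),$$ where terms involving $t_0=-\infty$ or $t_{K+1}=+\infty$ are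 $0$. With $c_0^+:=\{\{s_n\}\subset(0,\infty):s_n\to0\}$, $$\tilde Q(u,y,\varphi;\{s_n\},h):=\liminf_{n\to\infty}\frac1{s_n^2}\int_\Omega\sum_{i=0}^K\zeta_i(u,y;s_n,h)\nabla y\cdot\nabla\varphi\,\mathrm{d}x,\qquad Q_2(u,y,\varphi;h):=\inf_{\{s_n\}\in c_0^+}\tilde Q(u,y,\varphi;\{s_n\},h).$$ *)

theory Defs
  imports "HOL-Analysis.Analysis" "HOL-Library.Function_Algebras"
begin

section \<open>Functions as vectors\<close>

instantiation "fun" :: (type, real_vector) real_vector
begin

definition scaleR_fun :: "real \<Rightarrow> ('a \<Rightarrow> 'b) \<Rightarrow> 'a \<Rightarrow> 'b"
  where "scaleR_fun c f = (\<lambda>x. c *\<^sub>R f x)"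

instance
  by standard (simp_all add: scaleR_fun_def fun_eq_iff scaleR_right_distrib scaleR_left_distrib)

end

section \<open>Calculus on seminormed function spaces\<close>

text \<open>
  Lebesgue and Sobolev spaces over a domain are sets of functions with a seminorm; functions that
  agree almost everywhere have distance zero and stand for the same element. A map between two
  such spaces selects representatives, so linearity is required only up to elements of seminorm
  zero. A functional on \<open>X\<close> is a total function whose values outside \<open>X\<close> are irrelevant.
\<close>

definition bounded_linear_btw ::
    "'a::real_vector set \<Rightarrow> ('a \<Rightarrow> real) \<Rightarrow> 'b::real_vector set \<Rightarrow> ('b \<Rightarrow> real) \<Rightarrow> ('a \<Rightarrow> 'b) \<Rightarrow> bool"
  where "bounded_linear_btw X nX Y nY D \<longleftrightarrow>
     (\<forall>x\<in>X. D x \<in> Y) \<and>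
     (\<forall>x\<in>X. \<forall>z\<in>X. nY (D (x + z) - D x - D z) = 0) \<and>
     (\<forall>c. \<forall>x\<in>X. nY (D (c *\<^sub>R x) - c *\<^sub>R D x) = 0) \<and>
     (\<exists>C. \<forall>x\<in>X. nY (D x) \<le> C * nX x)"

definition op_norm :: "'a set \<Rightarrow> ('a \<Rightarrow> real) \<Rightarrow> ('b \<Rightarrow> real) \<Rightarrow> ('a \<Rightarrow> 'b) \<Rightarrow> real"
  where "op_norm X nX nY D = (SUP x\<in>{x\<in>X. nX x \<le> 1}. nY (D x))"

definition dual_space :: "'a::real_vector set \<Rightarrow> ('a \<Rightarrow> real) \<Rightarrow> ('a \<Rightarrow> real) set"
  where "dual_space X nX = {F. bounded_linear_btw X nX UNIV abs F}"

definition dual_norm :: "'a::real_vector set \<Rightarrow> ('a \<Rightarrow> real) \<Rightarrow> ('a \<Rightarrow> real) \<Rightarrow> real"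
  where "dual_norm X nX = op_norm X nX abs"

definition has_frechet_derivative ::
    "'a::real_vector set \<Rightarrow> ('a \<Rightarrow> real) \<Rightarrow> 'b::real_vector set \<Rightarrow> ('b \<Rightarrow> real) \<Rightarrow>
     ('a \<Rightarrow> 'b) \<Rightarrow> ('a \<Rightarrow> 'b) \<Rightarrow> 'a \<Rightarrow> bool"
  where "has_frechet_derivative X nX Y nY f D x \<longleftrightarrow>
     bounded_linear_btw X nX Y nY D \<and>
     (\<forall>\<epsilon>>0. \<exists>\<rho>>0. \<forall>h\<in>X. nX h < \<rho> \<longrightarrow> nY (f (x + h) - f x - D h) \<le> \<epsilon> * nX h)"

text \<open>\<open>G\<close> is of class \<open>C\<^sup>2\<close> on \<open>X\<close> with derivatives \<open>G'\<close> and \<open>G''\<close>; the second derivative at \<open>y\<close> is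
  the bounded linear map \<open>G'' y\<close> from \<open>X\<close> into its dual, so \<open>G'' y z w\<close> is its value at \<open>(z, w)\<close>.\<close>

definition C2_functional ::
    "'a::real_vector set \<Rightarrow> ('a \<Rightarrow> real) \<Rightarrow> ('a \<Rightarrow> real) \<Rightarrow> ('a \<Rightarrow> 'a \<Rightarrow> real) \<Rightarrow>
     ('a \<Rightarrow> 'a \<Rightarrow> 'a \<Rightarrow> real) \<Rightarrow> bool"
  where "C2_functional X nX G G' G'' \<longleftrightarrow>
     (\<forall>y\<in>X. has_frechet_derivative X nX UNIV abs G (G' y) y \<and>
            has_frechet_derivative X nX (dual_space X nX) (dual_norm X nX) G' (G'' y) y \<and>
            (\<forall>\<epsilon>>0. \<exists>\<rho>>0. \<forall>z\<in>X. nX (z - y) < \<rho> \<longrightarrow>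
               op_norm X nX (dual_norm X nX) (G'' z - G'' y) < \<epsilon>))"

section \<open>Lebesgue and Sobolev spaces\<close>

definition Lp :: "(real^'n) set \<Rightarrow> real \<Rightarrow> (real^'n \<Rightarrow> 'b::euclidean_space) set"
  where "Lp \<Omega> p = {f \<in> borel_measurable (lebesgue_on \<Omega>).
                    integrable (lebesgue_on \<Omega>) (\<lambda>x. norm (f x) powr p)}"

definition Lp_norm :: "(real^'n) set \<Rightarrow> real \<Rightarrow> (real^'n \<Rightarrow> 'b::euclidean_space) \<Rightarrow> real"
  where "Lp_norm \<Omega> p f = (LINT x|lebesgue_on \<Omega>. norm (f x) powr p) powr (1 / p)"

definition Linf :: "(real^'n) set \<Rightarrow> (real^'n \<Rightarrow> 'b::euclidean_space) set"
  where "Linf \<Omega> = {f \<in> borel_measurable (lebesgue_on \<Omega>).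
                    \<exists>C. AE x in lebesgue_on \<Omega>. norm (f x) \<le> C}"

definition partial_deriv :: "'n \<Rightarrow> (real^'n \<Rightarrow> real) \<Rightarrow> real^'n \<Rightarrow> real"
  where "partial_deriv i f x = frechet_derivative f (at x) (axis i 1)"

primrec C_k :: "nat \<Rightarrow> (real^'n \<Rightarrow> real) \<Rightarrow> bool"
  where
    "C_k 0 f = continuous_on UNIV f"
  | "C_k (Suc k) f = (f differentiable_on UNIV \<and> (\<forall>i. C_k k (partial_deriv i f)))"

definition test_functions :: "(real^'n) set \<Rightarrow> (real^'n \<Rightarrow> real) set"
  where "test_functions \<Omega> = {\<phi>. (\<forall>k. C_k k \<phi>) \<and>
           compact (closure {x. \<phi> x \<noteq> 0}) \<and> closure {x. \<phi> x \<noteq> 0} \<subseteq> \<Omega>}"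

definition has_weak_grad ::
    "(real^'n) set \<Rightarrow> (real^'n \<Rightarrow> real) \<Rightarrow> (real^'n \<Rightarrow> real^'n) \<Rightarrow> bool"
  where "has_weak_grad \<Omega> y g \<longleftrightarrow>
     (\<forall>C. compact C \<and> C \<subseteq> \<Omega> \<longrightarrow> y absolutely_integrable_on C \<and> g absolutely_integrable_on C) \<and>
     (\<forall>\<phi>\<in>test_functions \<Omega>. \<forall>i.
        (LINT x|lebesgue_on \<Omega>. y x * partial_deriv i \<phi> x) =
        - (LINT x|lebesgue_on \<Omega>. (g x $ i) * \<phi> x))"

text \<open>The weak gradient is unique up to null sets.\<close>

definition weak_grad :: "(real^'n) set \<Rightarrow> (real^'n \<Rightarrow> real) \<Rightarrow> real^'n \<Rightarrow> real^'n"
  where "weak_grad \<Omega> y = (SOME g. has_weak_grad \<Omega> y g)"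

definition W1p :: "(real^'n) set \<Rightarrow> real \<Rightarrow> (real^'n \<Rightarrow> real) set"
  where "W1p \<Omega> p = {y \<in> Lp \<Omega> p. \<exists>g\<in>Lp \<Omega> p. has_weak_grad \<Omega> y g}"

definition W1inf :: "(real^'n) set \<Rightarrow> (real^'n \<Rightarrow> real) set"
  where "W1inf \<Omega> = {y \<in> Linf \<Omega>. \<exists>g\<in>Linf \<Omega>. has_weak_grad \<Omega> y g}"

definition W1p_norm :: "(real^'n) set \<Rightarrow> real \<Rightarrow> (real^'n \<Rightarrow> real) \<Rightarrow> real"
  where "W1p_norm \<Omega> p y =
     ((LINT x|lebesgue_on \<Omega>. \<bar>y x\<bar> powr p) +
      (LINT x|lebesgue_on \<Omega>. norm (weak_grad \<Omega> y x) powr p)) powr (1 / p)"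

definition W01p :: "(real^'n) set \<Rightarrow> real \<Rightarrow> (real^'n \<Rightarrow> real) set"
  where "W01p \<Omega> p = {y \<in> W1p \<Omega> p.
     \<exists>\<phi> :: nat \<Rightarrow> real^'n \<Rightarrow> real. (\<forall>n. \<phi> n \<in> test_functions \<Omega>) \<and>
        (\<lambda>n. W1p_norm \<Omega> p (\<phi> n - y)) \<longlonglongrightarrow> 0}"

abbreviation H10 :: "(real^'n) set \<Rightarrow> (real^'n \<Rightarrow> real) set"
  where "H10 \<Omega> \<equiv> W01p \<Omega> 2"

abbreviation H1_norm :: "(real^'n) set \<Rightarrow> (real^'n \<Rightarrow> real) \<Rightarrow> real"
  where "H1_norm \<Omega> \<equiv> W1p_norm \<Omega> 2"

definition conj_exp :: "real \<Rightarrow> real"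
  where "conj_exp p = p / (p - 1)"

definition Wm1p :: "(real^'n) set \<Rightarrow> real \<Rightarrow> ((real^'n \<Rightarrow> real) \<Rightarrow> real) set"
  where "Wm1p \<Omega> p = dual_space (W01p \<Omega> (conj_exp p)) (W1p_norm \<Omega> (conj_exp p))"

definition Wm1p_norm :: "(real^'n) set \<Rightarrow> real \<Rightarrow> ((real^'n \<Rightarrow> real) \<Rightarrow> real) \<Rightarrow> real"
  where "Wm1p_norm \<Omega> p = dual_norm (W01p \<Omega> (conj_exp p)) (W1p_norm \<Omega> (conj_exp p))"

text \<open>The functional represented by a function, i.e.\ the embedding of \<open>L\<^sup>2\<close> into \<open>W\<^sup>-\<^sup>1\<^sup>,\<^sup>p\<close>.\<close>

definition fnl :: "(real^'n) set \<Rightarrow> (real^'n \<Rightarrow> real) \<Rightarrow> (real^'n \<Rightarrow> real) \<Rightarrow> real"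
  where "fnl \<Omega> u = (\<lambda>\<phi>. LINT x|lebesgue_on \<Omega>. u x * \<phi> x)"

section \<open>The nonlinearity\<close>

definition C2_real :: "(real \<Rightarrow> real) \<Rightarrow> bool"
  where "C2_real f \<longleftrightarrow> (\<forall>s. f field_differentiable at s) \<and>
     (\<forall>s. deriv f field_differentiable at s) \<and> continuous_on UNIV (deriv (deriv f))"

text \<open>The interval \<open>(t\<^sub>i, t\<^sub>i\<^sub>+\<^sub>1]\<close> for \<open>0 \<le> i \<le> K\<close>, with the lower end dropped for \<open>i = 0\<close> and the upper end
  dropped for \<open>i = K\<close>; only the values \<open>t 1, \<dots>, t K\<close> are used.\<close>

definition piece :: "nat \<Rightarrow> (nat \<Rightarrow> real) \<Rightarrow> nat \<Rightarrow> real set"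
  where "piece K t i = {s. (1 \<le> i \<longrightarrow> t i < s) \<and> (i < K \<longrightarrow> s \<le> t (i + 1))}"

definition kinks :: "nat \<Rightarrow> (nat \<Rightarrow> real) \<Rightarrow> real set"
  where "kinks K t = t ` {1..K}"

definition finitely_PC2 ::
    "nat \<Rightarrow> (nat \<Rightarrow> real) \<Rightarrow> (nat \<Rightarrow> real \<Rightarrow> real) \<Rightarrow> (real \<Rightarrow> real) \<Rightarrow> bool"
  where "finitely_PC2 K t ai a \<longleftrightarrow>
     (\<forall>i\<in>{1..<K}. t i < t (i + 1)) \<and>
     (\<forall>i\<le>K. C2_real (ai i) \<and> (\<forall>s. 0 \<le> ai i s)) \<and>
     (\<forall>i\<in>{1..K}. ai (i - 1) (t i) = ai i (t i)) \<and>
     (\<forall>s. a s = (\<Sum>i\<le>K. indicator (piece K t i) s * ai i s)) \<and>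
     continuous_on UNIV a \<and>
     {s. \<not> a differentiable at s} = kinks K t"

definition dir_deriv :: "(real \<Rightarrow> real) \<Rightarrow> real \<Rightarrow> real \<Rightarrow> real"
  where "dir_deriv a s h = Lim (at_right 0) (\<lambda>r. (a (s + r * h) - a s) / r)"

definition D1 :: "nat \<Rightarrow> (nat \<Rightarrow> real) \<Rightarrow> (real \<Rightarrow> real) \<Rightarrow> real \<Rightarrow> real"
  where "D1 K t a s = (if s \<in> kinks K t then 0 else deriv a s)"

definition D2 :: "nat \<Rightarrow> (nat \<Rightarrow> real) \<Rightarrow> (real \<Rightarrow> real) \<Rightarrow> real \<Rightarrow> real"
  where "D2 K t a s = (if s \<in> kinks K t then 0 else deriv (deriv a) s)"

section \<open>State and adjoint equation\<close>

definition weak_state_solution ::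
    "(real^'n) set \<Rightarrow> (real^'n \<Rightarrow> real) \<Rightarrow> (real \<Rightarrow> real) \<Rightarrow> real \<Rightarrow>
     ((real^'n \<Rightarrow> real) \<Rightarrow> real) \<Rightarrow> (real^'n \<Rightarrow> real) \<Rightarrow> bool"
  where "weak_state_solution \<Omega> b a p F y \<longleftrightarrow> y \<in> W01p \<Omega> p \<and>
     (\<forall>w\<in>W01p \<Omega> (conj_exp p).
        (LINT x|lebesgue_on \<Omega>. (b x + a (y x)) * (weak_grad \<Omega> y x \<bullet> weak_grad \<Omega> w x)) = F w)"

text \<open>\<open>S\<close> is the control-to-state operator from \<open>W\<^sup>-\<^sup>1\<^sup>,\<^sup>p\<close> to \<open>W\<^sub>0\<^sup>1\<^sup>,\<^sup>p\<close>: it maps each right-hand side to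
  the unique weak solution.\<close>

definition control_to_state ::
    "(real^'n) set \<Rightarrow> (real^'n \<Rightarrow> real) \<Rightarrow> (real \<Rightarrow> real) \<Rightarrow> real \<Rightarrow>
     (((real^'n \<Rightarrow> real) \<Rightarrow> real) \<Rightarrow> real^'n \<Rightarrow> real) \<Rightarrow> bool"
  where "control_to_state \<Omega> b a p S \<longleftrightarrow>
     (\<forall>F\<in>Wm1p \<Omega> p. weak_state_solution \<Omega> b a p F (S F) \<and>
        (\<forall>y. weak_state_solution \<Omega> b a p F y \<longrightarrow> (AE x in lebesgue_on \<Omega>. y x = S F x)))"

definition weak_adjoint_solution ::
    "(real^'n) set \<Rightarrow> (real^'n \<Rightarrow> real) \<Rightarrow> nat \<Rightarrow> (nat \<Rightarrow> real) \<Rightarrow> (real \<Rightarrow> real) \<Rightarrow>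
     (real^'n \<Rightarrow> real) \<Rightarrow> ((real^'n \<Rightarrow> real) \<Rightarrow> real) \<Rightarrow> (real^'n \<Rightarrow> real) \<Rightarrow> bool"
  where "weak_adjoint_solution \<Omega> b K t a y F \<phi> \<longleftrightarrow>
     \<phi> \<in> H10 \<Omega> \<and>
     (\<forall>w\<in>H10 \<Omega>.
        (LINT x|lebesgue_on \<Omega>. (b x + a (y x)) * (weak_grad \<Omega> \<phi> x \<bullet> weak_grad \<Omega> w x)) +
        (LINT x|lebesgue_on \<Omega>. D1 K t a (y x) * (weak_grad \<Omega> y x \<bullet> weak_grad \<Omega> \<phi> x) * w x) = F w)"

section \<open>Admissible controls and cones\<close>

definition Uad :: "(real^'n) set \<Rightarrow> (real^'n \<Rightarrow> real) \<Rightarrow> (real^'n \<Rightarrow> real) \<Rightarrow> (real^'n \<Rightarrow> real) set"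
  where "Uad \<Omega> \<alpha> \<beta> = {u \<in> Linf \<Omega>. AE x in lebesgue_on \<Omega>. \<alpha> x \<le> u x \<and> u x \<le> \<beta> x}"

definition tangent_cone ::
    "(real^'n) set \<Rightarrow> (real^'n \<Rightarrow> real) set \<Rightarrow> (real^'n \<Rightarrow> real) \<Rightarrow> (real^'n \<Rightarrow> real) set"
  where "tangent_cone \<Omega> U u = {v \<in> Lp \<Omega> 2.
     \<exists>(s :: nat \<Rightarrow> real) vn. (\<forall>n. 0 < s n) \<and> s \<longlonglongrightarrow> 0 \<and> (\<forall>n. vn n \<in> Lp \<Omega> 2) \<and>
        (\<lambda>n. Lp_norm \<Omega> 2 (vn n - v)) \<longlonglongrightarrow> 0 \<and> (\<forall>n. u + s n *\<^sub>R vn n \<in> U)}"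

definition critical_cone ::
    "(real^'n) set \<Rightarrow> (real^'n \<Rightarrow> real) set \<Rightarrow> (real^'n \<Rightarrow> real) \<Rightarrow> (real^'n \<Rightarrow> real) \<Rightarrow>
     (real^'n \<Rightarrow> real) set"
  where "critical_cone \<Omega> U u d = {h \<in> tangent_cone \<Omega> U u. (LINT x|lebesgue_on \<Omega>. d x * h x) = 0}"

definition extended_critical_cone ::
    "(real^'n) set \<Rightarrow> (real^'n \<Rightarrow> real) \<Rightarrow> (real^'n \<Rightarrow> real) \<Rightarrow> (real^'n \<Rightarrow> real) \<Rightarrow>
     (real^'n \<Rightarrow> real) \<Rightarrow> real \<Rightarrow> (real^'n \<Rightarrow> real) set"
  where "extended_critical_cone \<Omega> \<alpha> \<beta> u d \<tau> = {h \<in> Lp \<Omega> 2. AE x in lebesgue_on \<Omega>.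
     (u x = \<alpha> x \<longrightarrow> 0 \<le> h x) \<and> (u x = \<beta> x \<longrightarrow> h x \<le> 0) \<and> (\<bar>d x\<bar> > \<tau> \<longrightarrow> h x = 0)}"

section \<open>Jump and curvature functionals\<close>

definition jump :: "(nat \<Rightarrow> real) \<Rightarrow> (nat \<Rightarrow> real \<Rightarrow> real) \<Rightarrow> nat \<Rightarrow> real"
  where "jump t ai i = \<bar>deriv (ai (i - 1)) (t i) - deriv (ai i) (t i)\<bar>"

definition jump_functional ::
    "(real^'n) set \<Rightarrow> nat \<Rightarrow> (nat \<Rightarrow> real) \<Rightarrow> (nat \<Rightarrow> real \<Rightarrow> real) \<Rightarrow> (real^'n \<Rightarrow> real) \<Rightarrow> ennreal"
  where "jump_functional \<Omega> K t ai y =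
     Limsup (at_right (0::real)) (\<lambda>r. ennreal (1 / r) *
       (\<Sum>m\<in>UNIV. \<Sum>i=1..K. ennreal (jump t ai i) *
          (\<integral>\<^sup>+x. ennreal (indicator {x. 0 < \<bar>y x - t i\<bar> \<and> \<bar>y x - t i\<bar> \<le> r} x *
                        \<bar>weak_grad \<Omega> y x $ m\<bar>) \<partial>lebesgue_on \<Omega>)))"

text \<open>In the curvature functionals, \<open>z1\<close>, \<open>z2\<close> stand for \<open>S'(u)h\<^sub>1\<close>, \<open>S'(u)h\<^sub>2\<close>, where \<open>S' F\<close> is the derivative
  of \<open>S\<close> at the functional \<open>F\<close>.\<close>

definition Q_s ::
    "(real^'n) set \<Rightarrow> nat \<Rightarrow> (nat \<Rightarrow> real) \<Rightarrow> (real \<Rightarrow> real) \<Rightarrow> real \<Rightarrow>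
     ((real^'n \<Rightarrow> real) \<Rightarrow> (real^'n \<Rightarrow> real) \<Rightarrow> (real^'n \<Rightarrow> real) \<Rightarrow> real) \<Rightarrow>
     (((real^'n \<Rightarrow> real) \<Rightarrow> real) \<Rightarrow> ((real^'n \<Rightarrow> real) \<Rightarrow> real) \<Rightarrow> real^'n \<Rightarrow> real) \<Rightarrow>
     (real^'n \<Rightarrow> real) \<Rightarrow> (real^'n \<Rightarrow> real) \<Rightarrow> (real^'n \<Rightarrow> real) \<Rightarrow>
     (real^'n \<Rightarrow> real) \<Rightarrow> (real^'n \<Rightarrow> real) \<Rightarrow> real"
  where "Q_s \<Omega> K t a \<nu> G'' S' u y \<phi> h1 h2 =
     (let z1 = S' (fnl \<Omega> u) (fnl \<Omega> h1); z2 = S' (fnl \<Omega> u) (fnl \<Omega> h2) in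
      1 / 2 * G'' y z1 z2 + \<nu> / 2 * (LINT x|lebesgue_on \<Omega>. h1 x * h2 x)
      - 1 / 2 * (LINT x|lebesgue_on \<Omega>.
          D2 K t a (y x) * z1 x * z2 x * (weak_grad \<Omega> y x \<bullet> weak_grad \<Omega> \<phi> x)))"

definition Q_1 ::
    "(real^'n) set \<Rightarrow> (real \<Rightarrow> real) \<Rightarrow>
     (((real^'n \<Rightarrow> real) \<Rightarrow> real) \<Rightarrow> ((real^'n \<Rightarrow> real) \<Rightarrow> real) \<Rightarrow> real^'n \<Rightarrow> real) \<Rightarrow>
     (real^'n \<Rightarrow> real) \<Rightarrow> (real^'n \<Rightarrow> real) \<Rightarrow> (real^'n \<Rightarrow> real) \<Rightarrow>
     (real^'n \<Rightarrow> real) \<Rightarrow> (real^'n \<Rightarrow> real) \<Rightarrow> real"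
  where "Q_1 \<Omega> a S' u y \<phi> h1 h2 =
     (let z1 = S' (fnl \<Omega> u) (fnl \<Omega> h1); z2 = S' (fnl \<Omega> u) (fnl \<Omega> h2) in
      - 1 / 2 * (LINT x|lebesgue_on \<Omega>.
          (dir_deriv a (y x) (z1 x) *\<^sub>R weak_grad \<Omega> z2 x +
           dir_deriv a (y x) (z2 x) *\<^sub>R weak_grad \<Omega> z1 x) \<bullet> weak_grad \<Omega> \<phi> x))"

text \<open>\<open>zeta\<close> is the pointwise value of \<open>\<zeta>\<^sub>i\<close> as a function of \<open>y(x)\<close> and \<open>ys = y\<^sup>s\<^sup>,\<^sup>h(x)\<close>. The term at \<open>t\<^sub>0\<close>
  (\<open>i = 0\<close>) and the term at \<open>t\<^sub>K\<^sub>+\<^sub>1\<close> (\<open>i = K\<close>) are zero.\<close>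

definition zeta ::
    "nat \<Rightarrow> (nat \<Rightarrow> real) \<Rightarrow> (nat \<Rightarrow> real \<Rightarrow> real) \<Rightarrow> real \<Rightarrow> nat \<Rightarrow> real \<Rightarrow> real \<Rightarrow> real"
  where "zeta K t ai \<delta> i y ys =
     (if 1 \<le> i \<and> y \<in> {t i<..<t i + \<delta>} \<and> ys \<in> {t i - \<delta><..t i}
      then (deriv (ai (i - 1)) (t i) - deriv (ai i) (t i)) * (t i - ys) else 0) +
     (if i < K \<and> y \<in> {t (i + 1) - \<delta><..<t (i + 1)} \<and> ys \<in> {t (i + 1)..<t (i + 1) + \<delta>}
      then (deriv (ai (i + 1)) (t (i + 1)) - deriv (ai i) (t (i + 1))) * (t (i + 1) - ys) else 0)"

definition Q_tilde ::
    "(real^'n) set \<Rightarrow> nat \<Rightarrow> (nat \<Rightarrow> real) \<Rightarrow> (nat \<Rightarrow> real \<Rightarrow> real) \<Rightarrow> real \<Rightarrow>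
     (((real^'n \<Rightarrow> real) \<Rightarrow> real) \<Rightarrow> real^'n \<Rightarrow> real) \<Rightarrow>
     (real^'n \<Rightarrow> real) \<Rightarrow> (real^'n \<Rightarrow> real) \<Rightarrow> (real^'n \<Rightarrow> real) \<Rightarrow>
     (nat \<Rightarrow> real) \<Rightarrow> (real^'n \<Rightarrow> real) \<Rightarrow> ereal"
  where "Q_tilde \<Omega> K t ai \<delta> S u y \<phi> s h =
     liminf (\<lambda>n. ereal (1 / (s n)\<^sup>2 *
       (LINT x|lebesgue_on \<Omega>.
          (\<Sum>i\<le>K. zeta K t ai \<delta> i (y x) (S (fnl \<Omega> (u + s n *\<^sub>R h)) x)) *
          (weak_grad \<Omega> y x \<bullet> weak_grad \<Omega> \<phi> x))))"

definition Q_2 ::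
    "(real^'n) set \<Rightarrow> nat \<Rightarrow> (nat \<Rightarrow> real) \<Rightarrow> (nat \<Rightarrow> real \<Rightarrow> real) \<Rightarrow> real \<Rightarrow>
     (((real^'n \<Rightarrow> real) \<Rightarrow> real) \<Rightarrow> real^'n \<Rightarrow> real) \<Rightarrow>
     (real^'n \<Rightarrow> real) \<Rightarrow> (real^'n \<Rightarrow> real) \<Rightarrow> (real^'n \<Rightarrow> real) \<Rightarrow>
     (real^'n \<Rightarrow> real) \<Rightarrow> ereal"
  where "Q_2 \<Omega> K t ai \<delta> S u y \<phi> h =
     (INF s\<in>{s. (\<forall>n. 0 < s n) \<and> s \<longlonglongrightarrow> 0}. Q_tilde \<Omega> K t ai \<delta> S u y \<phi> s h)"

end

theory Submission
  imports Defs "HOL-Complex_Analysis.Great_Picard"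
begin

text \<open>
  Suppose the coercivity on the enlarged cones fails. Then there are \<open>h\<^sub>n\<close> of unit norm in the cone for \<open>\<tau> = 1/n\<close>
  whose total curvature is below \<open>1/n\<close>. The averages of \<open>h\<^sub>n\<close> over cubes converge uniformly along a subsequence
  (Arzela-Ascoli), and replacing a \<open>W\<^sub>0\<^sup>1\<^sup>,\<^sup>p\<close> function by its cube averages costs only a positive power of the
  side length; hence \<open>L\<^sup>2 \<rightarrow> W\<^sup>-\<^sup>1\<^sup>,\<^sup>p\<close> is compact, and \<open>z\<^sub>n = S'(u)h\<^sub>n\<close> converges in \<open>W\<^sub>0\<^sup>1\<^sup>,\<^sup>p\<close>, so uniformly.
  Nearly norm-minimal convex combinations of the tails of \<open>h\<^sub>n\<close> converge in \<open>L\<^sup>2\<close> to some \<open>g\<close> of norm at most 1, which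
  lies in the critical cone because each enlarged cone is convex, and \<open>z\<^sub>n\<close> converges to \<open>S'(u)g\<close>.
  Apart from \<open>\<nu>/2 \<bar>h\<bar>\<^sup>2\<close> the total curvature depends on \<open>h\<close> only through \<open>S'(u)h\<close>, and continuously so: for \<open>Q\<^sub>2\<close> this
  is a Lipschitz estimate that uses the finite jump functional. The limit is that the curvature at \<open>g\<close> is at most
  \<open>0\<close>, so \<open>g = 0\<close>; but then \<open>\<nu>/2 \<le> 0\<close>.
\<close>

section \<open>Smooth bump functions\<close>

text \<open>The obstacle is \<open>Q_2\<close>: an infimum of lower limits along null sequences, not
  a quadratic form, whose finiteness and continuity are not evident, so lower semicontinuity of
  quadratic forms does not apply. What survives is homogeneity of degree two under positive factors,
  and the bound \<open>C * nm (z h - z k) * (nm (z h) + nm (z k))\<close> for the difference of two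
  values. The remaining terms satisfy the same bound, and it vanishes when two linearised states
  agree up to seminorm zero, so the representatives that \<open>S'\<close> selects do not matter.
  For \<open>Q_2\<close> the bound needs supremum estimates, which rest on p > N: a perturbed state
  crosses a kink only where \<open>ybar\<close> is within O(s) of it, and this is where the jump
  functional measures. The restriction p < 6 keeps the exponent of the averaging error \<epsilon>^(1
  - \<theta>) positive in dimension 3, where \<theta> = N (1/2 - 1/p). Homogeneity serves to
  normalise the contradicting sequence; the norm of the limit is only bounded above, which is the
  direction in which the Tikhonov term enters.\<close>

lemma C_k_SucD: "C_k (Suc k) f \<Longrightarrow> C_k k f"
proof (induction k arbitrary: f)
  case 0
  then show ?case by (simp add: differentiable_imp_continuous_on)
next
  case (Suc k)
  then show ?case by (metis C_k.simps(2))
qed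

lemma C_k_imp_continuous: "C_k k f \<Longrightarrow> continuous_on UNIV f"
  by (cases k) (simp_all add: differentiable_imp_continuous_on)

lemma partial_deriv_eqI: "(f has_derivative D) (at x) \<Longrightarrow> partial_deriv i f x = D (axis i 1)"
  unfolding partial_deriv_def by (metis frechet_derivative_at)

lemma partial_deriv_eq:
  assumes "\<And>x. (f has_derivative D x) (at x)"
  shows "partial_deriv i f = (\<lambda>x. D x (axis i 1))"
  using partial_deriv_eqI[OF assms] by auto

lemma C_k_const: "C_k k (\<lambda>_. c)"
proof (induction k arbitrary: c)
  case (Suc k)
  have "partial_deriv i (\<lambda>_. c) = (\<lambda>_. 0)" for i :: 'a
    by (rule partial_deriv_eq) (rule has_derivative_const)
  then show ?case using Suc by simp
qed simp

lemma C_k_add: "C_k k f \<Longrightarrow> C_k k g \<Longrightarrow> C_k k (\<lambda>x. f x + g x)"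
proof (induction k arbitrary: f g)
  case (Suc k)
  have d: "(f has_derivative frechet_derivative f (at x)) (at x)"
       "(g has_derivative frechet_derivative g (at x)) (at x)" for x
    using Suc.prems by (auto simp: frechet_derivative_works[symmetric] differentiable_on_def)
  have "partial_deriv i (\<lambda>x. f x + g x) = (\<lambda>x. partial_deriv i f x + partial_deriv i g x)" for i
    unfolding partial_deriv_def[of i f] partial_deriv_def[of i g]
    by (rule partial_deriv_eq) (intro has_derivative_add d)
  then show ?case using Suc by (auto intro: differentiable_on_add)
qed (auto intro: continuous_on_add)

lemma C_k_mult: "C_k k f \<Longrightarrow> C_k k g \<Longrightarrow> C_k k (\<lambda>x. f x * g x)"
proof (induction k arbitrary: f g)
  case (Suc k)
  have d: "(f has_derivative frechet_derivative f (at x)) (at x)"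
       "(g has_derivative frechet_derivative g (at x)) (at x)" for x
    using Suc.prems by (auto simp: frechet_derivative_works[symmetric] differentiable_on_def)
  have "partial_deriv i (\<lambda>x. f x * g x) = (\<lambda>x. f x * partial_deriv i g x + partial_deriv i f x * g x)" for i
    unfolding partial_deriv_def[of i f] partial_deriv_def[of i g]
    by (rule partial_deriv_eq) (intro has_derivative_mult d)
  moreover have "C_k k f" "C_k k g"
    using Suc.prems by (auto dest: C_k_SucD simp del: C_k.simps)
  ultimately show ?case using Suc by (auto intro: differentiable_on_mult intro!: C_k_add)
qed (auto intro: continuous_on_mult)

lemma C_k_prod: "finite A \<Longrightarrow> (\<And>i. i \<in> A \<Longrightarrow> C_k k (f i)) \<Longrightarrow> C_k k (\<lambda>x. \<Prod>i\<in>A. f i x)"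
  by (induction A rule: finite_induct) (auto intro: C_k_const C_k_mult)

text \<open>These functions are closed under differentiation, which gives smoothness of all orders at once.\<close>

definition flat :: "real poly \<Rightarrow> real \<Rightarrow> real"
  where "flat P s = (if s \<le> 0 then 0 else poly P (1 / s) * exp (- (1 / s)))"

text \<open>In the variable u = 1/s the derivative of P(u) exp(-u) with respect to s is u^2 (P -
  P')(u) exp(-u); the factor \<open>[:0, 0, 1:]\<close> is the polynomial u^2, which comes from
  du/ds = -u^2.\<close>

definition flat_deriv :: "real poly \<Rightarrow> real poly"
  where "flat_deriv P = [:0, 0, 1:] * (P - pderiv P)"

lemma poly_times_exp_minus_tendsto: "((\<lambda>u. poly P u * exp (- u)) \<longlongrightarrow> (0::real)) at_top"
proof -
  have "((\<lambda>u. \<Sum>i\<le>degree P. coeff P i * (u ^ i / exp u)) \<longlongrightarrow> (\<Sum>i\<le>degree P. coeff P i * 0)) at_top"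
    by (intro tendsto_intros tendsto_power_div_exp_0)
  moreover have "(\<lambda>u. \<Sum>i\<le>degree P. coeff P i * (u ^ i / exp u)) = (\<lambda>u. poly P u * exp (- u))"
    by (auto simp: poly_altdef exp_minus field_simps sum_distrib_right sum_divide_distrib)
  ultimately show ?thesis by simp
qed

lemma flat_has_derivative: "(flat P has_real_derivative flat (flat_deriv P) s) (at s)"
proof -
  consider "s < 0" | "s = 0" | "s > 0" by linarith
  then show ?thesis
  proof cases
    case 1
    have "((\<lambda>_. 0) has_real_derivative 0) (at s)" by simp
    then have "(flat P has_real_derivative 0) (at s)"
      by (rule has_field_derivative_transform_within_open[of _ _ _ "{..<0}"])
         (use 1 in \<open>auto simp: flat_def\<close>)
    then show ?thesis using 1 by (simp add: flat_def)
  next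
    case 3
    have "((\<lambda>s. poly P (1 / s) * exp (- (1 / s))) has_real_derivative
        flat (flat_deriv P) s) (at s)"
      by (rule derivative_eq_intros DERIV_cong poly_DERIV | use 3 in \<open>force\<close>)+
         (use 3 in \<open>simp add: flat_def flat_deriv_def field_simps power2_eq_square\<close>)
    then show ?thesis
      by (rule has_field_derivative_transform_within_open[of _ _ _ "{0<..}"])
         (use 3 in \<open>auto simp: flat_def\<close>)
  next
    case 2
    \<comment> \<open>Dividing by h multiplies the polynomial in 1/h by one more factor 1/h, hence
      \<open>pCons 0 P\<close>; the exponential beats every power.\<close>
    have "((\<lambda>h. (poly (pCons 0 P) (inverse h) * exp (- inverse h))) \<longlongrightarrow> 0) (at_right (0::real))"
      by (rule filterlim_compose[OF poly_times_exp_minus_tendsto filterlim_inverse_at_top_right])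
    then have "((\<lambda>h. flat P h / h) \<longlongrightarrow> 0) (at_right 0)"
      by (rule Lim_transform_eventually)
         (auto simp: eventually_at_right_less flat_def divide_simps intro!: eventually_at_rightI[of 0 1])
    moreover have "((\<lambda>h. flat P h / h) \<longlongrightarrow> 0) (at_left 0)"
      by (rule Lim_transform_eventually[OF tendsto_const])
         (auto simp: flat_def intro!: eventually_at_leftI[of "-1"])
    ultimately have "((\<lambda>h. flat P h / h) \<longlongrightarrow> 0) (at 0)"
      by (simp add: filterlim_at_split)
    then show ?thesis using 2 by (simp add: DERIV_def flat_def)
  qed
qed

lemma flat_bounds: "0 \<le> flat 1 s" "flat 1 s \<le> 1"
  by (auto simp: flat_def)

text \<open>Stretching makes the profile exp(-1/s) rise to 1 at each positive s, so the Heaviside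
  function is reached in the limit without building a profile that has a plateau.\<close>

lemma flat_scale_tendsto: "(\<lambda>k. flat 1 (real (Suc k) * s)) \<longlonglongrightarrow> (if 0 < s then 1 else 0)"
proof (cases "0 < s")
  case True
  have "(\<lambda>k. exp (- ((1 / s) * (1 / real (Suc k))))) \<longlonglongrightarrow> exp (- ((1 / s) * 0))"
    by (intro tendsto_intros LIMSEQ_Suc[OF lim_1_over_n])
  moreover have "flat 1 (real (Suc k) * s) = exp (- ((1 / s) * (1 / real (Suc k))))" for k
    using True by (simp add: flat_def mult_pos_pos not_le mult.commute del: of_nat_Suc)
  ultimately show ?thesis using True by simp
next
  case False
  then have "flat 1 (real (Suc k) * s) = 0" for k
    by (simp add: flat_def mult_nonneg_nonpos del: of_nat_Suc)
  then show ?thesis using False by simp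
qed

lemma C_k_flat: "C_k k (\<lambda>x::real^'n. flat P (c * x $ i + d))"
proof (induction k arbitrary: P)
  case 0
  have "continuous_on UNIV (flat P)"
    using flat_has_derivative by (meson DERIV_continuous_on has_field_derivative_at_within)
  then have "continuous_on UNIV (flat P \<circ> (\<lambda>x::real^'n. c * x $ i + d))"
    by (intro continuous_on_compose continuous_intros) (auto intro: continuous_on_subset)
  then show ?case by (simp add: o_def)
next
  case (Suc k)
  have D: "((\<lambda>x::real^'n. flat P (c * x $ i + d)) has_derivative
          (\<lambda>v. flat (flat_deriv P) (c * x $ i + d) * (c * v $ i))) (at x)" for x
  proof -
    have "((\<lambda>x::real^'n. c * x $ i + d) has_derivative (\<lambda>v. c * v $ i)) (at x)"
      by (rule derivative_eq_intros bounded_linear_imp_has_derivative[OF bounded_linear_vec_nth] refl)+ simp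
    then have "(flat P \<circ> (\<lambda>x::real^'n. c * x $ i + d) has_derivative
        (\<lambda>y. flat (flat_deriv P) (c * x $ i + d) * y) \<circ> (\<lambda>v. c * v $ i)) (at x)"
      by (intro diff_chain_at) (auto simp: has_field_derivative_imp_has_derivative flat_has_derivative)
    then show ?thesis by (simp add: o_def)
  qed
  have "partial_deriv j (\<lambda>x::real^'n. flat P (c * x $ i + d)) =
      (\<lambda>x. c * axis j 1 $ i * flat (flat_deriv P) (c * x $ i + d))" for j
    using partial_deriv_eq[OF D] by (simp add: mult_ac)
  moreover have "(\<lambda>x::real^'n. flat P (c * x $ i + d)) differentiable_on UNIV"
    using D by (auto simp: differentiable_on_def differentiable_def)
  ultimately show ?case using Suc by (auto intro!: C_k_mult C_k_const)
qed

text \<open>A product of one-sided profiles, two per coordinate. The values stay below 1 even inside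
  the box; pointwise convergence to the indicator under the bound 1 is what dominated convergence
  asks for.\<close>

definition box_bump :: "nat \<Rightarrow> real^'n \<Rightarrow> real^'n \<Rightarrow> real^'n \<Rightarrow> real"
  where "box_bump k a b x =
    (\<Prod>i\<in>UNIV. flat 1 (real (Suc k) * (x $ i - a $ i)) * flat 1 (real (Suc k) * (b $ i - x $ i)))"

lemma box_bump_bounds: "0 \<le> box_bump k a b x" "box_bump k a b x \<le> 1"
  unfolding box_bump_def
  by (auto intro!: prod_nonneg prod_le_1 mult_nonneg_nonneg mult_le_one simp: flat_bounds)

lemma box_bump_outside: "x \<notin> box a b \<Longrightarrow> box_bump k a b x = 0"
proof -
  assume "x \<notin> box a b"
  then obtain i where "x $ i - a $ i \<le> 0 \<or> b $ i - x $ i \<le> 0"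
    by (force simp: mem_box_cart not_less)
  then have "flat 1 (real (Suc k) * (x $ i - a $ i)) * flat 1 (real (Suc k) * (b $ i - x $ i)) = 0"
    using mult_nonneg_nonpos[of "real (Suc k)"] by (auto simp: flat_def simp del: of_nat_Suc)
  then show ?thesis
    unfolding box_bump_def by (intro prod_zero) auto
qed

lemma box_bump_tendsto: "(\<lambda>k. box_bump k a b x) \<longlonglongrightarrow> indicator (box a b) x"
proof -
  have "(\<lambda>k. box_bump k a b x) \<longlonglongrightarrow>
    (\<Prod>i\<in>UNIV. (if 0 < x $ i - a $ i then 1 else 0) * (if 0 < b $ i - x $ i then 1 else 0))"
    unfolding box_bump_def by (intro tendsto_intros flat_scale_tendsto)
  also have "(\<Prod>i\<in>UNIV. (if 0 < x $ i - a $ i then 1 else 0) * (if 0 < b $ i - x $ i then 1 else 0)) =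
     (indicator (box a b) x :: real)"
    by (auto simp: indicator_def mem_box_cart intro!: prod.neutral prod_zero)
  finally show ?thesis .
qed

lemma box_bump_test_function:
  assumes "cbox a b \<subseteq> \<Omega>"
  shows "box_bump k a b \<in> test_functions \<Omega>"
proof -
  have "C_k m (box_bump k a b)" for m
  proof -
    have *: "flat 1 (real (Suc k) * (x $ i - a $ i)) = flat 1 (real (Suc k) * x $ i + - (real (Suc k) * a $ i))"
         "flat 1 (real (Suc k) * (b $ i - x $ i)) = flat 1 (- real (Suc k) * x $ i + real (Suc k) * b $ i)" for x i
      by (simp_all add: algebra_simps)
    show ?thesis
      unfolding box_bump_def[abs_def] * by (intro C_k_prod C_k_mult C_k_flat) auto
  qed
  moreover have sub: "{x. box_bump k a b x \<noteq> 0} \<subseteq> cbox a b"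
    using box_bump_outside box_subset_cbox by blast
  then have "closure {x. box_bump k a b x \<noteq> 0} \<subseteq> cbox a b"
    by (rule closure_minimal[OF _ closed_cbox])
  ultimately show ?thesis
    using assms sub unfolding test_functions_def
    by (auto simp: compact_closure intro: bounded_subset[OF bounded_cbox])
qed

section \<open>Linear structure of the test functions\<close>

lemma test_function_add:
  assumes "\<phi> \<in> test_functions \<Omega>" "\<psi> \<in> test_functions \<Omega>"
  shows "\<phi> + \<psi> \<in> test_functions \<Omega>"
proof -
  have "{x. (\<phi> + \<psi>) x \<noteq> 0} \<subseteq> {x. \<phi> x \<noteq> 0} \<union> {x. \<psi> x \<noteq> 0}" by auto
  then have sub: "closure {x. (\<phi> + \<psi>) x \<noteq> 0} \<subseteq> closure {x. \<phi> x \<noteq> 0} \<union> closure {x. \<psi> x \<noteq> 0}"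
    by (metis closure_Un closure_mono)
  moreover have "compact (closure {x. \<phi> x \<noteq> 0} \<union> closure {x. \<psi> x \<noteq> 0})"
    using assms by (auto simp: test_functions_def)
  ultimately have "compact (closure {x. (\<phi> + \<psi>) x \<noteq> 0})"
    by (metis bounded_subset compact_closure compact_imp_bounded closure_closure)
  moreover have "C_k k (\<phi> + \<psi>)" for k
    using assms C_k_add[of k \<phi> \<psi>] by (auto simp: test_functions_def plus_fun_def)
  ultimately show ?thesis using sub assms by (auto simp: test_functions_def)
qed

lemma test_function_scaleR:
  assumes "\<phi> \<in> test_functions \<Omega>"
  shows "c *\<^sub>R \<phi> \<in> test_functions \<Omega>"
proof -
  have "{x. (c *\<^sub>R \<phi>) x \<noteq> 0} \<subseteq> {x. \<phi> x \<noteq> 0}" by (auto simp: scaleR_fun_def)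
  then have sub: "closure {x. (c *\<^sub>R \<phi>) x \<noteq> 0} \<subseteq> closure {x. \<phi> x \<noteq> 0}"
    by (rule closure_mono)
  moreover have "compact (closure {x. \<phi> x \<noteq> 0})"
    using assms by (auto simp: test_functions_def)
  ultimately have "compact (closure {x. (c *\<^sub>R \<phi>) x \<noteq> 0})"
    by (metis bounded_subset compact_closure compact_imp_bounded closure_closure)
  moreover have "C_k k (c *\<^sub>R \<phi>)" for k
    using assms C_k_mult[OF C_k_const, of k \<phi> c] by (auto simp: test_functions_def scaleR_fun_def)
  ultimately show ?thesis using sub assms by (auto simp: test_functions_def)
qed

section \<open>Weak gradients of test functions\<close>

lemma integrable_compact_support:
  fixes f :: "'a::euclidean_space \<Rightarrow> real"
  assumes "continuous_on UNIV f" "compact K" "\<And>x. x \<notin> K \<Longrightarrow> f x = 0"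
  shows "integrable lborel f"
proof -
  have "integrable lborel (\<lambda>x. indicator K x *\<^sub>R f x)"
    using assms by (intro borel_integrable_compact) (auto intro: continuous_on_subset)
  also have "(\<lambda>x. indicator K x *\<^sub>R f x) = f"
    using assms(3) by (auto simp: indicator_def fun_eq_iff)
  finally show ?thesis .
qed

lemma bounded_compact_support:
  fixes f :: "'a::euclidean_space \<Rightarrow> real"
  assumes "continuous_on UNIV f" "compact K" "\<And>x. x \<notin> K \<Longrightarrow> f x = 0"
  obtains M where "0 \<le> M" "\<And>x. \<bar>f x\<bar> \<le> M"
proof -
  have "compact (f ` K)"
    using assms by (intro compact_continuous_image) (auto intro: continuous_on_subset)
  then obtain M where "\<And>y. y \<in> f ` K \<Longrightarrow> norm y \<le> M"
    using compact_imp_bounded bounded_iff by metis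
  then have "\<bar>f x\<bar> \<le> max M 0" for x
    using assms(3)[of x] by (cases "x \<in> K") force+
  then show ?thesis using that[of "max M 0"] by simp
qed

lemma zero_outside_support: "x \<notin> closure {x. f x \<noteq> 0} \<Longrightarrow> f x = 0"
  using closure_subset[of "{x. f x \<noteq> 0}"] by auto

lemma partial_deriv_outside:
  assumes "x \<notin> closure {x. f x \<noteq> 0}"
  shows "partial_deriv i f x = 0"
proof -
  have "(f has_derivative (\<lambda>_. 0)) (at x)"
  proof (rule has_derivative_transform_within_open)
    show "((\<lambda>_. 0) has_derivative (\<lambda>_. 0)) (at x)" by (rule has_derivative_const)
    show "open (- closure {x. f x \<noteq> 0})" by (simp add: open_Compl)
    show "x \<in> - closure {x. f x \<noteq> 0}" using assms by simp
    show "0 = f y" if "y \<in> - closure {x. f x \<noteq> 0}" for y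
      using that zero_outside_support[of y f] by simp
  qed
  then show ?thesis by (metis partial_deriv_eqI)
qed

definition grad :: "(real^'n \<Rightarrow> real) \<Rightarrow> real^'n \<Rightarrow> real^'n"
  where "grad f x = (\<chi> i. partial_deriv i f x)"

lemma grad_has_derivative:
  assumes "f differentiable (at x)"
  shows "(f has_derivative (\<lambda>v. grad f x \<bullet> v)) (at x)"
proof -
  let ?D = "frechet_derivative f (at x)"
  have D: "(f has_derivative ?D) (at x)"
    using assms by (simp add: frechet_derivative_works)
  then interpret bounded_linear ?D by (rule has_derivative_bounded_linear)
  have "?D v = grad f x \<bullet> v" for v
  proof -
    have "?D v = ?D (\<Sum>i\<in>UNIV. v $ i *\<^sub>R axis i 1)"
      using basis_expansion[of v] by (simp add: scalar_mult_eq_scaleR)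
    also have "\<dots> = (\<Sum>i\<in>UNIV. v $ i * partial_deriv i f x)"
      by (simp add: sum scaleR partial_deriv_def)
    finally show ?thesis by (simp add: grad_def inner_vec_def mult.commute)
  qed
  then have "?D = (\<lambda>v. grad f x \<bullet> v)" by auto
  then show ?thesis using D by simp
qed

lemma C_1_differentiable: "C_k (Suc k) f \<Longrightarrow> f differentiable (at x)"
  by (auto simp: differentiable_on_def)

lemma C_1_continuous_partial: "C_k (Suc k) f \<Longrightarrow> continuous_on UNIV (partial_deriv i f)"
  by (auto intro: C_k_imp_continuous)

lemma continuous_grad: "C_k (Suc k) f \<Longrightarrow> continuous_on UNIV (grad f)"
  unfolding grad_def[abs_def] by (intro continuous_on_vec_lambda C_1_continuous_partial)

section \<open>Integration by parts on the whole space\<close>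

lemma integral_translate:
  fixes f :: "'a::euclidean_space \<Rightarrow> real"
  assumes [measurable]: "f \<in> borel_measurable borel"
  shows "(LINT x|lborel. f (x + c)) = (LINT x|lborel. f x)"
proof -
  have "(LINT x|lborel. f x) = (LINT x|distr lborel borel ((+) c). f x)"
    by (simp add: lborel_distr_plus)
  also have "\<dots> = (LINT x|lborel. f (c + x))"
    by (rule integral_distr) auto
  finally show ?thesis by (simp add: add.commute)
qed

lemma nn_integral_translate:
  fixes f :: "'a::euclidean_space \<Rightarrow> ennreal"
  assumes [measurable]: "f \<in> borel_measurable borel"
  shows "(\<integral>\<^sup>+x. f (x + c) \<partial>lborel) = (\<integral>\<^sup>+x. f x \<partial>lborel)"
proof -
  have "(\<integral>\<^sup>+x. f x \<partial>lborel) = (\<integral>\<^sup>+x. f x \<partial>distr lborel borel ((+) c))"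
    by (simp add: lborel_distr_plus)
  also have "\<dots> = (\<integral>\<^sup>+x. f (c + x) \<partial>lborel)"
    by (rule nn_integral_distr) auto
  finally show ?thesis by (simp add: add.commute)
qed

text \<open>Difference quotients have integral zero by translation invariance of Lebesgue measure,
  and dominated convergence carries this over to the derivative; no iterated integration along lines
  is involved.\<close>

lemma integral_partial_deriv_eq_0:
  fixes f :: "real^'n \<Rightarrow> real"
  assumes C1: "C_k (Suc k) f" and K: "compact (closure {x. f x \<noteq> 0})"
  shows "(LINT x|lborel. partial_deriv i f x) = 0"
proof -
  let ?K = "closure {x. f x \<noteq> 0}"
  have f0: "f x = 0" if "x \<notin> ?K" for x :: "real^'n"
    using that by (rule zero_outside_support)
  have cf: "continuous_on UNIV f" using C1 by (rule C_k_imp_continuous)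
  then have [measurable]: "f \<in> borel_measurable borel"
    by (rule borel_measurable_continuous_onI)
  have cp: "continuous_on UNIV (partial_deriv i f)" using C1 by (rule C_1_continuous_partial)
  obtain M where M: "0 \<le> M" "\<And>x. \<bar>partial_deriv i f x\<bar> \<le> M"
    using bounded_compact_support[OF cp K partial_deriv_outside] by metis
  have deriv: "((\<lambda>s. f (x + s *\<^sub>R axis i 1)) has_real_derivative partial_deriv i f (x + s *\<^sub>R axis i 1)) (at s)" for x s
  proof -
    have "(f has_derivative (\<lambda>v. grad f (x + s *\<^sub>R axis i 1) \<bullet> v)) (at (x + s *\<^sub>R axis i 1))"
      by (intro grad_has_derivative C_1_differentiable[OF C1])
    moreover have "((\<lambda>s. x + s *\<^sub>R axis i (1::real)) has_derivative (\<lambda>r. r *\<^sub>R axis i 1)) (at s)"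
      by (auto intro!: derivative_eq_intros)
    ultimately have "(f \<circ> (\<lambda>s. x + s *\<^sub>R axis i 1) has_derivative
        (\<lambda>v. grad f (x + s *\<^sub>R axis i 1) \<bullet> v) \<circ> (\<lambda>r. r *\<^sub>R axis i 1)) (at s)"
      by (rule diff_chain_at[rotated])
    then show ?thesis
      by (simp add: o_def has_field_derivative_def grad_def inner_axis mult_commute_abs)
  qed
  let ?F = "\<lambda>n x. real (Suc n) * (f (x + (1 / real (Suc n)) *\<^sub>R axis i 1) - f x)"
  have int_f: "integrable lborel f" by (rule integrable_compact_support[OF cf K f0])
  have int_ft: "integrable lborel (\<lambda>x. f (x + c))" for c
  proof (rule integrable_compact_support)
    show "continuous_on UNIV (\<lambda>x. f (x + c))"
      using cf by (auto intro!: continuous_on_compose2[of UNIV f] continuous_intros)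
    show "compact ((\<lambda>x. - c + x) ` ?K)" using K by (rule compact_translation)
    show "f (x + c) = 0" if "x \<notin> (\<lambda>x. - c + x) ` ?K" for x
      by (rule f0) (use that in \<open>force simp: image_iff\<close>)
  qed
  have zero: "(LINT x|lborel. ?F n x) = 0" for n
    using int_f int_ft[of "(1 / real (Suc n)) *\<^sub>R axis i 1"] integral_translate[of f "(1 / real (Suc n)) *\<^sub>R axis i 1"]
    by simp
  \<comment> \<open>The closed 1-neighbourhood of the support: the step sizes 1/(n+1) are at most 1,
    so all difference quotients live there, and a multiple of its indicator dominates them.\<close>
  define K' where "K' = {x + y | x y. x \<in> ?K \<and> y \<in> cball (0::real^'n) 1}"
  have K': "compact K'" unfolding K'_def using compact_sums[OF K compact_cball] .
  have bound: "norm (?F n x) \<le> indicator K' x * M" for n x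
  proof -
    let ?h = "1 / real (Suc n)"
    have h: "0 < ?h" "?h \<le> 1" by auto
    show ?thesis
    proof (cases "x \<in> K'")
      case True
      have "norm (f (x + ?h *\<^sub>R axis i 1) - f (x + 0 *\<^sub>R axis i 1)) \<le> M * norm (?h - 0)"
      proof (rule field_differentiable_bound[where S=UNIV and f="\<lambda>s. f (x + s *\<^sub>R axis i 1)"])
        show "((\<lambda>s. f (x + s *\<^sub>R axis i 1)) has_real_derivative partial_deriv i f (x + s *\<^sub>R axis i 1)) (at s within UNIV)" for s
          using deriv by simp
      qed (use M in auto)
      then have "\<bar>f (x + ?h *\<^sub>R axis i 1) - f x\<bar> \<le> M * ?h" by simp
      then have "real (Suc n) * \<bar>f (x + ?h *\<^sub>R axis i 1) - f x\<bar> \<le> real (Suc n) * (M * ?h)"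
        by (intro mult_left_mono) auto
      then show ?thesis using True by (simp add: abs_mult del: of_nat_Suc)
    next
      case False
      have "x \<notin> ?K" using False unfolding K'_def by force
      moreover have "x + ?h *\<^sub>R axis i 1 \<notin> ?K"
      proof
        assume "x + ?h *\<^sub>R axis i 1 \<in> ?K"
        moreover have "- (?h *\<^sub>R axis i 1) \<in> cball (0::real^'n) 1"
          using h by (simp add: norm_axis_1)
        moreover have "x = (x + ?h *\<^sub>R axis i 1) + - (?h *\<^sub>R axis i 1)" by simp
        ultimately show False using False unfolding K'_def by blast
      qed
      ultimately have "f x = 0" "f (x + ?h *\<^sub>R axis i 1) = 0" using f0 by blast+
      then show ?thesis using False by simp
    qed
  qed
  have "(\<lambda>n. LINT x|lborel. ?F n x) \<longlonglongrightarrow> (LINT x|lborel. partial_deriv i f x)"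
  proof (rule integral_dominated_convergence)
    show "partial_deriv i f \<in> borel_measurable lborel"
      using borel_measurable_continuous_onI[OF cp] by simp
    show "integrable lborel (\<lambda>x. indicator K' x * M)"
      using borel_integrable_compact[OF K', of "\<lambda>_. M"] by (simp add: continuous_on_const)
    show "AE x in lborel. (\<lambda>n. ?F n x) \<longlonglongrightarrow> partial_deriv i f x"
    proof (rule AE_I2)
      fix x
      have "(\<lambda>h. (f (x + (0 + h) *\<^sub>R axis i 1) - f (x + 0 *\<^sub>R axis i 1)) / h) \<midarrow>0\<rightarrow> partial_deriv i f (x + 0 *\<^sub>R axis i 1)"
        using deriv[of x 0] unfolding DERIV_def .
      moreover have "filterlim (\<lambda>n. 1 / real (Suc n)) (at 0) sequentially"
        using LIMSEQ_Suc[OF lim_1_over_n] by (auto simp: filterlim_at)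
      ultimately have "(\<lambda>n. (f (x + (0 + 1 / real (Suc n)) *\<^sub>R axis i 1) - f (x + 0 *\<^sub>R axis i 1)) / (1 / real (Suc n)))
         \<longlonglongrightarrow> partial_deriv i f (x + 0 *\<^sub>R axis i 1)"
        by (rule filterlim_compose)
      then show "(\<lambda>n. ?F n x) \<longlonglongrightarrow> partial_deriv i f x"
        by (simp add: mult.commute del: of_nat_Suc)
    qed
  qed (use bound in auto)
  then show ?thesis unfolding zero using LIMSEQ_unique tendsto_const by blast
qed

lemma test_functionD:
  assumes "\<phi> \<in> test_functions \<Omega>"
  shows "C_k k \<phi>" "compact (closure {x. \<phi> x \<noteq> 0})" "closure {x. \<phi> x \<noteq> 0} \<subseteq> \<Omega>"
    "x \<notin> closure {x. \<phi> x \<noteq> 0} \<Longrightarrow> \<phi> x = 0" "x \<notin> \<Omega> \<Longrightarrow> \<phi> x = 0"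
    "continuous_on S \<phi>" "continuous_on S (grad \<phi>)" "continuous_on S (partial_deriv i \<phi>)"
    "x \<notin> \<Omega> \<Longrightarrow> grad \<phi> x = 0" "\<phi> differentiable (at x)"
    "integrable lborel \<phi>"
proof -
  show 1: "C_k k \<phi>" "compact (closure {x. \<phi> x \<noteq> 0})" "closure {x. \<phi> x \<noteq> 0} \<subseteq> \<Omega>" for k
    using assms by (auto simp: test_functions_def)
  show 2: "x \<notin> closure {x. \<phi> x \<noteq> 0} \<Longrightarrow> \<phi> x = 0" for x
    by (rule zero_outside_support)
  show "x \<notin> \<Omega> \<Longrightarrow> \<phi> x = 0" using 2 1 by blast
  show "continuous_on S \<phi>" "continuous_on S (grad \<phi>)" "continuous_on S (partial_deriv i \<phi>)"
    using C_k_imp_continuous[OF 1(1)] continuous_grad[OF 1(1)[of "Suc 0"]]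
      C_1_continuous_partial[OF 1(1)[of "Suc 0"]] by (auto intro: continuous_on_subset)
  show "x \<notin> \<Omega> \<Longrightarrow> grad \<phi> x = 0"
    using 1 partial_deriv_outside[of x \<phi>] by (auto simp: grad_def vec_eq_iff)
  show "\<phi> differentiable (at x)" using C_1_differentiable[OF 1(1)] .
  show "integrable lborel \<phi>"
    using integrable_compact_support[OF C_k_imp_continuous[OF 1(1)] 1(2) 2] .
qed

lemma integral_lebesgue_on_support:
  fixes f :: "'a::euclidean_space \<Rightarrow> real"
  assumes "open \<Omega>" "f \<in> borel_measurable borel" "\<And>x. x \<notin> \<Omega> \<Longrightarrow> f x = 0"
  shows "(LINT x|lebesgue_on \<Omega>. f x) = (LINT x|lborel. f x)"
proof -
  have "(LINT x|lebesgue_on \<Omega>. f x) = (LINT x|lebesgue. indicator \<Omega> x *\<^sub>R f x)"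
    using assms by (subst integral_restrict_space) auto
  also have "(\<lambda>x. indicator \<Omega> x *\<^sub>R f x) = f"
    using assms(3) by (auto simp: indicator_def fun_eq_iff)
  finally show ?thesis using assms by (simp add: integral_completion)
qed

lemma continuous_absolutely_integrable_compact:
  fixes f :: "'a::euclidean_space \<Rightarrow> 'b::euclidean_space"
  assumes "continuous_on UNIV f" "compact C"
  shows "f absolutely_integrable_on C"
proof -
  have "integrable lborel (\<lambda>x. indicator C x *\<^sub>R f x)"
    using assms by (intro borel_integrable_compact) (auto intro: continuous_on_subset)
  moreover have "(\<lambda>x. indicator C x *\<^sub>R f x) \<in> borel_measurable borel"
    using assms by (intro borel_measurable_continuous_on_indicator)
      (auto simp: compact_imp_closed borel_closed intro: continuous_on_subset)
  ultimately show ?thesis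
    unfolding set_integrable_def by (simp add: integrable_completion)
qed

text \<open>The product of two test functions has partial derivatives with integral zero; expanding
  them by the product rule is the integration by parts.\<close>

lemma test_function_has_weak_grad:
  assumes "open \<Omega>" "\<phi> \<in> test_functions \<Omega>"
  shows "has_weak_grad \<Omega> \<phi> (grad \<phi>)"
  unfolding has_weak_grad_def
proof safe
  note \<phi> = test_functionD[OF assms(2)]
  fix C assume C: "compact C" "C \<subseteq> \<Omega>"
  show "\<phi> absolutely_integrable_on C" "grad \<phi> absolutely_integrable_on C"
    using C \<phi>(6,7) by (auto intro: continuous_absolutely_integrable_compact)
next
  note \<phi> = test_functionD[OF assms(2)]
  fix \<psi> i assume "\<psi> \<in> test_functions \<Omega>"
  note \<psi> = test_functionD[OF this]
  have D: "((\<lambda>x. \<phi> x * \<psi> x) has_derivative (\<lambda>v. \<phi> x * (grad \<psi> x \<bullet> v) + (grad \<phi> x \<bullet> v) * \<psi> x)) (at x)" for x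
    by (intro has_derivative_mult grad_has_derivative \<phi> \<psi>)
  have pd: "partial_deriv i (\<lambda>x. \<phi> x * \<psi> x) = (\<lambda>x. \<phi> x * partial_deriv i \<psi> x + partial_deriv i \<phi> x * \<psi> x)"
    using partial_deriv_eq[OF D] by (simp add: inner_axis grad_def)
  have K: "compact (closure {x. \<phi> x * \<psi> x \<noteq> 0})"
    by (rule compact_closure[THEN iffD2], rule bounded_subset[of "{x. \<phi> x \<noteq> 0}"])
      (use \<phi>(2) compact_closure in auto)
  have "(LINT x|lborel. \<phi> x * partial_deriv i \<psi> x + partial_deriv i \<phi> x * \<psi> x) = 0"
    using integral_partial_deriv_eq_0[OF C_k_mult[OF \<phi>(1) \<psi>(1), of "Suc 0"] K, of i] unfolding pd .
  moreover have "integrable lborel (\<lambda>x. \<phi> x * partial_deriv i \<psi> x)"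
    "integrable lborel (\<lambda>x. partial_deriv i \<phi> x * \<psi> x)"
    by (rule integrable_compact_support[OF continuous_on_mult[OF \<phi>(6) \<psi>(8)] \<phi>(2)],
        metis mult_zero_left zero_outside_support)
       (rule integrable_compact_support[OF continuous_on_mult[OF \<phi>(8) \<psi>(6)] \<phi>(2)],
        metis mult_zero_left partial_deriv_outside)
  ultimately have eq: "(LINT x|lborel. \<phi> x * partial_deriv i \<psi> x) = - (LINT x|lborel. partial_deriv i \<phi> x * \<psi> x)"
    by simp
  have [measurable]: "\<phi> \<in> borel_measurable borel" "\<psi> \<in> borel_measurable borel"
     "partial_deriv i \<phi> \<in> borel_measurable borel" "partial_deriv i \<psi> \<in> borel_measurable borel"
    by (auto intro!: borel_measurable_continuous_onI \<phi> \<psi>)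
  show "(LINT x|lebesgue_on \<Omega>. \<phi> x * partial_deriv i \<psi> x) = - (LINT x|lebesgue_on \<Omega>. grad \<phi> x $ i * \<psi> x)"
    using assms eq \<phi>(5) \<psi>(5)
    by (subst (1 2) integral_lebesgue_on_support) (auto simp: grad_def)
qed

section \<open>The fundamental lemma of the calculus of variations\<close>

text \<open>Open boxes form an intersection-stable generator of the Borel sets, so a Dynkin argument
  extends the vanishing of the integrals to all Borel sets, and a density with vanishing integrals
  is null.\<close>

lemma AE_zero_if_box_integrals_zero:
  fixes f :: "'a::euclidean_space \<Rightarrow> real"
  assumes f: "integrable lborel f"
    and box: "\<And>a b. (LINT x|lborel. indicator (box a b) x * f x) = 0"
  shows "AE x in lborel. f x = 0"
proof -
  have [measurable]: "f \<in> borel_measurable borel" using f by simp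
  have ind: "integrable lborel (\<lambda>x. indicator A x * f x)" if "A \<in> sets borel" for A
    using integrable_mult_indicator[of A lborel f] that f by simp
  \<comment> \<open>Complements in the Dynkin argument need the integral over the whole space,
    obtained by exhausting it with boxes.\<close>
  have UN: "(LINT x|lborel. f x) = 0"
  proof -
    have "(\<lambda>n. LINT x|lborel. indicator (box (- real n *\<^sub>R One) (real n *\<^sub>R One)) x * f x) \<longlonglongrightarrow> (LINT x|lborel. f x)"
    proof (rule integral_dominated_convergence[where w="\<lambda>x. \<bar>f x\<bar>"])
      show "AE x in lborel. (\<lambda>n. indicator (box (- real n *\<^sub>R One) (real n *\<^sub>R One)) x * f x) \<longlonglongrightarrow> f x"
      proof (rule AE_I2)
        fix x :: 'a
        have "eventually (\<lambda>n. indicator (box (- real n *\<^sub>R One) (real n *\<^sub>R One)) x * f x = f x) sequentially"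
        proof -
          obtain N where N: "norm x < real N" using reals_Archimedean2 by blast
          have "x \<in> box (- real n *\<^sub>R One) (real n *\<^sub>R One)" if "n \<ge> N" for n
          proof -
            have "\<bar>x \<bullet> j\<bar> < real n" if "j \<in> Basis" for j
              using Basis_le_norm[OF that, of x] N \<open>n \<ge> N\<close> by linarith
            then show ?thesis by (force simp: mem_box abs_less_iff)
          qed
          then show ?thesis by (auto simp: eventually_sequentially intro!: exI[of _ N])
        qed
        then show "(\<lambda>n. indicator (box (- real n *\<^sub>R One) (real n *\<^sub>R One)) x * f x) \<longlonglongrightarrow> f x"
          by (rule tendsto_eventually)
      qed
    qed (use f in \<open>auto simp: indicator_def\<close>)
    then show ?thesis unfolding box by (simp add: LIMSEQ_const_iff)
  qed
  let ?G = "range (\<lambda>(a, b). box a b :: 'a set)"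
  have gen: "sets (borel :: 'a measure) = sigma_sets UNIV ?G"
    by (subst borel_eq_box) (simp add: sets_measure_of)
  have "(LINT x|lborel. indicator A x * f x) = 0" if "A \<in> sets borel" for A
  proof -
    have "Int_stable ?G" by (auto simp: Int_stable_def box_Int_box)
    moreover have "?G \<subseteq> Pow UNIV" by simp
    moreover have "A \<in> sigma_sets UNIV ?G" using that gen by simp
    ultimately show ?thesis
    proof (induction A rule: sigma_sets_induct_disjoint)
      case (basic A) then show ?case using box by auto
    next
      case (compl A)
      then have A: "A \<in> sets borel" using gen by simp
      have "(LINT x|lborel. indicator (UNIV - A) x * f x) = (LINT x|lborel. f x - indicator A x * f x)"
        by (intro Bochner_Integration.integral_cong) (auto simp: indicator_def)
      then show ?case using compl UN f ind[OF A] by simp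
    next
      case (union A)
      then have A: "A i \<in> sets borel" for i using gen by auto
      have "(LINT x:(\<Union>i. A i)|lborel. f x) = (\<Sum>i. LINT x:(A i)|lborel. f x)"
      proof (rule lebesgue_integral_countable_add)
        show "set_integrable lborel (\<Union>i. A i) f"
          unfolding set_integrable_def using ind[of "\<Union>i. A i"] A by simp
      qed (use A union.hyps in \<open>auto simp: disjoint_family_on_def\<close>)
      then show ?case using union by (simp add: set_lebesgue_integral_def)
    qed simp
  qed
  then show ?thesis
    by (intro density_unique_real[of lborel f "\<lambda>_. 0"]) (auto simp: f set_lebesgue_integral_def)
qed

text \<open>On a box whose closure lies in \<open>\<Omega>\<close> the function is integrable, and
  approximating indicators by bumps turns the hypothesis into vanishing integrals over all
  sub-boxes. Countably many such boxes cover \<open>\<Omega>\<close> up to a null set.\<close>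

lemma fundamental_lemma_of_variations:
  fixes u :: "real^'n \<Rightarrow> real"
  assumes \<Omega>: "open \<Omega>" and u: "\<And>C. compact C \<Longrightarrow> C \<subseteq> \<Omega> \<Longrightarrow> u absolutely_integrable_on C"
    and zero: "\<And>\<phi>. \<phi> \<in> test_functions \<Omega> \<Longrightarrow> (LINT x|lebesgue_on \<Omega>. u x * \<phi> x) = 0"
  shows "AE x in lebesgue_on \<Omega>. u x = 0"
proof -
  have local_box: "AE x in lebesgue. x \<in> box c d \<longrightarrow> u x = 0" if cd: "cbox c d \<subseteq> \<Omega>" for c d
  proof -
    have uC: "integrable lebesgue (\<lambda>x. indicator (cbox c d) x * u x)"
      using u[OF compact_cbox cd] by (simp add: set_integrable_def)
    have v: "integrable lebesgue (\<lambda>x. indicator (box a b) x * (indicator (cbox c d) x * u x))" for a b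
      using integrable_mult_indicator[OF _ uC, of "box a b"] by simp
    let ?v = "\<lambda>x. indicator (box c d) x * (indicator (cbox c d) x * u x)"
    obtain v' where v': "v' \<in> borel_measurable lborel" "AE x in lborel. ?v x = v' x"
      using completion_ex_borel_measurable_real[of ?v lborel] v[of c d] borel_measurable_integrable by blast
    have v'AE: "AE x in lebesgue. ?v x = v' x" using v'(2) by (rule AE_completion)
    have "integrable lebesgue v'"
      using integrable_cong_AE[OF borel_measurable_integrable[OF v[of c d]] measurable_completion[OF v'(1)] v'AE]
        v[of c d] by simp
    then have v'i: "integrable lborel v'" using v'(1) by (simp add: integrable_completion)
    have "(LINT x|lborel. indicator (box a b) x * v' x) = 0" for a b
    proof -
      \<comment> \<open>The box from a to b is arbitrary and may leave \<open>\<Omega>\<close>; what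
        matters is its intersection with the given box, whose closure stays inside unless the
        intersection is empty.\<close>
      obtain e f where ef: "box a b \<inter> box c d = box e f" using box_Int_box[of a b c d] by auto
      have sub: "cbox e f \<subseteq> \<Omega> \<or> box e f = {}"
      proof (cases "box e f = {}")
        case False
        have "box e f \<subseteq> cbox c d" using ef box_subset_cbox[of c d] by blast
        then have "closure (box e f) \<subseteq> cbox c d" by (rule closure_minimal[OF _ closed_cbox])
        then show ?thesis using closure_box[OF False] cd by auto
      qed simp
      have "(LINT x|lborel. indicator (box a b) x * v' x) = (LINT x|lebesgue. indicator (box a b) x * v' x)"
        using v'(1) by (simp add: integral_completion)
      also have "\<dots> = (LINT x|lebesgue. indicator (box a b) x * ?v x)"
      proof (rule integral_cong_AE)
        show "AE x in lebesgue. indicator (box a b) x * v' x = indicator (box a b) x * ?v x"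
          using v'AE by eventually_elim simp
        show "(\<lambda>x. indicator (box a b) x * v' x) \<in> borel_measurable lebesgue"
          using v'(1) by (intro borel_measurable_times measurable_completion) auto
        show "(\<lambda>x. indicator (box a b) x * ?v x) \<in> borel_measurable lebesgue"
          using borel_measurable_integrable[OF integrable_mult_indicator[OF _ v[of c d], of "box a b"]] by simp
      qed
      also have "\<dots> = (LINT x|lebesgue. indicator (box e f) x * (indicator (cbox c d) x * u x))"
        using ef[symmetric] by (intro Bochner_Integration.integral_cong) (auto simp: indicator_def)
      also have "\<dots> = 0"
      proof (cases "box e f = {}")
        case False
        with sub have sub: "cbox e f \<subseteq> \<Omega>" by simp
        have "(\<lambda>k. LINT x|lebesgue. box_bump k e f x * (indicator (cbox c d) x * u x)) \<longlonglongrightarrow>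
              (LINT x|lebesgue. indicator (box e f) x * (indicator (cbox c d) x * u x))"
        proof (rule integral_dominated_convergence[where w="\<lambda>x. \<bar>indicator (cbox c d) x * u x\<bar>"])
          show "integrable lebesgue (\<lambda>x. \<bar>indicator (cbox c d) x * u x\<bar>)" using uC by simp
          show "(\<lambda>x. box_bump k e f x * (indicator (cbox c d) x * u x)) \<in> borel_measurable lebesgue" for k
            by (rule borel_measurable_times[OF _ borel_measurable_integrable[OF uC]], rule measurable_completion)
              (simp add: borel_measurable_continuous_onI test_functionD(6)[OF box_bump_test_function[OF sub]])
          show "AE x in lebesgue. (\<lambda>k. box_bump k e f x * (indicator (cbox c d) x * u x))
             \<longlonglongrightarrow> indicator (box e f) x * (indicator (cbox c d) x * u x)"
            by (intro AE_I2 tendsto_mult box_bump_tendsto tendsto_const)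
          show "AE x in lebesgue. norm (box_bump k e f x * (indicator (cbox c d) x * u x))
             \<le> \<bar>indicator (cbox c d) x * u x\<bar>" for k
            using box_bump_bounds[of k e f] by (auto simp: abs_mult intro!: mult_left_le_one_le)
        qed (use v[of e f] in \<open>auto dest: borel_measurable_integrable\<close>)
        moreover have "(LINT x|lebesgue. box_bump k e f x * (indicator (cbox c d) x * u x)) = 0" for k
        proof -
          have "(LINT x|lebesgue. box_bump k e f x * (indicator (cbox c d) x * u x)) =
                (LINT x|lebesgue. indicator \<Omega> x *\<^sub>R (u x * box_bump k e f x))"
          proof (intro Bochner_Integration.integral_cong refl)
            fix x
            show "box_bump k e f x * (indicator (cbox c d) x * u x) = indicator \<Omega> x *\<^sub>R (u x * box_bump k e f x)"
            proof (cases "x \<in> box e f")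
              case True
              then have "x \<in> cbox c d" using ef box_subset_cbox by blast
              then show ?thesis using cd by (auto simp: indicator_def)
            qed (simp add: box_bump_outside)
          qed
          also have "\<dots> = (LINT x|lebesgue_on \<Omega>. u x * box_bump k e f x)"
            using \<Omega> by (subst integral_restrict_space) auto
          finally show ?thesis using zero[OF box_bump_test_function[OF sub]] by simp
        qed
        ultimately show ?thesis by (simp add: LIMSEQ_const_iff)
      qed simp
      finally show ?thesis .
    qed
    then have "AE x in lborel. v' x = 0" by (intro AE_zero_if_box_integrals_zero v'i)
    then have "AE x in lebesgue. v' x = 0" by (rule AE_completion)
    with v'AE show ?thesis
    proof eventually_elim
      case (elim x)
      then show ?case using box_subset_cbox[of c d] by (auto simp: indicator_def split: if_splits)
    qed
  qed
  obtain D where D: "countable D" "D \<subseteq> Pow \<Omega>" "\<And>X. X \<in> D \<Longrightarrow> \<exists>a b. X = box a b" "\<Union>D = \<Omega>"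
    using open_countable_Union_open_box[OF \<Omega>] by metis
  have "AE x in lebesgue. x \<in> X \<longrightarrow> u x = 0" if X: "X \<in> D" for X
  proof -
    have "open X" using D(3)[OF X] by auto
    \<comment> \<open>Each open box is resolved into closed boxes contained in it. These satisfy the
      premise of \<open>local_box\<close>, and the frontiers that its conclusion misses are null
      sets.\<close>
    obtain E where E: "countable E" "E \<subseteq> Pow X" "\<And>Y. Y \<in> E \<Longrightarrow> \<exists>a b. Y = cbox a b" "\<Union>E = X"
      using open_countable_Union_open_cbox[OF \<open>open X\<close>] by metis
    have "AE x in lebesgue. \<forall>Y\<in>E. x \<in> Y \<longrightarrow> u x = 0"
    proof (subst AE_ball_countable[OF E(1)], rule ballI)
      fix Y assume Y: "Y \<in> E"
      obtain a b where ab: "Y = cbox a b" using E(3)[OF Y] by auto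
      have "cbox a b \<subseteq> \<Omega>" using Y E(2) X D(2) ab by blast
      from local_box[OF this] have "AE x in lebesgue. x \<in> box a b \<longrightarrow> u x = 0" .
      moreover have "AE x in lebesgue. x \<notin> cbox a b - box a b"
        using negligible_frontier_interval[of a b] by (intro AE_not_in) (simp add: negligible_iff_null_sets)
      ultimately show "AE x in lebesgue. x \<in> Y \<longrightarrow> u x = 0"
        by eventually_elim (auto simp: ab)
    qed
    then show ?thesis by eventually_elim (use E(4) in blast)
  qed
  then have "AE x in lebesgue. \<forall>X\<in>D. x \<in> X \<longrightarrow> u x = 0"
    by (subst AE_ball_countable[OF D(1)]) auto
  then have "AE x in lebesgue. x \<in> \<Omega> \<longrightarrow> u x = 0"
    by eventually_elim (use D(4) in blast)
  then show ?thesis using \<Omega> by (subst AE_restrict_space_iff) auto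
qed

section \<open>Lebesgue and Sobolev spaces as vector spaces\<close>

lemma powr_add_le:
  assumes "0 \<le> a" "0 \<le> b" "0 < (p::real)"
  shows "(a + b) powr p \<le> 2 powr p * (a powr p + b powr p)"
proof -
  have "(a + b) powr p \<le> (2 * max a b) powr p"
    using assms by (intro powr_mono2) auto
  also have "\<dots> = 2 powr p * max a b powr p"
    using assms by (simp add: powr_mult)
  also have "max a b powr p \<le> a powr p + b powr p"
    by (cases "a \<le> b") (auto simp: max_def)
  finally show ?thesis by simp
qed

text \<open>For a > l the factor a^(r-p) is at most l^(r-p), because r - p is not positive. The free
  level l stands in for Hoelder's inequality: choosing it afterwards recovers inequalities between
  norms up to constants.\<close>

lemma powr_interpolate:
  assumes "0 \<le> a" "0 < l" "0 < r" "r \<le> (p::real)"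
  shows "a powr r \<le> l powr r + l powr (r - p) * a powr p"
proof (cases "a \<le> l")
  case True
  then have "a powr r \<le> l powr r" using assms by (intro powr_mono2) auto
  then show ?thesis by (simp add: add_increasing2)
next
  case False
  have "a powr r = a powr (r - p) * a powr p"
    using assms False by (simp add: powr_add[symmetric])
  also have "\<dots> \<le> l powr (r - p) * a powr p"
    using assms False by (intro mult_right_mono powr_mono2') auto
  finally show ?thesis by (simp add: add_increasing)
qed

lemma tendsto_0_le_seq:
  fixes f g :: "nat \<Rightarrow> real"
  assumes "f \<longlonglongrightarrow> 0" "\<And>n. 0 \<le> g n" "\<And>n. g n \<le> f n"
  shows "g \<longlonglongrightarrow> 0"
  by (rule tendsto_sandwich[OF _ _ tendsto_const assms(1)]) (use assms in auto)

lemma AE_lebesgue_on_iff: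
  assumes "open (\<Omega>::'a::euclidean_space set)"
  shows "(AE x in lebesgue_on \<Omega>. P x) \<longleftrightarrow> (AE x in lebesgue. x \<in> \<Omega> \<longrightarrow> P x)"
  using assms by (subst AE_restrict_space_iff) auto

text \<open>Lebesgue measure is complete, so after extension by zero a change on a null set
  preserves measurability.\<close>

lemma borel_measurable_lebesgue_on_AE:
  fixes f g :: "'a::euclidean_space \<Rightarrow> 'b::euclidean_space"
  assumes \<Omega>: "open \<Omega>" and f: "f \<in> borel_measurable (lebesgue_on \<Omega>)"
    and ae: "AE x in lebesgue_on \<Omega>. f x = g x"
  shows "g \<in> borel_measurable (lebesgue_on \<Omega>)"
proof -
  have "(\<lambda>x. indicator \<Omega> x *\<^sub>R f x) \<in> borel_measurable lebesgue"
    using f \<Omega> by (subst (asm) borel_measurable_restrict_space_iff) auto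
  moreover have "AE x in lebesgue. indicator \<Omega> x *\<^sub>R f x = indicator \<Omega> x *\<^sub>R g x"
    using ae unfolding AE_lebesgue_on_iff[OF \<Omega>] by eventually_elim (auto simp: indicator_def)
  ultimately have "(\<lambda>x. indicator \<Omega> x *\<^sub>R g x) \<in> borel_measurable lebesgue"
    by (rule borel_measurable_AE)
  then show ?thesis using \<Omega> by (subst borel_measurable_restrict_space_iff) auto
qed

lemma LpD:
  assumes "f \<in> Lp \<Omega> p"
  shows "f \<in> borel_measurable (lebesgue_on \<Omega>)" "integrable (lebesgue_on \<Omega>) (\<lambda>x. norm (f x) powr p)"
  using assms by (auto simp: Lp_def)

lemma Lp_AE_cong:
  assumes "open \<Omega>" "f \<in> Lp \<Omega> p" "AE x in lebesgue_on \<Omega>. f x = g x"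
  shows "g \<in> Lp \<Omega> p"
proof -
  have g: "g \<in> borel_measurable (lebesgue_on \<Omega>)"
    using borel_measurable_lebesgue_on_AE[OF assms(1) LpD(1)[OF assms(2)] assms(3)] .
  have "AE x in lebesgue_on \<Omega>. norm (f x) powr p = norm (g x) powr p"
    using assms(3) by eventually_elim simp
  then have "integrable (lebesgue_on \<Omega>) (\<lambda>x. norm (g x) powr p)"
    using LpD[OF assms(2)] g
    by (subst integrable_cong_AE[where g="\<lambda>x. norm (f x) powr p"]) (auto simp: eq_commute)
  then show ?thesis using g by (simp add: Lp_def)
qed

lemma Lp_add:
  assumes "f \<in> Lp \<Omega> p" "g \<in> Lp \<Omega> p" "0 < p"
  shows "(\<lambda>x. f x + g x) \<in> Lp \<Omega> p"
    "(LINT x|lebesgue_on \<Omega>. norm (f x + g x) powr p) \<le>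
      2 powr p * ((LINT x|lebesgue_on \<Omega>. norm (f x) powr p) + (LINT x|lebesgue_on \<Omega>. norm (g x) powr p))"
proof -
  note [measurable] = LpD(1)[OF assms(1)] LpD(1)[OF assms(2)]
  have bd: "norm (f x + g x) powr p \<le> 2 powr p * (norm (f x) powr p + norm (g x) powr p)" for x
    using powr_mono2[of p "norm (f x + g x)" "norm (f x) + norm (g x)"]
      powr_add_le[of "norm (f x)" "norm (g x)" p] assms(3) by (simp add: norm_triangle_ineq)
  have I: "integrable (lebesgue_on \<Omega>) (\<lambda>x. 2 powr p * (norm (f x) powr p + norm (g x) powr p))"
    using LpD(2)[OF assms(1)] LpD(2)[OF assms(2)] by auto
  have J: "integrable (lebesgue_on \<Omega>) (\<lambda>x. norm (f x + g x) powr p)"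
    by (rule Bochner_Integration.integrable_bound[OF I])
       (use bd in \<open>auto intro!: AE_I2 simp: abs_mult\<close>)
  then show "(\<lambda>x. f x + g x) \<in> Lp \<Omega> p" by (simp add: Lp_def)
  have "(LINT x|lebesgue_on \<Omega>. norm (f x + g x) powr p) \<le>
     (LINT x|lebesgue_on \<Omega>. 2 powr p * (norm (f x) powr p + norm (g x) powr p))"
    by (intro integral_mono I J bd)
  then show "(LINT x|lebesgue_on \<Omega>. norm (f x + g x) powr p) \<le>
      2 powr p * ((LINT x|lebesgue_on \<Omega>. norm (f x) powr p) + (LINT x|lebesgue_on \<Omega>. norm (g x) powr p))"
    using LpD(2)[OF assms(1)] LpD(2)[OF assms(2)] by simp
qed

lemma Lp_scaleR:
  assumes "f \<in> Lp \<Omega> p"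
  shows "(\<lambda>x. c *\<^sub>R f x) \<in> Lp \<Omega> p"
    "(LINT x|lebesgue_on \<Omega>. norm (c *\<^sub>R f x) powr p) = \<bar>c\<bar> powr p * (LINT x|lebesgue_on \<Omega>. norm (f x) powr p)"
  using LpD[OF assms] by (auto simp: Lp_def powr_mult)

lemma integrable_times_test:
  fixes u \<psi> :: "real^'n \<Rightarrow> real"
  assumes \<Omega>: "open \<Omega>" and u: "\<And>C. compact C \<Longrightarrow> C \<subseteq> \<Omega> \<Longrightarrow> u absolutely_integrable_on C"
    and \<psi>: "continuous_on UNIV \<psi>" "compact K" "K \<subseteq> \<Omega>" "\<And>x. x \<notin> K \<Longrightarrow> \<psi> x = 0"
  shows "integrable (lebesgue_on \<Omega>) (\<lambda>x. u x * \<psi> x)"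
proof -
  obtain M where M: "0 \<le> M" "\<And>x. \<bar>\<psi> x\<bar> \<le> M"
    using bounded_compact_support[OF \<psi>(1,2,4)] by metis
  have I: "integrable lebesgue (\<lambda>x. indicator K x * u x)"
    using u[OF \<psi>(2,3)] by (simp add: set_integrable_def)
  have "integrable lebesgue (\<lambda>x. (indicator K x * u x) * \<psi> x)"
  proof (rule Bochner_Integration.integrable_bound)
    show "integrable lebesgue (\<lambda>x. M * \<bar>indicator K x * u x\<bar>)" using I by auto
    show "(\<lambda>x. (indicator K x * u x) * \<psi> x) \<in> borel_measurable lebesgue"
      using borel_measurable_continuous_onI[OF \<psi>(1)]
      by (intro borel_measurable_times[OF borel_measurable_integrable[OF I]] measurable_completion) simp
    show "AE x in lebesgue. norm (indicator K x * u x * \<psi> x) \<le> norm (M * \<bar>indicator K x * u x\<bar>)"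
    proof (rule AE_I2)
      fix x
      have "\<bar>indicator K x * u x\<bar> * \<bar>\<psi> x\<bar> \<le> \<bar>indicator K x * u x\<bar> * M"
        using M by (intro mult_left_mono) auto
      then show "norm (indicator K x * u x * \<psi> x) \<le> norm (M * \<bar>indicator K x * u x\<bar>)"
        using M(1) by (simp add: abs_mult mult_ac)
    qed
  qed
  also have "(\<lambda>x. (indicator K x * u x) * \<psi> x) = (\<lambda>x. indicator \<Omega> x *\<^sub>R (u x * \<psi> x))"
    using \<psi>(3,4) by (auto simp: indicator_def fun_eq_iff)
  finally show ?thesis using \<Omega> by (subst integrable_restrict_space) auto
qed

lemma abs_integrable_component:
  fixes g :: "real^'n \<Rightarrow> real^'n"
  shows "g absolutely_integrable_on C \<Longrightarrow> (\<lambda>x. g x $ i) absolutely_integrable_on C"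
  by (drule absolutely_integrable_component[where b="axis i 1"]) (simp add: inner_axis)

section \<open>Linearity and uniqueness of weak gradients\<close>

lemma has_weak_gradD:
  assumes "open \<Omega>" "has_weak_grad \<Omega> y g"
  shows "compact C \<Longrightarrow> C \<subseteq> \<Omega> \<Longrightarrow> y absolutely_integrable_on C"
    "compact C \<Longrightarrow> C \<subseteq> \<Omega> \<Longrightarrow> g absolutely_integrable_on C"
    "\<phi> \<in> test_functions \<Omega> \<Longrightarrow> (LINT x|lebesgue_on \<Omega>. y x * partial_deriv i \<phi> x) =
        - (LINT x|lebesgue_on \<Omega>. (g x $ i) * \<phi> x)"
    "\<phi> \<in> test_functions \<Omega> \<Longrightarrow> integrable (lebesgue_on \<Omega>) (\<lambda>x. y x * partial_deriv i \<phi> x)"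
    "\<phi> \<in> test_functions \<Omega> \<Longrightarrow> integrable (lebesgue_on \<Omega>) (\<lambda>x. (g x $ i) * \<phi> x)"
proof -
  show 1: "compact C \<Longrightarrow> C \<subseteq> \<Omega> \<Longrightarrow> y absolutely_integrable_on C"
    "compact C \<Longrightarrow> C \<subseteq> \<Omega> \<Longrightarrow> g absolutely_integrable_on C"
    "\<phi> \<in> test_functions \<Omega> \<Longrightarrow> (LINT x|lebesgue_on \<Omega>. y x * partial_deriv i \<phi> x) =
        - (LINT x|lebesgue_on \<Omega>. (g x $ i) * \<phi> x)" for C \<phi> i
    using assms(2) by (auto simp: has_weak_grad_def)
  assume \<phi>: "\<phi> \<in> test_functions \<Omega>"
  show "integrable (lebesgue_on \<Omega>) (\<lambda>x. y x * partial_deriv i \<phi> x)"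
    using 1 test_functionD(2,3,8)[OF \<phi>]
    by (intro integrable_times_test[OF assms(1), where K="closure {x. \<phi> x \<noteq> 0}"] partial_deriv_outside) auto
  show "integrable (lebesgue_on \<Omega>) (\<lambda>x. (g x $ i) * \<phi> x)"
    using 1 test_functionD(2,3,6)[OF \<phi>]
    by (intro integrable_times_test[OF assms(1), where K="closure {x. \<phi> x \<noteq> 0}"] zero_outside_support)
      (auto intro: abs_integrable_component)
qed

lemma has_weak_grad_add:
  assumes "open \<Omega>" "has_weak_grad \<Omega> y g" "has_weak_grad \<Omega> z h"
  shows "has_weak_grad \<Omega> (\<lambda>x. y x + z x) (\<lambda>x. g x + h x)"
  unfolding has_weak_grad_def
proof safe
  note Y = has_weak_gradD[OF assms(1,2)] and Z = has_weak_gradD[OF assms(1,3)]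
  show "(\<lambda>x. y x + z x) absolutely_integrable_on C" "(\<lambda>x. g x + h x) absolutely_integrable_on C"
    if "compact C" "C \<subseteq> \<Omega>" for C
    using Y(1,2) Z(1,2) that by (auto intro: set_integral_add)
  show "(LINT x|lebesgue_on \<Omega>. (y x + z x) * partial_deriv i \<phi> x) =
       - (LINT x|lebesgue_on \<Omega>. (g x + h x) $ i * \<phi> x)" if \<phi>: "\<phi> \<in> test_functions \<Omega>" for \<phi> i
    using Y(3-5)[OF \<phi>, of i] Z(3-5)[OF \<phi>, of i] by (simp add: distrib_right)
qed

lemma has_weak_grad_scaleR:
  assumes "open \<Omega>" "has_weak_grad \<Omega> y g"
  shows "has_weak_grad \<Omega> (\<lambda>x. c * y x) (\<lambda>x. c *\<^sub>R g x)"
  unfolding has_weak_grad_def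
proof safe
  note Y = has_weak_gradD[OF assms(1,2)]
  show "(\<lambda>x. c * y x) absolutely_integrable_on C" "(\<lambda>x. c *\<^sub>R g x) absolutely_integrable_on C"
    if "compact C" "C \<subseteq> \<Omega>" for C
    using Y(1,2)[OF that] by (auto intro: absolutely_integrable_scaleR_left[of _ _ c] simp: absolutely_integrable_scaleR_left)
  show "(LINT x|lebesgue_on \<Omega>. (c * y x) * partial_deriv i \<phi> x) =
       - (LINT x|lebesgue_on \<Omega>. (c *\<^sub>R g x) $ i * \<phi> x)" if \<phi>: "\<phi> \<in> test_functions \<Omega>" for \<phi> i
    using Y(3)[OF \<phi>, of i] by (simp add: mult.assoc)
qed

text \<open>The difference of two weak gradients annihilates all test functions, component by
  component, so the fundamental lemma applies.\<close>

lemma has_weak_grad_unique: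
  assumes \<Omega>: "open \<Omega>" and "has_weak_grad \<Omega> y g" "has_weak_grad \<Omega> y h"
  shows "AE x in lebesgue_on \<Omega>. g x = h x"
proof -
  note G = has_weak_gradD[OF assms(1,2)] and H = has_weak_gradD[OF assms(1,3)]
  have "AE x in lebesgue_on \<Omega>. g x $ i - h x $ i = 0" for i
  proof (rule fundamental_lemma_of_variations[OF \<Omega>])
    show "(\<lambda>x. g x $ i - h x $ i) absolutely_integrable_on C" if "compact C" "C \<subseteq> \<Omega>" for C
      using abs_integrable_component[OF G(2)[OF that], of i] abs_integrable_component[OF H(2)[OF that], of i]
      by (rule set_integral_diff)
    show "(LINT x|lebesgue_on \<Omega>. (g x $ i - h x $ i) * \<phi> x) = 0" if \<phi>: "\<phi> \<in> test_functions \<Omega>" for \<phi>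
      using G(3,5)[OF \<phi>, of i] H(3,5)[OF \<phi>, of i] by (simp add: left_diff_distrib)
  qed
  then have "AE x in lebesgue_on \<Omega>. \<forall>i. g x $ i - h x $ i = 0"
    by (intro AE_all_countable[THEN iffD2]) auto
  then show ?thesis by eventually_elim (simp add: vec_eq_iff)
qed

lemma has_weak_grad_weak_grad: "has_weak_grad \<Omega> y g \<Longrightarrow> has_weak_grad \<Omega> y (weak_grad \<Omega> y)"
  unfolding weak_grad_def by (rule someI[of "has_weak_grad \<Omega> y" g])

lemma weak_grad_AE:
  assumes "open \<Omega>" "has_weak_grad \<Omega> y g"
  shows "AE x in lebesgue_on \<Omega>. weak_grad \<Omega> y x = g x"
  using has_weak_grad_unique[OF assms(1) has_weak_grad_weak_grad[OF assms(2)] assms(2)] .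

section \<open>Sobolev functions and their quasi-norm\<close>

lemma W1pD:
  assumes "open \<Omega>" "y \<in> W1p \<Omega> p"
  shows "y \<in> Lp \<Omega> p" "weak_grad \<Omega> y \<in> Lp \<Omega> p" "has_weak_grad \<Omega> y (weak_grad \<Omega> y)"
    "y \<in> borel_measurable (lebesgue_on \<Omega>)" "weak_grad \<Omega> y \<in> borel_measurable (lebesgue_on \<Omega>)"
proof -
  obtain g where g: "g \<in> Lp \<Omega> p" "has_weak_grad \<Omega> y g" using assms by (auto simp: W1p_def)
  show "weak_grad \<Omega> y \<in> Lp \<Omega> p"
    using weak_grad_AE[OF assms(1) g(2)] by (intro Lp_AE_cong[OF assms(1) g(1)]) (auto simp: eq_commute)
  then show "weak_grad \<Omega> y \<in> borel_measurable (lebesgue_on \<Omega>)" by (rule LpD)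
  show "y \<in> Lp \<Omega> p" using assms(2) by (simp add: W1p_def)
  then show "y \<in> borel_measurable (lebesgue_on \<Omega>)" by (rule LpD)
  show "has_weak_grad \<Omega> y (weak_grad \<Omega> y)" using g(2) by (rule has_weak_grad_weak_grad)
qed

lemma W1p_add:
  assumes "open \<Omega>" "0 < p" "y \<in> W1p \<Omega> p" "z \<in> W1p \<Omega> p"
  shows "y + z \<in> W1p \<Omega> p"
    "AE x in lebesgue_on \<Omega>. weak_grad \<Omega> (y + z) x = weak_grad \<Omega> y x + weak_grad \<Omega> z x"
proof -
  note Y = W1pD[OF assms(1,3)] and Z = W1pD[OF assms(1,4)]
  have g: "has_weak_grad \<Omega> (y + z) (\<lambda>x. weak_grad \<Omega> y x + weak_grad \<Omega> z x)"
    using has_weak_grad_add[OF assms(1) Y(3) Z(3)] by (simp add: plus_fun_def)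
  then show "AE x in lebesgue_on \<Omega>. weak_grad \<Omega> (y + z) x = weak_grad \<Omega> y x + weak_grad \<Omega> z x"
    by (rule weak_grad_AE[OF assms(1)])
  show "y + z \<in> W1p \<Omega> p"
    using Lp_add(1)[OF Y(1) Z(1) assms(2)] Lp_add(1)[OF Y(2) Z(2) assms(2)] g
    by (auto simp: W1p_def plus_fun_def)
qed

lemma W1p_scaleR:
  assumes "open \<Omega>" "y \<in> W1p \<Omega> p"
  shows "c *\<^sub>R y \<in> W1p \<Omega> p"
    "AE x in lebesgue_on \<Omega>. weak_grad \<Omega> (c *\<^sub>R y) x = c *\<^sub>R weak_grad \<Omega> y x"
proof -
  note Y = W1pD[OF assms]
  have g: "has_weak_grad \<Omega> (c *\<^sub>R y) (\<lambda>x. c *\<^sub>R weak_grad \<Omega> y x)"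
    using has_weak_grad_scaleR[OF assms(1) Y(3)] by (simp add: scaleR_fun_def)
  then show "AE x in lebesgue_on \<Omega>. weak_grad \<Omega> (c *\<^sub>R y) x = c *\<^sub>R weak_grad \<Omega> y x"
    by (rule weak_grad_AE[OF assms(1)])
  show "c *\<^sub>R y \<in> W1p \<Omega> p"
    using Lp_scaleR(1)[OF Y(1)] Lp_scaleR(1)[OF Y(2)] g
    by (auto simp: W1p_def scaleR_fun_def)
qed

lemma W1p_diff:
  assumes "open \<Omega>" "0 < p" "y \<in> W1p \<Omega> p" "z \<in> W1p \<Omega> p"
  shows "y - z \<in> W1p \<Omega> p"
    "AE x in lebesgue_on \<Omega>. weak_grad \<Omega> (y - z) x = weak_grad \<Omega> y x - weak_grad \<Omega> z x"
proof -
  have e: "y - z = y + (-1) *\<^sub>R z" by (simp add: scaleR_fun_def fun_eq_iff)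
  note Z = W1p_scaleR[OF assms(1,4), of "-1"]
  show "y - z \<in> W1p \<Omega> p" unfolding e by (rule W1p_add(1)[OF assms(1-3) Z(1)])
  show "AE x in lebesgue_on \<Omega>. weak_grad \<Omega> (y - z) x = weak_grad \<Omega> y x - weak_grad \<Omega> z x"
    unfolding e using W1p_add(2)[OF assms(1-3) Z(1)] Z(2) by eventually_elim simp
qed

text \<open>The p-th power of the norm. Being a sum of two integrals, it takes the estimates for the
  function and for the gradient separately.\<close>

definition W1p_pow :: "(real^'n) set \<Rightarrow> real \<Rightarrow> (real^'n \<Rightarrow> real) \<Rightarrow> real"
  where "W1p_pow \<Omega> p y = (LINT x|lebesgue_on \<Omega>. \<bar>y x\<bar> powr p) +
      (LINT x|lebesgue_on \<Omega>. norm (weak_grad \<Omega> y x) powr p)"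

lemma W1p_pow_nonneg: "0 \<le> W1p_pow \<Omega> p y"
  by (simp add: W1p_pow_def)

lemma W1p_norm_nonneg: "0 \<le> W1p_norm \<Omega> p y"
  by (simp add: W1p_norm_def)

lemma W1p_norm_eq: "W1p_norm \<Omega> p y = W1p_pow \<Omega> p y powr (1 / p)"
  by (simp add: W1p_norm_def W1p_pow_def)

lemma W1p_pow_eq: "p \<noteq> 0 \<Longrightarrow> W1p_pow \<Omega> p y = W1p_norm \<Omega> p y powr p"
  using W1p_pow_nonneg[of \<Omega> p y] by (simp add: W1p_norm_eq powr_powr)

lemma W1p_pow_add:
  assumes "open \<Omega>" "0 < p" "y \<in> W1p \<Omega> p" "z \<in> W1p \<Omega> p"
  shows "W1p_pow \<Omega> p (y + z) \<le> 2 powr p * (W1p_pow \<Omega> p y + W1p_pow \<Omega> p z)"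
proof -
  note Y = W1pD[OF assms(1,3)] and Z = W1pD[OF assms(1,4)] and A = W1p_add[OF assms]
  note YZ = W1pD[OF assms(1) A(1)]
  have "(LINT x|lebesgue_on \<Omega>. norm (weak_grad \<Omega> (y + z) x) powr p) =
        (LINT x|lebesgue_on \<Omega>. norm (weak_grad \<Omega> y x + weak_grad \<Omega> z x) powr p)"
  proof (rule integral_cong_AE)
    show "AE x in lebesgue_on \<Omega>. norm (weak_grad \<Omega> (y + z) x) powr p = norm (weak_grad \<Omega> y x + weak_grad \<Omega> z x) powr p"
      using A(2) by eventually_elim simp
  qed (use YZ(5) Y(5) Z(5) in measurable)
  then show ?thesis
    using Lp_add(2)[OF Y(1) Z(1) assms(2)] Lp_add(2)[OF Y(2) Z(2) assms(2)]
    by (simp add: W1p_pow_def distrib_left)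
qed

text \<open>With A and B the two norms, the p-th power of the left side is at most 2^p (A^p + B^p),
  hence at most 2^p times 2 (A + B)^p; since 2 <= 2^p for p >= 1, the factor 4 results.\<close>

lemma W1p_norm_add:
  assumes "open \<Omega>" "1 \<le> p" "y \<in> W1p \<Omega> p" "z \<in> W1p \<Omega> p"
  shows "W1p_norm \<Omega> p (y + z) \<le> 4 * (W1p_norm \<Omega> p y + W1p_norm \<Omega> p z)"
proof -
  let ?m = "W1p_norm \<Omega> p y + W1p_norm \<Omega> p z"
  have m: "0 \<le> ?m" by (simp add: add_nonneg_nonneg W1p_norm_nonneg)
  have "W1p_pow \<Omega> p (y + z) \<le> 2 powr p * (W1p_norm \<Omega> p y powr p + W1p_norm \<Omega> p z powr p)"
    using W1p_pow_add[OF assms(1) _ assms(3,4)] assms(2) by (simp add: W1p_pow_eq)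
  also have "\<dots> \<le> 2 powr p * (?m powr p + ?m powr p)"
    using assms(2) W1p_norm_nonneg[of \<Omega> p] by (intro mult_left_mono add_mono powr_mono2) auto
  also have "\<dots> = 2 powr p * 2 * ?m powr p" by simp
  also have "\<dots> \<le> 2 powr p * 2 powr p * ?m powr p"
    using powr_mono[of 1 p 2] assms(2) by (intro mult_right_mono mult_left_mono) auto
  also have "\<dots> = (4 * ?m) powr p"
    using m by (simp add: powr_mult[symmetric])
  finally have "W1p_pow \<Omega> p (y + z) powr (1 / p) \<le> ((4 * ?m) powr p) powr (1 / p)"
    using assms(2) W1p_pow_nonneg by (intro powr_mono2) auto
  then show ?thesis using assms(2) m by (simp add: W1p_norm_eq[symmetric] powr_powr)
qed

lemma W1p_norm_scaleR:
  assumes "open \<Omega>" "0 < p" "y \<in> W1p \<Omega> p"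
  shows "W1p_norm \<Omega> p (c *\<^sub>R y) = \<bar>c\<bar> * W1p_norm \<Omega> p y"
proof -
  note Y = W1pD[OF assms(1,3)] and A = W1p_scaleR[OF assms(1,3), of c]
  note YZ = W1pD[OF assms(1) A(1)]
  have "(LINT x|lebesgue_on \<Omega>. norm (weak_grad \<Omega> (c *\<^sub>R y) x) powr p) =
        (LINT x|lebesgue_on \<Omega>. norm (c *\<^sub>R weak_grad \<Omega> y x) powr p)"
  proof (rule integral_cong_AE)
    show "AE x in lebesgue_on \<Omega>. norm (weak_grad \<Omega> (c *\<^sub>R y) x) powr p = norm (c *\<^sub>R weak_grad \<Omega> y x) powr p"
      using A(2) by eventually_elim simp
  qed (use YZ(5) Y(5) in measurable)
  then have "W1p_pow \<Omega> p (c *\<^sub>R y) = \<bar>c\<bar> powr p * W1p_pow \<Omega> p y"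
    using Lp_scaleR(2)[OF Y(1), of c] Lp_scaleR(2)[OF Y(2), of c]
    by (simp add: W1p_pow_def distrib_left scaleR_fun_def)
  then show ?thesis
    using assms(2) W1p_pow_nonneg[of \<Omega> p y] by (simp add: W1p_norm_eq powr_mult powr_powr)
qed

lemma W1p_norm_minus_commute:
  assumes "open \<Omega>" "0 < p" "y \<in> W1p \<Omega> p" "z \<in> W1p \<Omega> p"
  shows "W1p_norm \<Omega> p (y - z) = W1p_norm \<Omega> p (z - y)"
proof -
  have "z - y = (-1) *\<^sub>R (y - z)" by (simp add: scaleR_fun_def fun_eq_iff)
  then show ?thesis using W1p_norm_scaleR[OF assms(1,2) W1p_diff(1)[OF assms], of "-1"] by simp
qed

lemma W1p_norm_eq_0D:
  assumes "open \<Omega>" "0 < p" "y \<in> W1p \<Omega> p" "W1p_norm \<Omega> p y = 0"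
  shows "AE x in lebesgue_on \<Omega>. y x = 0" "AE x in lebesgue_on \<Omega>. weak_grad \<Omega> y x = 0"
proof -
  note Y = W1pD[OF assms(1,3)]
  have "W1p_pow \<Omega> p y = 0" using assms(2,4) by (simp add: W1p_pow_eq)
  then have 0: "(LINT x|lebesgue_on \<Omega>. \<bar>y x\<bar> powr p) = 0"
    "(LINT x|lebesgue_on \<Omega>. norm (weak_grad \<Omega> y x) powr p) = 0"
    unfolding W1p_pow_def by (simp_all add: add_nonneg_eq_0_iff)
  have "AE x in lebesgue_on \<Omega>. \<bar>y x\<bar> powr p = 0"
    using 0(1) LpD(2)[OF Y(1)] by (subst (asm) integral_nonneg_eq_0_iff_AE) auto
  then show "AE x in lebesgue_on \<Omega>. y x = 0" by eventually_elim simp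
  have "AE x in lebesgue_on \<Omega>. norm (weak_grad \<Omega> y x) powr p = 0"
    using 0(2) LpD(2)[OF Y(2)] by (subst (asm) integral_nonneg_eq_0_iff_AE) auto
  then show "AE x in lebesgue_on \<Omega>. weak_grad \<Omega> y x = 0" by eventually_elim simp
qed

text \<open>Test functions vanish outside \<open>\<Omega>\<close>, so their Sobolev norms become
  Borel integrals over the whole space, where translations and Fubini are available.\<close>

lemma test_function_W1p:
  assumes \<Omega>: "open \<Omega>" and \<phi>: "\<phi> \<in> test_functions \<Omega>" and p: "0 < p"
  shows "\<phi> \<in> W1p \<Omega> p" "AE x in lebesgue_on \<Omega>. weak_grad \<Omega> \<phi> x = grad \<phi> x"
    "W1p_pow \<Omega> p \<phi> = (LINT x|lborel. \<bar>\<phi> x\<bar> powr p) + (LINT x|lborel. norm (grad \<phi> x) powr p)"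
    "integrable lborel (\<lambda>x. \<bar>\<phi> x\<bar> powr p)" "integrable lborel (\<lambda>x. norm (grad \<phi> x) powr p)"
proof -
  note T = test_functionD[OF \<phi>]
  have [measurable]: "\<phi> \<in> borel_measurable borel" "grad \<phi> \<in> borel_measurable borel"
    by (auto intro!: borel_measurable_continuous_onI T)
  have I: "integrable lborel (\<lambda>x. \<bar>\<phi> x\<bar> powr p)"
  proof (rule integrable_compact_support)
    show "continuous_on UNIV (\<lambda>x. \<bar>\<phi> x\<bar> powr p)"
      using p by (intro continuous_on_powr' continuous_intros T) auto
    show "\<bar>\<phi> x\<bar> powr p = 0" if "x \<notin> closure {x. \<phi> x \<noteq> 0}" for x
      by (simp only: T(4)[OF that]) simp
  qed (rule T(2))
  have J: "integrable lborel (\<lambda>x. norm (grad \<phi> x) powr p)"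
  proof (rule integrable_compact_support)
    show "continuous_on UNIV (\<lambda>x. norm (grad \<phi> x) powr p)"
      using p by (intro continuous_on_powr' continuous_intros T) auto
    show "norm (grad \<phi> x) powr p = 0" if "x \<notin> closure {x. \<phi> x \<noteq> 0}" for x
    proof -
      have "grad \<phi> x = 0" using partial_deriv_outside[OF that] by (simp add: grad_def vec_eq_iff)
      then show ?thesis by simp
    qed
  qed (use T(2) in auto)
  show "integrable lborel (\<lambda>x. \<bar>\<phi> x\<bar> powr p)" "integrable lborel (\<lambda>x. norm (grad \<phi> x) powr p)"
    using I J by auto
  have on: "integrable (lebesgue_on \<Omega>) f" if "integrable lborel f" "f \<in> borel_measurable borel" for f :: "real^'a \<Rightarrow> real"
  proof -
    have "integrable lebesgue (\<lambda>x. indicator \<Omega> x *\<^sub>R f x)"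
      using \<Omega> that by (intro integrable_mult_indicator) (auto simp: integrable_completion)
    then show ?thesis using \<Omega> by (subst integrable_restrict_space) auto
  qed
  have meas: "f \<in> borel_measurable (lebesgue_on \<Omega>)" if "f \<in> borel_measurable borel" for f :: "real^'a \<Rightarrow> 'b::euclidean_space"
    using that by (intro measurable_restrict_space1 measurable_completion) simp
  have "\<phi> \<in> Lp \<Omega> p" "grad \<phi> \<in> Lp \<Omega> p"
    using on[OF I] on[OF J] by (auto simp: Lp_def intro!: meas)
  then show W: "\<phi> \<in> W1p \<Omega> p"
    using test_function_has_weak_grad[OF \<Omega> \<phi>] by (auto simp: W1p_def)
  show ae: "AE x in lebesgue_on \<Omega>. weak_grad \<Omega> \<phi> x = grad \<phi> x"
    by (rule weak_grad_AE[OF \<Omega> test_function_has_weak_grad[OF \<Omega> \<phi>]])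
  have "(LINT x|lebesgue_on \<Omega>. norm (weak_grad \<Omega> \<phi> x) powr p) = (LINT x|lebesgue_on \<Omega>. norm (grad \<phi> x) powr p)"
  proof (rule integral_cong_AE)
    show "AE x in lebesgue_on \<Omega>. norm (weak_grad \<Omega> \<phi> x) powr p = norm (grad \<phi> x) powr p"
      using ae by eventually_elim simp
    show "(\<lambda>x. norm (grad \<phi> x) powr p) \<in> borel_measurable (lebesgue_on \<Omega>)"
      by (rule meas) measurable
  qed (use W1pD(5)[OF \<Omega> W] in measurable)
  also have "\<dots> = (LINT x|lborel. norm (grad \<phi> x) powr p)"
    using T(9) by (intro integral_lebesgue_on_support[OF \<Omega>]) auto
  moreover have "(LINT x|lebesgue_on \<Omega>. \<bar>\<phi> x\<bar> powr p) = (LINT x|lborel. \<bar>\<phi> x\<bar> powr p)"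
    using T(5) by (intro integral_lebesgue_on_support[OF \<Omega>]) auto
  ultimately show "W1p_pow \<Omega> p \<phi> = (LINT x|lborel. \<bar>\<phi> x\<bar> powr p) + (LINT x|lborel. norm (grad \<phi> x) powr p)"
    by (simp add: W1p_pow_def)
qed

section \<open>The closure of the test functions\<close>

lemma W01pD: "y \<in> W01p \<Omega> p \<Longrightarrow> y \<in> W1p \<Omega> p"
  by (simp add: W01p_def)

lemma W01p_approx:
  assumes "y \<in> W01p \<Omega> p"
  obtains \<phi> where "\<And>n. \<phi> n \<in> test_functions \<Omega>" "(\<lambda>n. W1p_norm \<Omega> p (\<phi> n - y)) \<longlonglongrightarrow> 0"
  using assms by (auto simp: W01p_def)

lemma W01p_scaleR:
  assumes "open \<Omega>" "0 < p" "y \<in> W01p \<Omega> p"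
  shows "c *\<^sub>R y \<in> W01p \<Omega> p"
proof -
  obtain \<phi> where \<phi>: "\<And>n. \<phi> n \<in> test_functions \<Omega>" "(\<lambda>n. W1p_norm \<Omega> p (\<phi> n - y)) \<longlonglongrightarrow> 0"
    using W01p_approx[OF assms(3)] by metis
  have "W1p_norm \<Omega> p (c *\<^sub>R \<phi> n - c *\<^sub>R y) = \<bar>c\<bar> * W1p_norm \<Omega> p (\<phi> n - y)" for n
  proof -
    have "c *\<^sub>R \<phi> n - c *\<^sub>R y = c *\<^sub>R (\<phi> n - y)"
      by (simp add: scaleR_fun_def fun_eq_iff algebra_simps)
    then show ?thesis
      using W1p_norm_scaleR[OF assms(1,2) W1p_diff(1)[OF assms(1,2) test_function_W1p(1)[OF assms(1) \<phi>(1) assms(2)] W01pD[OF assms(3)]]]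
      by simp
  qed
  then have "(\<lambda>n. W1p_norm \<Omega> p (c *\<^sub>R \<phi> n - c *\<^sub>R y)) \<longlonglongrightarrow> 0"
    using tendsto_mult_left[OF \<phi>(2), of "\<bar>c\<bar>"] by simp
  then show ?thesis
    using W1p_scaleR(1)[OF assms(1) W01pD[OF assms(3)], of c] test_function_scaleR[OF \<phi>(1), of c]
    unfolding W01p_def by (auto intro!: exI[of _ "\<lambda>n. c *\<^sub>R \<phi> n"])
qed

lemma W01p_add:
  assumes "open \<Omega>" "1 \<le> p" "y \<in> W01p \<Omega> p" "z \<in> W01p \<Omega> p"
  shows "y + z \<in> W01p \<Omega> p"
proof -
  have p: "0 < p" using assms(2) by simp
  obtain \<phi> where \<phi>: "\<And>n. \<phi> n \<in> test_functions \<Omega>" "(\<lambda>n. W1p_norm \<Omega> p (\<phi> n - y)) \<longlonglongrightarrow> 0"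
    using W01p_approx[OF assms(3)] by metis
  obtain \<psi> where \<psi>: "\<And>n. \<psi> n \<in> test_functions \<Omega>" "(\<lambda>n. W1p_norm \<Omega> p (\<psi> n - z)) \<longlonglongrightarrow> 0"
    using W01p_approx[OF assms(4)] by metis
  have le: "W1p_norm \<Omega> p ((\<phi> n + \<psi> n) - (y + z)) \<le> 4 * (W1p_norm \<Omega> p (\<phi> n - y) + W1p_norm \<Omega> p (\<psi> n - z))" for n
  proof -
    have e: "(\<phi> n + \<psi> n) - (y + z) = (\<phi> n - y) + (\<psi> n - z)"
      by (simp add: fun_eq_iff)
    show ?thesis unfolding e
      by (rule W1p_norm_add[OF assms(1,2) W1p_diff(1)[OF assms(1) p test_function_W1p(1)[OF assms(1) \<phi>(1)[of n] p] W01pD[OF assms(3)]]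
         W1p_diff(1)[OF assms(1) p test_function_W1p(1)[OF assms(1) \<psi>(1)[of n] p] W01pD[OF assms(4)]]])
  qed
  have "(\<lambda>n. W1p_norm \<Omega> p ((\<phi> n + \<psi> n) - (y + z))) \<longlonglongrightarrow> 0"
  proof (rule tendsto_0_le_seq)
    show "(\<lambda>n. 4 * (W1p_norm \<Omega> p (\<phi> n - y) + W1p_norm \<Omega> p (\<psi> n - z))) \<longlonglongrightarrow> 0"
      using tendsto_mult_left[OF tendsto_add[OF \<phi>(2) \<psi>(2)], of 4] by simp
  qed (use le W1p_norm_nonneg in auto)
  then show ?thesis
    using W1p_add(1)[OF assms(1) p W01pD[OF assms(3)] W01pD[OF assms(4)]] test_function_add[OF \<phi>(1) \<psi>(1)]
    unfolding W01p_def by (auto intro!: exI[of _ "\<lambda>n. \<phi> n + \<psi> n"])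
qed

lemma W01p_diff:
  assumes "open \<Omega>" "1 \<le> p" "y \<in> W01p \<Omega> p" "z \<in> W01p \<Omega> p"
  shows "y - z \<in> W01p \<Omega> p"
proof -
  have "y - z = y + (-1) *\<^sub>R z" by (simp add: scaleR_fun_def fun_eq_iff)
  then show ?thesis
    using W01p_add[OF assms(1-3) W01p_scaleR[OF assms(1) _ assms(4), of "-1"]] assms(2) by simp
qed

lemma test_function_W01p:
  assumes "open \<Omega>" "0 < p" "\<phi> \<in> test_functions \<Omega>"
  shows "\<phi> \<in> W01p \<Omega> p"
proof -
  have W: "\<phi> \<in> W1p \<Omega> p" by (rule test_function_W1p(1)[OF assms(1,3,2)])
  have "W1p_norm \<Omega> p (0 *\<^sub>R \<phi>) = 0" using W1p_norm_scaleR[OF assms(1,2) W, of 0] by simp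
  then have "W1p_norm \<Omega> p (\<phi> - \<phi>) = 0" by simp
  then show ?thesis using W assms(3) unfolding W01p_def
    by (auto intro!: exI[of _ "\<lambda>_. \<phi>"])
qed

section \<open>Comparison of exponents on bounded domains\<close>

lemma finite_measure_lebesgue_on_bounded:
  assumes "open (\<Omega>::'a::euclidean_space set)" "bounded \<Omega>"
  shows "finite_measure (lebesgue_on \<Omega>)"
  using assms by (intro finite_measure_lebesgue_on lmeasurable_open)

text \<open>\<open>powr_interpolate\<close> integrated over \<open>\<Omega>\<close>; the constant
  l^r contributes the volume. The level stays free so that function and gradient can share one
  choice.\<close>

lemma Lp_mono:
  assumes \<Omega>: "open \<Omega>" "bounded \<Omega>" and r: "0 < r" "r \<le> p" and f: "f \<in> Lp \<Omega> p"
  shows "f \<in> Lp \<Omega> r"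
    "0 < l \<Longrightarrow> (LINT x|lebesgue_on \<Omega>. norm (f x) powr r) \<le>
       measure lebesgue \<Omega> * l powr r + l powr (r - p) * (LINT x|lebesgue_on \<Omega>. norm (f x) powr p)"
proof -
  interpret finite_measure "lebesgue_on \<Omega>" by (rule finite_measure_lebesgue_on_bounded[OF \<Omega>])
  note F = LpD[OF f]
  note [measurable] = F(1)
  have bd: "norm (f x) powr r \<le> l powr r + l powr (r - p) * norm (f x) powr p" if "0 < l" for l x
    using powr_interpolate[OF _ that r, of "norm (f x)"] by simp
  have I: "integrable (lebesgue_on \<Omega>) (\<lambda>x. l powr r + l powr (r - p) * norm (f x) powr p)" for l
    using F(2) by auto
  have J: "integrable (lebesgue_on \<Omega>) (\<lambda>x. norm (f x) powr r)"
    by (rule Bochner_Integration.integrable_bound[OF I[of 1]])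
      (use bd[of 1] in \<open>auto intro!: AE_I2\<close>)
  then show "f \<in> Lp \<Omega> r" using F(1) by (simp add: Lp_def)
  assume "0 < l"
  then have "(LINT x|lebesgue_on \<Omega>. norm (f x) powr r) \<le> (LINT x|lebesgue_on \<Omega>. l powr r + l powr (r - p) * norm (f x) powr p)"
    by (intro integral_mono J I bd)
  then show "(LINT x|lebesgue_on \<Omega>. norm (f x) powr r) \<le>
       measure lebesgue \<Omega> * l powr r + l powr (r - p) * (LINT x|lebesgue_on \<Omega>. norm (f x) powr p)"
    using F(2) \<Omega> by (simp add: measure_restrict_space)
qed

text \<open>Taking the level to be the p-norm itself makes every term a multiple of its r-th power:
  the volume twice, from the function and from the gradient, plus 1 from the interpolated
  part.\<close>

lemma W1p_mono:
  assumes \<Omega>: "open \<Omega>" "bounded \<Omega>" and r: "0 < r" "r \<le> p" and y: "y \<in> W1p \<Omega> p"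
  shows "y \<in> W1p \<Omega> r"
    "W1p_norm \<Omega> r y \<le> (2 * measure lebesgue \<Omega> + 1) powr (1 / r) * W1p_norm \<Omega> p y"
proof -
  note Y = W1pD[OF \<Omega>(1) y]
  show y_r: "y \<in> W1p \<Omega> r"
    using Lp_mono(1)[OF \<Omega> r Y(1)] Lp_mono(1)[OF \<Omega> r Y(2)] Y(3) by (auto simp: W1p_def)
  let ?n = "W1p_norm \<Omega> p y"
  show "W1p_norm \<Omega> r y \<le> (2 * measure lebesgue \<Omega> + 1) powr (1 / r) * ?n"
  \<comment> \<open>The level has to be positive, so functions of norm zero are treated
    separately.\<close>
  proof (cases "?n = 0")
    case True
    have p: "0 < p" using r by simp
    note Z = W1p_norm_eq_0D[OF \<Omega>(1) p y True]
    have "(LINT x|lebesgue_on \<Omega>. \<bar>y x\<bar> powr r) = 0"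
      using Z(1) by (intro integral_eq_zero_AE) auto
    moreover have "(LINT x|lebesgue_on \<Omega>. norm (weak_grad \<Omega> y x) powr r) = 0"
      using Z(2) by (intro integral_eq_zero_AE) auto
    ultimately show ?thesis using True by (simp add: W1p_norm_def)
  next
    case False
    then have n: "0 < ?n" using W1p_norm_nonneg[of \<Omega> p y] by simp
    have "W1p_pow \<Omega> r y \<le> 2 * measure lebesgue \<Omega> * ?n powr r + ?n powr (r - p) * W1p_pow \<Omega> p y"
      using Lp_mono(2)[OF \<Omega> r Y(1) n] Lp_mono(2)[OF \<Omega> r Y(2) n] by (simp add: W1p_pow_def distrib_left)
    also have "?n powr (r - p) * W1p_pow \<Omega> p y = ?n powr r"
      using r by (simp add: W1p_pow_eq powr_add[symmetric])
    also have "2 * measure lebesgue \<Omega> * ?n powr r + ?n powr r = (2 * measure lebesgue \<Omega> + 1) * ?n powr r"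
      by (simp add: distrib_right)
    finally have "W1p_pow \<Omega> r y powr (1 / r) \<le> ((2 * measure lebesgue \<Omega> + 1) * ?n powr r) powr (1 / r)"
      using r W1p_pow_nonneg by (intro powr_mono2) auto
    then show ?thesis using r n by (simp add: W1p_norm_eq[symmetric] powr_mult powr_powr)
  qed
qed

lemma W01p_mono:
  assumes \<Omega>: "open \<Omega>" "bounded \<Omega>" and r: "0 < r" "r \<le> p" and y: "y \<in> W01p \<Omega> p"
  shows "y \<in> W01p \<Omega> r"
proof -
  have p: "0 < p" using r by simp
  obtain \<phi> where \<phi>: "\<And>n. \<phi> n \<in> test_functions \<Omega>" "(\<lambda>n. W1p_norm \<Omega> p (\<phi> n - y)) \<longlonglongrightarrow> 0"
    using W01p_approx[OF y] by metis
  have d: "\<phi> n - y \<in> W1p \<Omega> p" for n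
    by (rule W1p_diff(1)[OF \<Omega>(1) p test_function_W1p(1)[OF \<Omega>(1) \<phi>(1) p] W01pD[OF y]])
  have "(\<lambda>n. W1p_norm \<Omega> r (\<phi> n - y)) \<longlonglongrightarrow> 0"
  proof (rule tendsto_0_le_seq)
    show "(\<lambda>n. (2 * measure lebesgue \<Omega> + 1) powr (1 / r) * W1p_norm \<Omega> p (\<phi> n - y)) \<longlonglongrightarrow> 0"
      using tendsto_mult_left[OF \<phi>(2)] by simp
  qed (use W1p_mono(2)[OF \<Omega> r d] W1p_norm_nonneg in auto)
  then show ?thesis using W1p_mono(1)[OF \<Omega> r W01pD[OF y]] \<phi>(1) unfolding W01p_def by blast
qed

lemma L2_Cauchy_Schwarz:
  fixes f g :: "'a \<Rightarrow> real"
  assumes [measurable]: "f \<in> borel_measurable M" "g \<in> borel_measurable M"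
    and I: "integrable M (\<lambda>x. (f x)\<^sup>2)" "integrable M (\<lambda>x. (g x)\<^sup>2)"
  shows "integrable M (\<lambda>x. f x * g x)"
    "(LINT x|M. \<bar>f x * g x\<bar>) \<le> sqrt (LINT x|M. (f x)\<^sup>2) * sqrt (LINT x|M. (g x)\<^sup>2)"
    "\<bar>LINT x|M. f x * g x\<bar> \<le> sqrt (LINT x|M. (f x)\<^sup>2) * sqrt (LINT x|M. (g x)\<^sup>2)"
proof -
  have "\<bar>f x * g x\<bar> \<le> (f x)\<^sup>2 + (g x)\<^sup>2" for x
  proof -
    have "0 \<le> (\<bar>f x\<bar> - \<bar>g x\<bar>)\<^sup>2" by simp
    then have "2 * (\<bar>f x\<bar> * \<bar>g x\<bar>) \<le> (f x)\<^sup>2 + (g x)\<^sup>2" by (simp add: power2_diff)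
    moreover have "0 \<le> \<bar>f x\<bar> * \<bar>g x\<bar>" by simp
    ultimately show ?thesis unfolding abs_mult by linarith
  qed
  then show J: "integrable M (\<lambda>x. f x * g x)"
    by (intro Bochner_Integration.integrable_bound[OF Bochner_Integration.integrable_add[OF I]]) (auto intro!: AE_I2)
  let ?A = "LINT x|M. \<bar>f x * g x\<bar>" and ?F = "LINT x|M. (f x)\<^sup>2" and ?G = "LINT x|M. (g x)\<^sup>2"
  have "(\<integral>\<^sup>+x. ennreal \<bar>f x\<bar> * ennreal \<bar>g x\<bar> \<partial>M)\<^sup>2 \<le> (\<integral>\<^sup>+x. (ennreal \<bar>f x\<bar>)\<^sup>2 \<partial>M) * (\<integral>\<^sup>+x. (ennreal \<bar>g x\<bar>)\<^sup>2 \<partial>M)"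
    by (rule Cauchy_Schwarz_nn_integral) auto
  moreover have "(\<integral>\<^sup>+x. ennreal \<bar>f x\<bar> * ennreal \<bar>g x\<bar> \<partial>M) = ennreal ?A"
  proof -
    have "(\<integral>\<^sup>+x. ennreal \<bar>f x\<bar> * ennreal \<bar>g x\<bar> \<partial>M) = (\<integral>\<^sup>+x. ennreal \<bar>f x * g x\<bar> \<partial>M)"
      by (simp add: ennreal_mult'[symmetric] abs_mult)
    also have "\<dots> = ennreal ?A"
      using J by (intro nn_integral_eq_integral) auto
    finally show ?thesis .
  qed
  moreover have "(\<integral>\<^sup>+x. (ennreal \<bar>f x\<bar>)\<^sup>2 \<partial>M) = ennreal ?F" "(\<integral>\<^sup>+x. (ennreal \<bar>g x\<bar>)\<^sup>2 \<partial>M) = ennreal ?G"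
    using I by (simp_all add: ennreal_power nn_integral_eq_integral)
  ultimately have "ennreal (?A\<^sup>2) \<le> ennreal (?F * ?G)"
    by (simp add: ennreal_power ennreal_mult')
  then have "?A\<^sup>2 \<le> ?F * ?G"
    by (subst (asm) ennreal_le_iff) auto
  then have "sqrt (?A\<^sup>2) \<le> sqrt (?F * ?G)" by (rule real_sqrt_le_mono)
  then show A: "?A \<le> sqrt ?F * sqrt ?G" by (simp add: real_sqrt_mult)
  have "\<bar>LINT x|M. f x * g x\<bar> \<le> ?A" using integral_norm_bound[of M "\<lambda>x. f x * g x"] by simp
  then show "\<bar>LINT x|M. f x * g x\<bar> \<le> sqrt ?F * sqrt ?G" using A by linarith
qed

section \<open>Averages over cubes\<close>

abbreviation unit_cube :: "(real^'n) set" where "unit_cube \<equiv> cbox (- 1) 1"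

text \<open>This is 2^N, kept symbolic because only its positivity enters; the type argument carries
  the dimension.\<close>

definition cube_vol :: "(real^'n) itself \<Rightarrow> real"
  where "cube_vol _ = measure lborel (unit_cube :: (real^'n) set)"

lemma cube_vol_pos: "0 < cube_vol TYPE(real^'n)"
proof -
  have "unit_cube \<noteq> ({} :: (real^'n) set)" by (auto simp: interval_eq_empty_cart)
  then have "measure lborel (unit_cube :: (real^'n) set) = (\<Prod>i\<in>(UNIV::'n set). 1 - - 1)"
    by (subst content_cbox_cart) auto
  then show ?thesis by (simp add: cube_vol_def)
qed

lemma emeasure_unit_cube: "emeasure lborel (unit_cube :: (real^'n) set) = ennreal (cube_vol TYPE(real^'n))"
  unfolding cube_vol_def using emeasure_lborel_cbox_finite[of "- 1 :: real^'n" 1]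
  by (intro emeasure_eq_ennreal_measure) auto

lemma norm_unit_cube: "z \<in> unit_cube \<Longrightarrow> norm (z :: real^'n) \<le> real CARD('n)"
proof -
  assume "z \<in> unit_cube"
  then have "\<bar>z $ i\<bar> \<le> 1" for i by (auto simp: mem_box_cart abs_le_iff minus_le_iff)
  then have "(\<Sum>i\<in>UNIV. \<bar>z $ i\<bar>) \<le> (\<Sum>i\<in>(UNIV :: 'n set). 1)" by (intro sum_mono) auto
  then show ?thesis using norm_le_l1_cart[of z] by simp
qed

lemma nn_integral_affine:
  fixes f :: "real^'n \<Rightarrow> ennreal"
  assumes [measurable]: "f \<in> borel_measurable borel" and s: "0 < s"
  shows "(\<integral>\<^sup>+z. f (x + s *\<^sub>R z) \<partial>lborel) = ennreal (s powr (- real CARD('n))) * (\<integral>\<^sup>+z. f z \<partial>lborel)"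
proof -
  have "(\<integral>\<^sup>+z. f z \<partial>lborel) = ennreal (s ^ CARD('n)) * (\<integral>\<^sup>+z. f (x + s *\<^sub>R z) \<partial>lborel)"
    using s by (subst lborel_affine[of s x]) (simp_all add: nn_integral_density nn_integral_distr nn_integral_cmult)
  moreover have "ennreal (s powr (- real CARD('n))) * ennreal (s ^ CARD('n)) = 1"
    using s by (simp add: ennreal_mult'[symmetric] powr_realpow[symmetric] powr_add[symmetric])
  ultimately show ?thesis by (simp add: mult.assoc[symmetric])
qed

lemma integral_affine:
  fixes f :: "real^'n \<Rightarrow> real"
  assumes [measurable]: "f \<in> borel_measurable borel" and s: "s \<noteq> 0"
  shows "(LINT z|lborel. f z) = \<bar>s\<bar> ^ CARD('n) * (LINT z|lborel. f (x + s *\<^sub>R z))"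
  using s by (subst lborel_affine[of s x]) (simp_all add: integral_density integral_distr)

text \<open>For s > 0 this is, up to a constant factor, the mean of g over the cube with centre x
  and half side s. Values in \<open>ennreal\<close> let Fubini be applied without integrability
  conditions.\<close>

definition cube_int :: "(real^'n \<Rightarrow> real) \<Rightarrow> real \<Rightarrow> real^'n \<Rightarrow> ennreal"
  where "cube_int g s x = (\<integral>\<^sup>+z. ennreal (g (x + s *\<^sub>R z)) * indicator unit_cube z \<partial>lborel)"

lemma cube_int_measurable [measurable]:
  assumes [measurable]: "g \<in> borel_measurable borel"
  shows "(\<lambda>(s, x). cube_int g s x) \<in> borel_measurable (borel \<Otimes>\<^sub>M borel)"
    "cube_int g s \<in> borel_measurable borel" "(\<lambda>s. cube_int g s x) \<in> borel_measurable borel"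
  unfolding cube_int_def[abs_def] by measurable

lemma cube_int_scale:
  fixes g :: "real^'n \<Rightarrow> real"
  assumes [measurable]: "g \<in> borel_measurable borel" and s: "0 < s"
  shows "cube_int g s x \<le> ennreal (s powr (- real CARD('n))) * (\<integral>\<^sup>+z. ennreal (g z) \<partial>lborel)"
proof -
  have "cube_int g s x \<le> (\<integral>\<^sup>+z. ennreal (g (x + s *\<^sub>R z)) \<partial>lborel)"
    unfolding cube_int_def by (intro nn_integral_mono) (auto split: split_indicator)
  also have "\<dots> = ennreal (s powr (- real CARD('n))) * (\<integral>\<^sup>+z. ennreal (g z) \<partial>lborel)"
    by (rule nn_integral_affine[OF _ s]) measurable
  finally show ?thesis .
qed

lemma cube_int_total:
  fixes g :: "real^'n \<Rightarrow> real"
  assumes [measurable]: "g \<in> borel_measurable borel"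
  shows "(\<integral>\<^sup>+x. cube_int g s x \<partial>lborel) = ennreal (cube_vol TYPE(real^'n)) * (\<integral>\<^sup>+z. ennreal (g z) \<partial>lborel)"
proof -
  have "(\<integral>\<^sup>+x. cube_int g s x \<partial>lborel) =
     (\<integral>\<^sup>+z. (\<integral>\<^sup>+x. ennreal (g (x + s *\<^sub>R z)) * indicator unit_cube z \<partial>lborel) \<partial>lborel)"
    unfolding cube_int_def by (rule lborel_pair.Fubini') measurable
  also have "\<dots> = (\<integral>\<^sup>+z. (\<integral>\<^sup>+x. ennreal (g x) \<partial>lborel) * indicator unit_cube z \<partial>(lborel :: (real^'n) measure))"
  proof (rule nn_integral_cong)
    fix z :: "real^'n"
    have "(\<integral>\<^sup>+x. ennreal (g (x + s *\<^sub>R z)) \<partial>lborel) = (\<integral>\<^sup>+x. ennreal (g x) \<partial>lborel)"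
      by (rule nn_integral_translate) measurable
    then show "(\<integral>\<^sup>+x. ennreal (g (x + s *\<^sub>R z)) * indicator unit_cube z \<partial>lborel) =
        (\<integral>\<^sup>+x. ennreal (g x) \<partial>lborel) * indicator unit_cube z"
      by (simp add: nn_integral_multc)
  qed
  also have "\<dots> = (\<integral>\<^sup>+x. ennreal (g x) \<partial>lborel) * emeasure lborel (unit_cube :: (real^'n) set)"
    by (subst nn_integral_cmult_indicator) auto
  finally show ?thesis by (simp add: emeasure_unit_cube mult.commute)
qed

text \<open>\<open>powr_interpolate\<close> with the exponents 1 and r, integrated over the cube. It
  trades the mean of g for the mean of g^r, with the level l still to be chosen.\<close>

lemma cube_int_interpolate:
  fixes g :: "real^'n \<Rightarrow> real"
  assumes [measurable]: "g \<in> borel_measurable borel" and g0: "\<And>x. 0 \<le> g x" and r: "1 \<le> r" and l: "0 < l"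
  shows "cube_int g s x \<le> ennreal (l * cube_vol TYPE(real^'n)) + ennreal (l powr (1 - r)) * cube_int (\<lambda>x. g x powr r) s x"
proof -
  have "cube_int g s x \<le> (\<integral>\<^sup>+z. ennreal l * indicator unit_cube z +
      ennreal (l powr (1 - r)) * (ennreal (g (x + s *\<^sub>R z) powr r) * indicator unit_cube z) \<partial>lborel)"
    unfolding cube_int_def
  proof (rule nn_integral_mono)
    fix z
    have "g (x + s *\<^sub>R z) \<le> l + l powr (1 - r) * g (x + s *\<^sub>R z) powr r"
      using powr_interpolate[OF g0 l _ r, of "x + s *\<^sub>R z"] g0 l by simp
    then have "ennreal (g (x + s *\<^sub>R z)) \<le> ennreal (l + l powr (1 - r) * g (x + s *\<^sub>R z) powr r)"
      by (rule ennreal_leI)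
    also have "\<dots> = ennreal l + ennreal (l powr (1 - r)) * ennreal (g (x + s *\<^sub>R z) powr r)"
      using l by (simp add: ennreal_mult'[symmetric])
    finally show "ennreal (g (x + s *\<^sub>R z)) * indicator unit_cube z \<le> ennreal l * indicator unit_cube z +
      ennreal (l powr (1 - r)) * (ennreal (g (x + s *\<^sub>R z) powr r) * indicator unit_cube z)"
      by (auto split: split_indicator)
  qed
  also have "\<dots> = ennreal l * emeasure lborel (unit_cube :: (real^'n) set) +
       ennreal (l powr (1 - r)) * cube_int (\<lambda>x. g x powr r) s x"
    unfolding cube_int_def by (subst nn_integral_add) (auto simp: nn_integral_cmult)
  finally show ?thesis
    using l cube_vol_pos[where 'n='n] by (simp add: emeasure_unit_cube ennreal_mult')
qed

text \<open>The mean of g^r is at most s^(-N), and the level l = s^(-N/r) balances the two terms of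
  the interpolation. The resulting singularity is integrable at s = 0 when r > N.\<close>

lemma cube_int_sup_bound:
  fixes g :: "real^'n \<Rightarrow> real"
  assumes [measurable]: "g \<in> borel_measurable borel" and g0: "\<And>x. 0 \<le> g x" and r: "1 \<le> r" and s: "0 < s"
    and g1: "(\<integral>\<^sup>+z. ennreal (g z powr r) \<partial>lborel) \<le> 1"
  shows "cube_int g s x \<le> ennreal ((cube_vol TYPE(real^'n) + 1) * s powr (- real CARD('n) / r))"
proof -
  let ?m = "cube_vol TYPE(real^'n)"
  define l where "l = s powr (- real CARD('n) / r)"
  have l: "0 < l" using s by (simp add: l_def)
  have "cube_int (\<lambda>x. g x powr r) s x \<le> ennreal (s powr (- real CARD('n))) * (\<integral>\<^sup>+z. ennreal (g z powr r) \<partial>lborel)"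
    by (rule cube_int_scale[OF _ s]) measurable
  also have "\<dots> \<le> ennreal (s powr (- real CARD('n))) * 1"
    by (intro mult_left_mono g1) auto
  finally have "ennreal (l powr (1 - r)) * cube_int (\<lambda>x. g x powr r) s x \<le> ennreal (l powr (1 - r)) * ennreal (s powr (- real CARD('n)))"
    by (intro mult_left_mono) auto
  also have "\<dots> = ennreal l"
  proof -
    have "l powr (1 - r) * s powr (- real CARD('n)) = s powr (- real CARD('n) / r * (1 - r) + - real CARD('n))"
      by (simp add: l_def powr_powr powr_add[symmetric])
    also have "- real CARD('n) / r * (1 - r) + - real CARD('n) = - real CARD('n) / r"
      using r by (simp add: field_simps)
    finally show ?thesis by (simp add: l_def ennreal_mult'[symmetric])
  qed
  finally have "cube_int g s x \<le> ennreal (l * ?m) + ennreal l"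
    using cube_int_interpolate[OF assms(1) g0 r l, where s=s and x=x] by (meson add_left_mono assms(1) order_trans)
  also have "\<dots> = ennreal ((?m + 1) * l)"
    using l cube_vol_pos[where 'n='n] by (simp add: ennreal_plus[symmetric] algebra_simps del: ennreal_plus)
  finally show ?thesis by (simp add: l_def)
qed

text \<open>To be read with a = |h x|, i the mean of g^q over a cube of size s, and c i^(1/q) a
  bound for the mean of g. Since 2/q - 1 >= 0, the bound i <= s^(-N) gives i^(2/q) <= t^2 i for t =
  s^(-\<theta>), \<theta> = N (1/q - 1/2); expanding the square of t a - c i^(1/q) finishes.\<close>

lemma weighted_young:
  fixes s i N q a c :: real
  assumes s: "0 < s" and i: "0 \<le> i" "i \<le> s powr (- N)" and q: "1 \<le> q" "q \<le> 2" and a: "0 \<le> a" and c: "0 \<le> c"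
  shows "a * (c * i powr (1 / q)) \<le> s powr (- (N * (1 / q - 1 / 2))) * (a\<^sup>2 + c\<^sup>2 * i)"
proof -
  define t where "t = s powr (- (N * (1 / q - 1 / 2)))"
  define r where "r = i powr (1 / q)"
  have t: "0 < t" using s by (simp add: t_def)
  have r: "r\<^sup>2 \<le> t\<^sup>2 * i"
  proof (cases "i = 0")
    case False
    then have ipos: "0 < i" using i by simp
    have "r\<^sup>2 = i powr (2 / q)"
      using ipos by (simp add: r_def powr_realpow[symmetric] powr_powr)
    moreover have "i powr (2 / q) = i powr (2 / q - 1) * i"
      using ipos by (simp add: powr_diff)
    moreover have "i powr (2 / q - 1) \<le> (s powr (- N)) powr (2 / q - 1)"
      using i q ipos by (intro powr_mono2) (auto simp: field_simps)
    moreover have "(s powr (- N)) powr (2 / q - 1) = t\<^sup>2"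
      using s by (simp add: t_def powr_realpow[symmetric] powr_powr algebra_simps)
    ultimately show ?thesis using ipos by (simp add: mult_right_mono)
  qed (simp add: r_def)
  have "0 \<le> (t * a - c * r)\<^sup>2" by simp
  then have "2 * (t * (a * (c * r))) \<le> t\<^sup>2 * a\<^sup>2 + c\<^sup>2 * r\<^sup>2"
    by (simp add: power2_eq_square algebra_simps)
  moreover have "c\<^sup>2 * r\<^sup>2 \<le> c\<^sup>2 * (t\<^sup>2 * i)" using r by (intro mult_left_mono) auto
  moreover have "0 \<le> t * (a * (c * r))" using t a c by (simp add: r_def)
  ultimately have "t * (a * (c * r)) \<le> t\<^sup>2 * a\<^sup>2 + c\<^sup>2 * (t\<^sup>2 * i)" by linarith
  then have "t * (a * (c * r)) \<le> t * (t * (a\<^sup>2 + c\<^sup>2 * i))"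
    by (simp add: power2_eq_square algebra_simps)
  then show ?thesis using t by (simp add: t_def r_def)
qed

text \<open>Young's inequality for the convolution with a cube of side \<open>s\<close>; the interpolation
  \<open>a \<le> l + l\<^sup>1\<^sup>-\<^sup>q a\<^sup>q\<close> with \<open>l\<close> the local mean of \<open>g\<^sup>q\<close> to the power \<open>1/q\<close> takes the place of Hoelder's inequality.\<close>

lemma cube_int_L2_pairing:
  fixes g h :: "real^'n \<Rightarrow> real"
  assumes [measurable]: "g \<in> borel_measurable borel" "h \<in> borel_measurable borel"
    and g0: "\<And>x. 0 \<le> g x" and q: "1 \<le> q" "q \<le> 2" and s: "0 < s"
    and g1: "(\<integral>\<^sup>+z. ennreal (g z powr q) \<partial>lborel) \<le> 1"
    and h1: "(\<integral>\<^sup>+x. ennreal ((h x)\<^sup>2) \<partial>lborel) \<le> 1"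
  shows "(\<integral>\<^sup>+x. ennreal \<bar>h x\<bar> * cube_int g s x \<partial>lborel) \<le>
     ennreal ((1 + (cube_vol TYPE(real^'n) + 1)\<^sup>2 * cube_vol TYPE(real^'n)) * s powr (- (real CARD('n) * (1 / q - 1 / 2))))"
proof -
  let ?m = "cube_vol TYPE(real^'n)"
  define \<theta> where "\<theta> = real CARD('n) * (1 / q - 1 / 2)"
  let ?I = "cube_int (\<lambda>x. g x powr q) s"
  have m: "0 < ?m" by (rule cube_vol_pos)
  have pt: "ennreal \<bar>h x\<bar> * cube_int g s x \<le> ennreal (s powr (- \<theta>)) * (ennreal ((h x)\<^sup>2) + ennreal ((?m + 1)\<^sup>2) * ?I x)" for x
  proof -
    have "?I x \<le> ennreal (s powr (- real CARD('n))) * (\<integral>\<^sup>+z. ennreal (g z powr q) \<partial>lborel)"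
      by (rule cube_int_scale[OF _ s]) measurable
    also have "\<dots> \<le> ennreal (s powr (- real CARD('n))) * 1"
      by (intro mult_left_mono g1) auto
    finally have Ile: "?I x \<le> ennreal (s powr (- real CARD('n)))" by simp
    then have "?I x \<noteq> top" by (rule neq_top_trans[OF ennreal_neq_top])
    then obtain i where i: "?I x = ennreal i" "0 \<le> i" by (cases "?I x" rule: ennreal_cases) auto
    with Ile have ile: "i \<le> s powr (- real CARD('n))" by simp
    have T: "cube_int g s x \<le> ennreal ((?m + 1) * i powr (1 / q))"
    proof (cases "i = 0")
      case True
      \<comment> \<open>If the mean of g^q vanishes, only the first term of the interpolation is
        left, and its level can be made arbitrarily small.\<close>
      have "cube_int g s x \<le> 0 + ennreal e" if "0 < e" for e
        using cube_int_interpolate[OF assms(1) g0 q(1), where l="e / ?m" and s=s and x=x] that m i(1) True by simp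
      then have "cube_int g s x \<le> 0" by (rule ennreal_le_epsilon)
      then show ?thesis by simp
    next
      case False
      then have ipos: "0 < i" using i by simp
      \<comment> \<open>The level l = i^(1/q) makes both terms of the interpolation multiples of
        i^(1/q).\<close>
      have "(i powr (1 / q)) powr (1 - q) * i = i powr (1 / q)"
      proof -
        have "(i powr (1 / q)) powr (1 - q) * i = i powr (1 / q * (1 - q) + 1)"
          using ipos by (simp only: powr_powr powr_add powr_one)
        also have "1 / q * (1 - q) + 1 = 1 / q" using q by (simp add: field_simps)
        finally show ?thesis .
      qed
      then have e: "ennreal ((i powr (1 / q)) powr (1 - q)) * ?I x = ennreal (i powr (1 / q))"
        using i by (simp add: ennreal_mult'[symmetric])
      have "cube_int g s x \<le> ennreal (i powr (1 / q) * ?m) + ennreal (i powr (1 / q))"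
        using cube_int_interpolate[OF assms(1) g0 q(1), where l="i powr (1 / q)" and s=s and x=x] ipos unfolding e by simp
      also have "\<dots> = ennreal ((?m + 1) * i powr (1 / q))"
        using m by (simp add: ennreal_plus[symmetric] algebra_simps del: ennreal_plus)
      finally show ?thesis .
    qed
    let ?b = "(?m + 1) * i powr (1 / q)"
    have "\<bar>h x\<bar> * ?b \<le> s powr (- \<theta>) * ((h x)\<^sup>2 + (?m + 1)\<^sup>2 * i)"
      using weighted_young[OF s i(2) ile q, of "\<bar>h x\<bar>" "?m + 1"] m by (simp add: \<theta>_def)
    then have "ennreal (\<bar>h x\<bar> * ?b) \<le> ennreal (s powr (- \<theta>) * ((h x)\<^sup>2 + (?m + 1)\<^sup>2 * i))"
      by (rule ennreal_leI)
    moreover have "ennreal \<bar>h x\<bar> * cube_int g s x \<le> ennreal (\<bar>h x\<bar> * ?b)"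
      using T by (subst ennreal_mult') (auto intro: mult_left_mono)
    moreover have "ennreal (s powr (- \<theta>) * ((h x)\<^sup>2 + (?m + 1)\<^sup>2 * i)) =
        ennreal (s powr (- \<theta>)) * (ennreal ((h x)\<^sup>2) + ennreal ((?m + 1)\<^sup>2) * ?I x)"
      using i by (simp add: ennreal_mult')
    ultimately show ?thesis by simp
  qed
  have "(\<integral>\<^sup>+x. ennreal \<bar>h x\<bar> * cube_int g s x \<partial>lborel) \<le>
     (\<integral>\<^sup>+x. ennreal (s powr (- \<theta>)) * (ennreal ((h x)\<^sup>2) + ennreal ((?m + 1)\<^sup>2) * ?I x) \<partial>lborel)"
    by (rule nn_integral_mono) (rule pt)
  also have "\<dots> = ennreal (s powr (- \<theta>)) * ((\<integral>\<^sup>+x. ennreal ((h x)\<^sup>2) \<partial>lborel) + ennreal ((?m + 1)\<^sup>2) * (\<integral>\<^sup>+x. ?I x \<partial>lborel))"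
    by (simp add: nn_integral_cmult nn_integral_add)
  also have "\<dots> \<le> ennreal (s powr (- \<theta>)) * (1 + ennreal ((?m + 1)\<^sup>2) * (ennreal ?m * 1))"
  proof (subst cube_int_total)
    have X: "ennreal ?m * (\<integral>\<^sup>+z. ennreal (g z powr q) \<partial>lborel) \<le> ennreal ?m * 1"
      by (intro mult_left_mono g1) auto
    show "ennreal (s powr (- \<theta>)) * ((\<integral>\<^sup>+x. ennreal ((h x)\<^sup>2) \<partial>lborel) +
        ennreal ((?m + 1)\<^sup>2) * (ennreal ?m * (\<integral>\<^sup>+z. ennreal (g z powr q) \<partial>lborel))) \<le>
        ennreal (s powr (- \<theta>)) * (1 + ennreal ((?m + 1)\<^sup>2) * (ennreal ?m * 1))"
      by (rule mult_left_mono[OF add_mono[OF h1 mult_left_mono[OF X]]]) auto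
  qed measurable
  also have "\<dots> = ennreal (s powr (- \<theta>) * (1 + (?m + 1)\<^sup>2 * ?m))"
    using m by (simp add: ennreal_mult')
  finally show ?thesis by (simp add: \<theta>_def mult.commute)
qed

section \<open>Distance of a function from its cube averages\<close>

lemma nn_integral_powr_neg:
  assumes "\<theta> < 1" "0 \<le> \<epsilon>"
  shows "(\<integral>\<^sup>+s. ennreal (s powr (- \<theta>)) * indicator {0<..\<epsilon>} s \<partial>lborel) \<le> ennreal (\<epsilon> powr (1 - \<theta>) / (1 - \<theta>))"
proof -
  have "(\<integral>\<^sup>+s. ennreal (s powr (- \<theta>)) * indicator {0<..\<epsilon>} s \<partial>lborel) \<le> (\<integral>\<^sup>+s. ennreal (s powr (- \<theta>)) * indicator {0..\<epsilon>} s \<partial>lborel)"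
    by (intro nn_integral_mono) (auto split: split_indicator)
  also have "\<dots> = ennreal (\<epsilon> powr (- \<theta> + 1) / (- \<theta> + 1))"
    using assms by (intro nn_integral_has_integral_lebesgue' has_integral_powr_from_0) auto
  finally show ?thesis by simp
qed

text \<open>The fundamental theorem of calculus along the segment from x to x + \<epsilon> z. The
  endpoint s = 0 is left out of the interval, a null set, because the cube estimates to be inserted
  hold for s > 0 only.\<close>

lemma segment_bound:
  fixes w :: "real^'n \<Rightarrow> real"
  assumes w: "C_k (Suc k) w" and \<epsilon>: "0 \<le> \<epsilon>"
  shows "ennreal \<bar>w (x + \<epsilon> *\<^sub>R z) - w x\<bar> \<le>
    (\<integral>\<^sup>+s. ennreal (norm z * norm (grad w (x + s *\<^sub>R z))) * indicator {0<..\<epsilon>} s \<partial>lborel)"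
proof -
  let ?f = "\<lambda>s. grad w (x + s *\<^sub>R z) \<bullet> z"
  have cg: "continuous_on UNIV (\<lambda>s. grad w (x + s *\<^sub>R z))"
    by (rule continuous_on_compose2[OF continuous_grad[OF w]]) (auto intro!: continuous_intros)
  have D: "((\<lambda>s. w (x + s *\<^sub>R z)) has_vector_derivative ?f s) (at s within {0..\<epsilon>})" for s
  proof -
    have "(w has_derivative (\<lambda>v. grad w (x + s *\<^sub>R z) \<bullet> v)) (at (x + s *\<^sub>R z))"
      by (intro grad_has_derivative C_1_differentiable[OF w])
    moreover have "((\<lambda>s. x + s *\<^sub>R z) has_derivative (\<lambda>r. r *\<^sub>R z)) (at s)"
      by (auto intro!: derivative_eq_intros)
    ultimately have "(w \<circ> (\<lambda>s. x + s *\<^sub>R z) has_derivative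
        (\<lambda>v. grad w (x + s *\<^sub>R z) \<bullet> v) \<circ> (\<lambda>r. r *\<^sub>R z)) (at s)"
      by (rule diff_chain_at[rotated])
    then have "((\<lambda>s. w (x + s *\<^sub>R z)) has_vector_derivative ?f s) (at s)"
      by (simp add: o_def has_vector_derivative_def)
    then show ?thesis by (rule has_vector_derivative_at_within)
  qed
  have "has_bochner_integral lborel (\<lambda>s. indicator {0..\<epsilon>} s *\<^sub>R ?f s) (w (x + \<epsilon> *\<^sub>R z) - w (x + 0 *\<^sub>R z))"
  proof (rule has_bochner_integral_FTC_Icc[OF \<epsilon> D])
    show "continuous_on {0..\<epsilon>} ?f"
      by (intro continuous_intros continuous_on_subset[OF cg]) auto
  qed
  then have "ennreal \<bar>w (x + \<epsilon> *\<^sub>R z) - w x\<bar> \<le> (\<integral>\<^sup>+s. ennreal (norm (indicator {0..\<epsilon>} s *\<^sub>R ?f s)) \<partial>lborel)"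
    using has_bochner_integral_norm_bound by fastforce
  also have "\<dots> \<le> (\<integral>\<^sup>+s. ennreal (norm z * norm (grad w (x + s *\<^sub>R z))) * indicator {0<..\<epsilon>} s \<partial>lborel)"
  proof (rule nn_integral_mono_AE)
    show "AE s in lborel. ennreal (norm (indicator {0..\<epsilon>} s *\<^sub>R ?f s)) \<le>
       ennreal (norm z * norm (grad w (x + s *\<^sub>R z))) * indicator {0<..\<epsilon>} s"
      using AE_lborel_singleton[of "0::real"]
    proof eventually_elim
      case (elim s)
      have "\<bar>?f s\<bar> \<le> norm z * norm (grad w (x + s *\<^sub>R z))"
        using Cauchy_Schwarz_ineq2[of "grad w (x + s *\<^sub>R z)" z] by (simp add: mult.commute)
      then show ?case using elim by (auto split: split_indicator intro: ennreal_leI)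
    qed
  qed
  finally show ?thesis .
qed

text \<open>An unnormalised average, hence compared with \<open>cube_vol\<close> times w. The
  parameter may be negative, which is how the adjoint of averaging is expressed.\<close>

definition cube_sum :: "(real^'n \<Rightarrow> real) \<Rightarrow> real \<Rightarrow> real^'n \<Rightarrow> real"
  where "cube_sum w \<epsilon> x = (LINT z|lborel. indicator unit_cube z * w (x + \<epsilon> *\<^sub>R z))"

lemma cube_sum_integrable:
  fixes w :: "real^'n \<Rightarrow> real"
  assumes w: "continuous_on UNIV w"
  shows "integrable lborel (\<lambda>z. indicator unit_cube z * w (x + \<epsilon> *\<^sub>R z))"
proof -
  have "continuous_on unit_cube (\<lambda>z. w (x + \<epsilon> *\<^sub>R z))"
    by (rule continuous_on_compose2[OF w]) (auto intro!: continuous_intros)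
  then show ?thesis using borel_integrable_compact[OF compact_cbox] by fastforce
qed

lemma cube_sum_le:
  fixes w :: "real^'n \<Rightarrow> real"
  assumes w: "continuous_on UNIV w"
  shows "ennreal \<bar>cube_sum w \<epsilon> x\<bar> \<le> cube_int (\<lambda>x. \<bar>w x\<bar>) \<epsilon> x"
proof -
  have "ennreal \<bar>cube_sum w \<epsilon> x\<bar> \<le> (\<integral>\<^sup>+z. ennreal (norm (indicator unit_cube z * w (x + \<epsilon> *\<^sub>R z))) \<partial>lborel)"
    unfolding cube_sum_def using integral_norm_bound_ennreal[OF cube_sum_integrable[OF w]] by simp
  also have "\<dots> = cube_int (\<lambda>x. \<bar>w x\<bar>) \<epsilon> x"
    unfolding cube_int_def by (intro nn_integral_cong) (auto split: split_indicator)
  finally show ?thesis .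
qed

text \<open>\<open>segment_bound\<close> is averaged over z; after Fubini the inner integral is a
  cube average of the gradient at scale s. The factor N bounds the norm of z on the unit
  cube.\<close>

lemma cube_sum_diff_bound:
  fixes w :: "real^'n \<Rightarrow> real"
  assumes w: "C_k (Suc k) w" and \<epsilon>: "0 \<le> \<epsilon>"
  shows "ennreal \<bar>cube_vol TYPE(real^'n) * w x - cube_sum w \<epsilon> x\<bar> \<le>
    ennreal (real CARD('n)) * (\<integral>\<^sup>+s. cube_int (\<lambda>x. norm (grad w x)) s x * indicator {0<..\<epsilon>} s \<partial>lborel)"
proof -
  have wc: "continuous_on UNIV w" using w by (rule C_k_imp_continuous)
  have [measurable]: "grad w \<in> borel_measurable borel" "w \<in> borel_measurable borel"
    using continuous_grad[OF w] wc by (auto intro!: borel_measurable_continuous_onI)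
  have I: "integrable lborel (\<lambda>z::real^'n. indicator unit_cube z * w x)"
    by (intro integrable_mult_left) (simp add: integrable_indicator_iff emeasure_unit_cube)
  have "cube_vol TYPE(real^'n) * w x = (LINT z::real^'n|lborel. indicator unit_cube z * w x)"
    by (simp add: cube_vol_def)
  then have eq: "cube_vol TYPE(real^'n) * w x - cube_sum w \<epsilon> x =
      (LINT z|lborel. indicator unit_cube z * w x - indicator unit_cube z * w (x + \<epsilon> *\<^sub>R z))"
    unfolding cube_sum_def using I cube_sum_integrable[OF wc, of x \<epsilon>] by simp
  have "ennreal \<bar>cube_vol TYPE(real^'n) * w x - cube_sum w \<epsilon> x\<bar> \<le>
      (\<integral>\<^sup>+z. ennreal (norm (indicator unit_cube z * w x - indicator unit_cube z * w (x + \<epsilon> *\<^sub>R z))) \<partial>lborel)"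
    unfolding eq real_norm_def[symmetric]
    by (rule integral_norm_bound_ennreal[OF Bochner_Integration.integrable_diff[OF I cube_sum_integrable[OF wc]]])
  also have "\<dots> \<le> (\<integral>\<^sup>+z. (\<integral>\<^sup>+s. ennreal (real CARD('n)) * (ennreal (norm (grad w (x + s *\<^sub>R z))) * indicator unit_cube z * indicator {0<..\<epsilon>} s) \<partial>lborel) \<partial>lborel)"
  proof (rule nn_integral_mono)
    fix z :: "real^'n"
    show "ennreal (norm (indicator unit_cube z * w x - indicator unit_cube z * w (x + \<epsilon> *\<^sub>R z))) \<le>
      (\<integral>\<^sup>+s. ennreal (real CARD('n)) * (ennreal (norm (grad w (x + s *\<^sub>R z))) * indicator unit_cube z * indicator {0<..\<epsilon>} s) \<partial>lborel)"
    proof (cases "z \<in> unit_cube")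
      case True
      have "ennreal \<bar>w (x + \<epsilon> *\<^sub>R z) - w x\<bar> \<le>
         (\<integral>\<^sup>+s. ennreal (norm z * norm (grad w (x + s *\<^sub>R z))) * indicator {0<..\<epsilon>} s \<partial>lborel)"
        by (rule segment_bound[OF w \<epsilon>])
      also have "\<dots> \<le> (\<integral>\<^sup>+s. ennreal (real CARD('n)) * (ennreal (norm (grad w (x + s *\<^sub>R z))) * indicator unit_cube z * indicator {0<..\<epsilon>} s) \<partial>lborel)"
        using True norm_unit_cube[OF True]
        by (intro nn_integral_mono)
          (auto split: split_indicator simp: ennreal_mult'[symmetric] intro!: ennreal_leI mult_right_mono)
      finally show ?thesis using True by (simp add: abs_minus_commute)
    qed simp
  qed
  also have "\<dots> = (\<integral>\<^sup>+s. (\<integral>\<^sup>+z. ennreal (real CARD('n)) * (ennreal (norm (grad w (x + s *\<^sub>R z))) * indicator unit_cube z * indicator {0<..\<epsilon>} s) \<partial>lborel) \<partial>lborel)"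
    by (rule lborel_pair.Fubini') measurable
  also have "\<dots> = (\<integral>\<^sup>+s. ennreal (real CARD('n)) * (cube_int (\<lambda>x. norm (grad w x)) s x * indicator {0<..\<epsilon>} s) \<partial>lborel)"
    unfolding cube_int_def by (intro nn_integral_cong) (simp add: nn_integral_cmult nn_integral_multc)
  also have "\<dots> = ennreal (real CARD('n)) * (\<integral>\<^sup>+s. cube_int (\<lambda>x. norm (grad w x)) s x * indicator {0<..\<epsilon>} s \<partial>lborel)"
    by (rule nn_integral_cmult) measurable
  finally show ?thesis .
qed

section \<open>Supremum and pairing bounds for normalised test functions\<close>

lemma test_function_normalized:
  assumes "open \<Omega>" "\<phi> \<in> test_functions \<Omega>" "0 < p" "W1p_pow \<Omega> p \<phi> \<le> 1"
  shows "(\<integral>\<^sup>+x. ennreal (\<bar>\<phi> x\<bar> powr p) \<partial>lborel) \<le> 1"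
    "(\<integral>\<^sup>+x. ennreal (norm (grad \<phi> x) powr p) \<partial>lborel) \<le> 1"
proof -
  note T = test_function_W1p[OF assms(1-3)]
  have "0 \<le> (LINT x|lborel. \<bar>\<phi> x\<bar> powr p)" "0 \<le> (LINT x|lborel. norm (grad \<phi> x) powr p)" by auto
  with assms(4) have "(LINT x|lborel. \<bar>\<phi> x\<bar> powr p) \<le> 1" "(LINT x|lborel. norm (grad \<phi> x) powr p) \<le> 1"
    unfolding T(3) by linarith+
  then show "(\<integral>\<^sup>+x. ennreal (\<bar>\<phi> x\<bar> powr p) \<partial>lborel) \<le> 1"
    "(\<integral>\<^sup>+x. ennreal (norm (grad \<phi> x) powr p) \<partial>lborel) \<le> 1"
    using T(4,5) by (simp_all add: nn_integral_eq_integral)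
qed

text \<open>Morrey's estimate at scale 1. The gradient part is a multiple of the integral of
  s^(-N/p) over (0,1], which is 1/(1 - N/p) because p > N; the average itself is bounded by
  \<open>cube_int_sup_bound\<close>.\<close>

lemma test_function_sup_bound:
  fixes \<phi> :: "real^'n \<Rightarrow> real"
  assumes \<Omega>: "open \<Omega>" and \<phi>: "\<phi> \<in> test_functions \<Omega>" and p: "real CARD('n) < p" and n: "W1p_pow \<Omega> p \<phi> \<le> 1"
  defines "m \<equiv> cube_vol TYPE(real^'n)"
  shows "\<bar>\<phi> x\<bar> \<le> (m + 1) * (1 + real CARD('n) / (1 - real CARD('n) / p)) / m"
proof -
  let ?N = "real CARD('n)"
  have N: "1 \<le> ?N" by (simp add: Suc_le_eq)
  then have p1: "1 \<le> p" "0 < p" using p by linarith+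
  note T = test_functionD[OF \<phi>] and nrm = test_function_normalized[OF \<Omega> \<phi> p1(2) n]
  have [measurable]: "grad \<phi> \<in> borel_measurable borel" "\<phi> \<in> borel_measurable borel"
    by (auto intro!: borel_measurable_continuous_onI T)
  have m: "0 < m" unfolding m_def by (rule cube_vol_pos)
  have th: "0 < 1 - ?N / p" using p p1 by simp
  have "(\<integral>\<^sup>+s. cube_int (\<lambda>x. norm (grad \<phi> x)) s x * indicator {0<..1} s \<partial>lborel) \<le>
     (\<integral>\<^sup>+s. ennreal (m + 1) * (ennreal (s powr (- (?N / p))) * indicator {0<..1} s) \<partial>lborel)"
  proof (rule nn_integral_mono)
    fix s :: real
    show "cube_int (\<lambda>x. norm (grad \<phi> x)) s x * indicator {0<..1} s \<le>
        ennreal (m + 1) * (ennreal (s powr (- (?N / p))) * indicator {0<..1} s)"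
      using cube_int_sup_bound[of "\<lambda>x. norm (grad \<phi> x)" p s x] nrm(2) p1 m
      by (auto split: split_indicator simp: m_def[symmetric] ennreal_mult')
  qed
  also have "\<dots> = ennreal (m + 1) * (\<integral>\<^sup>+s. ennreal (s powr (- (?N / p))) * indicator {0<..1} s \<partial>lborel)"
    by (rule nn_integral_cmult) measurable
  also have "\<dots> \<le> ennreal (m + 1) * ennreal (1 powr (1 - ?N / p) / (1 - ?N / p))"
    using th by (intro mult_left_mono nn_integral_powr_neg) auto
  also have "\<dots> = ennreal ((m + 1) / (1 - ?N / p))"
    using m th by (simp add: ennreal_mult'[symmetric] del: ennreal_plus)
  finally have S: "(\<integral>\<^sup>+s. cube_int (\<lambda>x. norm (grad \<phi> x)) s x * indicator {0<..1} s \<partial>lborel) \<le> ennreal ((m + 1) / (1 - ?N / p))" .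
  have "ennreal \<bar>m * \<phi> x - cube_sum \<phi> 1 x\<bar> \<le>
      ennreal ?N * (\<integral>\<^sup>+s. cube_int (\<lambda>x. norm (grad \<phi> x)) s x * indicator {0<..1} s \<partial>lborel)"
    unfolding m_def by (rule cube_sum_diff_bound[OF T(1)]) simp
  also have "\<dots> \<le> ennreal ?N * ennreal ((m + 1) / (1 - ?N / p))"
    using S by (rule mult_left_mono) simp
  finally have "ennreal \<bar>m * \<phi> x - cube_sum \<phi> 1 x\<bar> \<le> ennreal (?N * ((m + 1) / (1 - ?N / p)))"
    by (simp add: ennreal_mult'[symmetric])
  then have A: "\<bar>m * \<phi> x - cube_sum \<phi> 1 x\<bar> \<le> ?N * ((m + 1) / (1 - ?N / p))"
    using m th by (subst (asm) ennreal_le_iff) auto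
  have "ennreal \<bar>cube_sum \<phi> 1 x\<bar> \<le> cube_int (\<lambda>x. \<bar>\<phi> x\<bar>) 1 x"
    by (rule cube_sum_le[OF T(6)])
  also have "\<dots> \<le> ennreal ((m + 1) * 1 powr (- ?N / p))"
    unfolding m_def using nrm(1) p1 by (intro cube_int_sup_bound) auto
  finally have B: "\<bar>cube_sum \<phi> 1 x\<bar> \<le> m + 1"
    using m by (simp add: ennreal_le_iff del: ennreal_plus)
  have "m * \<bar>\<phi> x\<bar> \<le> (m + 1) * (1 + ?N / (1 - ?N / p))"
  proof -
    have "m * \<bar>\<phi> x\<bar> = \<bar>m * \<phi> x\<bar>" using m by (simp add: abs_mult)
    also have "\<dots> \<le> \<bar>m * \<phi> x - cube_sum \<phi> 1 x\<bar> + \<bar>cube_sum \<phi> 1 x\<bar>" by linarith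
    also have "\<dots> \<le> ?N * ((m + 1) / (1 - ?N / p)) + (m + 1)" using A B by linarith
    finally show ?thesis by (simp add: distrib_left mult_ac)
  qed
  then show ?thesis using m by (simp add: field_simps)
qed

text \<open>At each scale s the pairing of h with the averaged gradient costs s^(-\<theta>), and
  integrating up to \<epsilon> leaves \<epsilon>^(1-\<theta>). This rate, uniform in both functions,
  is the source of compactness.\<close>

lemma pairing_diff_bound:
  fixes \<phi> h :: "real^'n \<Rightarrow> real"
  assumes \<Omega>: "open \<Omega>" and \<phi>: "\<phi> \<in> test_functions \<Omega>" and q: "1 \<le> q" "q \<le> 2"
    and [measurable]: "h \<in> borel_measurable borel"
    and h1: "(\<integral>\<^sup>+x. ennreal ((h x)\<^sup>2) \<partial>lborel) \<le> 1"
    and n: "W1p_pow \<Omega> q \<phi> \<le> 1" and \<epsilon>: "0 \<le> \<epsilon>"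
  defines "m \<equiv> cube_vol TYPE(real^'n)"
  defines "\<theta> \<equiv> real CARD('n) * (1 / q - 1 / 2)"
  assumes th: "\<theta> < 1"
  shows "(\<integral>\<^sup>+x. ennreal (\<bar>h x\<bar> * \<bar>m * \<phi> x - cube_sum \<phi> \<epsilon> x\<bar>) \<partial>lborel) \<le>
    ennreal (real CARD('n) * ((1 + (m + 1)\<^sup>2 * m) * (\<epsilon> powr (1 - \<theta>) / (1 - \<theta>))))"
proof -
  let ?N = "real CARD('n)" and ?C = "1 + (m + 1)\<^sup>2 * m"
  have q0: "0 < q" using q by simp
  note T = test_functionD[OF \<phi>] and nrm = test_function_normalized[OF \<Omega> \<phi> q0 n]
  have [measurable]: "grad \<phi> \<in> borel_measurable borel" "\<phi> \<in> borel_measurable borel"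
    by (auto intro!: borel_measurable_continuous_onI T)
  have m: "0 < m" unfolding m_def by (rule cube_vol_pos)
  then have C: "0 \<le> ?C" by simp
  let ?g = "\<lambda>x. norm (grad \<phi> x)"
  have "(\<integral>\<^sup>+x. ennreal (\<bar>h x\<bar> * \<bar>m * \<phi> x - cube_sum \<phi> \<epsilon> x\<bar>) \<partial>lborel) \<le>
     (\<integral>\<^sup>+x. ennreal ?N * (\<integral>\<^sup>+s. ennreal \<bar>h x\<bar> * (cube_int ?g s x * indicator {0<..\<epsilon>} s) \<partial>lborel) \<partial>lborel)"
  proof (rule nn_integral_mono)
    fix x
    have "ennreal (\<bar>h x\<bar> * \<bar>m * \<phi> x - cube_sum \<phi> \<epsilon> x\<bar>) = ennreal \<bar>h x\<bar> * ennreal \<bar>m * \<phi> x - cube_sum \<phi> \<epsilon> x\<bar>"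
      by (rule ennreal_mult') simp
    also have "\<dots> \<le> ennreal \<bar>h x\<bar> * (ennreal ?N * (\<integral>\<^sup>+s. cube_int ?g s x * indicator {0<..\<epsilon>} s \<partial>lborel))"
      unfolding m_def by (rule mult_left_mono[OF cube_sum_diff_bound[OF T(1) \<epsilon>]]) simp
    also have "\<dots> = ennreal ?N * (\<integral>\<^sup>+s. ennreal \<bar>h x\<bar> * (cube_int ?g s x * indicator {0<..\<epsilon>} s) \<partial>lborel)"
      by (subst nn_integral_cmult) (simp_all add: mult_ac)
    finally show "ennreal (\<bar>h x\<bar> * \<bar>m * \<phi> x - cube_sum \<phi> \<epsilon> x\<bar>) \<le>
       ennreal ?N * (\<integral>\<^sup>+s. ennreal \<bar>h x\<bar> * (cube_int ?g s x * indicator {0<..\<epsilon>} s) \<partial>lborel)" .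
  qed
  also have "\<dots> = ennreal ?N * (\<integral>\<^sup>+x. \<integral>\<^sup>+s. ennreal \<bar>h x\<bar> * (cube_int ?g s x * indicator {0<..\<epsilon>} s) \<partial>lborel \<partial>lborel)"
    by (rule nn_integral_cmult) measurable
  also have "(\<integral>\<^sup>+x. \<integral>\<^sup>+s. ennreal \<bar>h x\<bar> * (cube_int ?g s x * indicator {0<..\<epsilon>} s) \<partial>lborel \<partial>lborel) =
      (\<integral>\<^sup>+s. \<integral>\<^sup>+x. ennreal \<bar>h x\<bar> * (cube_int ?g s x * indicator {0<..\<epsilon>} s) \<partial>lborel \<partial>lborel)"
    by (rule lborel_pair.Fubini') measurable
  also have "ennreal ?N * \<dots> \<le> ennreal ?N * (\<integral>\<^sup>+s. ennreal ?C * (ennreal (s powr (- \<theta>)) * indicator {0<..\<epsilon>} s) \<partial>lborel)"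
  proof (intro mult_left_mono nn_integral_mono)
    fix s :: real
    have "(\<integral>\<^sup>+x. ennreal \<bar>h x\<bar> * (cube_int ?g s x * indicator {0<..\<epsilon>} s) \<partial>lborel) =
        (\<integral>\<^sup>+x. ennreal \<bar>h x\<bar> * cube_int ?g s x \<partial>lborel) * indicator {0<..\<epsilon>} s"
      by (subst nn_integral_multc[symmetric]) (auto simp: mult_ac)
    also have "\<dots> \<le> ennreal ?C * (ennreal (s powr (- \<theta>)) * indicator {0<..\<epsilon>} s)"
    proof (cases "s \<in> {0<..\<epsilon>}")
      case True
      then have "(\<integral>\<^sup>+x. ennreal \<bar>h x\<bar> * cube_int ?g s x \<partial>lborel) \<le> ennreal (?C * s powr (- \<theta>))"
        unfolding m_def \<theta>_def using nrm(2) h1 q by (intro cube_int_L2_pairing) auto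
      then show ?thesis using True C by (simp add: ennreal_mult')
    qed simp
    finally show "(\<integral>\<^sup>+x. ennreal \<bar>h x\<bar> * (cube_int ?g s x * indicator {0<..\<epsilon>} s) \<partial>lborel) \<le>
        ennreal ?C * (ennreal (s powr (- \<theta>)) * indicator {0<..\<epsilon>} s)" .
  qed simp
  also have "(\<integral>\<^sup>+s. ennreal ?C * (ennreal (s powr (- \<theta>)) * indicator {0<..\<epsilon>} s) \<partial>lborel) =
      ennreal ?C * (\<integral>\<^sup>+s. ennreal (s powr (- \<theta>)) * indicator {0<..\<epsilon>} s \<partial>lborel)"
    by (rule nn_integral_cmult) measurable
  also have "ennreal ?N * (ennreal ?C * (\<integral>\<^sup>+s. ennreal (s powr (- \<theta>)) * indicator {0<..\<epsilon>} s \<partial>lborel)) \<le>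
      ennreal ?N * (ennreal ?C * ennreal (\<epsilon> powr (1 - \<theta>) / (1 - \<theta>)))"
    by (intro mult_left_mono nn_integral_powr_neg th \<epsilon>) auto
  also have "\<dots> = ennreal (?N * (?C * (\<epsilon> powr (1 - \<theta>) / (1 - \<theta>))))"
    unfolding ennreal_mult'[OF of_nat_0_le_iff] ennreal_mult'[OF C] ..
  finally show ?thesis .
qed

text \<open>The averaging error at scale 1 plus the pairing with the average itself. It makes L^2
  act boundedly on test functions, the core of the embedding into the dual space.\<close>

lemma test_pairing_bound:
  fixes \<phi> h :: "real^'n \<Rightarrow> real"
  assumes \<Omega>: "open \<Omega>" and \<phi>: "\<phi> \<in> test_functions \<Omega>" and q: "1 \<le> q" "q \<le> 2"
    and [measurable]: "h \<in> borel_measurable borel"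
    and h1: "(\<integral>\<^sup>+x. ennreal ((h x)\<^sup>2) \<partial>lborel) \<le> 1"
    and n: "W1p_pow \<Omega> q \<phi> \<le> 1"
  defines "m \<equiv> cube_vol TYPE(real^'n)"
  defines "\<theta> \<equiv> real CARD('n) * (1 / q - 1 / 2)"
  assumes th: "\<theta> < 1"
  shows "(\<integral>\<^sup>+x. ennreal (\<bar>h x\<bar> * \<bar>\<phi> x\<bar>) \<partial>lborel) \<le>
    ennreal ((1 + (m + 1)\<^sup>2 * m) * (real CARD('n) / (1 - \<theta>) + 1) / m)"
proof -
  let ?N = "real CARD('n)" and ?C = "1 + (m + 1)\<^sup>2 * m"
  have q0: "0 < q" using q by simp
  note T = test_functionD[OF \<phi>] and nrm = test_function_normalized[OF \<Omega> \<phi> q0 n]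
  have [measurable]: "\<phi> \<in> borel_measurable borel"
    by (auto intro!: borel_measurable_continuous_onI T)
  have m: "0 < m" unfolding m_def by (rule cube_vol_pos)
  have cs[measurable]: "cube_sum \<phi> 1 \<in> borel_measurable borel"
    unfolding cube_sum_def[abs_def] by measurable
  have A: "(\<integral>\<^sup>+x. ennreal (\<bar>h x\<bar> * \<bar>m * \<phi> x - cube_sum \<phi> 1 x\<bar>) \<partial>lborel) \<le> ennreal (?N * (?C / (1 - \<theta>)))"
    using pairing_diff_bound[OF \<Omega> \<phi> q _ h1 n, of 1] th unfolding m_def \<theta>_def by simp
  have B: "(\<integral>\<^sup>+x. ennreal \<bar>h x\<bar> * cube_int (\<lambda>x. \<bar>\<phi> x\<bar>) 1 x \<partial>lborel) \<le> ennreal ?C"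
    using cube_int_L2_pairing[of "\<lambda>x. \<bar>\<phi> x\<bar>" h q 1] nrm(1) h1 q unfolding m_def by simp
  have "(\<integral>\<^sup>+x. ennreal (\<bar>h x\<bar> * \<bar>\<phi> x\<bar>) \<partial>lborel) \<le>
     (\<integral>\<^sup>+x. ennreal (1 / m) * (ennreal (\<bar>h x\<bar> * \<bar>m * \<phi> x - cube_sum \<phi> 1 x\<bar>) + ennreal \<bar>h x\<bar> * cube_int (\<lambda>x. \<bar>\<phi> x\<bar>) 1 x) \<partial>lborel)"
  proof (rule nn_integral_mono)
    fix x
    have "m * \<bar>\<phi> x\<bar> \<le> \<bar>m * \<phi> x - cube_sum \<phi> 1 x\<bar> + \<bar>cube_sum \<phi> 1 x\<bar>"
      using m abs_triangle_ineq[of "m * \<phi> x - cube_sum \<phi> 1 x" "cube_sum \<phi> 1 x"] by (simp add: abs_mult)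
    then have "\<bar>h x\<bar> * (m * \<bar>\<phi> x\<bar>) \<le> \<bar>h x\<bar> * (\<bar>m * \<phi> x - cube_sum \<phi> 1 x\<bar> + \<bar>cube_sum \<phi> 1 x\<bar>)"
      by (rule mult_left_mono) simp
    then have "\<bar>h x\<bar> * \<bar>\<phi> x\<bar> \<le> 1 / m * (\<bar>h x\<bar> * \<bar>m * \<phi> x - cube_sum \<phi> 1 x\<bar> + \<bar>h x\<bar> * \<bar>cube_sum \<phi> 1 x\<bar>)"
      using m by (simp add: field_simps)
    then have "ennreal (\<bar>h x\<bar> * \<bar>\<phi> x\<bar>) \<le> ennreal (1 / m) * (ennreal (\<bar>h x\<bar> * \<bar>m * \<phi> x - cube_sum \<phi> 1 x\<bar>) + ennreal \<bar>h x\<bar> * ennreal \<bar>cube_sum \<phi> 1 x\<bar>)"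
      using m by (simp add: ennreal_mult'[symmetric] ennreal_plus[symmetric] ennreal_leI del: ennreal_plus)
    also have "\<dots> \<le> ennreal (1 / m) * (ennreal (\<bar>h x\<bar> * \<bar>m * \<phi> x - cube_sum \<phi> 1 x\<bar>) + ennreal \<bar>h x\<bar> * cube_int (\<lambda>x. \<bar>\<phi> x\<bar>) 1 x)"
      by (intro mult_left_mono add_left_mono cube_sum_le T) auto
    finally show "ennreal (\<bar>h x\<bar> * \<bar>\<phi> x\<bar>) \<le> ennreal (1 / m) * (ennreal (\<bar>h x\<bar> * \<bar>m * \<phi> x - cube_sum \<phi> 1 x\<bar>) + ennreal \<bar>h x\<bar> * cube_int (\<lambda>x. \<bar>\<phi> x\<bar>) 1 x)" .
  qed
  also have "\<dots> = ennreal (1 / m) * ((\<integral>\<^sup>+x. ennreal (\<bar>h x\<bar> * \<bar>m * \<phi> x - cube_sum \<phi> 1 x\<bar>) \<partial>lborel) +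
       (\<integral>\<^sup>+x. ennreal \<bar>h x\<bar> * cube_int (\<lambda>x. \<bar>\<phi> x\<bar>) 1 x \<partial>lborel))"
    by (subst nn_integral_cmult, simp, subst nn_integral_add) simp_all
  also have "\<dots> \<le> ennreal (1 / m) * (ennreal (?N * (?C / (1 - \<theta>))) + ennreal ?C)"
    by (rule mult_left_mono[OF add_mono[OF A B]]) simp
  also have "\<dots> = ennreal (1 / m * (?N * (?C / (1 - \<theta>)) + ?C))"
  proof -
    have "ennreal (?N * (?C / (1 - \<theta>))) + ennreal ?C = ennreal (?N * (?C / (1 - \<theta>)) + ?C)"
      using m th by (intro ennreal_plus[symmetric]) auto
    moreover have "ennreal (1 / m * (?N * (?C / (1 - \<theta>)) + ?C)) = ennreal (1 / m) * ennreal (?N * (?C / (1 - \<theta>)) + ?C)"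
      using m by (intro ennreal_mult') auto
    ultimately show ?thesis by simp
  qed
  also have "1 / m * (?N * (?C / (1 - \<theta>)) + ?C) = ?C * (?N / (1 - \<theta>) + 1) / m"
  proof -
    have "1 / m * (?N * (c / d) + c) = c * (?N / d + 1) / m" for c d
      by (simp add: distrib_left add_divide_distrib mult.commute)
    then show ?thesis .
  qed
  finally show ?thesis .
qed

section \<open>Compactness\<close>

text \<open>Centre and half side form one parameter, so that Arzela-Ascoli treats all scales in
  [0,1] at once and no diagonal sequence over \<epsilon> is needed.\<close>

definition cube_at :: "(real^'n) \<times> real \<Rightarrow> (real^'n) set"
  where "cube_at a = cbox (fst a - snd a *\<^sub>R 1) (fst a + snd a *\<^sub>R 1)"

lemma mem_cube_at: "y \<in> cube_at a \<longleftrightarrow> (\<forall>i. fst a $ i - snd a \<le> y $ i \<and> y $ i \<le> fst a $ i + snd a)"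
  by (auto simp: cube_at_def mem_box_cart)

lemma cube_at_borel [measurable]: "cube_at a \<in> sets borel"
  by (simp add: cube_at_def)

text \<open>Off the frontier of the limiting cube, a null set, membership of a point is eventually
  constant, and one large box dominates all indicators.\<close>

lemma cube_at_continuous:
  fixes a :: "(real^'n) \<times> real"
  shows "isCont (\<lambda>b. LINT y|lborel. (indicator (cube_at b) y - indicator (cube_at a) y :: real)\<^sup>2) a"
  unfolding continuous_at_sequentially
proof (intro allI impI)
  fix b :: "nat \<Rightarrow> (real^'n) \<times> real" assume b: "b \<longlonglongrightarrow> a"
  have "Bseq b" by (rule convergent_imp_Bseq[OF convergentI[OF b]])
  then obtain B0 where B0: "\<And>n. norm (b n) \<le> B0" by (auto simp: Bseq_def)
  define B where "B = max B0 (norm a)"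
  have B: "norm (b n) \<le> B" "norm a \<le> B" for n using B0[of n] by (auto simp: B_def)
  \<comment> \<open>Centres and half sides are bounded by \<open>B\<close>, so each coordinate of a
    point in any of the cubes is at most 2 B in absolute value.\<close>
  let ?W = "cbox (- (2 * B) *\<^sub>R 1) ((2 * B) *\<^sub>R 1) :: (real^'n) set"
  have sub: "cube_at c \<subseteq> ?W" if "norm c \<le> B" for c :: "(real^'n) \<times> real"
  proof
    fix y assume y: "y \<in> cube_at c"
    have "\<bar>fst c $ i\<bar> \<le> B" for i
      using component_le_norm_cart[of "fst c" i] norm_fst_le[of "fst c" "snd c"] that by simp
    moreover have "\<bar>snd c\<bar> \<le> B" using norm_snd_le[of "snd c" "fst c"] that by simp
    ultimately show "y \<in> ?W"
      using y unfolding mem_cube_at mem_box_cart by (auto simp: abs_le_iff) (smt (verit))+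
  qed
  have "(\<lambda>n. LINT y|lborel. (indicator (cube_at (b n)) y - indicator (cube_at a) y :: real)\<^sup>2) \<longlonglongrightarrow>
      (LINT y|(lborel :: (real^'n) measure). 0)"
  proof (rule integral_dominated_convergence[where w="indicator ?W"])
    show "integrable lborel (indicator ?W :: _ \<Rightarrow> real)"
      using emeasure_lborel_cbox_finite by (simp add: integrable_indicator_iff)
    have "AE y in lborel. y \<notin> cube_at a - box (fst a - snd a *\<^sub>R 1) (fst a + snd a *\<^sub>R 1)"
    proof (rule AE_not_in)
      have "negligible (cube_at a - box (fst a - snd a *\<^sub>R 1) (fst a + snd a *\<^sub>R 1))"
        unfolding cube_at_def by (rule negligible_frontier_interval)
      then show "cube_at a - box (fst a - snd a *\<^sub>R 1) (fst a + snd a *\<^sub>R 1) \<in> null_sets lborel"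
        by (simp add: negligible_iff_null_sets null_sets_completion_iff)
    qed
    then show "AE y in lborel. (\<lambda>n. (indicator (cube_at (b n)) y - indicator (cube_at a) y :: real)\<^sup>2) \<longlonglongrightarrow> 0"
    proof eventually_elim
      case (elim y)
      have lim: "(\<lambda>n. fst (b n) $ i - snd (b n)) \<longlonglongrightarrow> fst a $ i - snd a" "(\<lambda>n. fst (b n) $ i + snd (b n)) \<longlonglongrightarrow> fst a $ i + snd a" for i
        using b by (auto intro!: tendsto_intros)
      have "\<forall>\<^sub>F n in sequentially. y \<in> cube_at (b n) \<longleftrightarrow> y \<in> cube_at a"
      proof (cases "y \<in> cube_at a")
        case True
        with elim have y: "fst a $ i - snd a < y $ i" "y $ i < fst a $ i + snd a" for i
          by (auto simp: mem_box_cart)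
        have "\<forall>\<^sub>F n in sequentially. \<forall>i. fst (b n) $ i - snd (b n) < y $ i \<and> y $ i < fst (b n) $ i + snd (b n)"
          by (intro eventually_all_finite eventually_conj order_tendstoD[OF lim(1)] order_tendstoD[OF lim(2)] y)
        then show ?thesis by eventually_elim (use True in \<open>auto simp: mem_cube_at less_imp_le\<close>)
      next
        case False
        then obtain i where "y $ i < fst a $ i - snd a \<or> fst a $ i + snd a < y $ i"
          by (auto simp: mem_cube_at not_le)
        then have "\<forall>\<^sub>F n in sequentially. y $ i < fst (b n) $ i - snd (b n) \<or> fst (b n) $ i + snd (b n) < y $ i"
        proof
          assume "y $ i < fst a $ i - snd a"
          from order_tendstoD(1)[OF lim(1) this] show ?thesis by eventually_elim simp
        next
          assume "fst a $ i + snd a < y $ i"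
          from order_tendstoD(2)[OF lim(2) this] show ?thesis by eventually_elim simp
        qed
        then show ?thesis
        proof eventually_elim
          case (elim n)
          then have "y \<notin> cube_at (b n)" unfolding mem_cube_at by (meson leD)
          then show ?case using False by simp
        qed
      qed
      then have "\<forall>\<^sub>F n in sequentially. (indicator (cube_at (b n)) y - indicator (cube_at a) y :: real)\<^sup>2 = 0"
        by eventually_elim (auto simp: indicator_def)
      then show ?case by (rule tendsto_eventually)
    qed
    show "AE y in lborel. norm ((indicator (cube_at (b n)) y - indicator (cube_at a) y :: real)\<^sup>2) \<le> indicator ?W y" for n
      using sub[OF B(1)[of n]] sub[OF B(2)] by (auto intro!: AE_I2 split: split_indicator)
  qed measurable
  then show "((\<lambda>b. LINT y|lborel. (indicator (cube_at b) y - indicator (cube_at a) y :: real)\<^sup>2) \<circ> b) \<longlonglongrightarrow>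
     (LINT y|lborel. (indicator (cube_at a) y - indicator (cube_at a) y :: real)\<^sup>2)"
    by (simp add: o_def)
qed

text \<open>By Cauchy-Schwarz the difference is at most the L^2 distance of the two indicators, a
  modulus that does not depend on h in the unit ball.\<close>

lemma cube_at_equicontinuous:
  fixes a :: "(real^'n) \<times> real"
  assumes "0 < (e::real)"
  obtains d where "0 < d" "\<And>b h. norm (a - b) < d \<Longrightarrow> h \<in> borel_measurable borel \<Longrightarrow> integrable lborel (\<lambda>x. (h x)\<^sup>2) \<Longrightarrow>
     (LINT x|lborel. (h x)\<^sup>2) \<le> 1 \<Longrightarrow>
     \<bar>(LINT x|lborel. indicator (cube_at a) x * h x) - (LINT x|lborel. indicator (cube_at b) x * h x)\<bar> < e"
proof -
  let ?\<Phi> = "\<lambda>b. LINT y|lborel. (indicator (cube_at b) y - indicator (cube_at a) y :: real)\<^sup>2"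
  have e2: "0 < e\<^sup>2" using assms by simp
  have "\<exists>d>0. \<forall>b. dist b a < d \<longrightarrow> dist (?\<Phi> b) (?\<Phi> a) < e\<^sup>2"
    using cube_at_continuous[of a] e2 unfolding continuous_at_eps_delta by blast
  moreover have "?\<Phi> a = 0" by simp
  ultimately obtain d where d: "0 < d" "\<And>b. dist b a < d \<Longrightarrow> dist (?\<Phi> b) 0 < e\<^sup>2" by auto
  show thesis
  proof (rule that[OF d(1)])
    fix b and h :: "real^'n \<Rightarrow> real" assume b: "norm (a - b) < d" and [measurable]: "h \<in> borel_measurable borel"
      and h: "integrable lborel (\<lambda>x. (h x)\<^sup>2)" "(LINT x|lborel. (h x)\<^sup>2) \<le> 1"
    have ci: "integrable lborel (indicator (cube_at c) :: (real^'n) \<Rightarrow> real)" for c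
      unfolding cube_at_def using emeasure_lborel_cbox_finite by (simp add: integrable_indicator_iff)
    have "?\<Phi> b < e\<^sup>2" using d(2)[of b] b by (simp add: dist_norm norm_minus_commute)
    have I2: "integrable lborel (\<lambda>y. (indicator (cube_at b) y - indicator (cube_at a) y :: real)\<^sup>2)"
    proof (rule Bochner_Integration.integrable_bound)
      show "integrable lborel (\<lambda>x. indicator (cube_at a) x + indicator (cube_at b) x :: real)"
        by (intro Bochner_Integration.integrable_add ci)
    qed (auto intro!: AE_I2 split: split_indicator)
    have S: "integrable lborel (\<lambda>x. indicator (cube_at c) x * h x)" for c
    proof (rule L2_Cauchy_Schwarz(1))
      have "(\<lambda>x. (indicator (cube_at c) x)\<^sup>2) = (indicator (cube_at c) :: _ \<Rightarrow> real)" by (auto simp: indicator_def fun_eq_iff)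
      then show "integrable lborel (\<lambda>x. (indicator (cube_at c) x :: real)\<^sup>2)" using ci by simp
    qed (use h in auto)
    have "(LINT x|lborel. indicator (cube_at a) x * h x) - (LINT x|lborel. indicator (cube_at b) x * h x) =
       - (LINT x|lborel. (indicator (cube_at b) x - indicator (cube_at a) x) * h x)"
      using S[of a] S[of b] by (simp add: left_diff_distrib)
    moreover have "\<bar>LINT x|lborel. (indicator (cube_at b) x - indicator (cube_at a) x) * h x\<bar> \<le>
        sqrt (?\<Phi> b) * sqrt (LINT x|lborel. (h x)\<^sup>2)"
      by (rule L2_Cauchy_Schwarz(3)) (use h I2 in auto)
    moreover have "sqrt (?\<Phi> b) * sqrt (LINT x|lborel. (h x)\<^sup>2) \<le> sqrt (?\<Phi> b) * 1"
      using h(2) by (intro mult_left_mono) auto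
    moreover have "sqrt (?\<Phi> b) < e"
      using \<open>?\<Phi> b < e\<^sup>2\<close> assms by (intro real_less_lsqrt) auto
    ultimately show "\<bar>(LINT x|lborel. indicator (cube_at a) x * h x) - (LINT x|lborel. indicator (cube_at b) x * h x)\<bar> < e"
      by linarith
  qed
qed

text \<open>Under Fubini the translation by \<epsilon> z moves the average from w to h and reverses
  the sign of \<epsilon>. Boundedness of w supplies integrability on the product space.\<close>

lemma cube_sum_adjoint:
  fixes h w :: "real^'n \<Rightarrow> real"
  assumes h: "integrable lborel h" and w: "continuous_on UNIV w" and M: "\<And>x. \<bar>w x\<bar> \<le> M"
  shows "(LINT x|lborel. h x * cube_sum w \<epsilon> x) = (LINT x|lborel. w x * cube_sum h (- \<epsilon>) x)"
proof -
  have M0: "0 \<le> M" using M[of 0] by linarith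
  have [measurable]: "h \<in> borel_measurable borel" "w \<in> borel_measurable borel"
    using h borel_measurable_continuous_onI[OF w] by auto
  have hfin: "(\<integral>\<^sup>+x. ennreal (M * \<bar>h x\<bar>) \<partial>lborel) < \<infinity>"
    using h by (simp add: integrable_iff_bounded ennreal_mult' nn_integral_cmult ennreal_mult_less_top M0)
  have fin: "(\<integral>\<^sup>+x. ennreal (M * \<bar>h x\<bar>) \<partial>lborel) * emeasure lborel (unit_cube :: (real^'n) set) < \<infinity>"
    using hfin by (simp add: emeasure_unit_cube ennreal_mult_less_top)
  have I1: "integrable (lborel \<Otimes>\<^sub>M lborel) (\<lambda>(x, z). h x * (indicator unit_cube z * w (x + \<epsilon> *\<^sub>R z)))"
  proof (rule integrableI_bounded)
    have "(\<integral>\<^sup>+xz. ennreal (norm (case xz of (x, z) \<Rightarrow> h x * (indicator unit_cube z * w (x + \<epsilon> *\<^sub>R z)))) \<partial>(lborel \<Otimes>\<^sub>M lborel)) =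
       (\<integral>\<^sup>+x. \<integral>\<^sup>+z. ennreal (norm (h x * (indicator unit_cube z * w (x + \<epsilon> *\<^sub>R z)))) \<partial>lborel \<partial>lborel)"
      by (subst lborel.nn_integral_fst[symmetric]) (simp_all add: split_beta')
    also have "\<dots> \<le> (\<integral>\<^sup>+x. \<integral>\<^sup>+z. ennreal (M * \<bar>h x\<bar>) * indicator (unit_cube :: (real^'n) set) z \<partial>lborel \<partial>lborel)"
      using M M0 by (intro nn_integral_mono)
        (auto split: split_indicator simp: abs_mult mult.commute[of M] intro!: ennreal_leI mult_left_mono)
    also have "\<dots> = (\<integral>\<^sup>+x. ennreal (M * \<bar>h x\<bar>) \<partial>lborel) * emeasure lborel (unit_cube :: (real^'n) set)"
      by (simp add: nn_integral_cmult nn_integral_multc)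
    also note fin
    finally show "(\<integral>\<^sup>+xz. ennreal (norm (case xz of (x, z) \<Rightarrow> h x * (indicator unit_cube z * w (x + \<epsilon> *\<^sub>R z)))) \<partial>(lborel \<Otimes>\<^sub>M lborel)) < \<infinity>" .
  qed measurable
  have I2: "integrable (lborel \<Otimes>\<^sub>M lborel) (\<lambda>(x, z). w x * (indicator unit_cube z * h (x + (- \<epsilon>) *\<^sub>R z)))"
  proof (rule integrableI_bounded)
    have "(\<integral>\<^sup>+xz. ennreal (norm (case xz of (x, z) \<Rightarrow> w x * (indicator unit_cube z * h (x + (- \<epsilon>) *\<^sub>R z)))) \<partial>(lborel \<Otimes>\<^sub>M lborel)) =
       (\<integral>\<^sup>+z. \<integral>\<^sup>+x. ennreal (norm (w x * (indicator unit_cube z * h (x + (- \<epsilon>) *\<^sub>R z)))) \<partial>lborel \<partial>lborel)"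
      by (subst lborel_pair.nn_integral_snd[symmetric]) (simp_all add: split_beta')
    also have "\<dots> \<le> (\<integral>\<^sup>+z. \<integral>\<^sup>+x. ennreal (M * \<bar>h (x + (- \<epsilon>) *\<^sub>R z)\<bar>) * indicator unit_cube z \<partial>lborel \<partial>(lborel :: (real^'n) measure))"
      using M M0 by (intro nn_integral_mono)
        (auto split: split_indicator simp: abs_mult intro!: ennreal_leI mult_right_mono)
    also have "\<dots> = (\<integral>\<^sup>+z. (\<integral>\<^sup>+x. ennreal (M * \<bar>h x\<bar>) \<partial>lborel) * indicator unit_cube z \<partial>(lborel :: (real^'n) measure))"
    proof (rule nn_integral_cong)
      fix z :: "real^'n"
      have "(\<integral>\<^sup>+x. ennreal (M * \<bar>h (x + (- \<epsilon>) *\<^sub>R z)\<bar>) \<partial>lborel) = (\<integral>\<^sup>+x. ennreal (M * \<bar>h x\<bar>) \<partial>lborel)"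
        by (rule nn_integral_translate[of "\<lambda>x. ennreal (M * \<bar>h x\<bar>)"]) measurable
      then show "(\<integral>\<^sup>+x. ennreal (M * \<bar>h (x + (- \<epsilon>) *\<^sub>R z)\<bar>) * indicator unit_cube z \<partial>lborel) =
         (\<integral>\<^sup>+x. ennreal (M * \<bar>h x\<bar>) \<partial>lborel) * indicator unit_cube z"
        by (simp add: nn_integral_multc)
    qed
    also have "\<dots> = (\<integral>\<^sup>+x. ennreal (M * \<bar>h x\<bar>) \<partial>lborel) * emeasure lborel (unit_cube :: (real^'n) set)"
      by (simp add: nn_integral_cmult)
    also note fin
    finally show "(\<integral>\<^sup>+xz. ennreal (norm (case xz of (x, z) \<Rightarrow> w x * (indicator unit_cube z * h (x + (- \<epsilon>) *\<^sub>R z)))) \<partial>(lborel \<Otimes>\<^sub>M lborel)) < \<infinity>" .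
  qed measurable
  have "(LINT x|lborel. h x * cube_sum w \<epsilon> x) = (LINT x|lborel. LINT z|lborel. h x * (indicator unit_cube z * w (x + \<epsilon> *\<^sub>R z)))"
    unfolding cube_sum_def by simp
  also have "\<dots> = (LINT z|lborel. LINT x|lborel. h x * (indicator unit_cube z * w (x + \<epsilon> *\<^sub>R z)))"
    by (rule lborel_pair.Fubini_integral[OF I1, symmetric])
  also have "\<dots> = (LINT z|lborel. LINT x|lborel. w x * (indicator unit_cube z * h (x + (- \<epsilon>) *\<^sub>R z)))"
  proof (rule Bochner_Integration.integral_cong[OF refl])
    fix z :: "real^'n"
    have "(LINT x|lborel. w x * (indicator unit_cube z * h (x + (- \<epsilon>) *\<^sub>R z))) =
       (LINT x|lborel. w (x + \<epsilon> *\<^sub>R z) * (indicator unit_cube z * h ((x + \<epsilon> *\<^sub>R z) + (- \<epsilon>) *\<^sub>R z)))"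
      by (rule integral_translate[symmetric]) measurable
    then show "(LINT x|lborel. h x * (indicator unit_cube z * w (x + \<epsilon> *\<^sub>R z))) =
       (LINT x|lborel. w x * (indicator unit_cube z * h (x + (- \<epsilon>) *\<^sub>R z)))"
      by (simp add: mult_ac)
  qed
  also have "\<dots> = (LINT x|lborel. LINT z|lborel. w x * (indicator unit_cube z * h (x + (- \<epsilon>) *\<^sub>R z)))"
    by (rule lborel_pair.Fubini_integral[OF I2])
  also have "\<dots> = (LINT x|lborel. w x * cube_sum h (- \<epsilon>) x)"
    unfolding cube_sum_def by simp
  finally show ?thesis .
qed

text \<open>The substitution y = x - \<epsilon> z together with the symmetry of the unit
  cube.\<close>

lemma cube_sum_eq_cube_at:
  fixes h :: "real^'n \<Rightarrow> real"
  assumes [measurable]: "h \<in> borel_measurable borel" and \<epsilon>: "0 < \<epsilon>"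
  shows "(LINT y|lborel. indicator (cube_at (x, \<epsilon>)) y * h y) = \<epsilon> ^ CARD('n) * cube_sum h (- \<epsilon>) x"
proof -
  have "(LINT y|lborel. indicator (cube_at (x, \<epsilon>)) y * h y) =
     \<bar>- \<epsilon>\<bar> ^ CARD('n) * (LINT z|lborel. indicator (cube_at (x, \<epsilon>)) (x + (- \<epsilon>) *\<^sub>R z) * h (x + (- \<epsilon>) *\<^sub>R z))"
    using \<epsilon> by (intro integral_affine) auto
  moreover have "indicator (cube_at (x, \<epsilon>)) (x + (- \<epsilon>) *\<^sub>R z) = (indicator unit_cube z :: real)" for z
  proof -
    have "x + (- \<epsilon>) *\<^sub>R z \<in> cube_at (x, \<epsilon>) \<longleftrightarrow> (\<forall>i. \<epsilon> * z $ i \<le> \<epsilon> * 1 \<and> \<epsilon> * (- 1) \<le> \<epsilon> * z $ i)"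
      unfolding mem_cube_at by (rule iff_allI) auto
    also have "\<dots> \<longleftrightarrow> z \<in> unit_cube"
      using \<epsilon> unfolding mult_le_cancel_left_pos[OF \<epsilon>] by (auto simp: mem_box_cart)
    finally show ?thesis by (simp add: indicator_def)
  qed
  ultimately show ?thesis using \<epsilon> by (simp add: cube_sum_def)
qed

lemma ex_small_powr:
  assumes "0 < K" "0 < c" "0 < (r::real)"
  obtains \<epsilon> where "0 < \<epsilon>" "\<epsilon> \<le> 1" "K * \<epsilon> powr r \<le> c"
proof
  let ?e = "min 1 ((c / K) powr (1 / r))"
  show "0 < ?e" "?e \<le> 1" using assms by auto
  have "?e powr r \<le> ((c / K) powr (1 / r)) powr r"
    using assms by (intro powr_mono2) auto
  also have "\<dots> = c / K" using assms by (simp add: powr_powr)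
  finally show "K * ?e powr r \<le> c" using assms by (simp add: field_simps)
qed

text \<open>A Frechet-Kolmogorov argument. A test function is its cube average plus an error whose
  pairing is uniformly small for small \<epsilon>; adjointness shifts the average to the functions
  h, whose cube integrals converge uniformly along a subsequence.\<close>

lemma compact_pairing_borel:
  fixes h :: "nat \<Rightarrow> real^'n \<Rightarrow> real"
  assumes \<Omega>: "open \<Omega>" "bounded \<Omega>" and q: "1 \<le> q" "q \<le> 2" "real CARD('n) * (1 / q - 1 / 2) < 1"
    and hm[measurable]: "\<And>n. h n \<in> borel_measurable borel" and h0: "\<And>n x. x \<notin> \<Omega> \<Longrightarrow> h n x = 0"
    and hI: "\<And>n. integrable lborel (\<lambda>x. (h n x)\<^sup>2)" and h1: "\<And>n. (LINT x|lborel. (h n x)\<^sup>2) \<le> 1"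
  obtains k :: "nat \<Rightarrow> nat" where "strict_mono k"
    "\<And>\<eta>. 0 < \<eta> \<Longrightarrow> \<exists>N. \<forall>i\<ge>N. \<forall>j\<ge>N. \<forall>\<phi>\<in>test_functions \<Omega>. W1p_pow \<Omega> q \<phi> \<le> 1 \<longrightarrow>
        \<bar>LINT x|lborel. (h (k i) x - h (k j) x) * \<phi> x\<bar> \<le> \<eta>"
proof -
  let ?N = "real CARD('n)" and ?m = "cube_vol TYPE(real^'n)" and ?v = "measure lborel \<Omega>"
  define \<theta> where "\<theta> = ?N * (1 / q - 1 / 2)"
  have th: "\<theta> < 1" using q(3) by (simp add: \<theta>_def)
  have m: "0 < ?m" by (rule cube_vol_pos)
  have [measurable]: "\<Omega> \<in> sets borel" using \<Omega>(1) by auto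
  have \<Omega>fin: "emeasure lborel \<Omega> < \<infinity>" using \<Omega>(2) by (rule emeasure_bounded_finite)
  have \<Omega>I: "integrable lborel (indicator \<Omega> :: _ \<Rightarrow> real)" using \<Omega>fin by (simp add: integrable_indicator_iff)
  \<comment> \<open>From |r| <= r^2 + 1 on the bounded set \<open>\<Omega>\<close>; this is the
    uniform bound that Arzela-Ascoli asks for.\<close>
  have hI1: "integrable lborel (h n)" "(LINT x|lborel. \<bar>h n x\<bar>) \<le> 1 + ?v" for n
  proof -
    have bd: "\<bar>h n x\<bar> \<le> (h n x)\<^sup>2 + indicator \<Omega> x" for x
    proof (cases "x \<in> \<Omega>")
      case True
      have "0 \<le> (\<bar>h n x\<bar> - 1)\<^sup>2" by simp
      then have "2 * \<bar>h n x\<bar> \<le> (h n x)\<^sup>2 + 1" by (simp add: power2_diff)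
      then show ?thesis using True by simp
    qed (simp add: h0)
    have I: "integrable lborel (\<lambda>x. (h n x)\<^sup>2 + indicator \<Omega> x :: real)"
      by (intro Bochner_Integration.integrable_add hI \<Omega>I)
    show J: "integrable lborel (h n)"
      by (rule Bochner_Integration.integrable_bound[OF I]) (use bd in \<open>auto intro!: AE_I2\<close>)
    have "(LINT x|lborel. \<bar>h n x\<bar>) \<le> (LINT x|lborel. (h n x)\<^sup>2 + indicator \<Omega> x)"
      using J bd I by (intro integral_mono) auto
    also have "\<dots> = (LINT x|lborel. (h n x)\<^sup>2) + ?v"
      using hI \<Omega>I by simp
    finally show "(LINT x|lborel. \<bar>h n x\<bar>) \<le> 1 + ?v" using h1[of n] by linarith
  qed
  define F where "F n a = (LINT x|lborel. indicator (cube_at a) x * h n x)" for n a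
  have Fi: "integrable lborel (\<lambda>x. indicator (cube_at a) x * h n x)" for n a
    using integrable_mult_indicator[OF _ hI1(1), of "cube_at a" n] by simp
  obtain g k where k: "strict_mono (k :: nat \<Rightarrow> nat)"
    and F: "\<And>e. 0 < e \<Longrightarrow> \<exists>N. \<forall>n a. n \<ge> N \<and> a \<in> closure \<Omega> \<times> {0..1} \<longrightarrow> norm (F (k n) a - g a) < e"
  proof (rule Arzela_Ascoli[of "closure \<Omega> \<times> {0..1::real}" F "1 + ?v"])
    show "compact (closure \<Omega> \<times> {0..1::real})"
      using \<Omega>(2) by (intro compact_Times) auto
    show "norm (F n a) \<le> 1 + ?v" for n a
    proof -
      have "norm (F n a) \<le> (LINT x|lborel. \<bar>indicator (cube_at a) x * h n x\<bar>)"
        unfolding F_def using integral_norm_bound[of lborel "\<lambda>x. indicator (cube_at a) x * h n x"] by simp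
      also have "\<dots> \<le> (LINT x|lborel. \<bar>h n x\<bar>)"
        using Fi[of a n] hI1(1)[of n] by (intro integral_mono) (auto split: split_indicator)
      finally show ?thesis using hI1(2)[of n] by linarith
    qed
    show "\<exists>d. 0 < d \<and> (\<forall>n b. b \<in> closure \<Omega> \<times> {0..1} \<and> norm (a - b) < d \<longrightarrow> norm (F n a - F n b) < e)"
      if "0 < e" for a e
    proof -
      obtain d where d: "0 < d" "\<And>b h. norm (a - b) < d \<Longrightarrow> h \<in> borel_measurable borel \<Longrightarrow> integrable lborel (\<lambda>x. (h x)\<^sup>2) \<Longrightarrow>
         (LINT x|lborel. (h x)\<^sup>2) \<le> 1 \<Longrightarrow>
         \<bar>(LINT x|lborel. indicator (cube_at a) x * h x) - (LINT x|lborel. indicator (cube_at b) x * h x)\<bar> < e"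
        using cube_at_equicontinuous[OF \<open>0 < e\<close>, of a] by blast
      show ?thesis
        using d(2)[OF _ hm hI h1] d(1) unfolding F_def by auto
    qed
  qed blast
  show thesis
  proof (rule that[OF k])
    fix \<eta> :: real assume \<eta>: "0 < \<eta>"
    \<comment> \<open>The constant of \<open>pairing_diff_bound\<close>, without the power of
      \<epsilon>.\<close>
    define K where "K = ?N * ((1 + (?m + 1)\<^sup>2 * ?m) / (1 - \<theta>))"
    have K: "0 < K" using m th by (auto simp: K_def intro!: mult_pos_pos divide_pos_pos add_pos_nonneg)
    \<comment> \<open>The factor 4 combines a doubling, since the error is estimated for half of the
      difference, with the aim of spending only half of the tolerance on it.\<close>
    obtain \<epsilon> where \<epsilon>: "0 < \<epsilon>" "\<epsilon> \<le> 1" "4 * K * \<epsilon> powr (1 - \<theta>) \<le> \<eta> * ?m"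
      using ex_small_powr[of "4 * K" "\<eta> * ?m" "1 - \<theta>"] K \<eta> m th by auto
    have v: "0 \<le> ?v" by simp
    \<comment> \<open>Chosen so that the averaged part, at most (|\<Omega>| + 1) \<eta>' /
      \<epsilon>^N, uses up the other half of the tolerance.\<close>
    define \<eta>' where "\<eta>' = \<eta> * ?m * \<epsilon> ^ CARD('n) / (2 * (?v + 1))"
    have \<eta>': "0 < \<eta>'" unfolding \<eta>'_def using \<eta> m \<epsilon>(1) v by (intro divide_pos_pos mult_pos_pos add_nonneg_pos) auto
    obtain N where N: "\<And>n a. n \<ge> N \<Longrightarrow> a \<in> closure \<Omega> \<times> {0..1} \<Longrightarrow> norm (F (k n) a - g a) < \<eta>' / 2"
      using F[OF half_gt_zero[OF \<eta>']] by blast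
    show "\<exists>N. \<forall>i\<ge>N. \<forall>j\<ge>N. \<forall>\<phi>\<in>test_functions \<Omega>. W1p_pow \<Omega> q \<phi> \<le> 1 \<longrightarrow>
        \<bar>LINT x|lborel. (h (k i) x - h (k j) x) * \<phi> x\<bar> \<le> \<eta>"
    proof (intro exI[of _ N] allI ballI impI)
      fix i j \<phi> assume i: "N \<le> i" and j: "N \<le> j" and \<phi>: "\<phi> \<in> test_functions \<Omega>" and n: "W1p_pow \<Omega> q \<phi> \<le> 1"
      note T = test_functionD[OF \<phi>]
      have q0: "0 < q" using q by simp
      note nrm = test_function_normalized[OF \<Omega>(1) \<phi> q0 n]
      obtain M where M: "0 \<le> M" "\<And>x. \<bar>\<phi> x\<bar> \<le> M"
        using bounded_compact_support[OF T(6) T(2) T(4)] by metis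
      have [measurable]: "\<phi> \<in> borel_measurable borel" "cube_sum \<phi> \<epsilon> \<in> borel_measurable borel"
      proof -
        show [measurable]: "\<phi> \<in> borel_measurable borel" by (auto intro!: borel_measurable_continuous_onI T)
        show "cube_sum \<phi> \<epsilon> \<in> borel_measurable borel" unfolding cube_sum_def[abs_def] by measurable
      qed
      define f where "f x = h (k i) x - h (k j) x" for x
      have [measurable]: "f \<in> borel_measurable borel" unfolding f_def by measurable
      have fI: "integrable lborel f" unfolding f_def using hI1(1) by auto
      have f2: "(\<integral>\<^sup>+x. ennreal ((f x / 2)\<^sup>2) \<partial>lborel) \<le> 1"
      proof -
        have "(f x / 2)\<^sup>2 \<le> ((h (k i) x)\<^sup>2 + (h (k j) x)\<^sup>2) / 2" for x
        proof -
          have "0 \<le> (h (k i) x + h (k j) x)\<^sup>2" by simp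
          then show ?thesis by (simp add: f_def power2_eq_square field_simps)
        qed
        then have "(\<integral>\<^sup>+x. ennreal ((f x / 2)\<^sup>2) \<partial>lborel) \<le> (\<integral>\<^sup>+x. ennreal (((h (k i) x)\<^sup>2 + (h (k j) x)\<^sup>2) / 2) \<partial>lborel)"
          by (intro nn_integral_mono ennreal_leI)
        also have "\<dots> = ennreal (LINT x|lborel. ((h (k i) x)\<^sup>2 + (h (k j) x)\<^sup>2) / 2)"
          using hI by (intro nn_integral_eq_integral) auto
        also have "(LINT x|lborel. ((h (k i) x)\<^sup>2 + (h (k j) x)\<^sup>2) / 2) \<le> 1"
          using hI h1[of "k i"] h1[of "k j"] by simp
        finally show ?thesis by (simp add: ennreal_leI)
      qed
      \<comment> \<open>A difference of two elements of the unit ball is halved to stay in the unit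
        ball.\<close>
      define f0 where "f0 x = f x / 2" for x
      have [measurable]: "f0 \<in> borel_measurable borel" unfolding f0_def by measurable
      let ?r = "\<lambda>x. f0 x * (?m * \<phi> x - cube_sum \<phi> \<epsilon> x)"
      have R: "(\<integral>\<^sup>+x. ennreal (norm (?r x)) \<partial>lborel) \<le> ennreal (K * \<epsilon> powr (1 - \<theta>))"
        using pairing_diff_bound[OF \<Omega>(1) \<phi> q(1,2) _ f2[folded f0_def] n, of \<epsilon>] \<epsilon>(1) q(3)
        by (simp add: abs_mult K_def \<theta>_def mult.assoc)
      have rI: "integrable lborel ?r"
        using le_less_trans[OF R ennreal_less_top] by (intro integrableI_bounded) (simp_all add: infinity_ennreal_def)
      have "ennreal \<bar>LINT x|lborel. ?r x\<bar> \<le> ennreal (K * \<epsilon> powr (1 - \<theta>))"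
        using order_trans[OF integral_norm_bound_ennreal[OF rI] R] by (simp only: real_norm_def)
      then have R2: "\<bar>LINT x|lborel. ?r x\<bar> \<le> K * \<epsilon> powr (1 - \<theta>)"
        using K by (subst (asm) ennreal_le_iff) auto
      have f\<phi>I: "integrable lborel (\<lambda>x. f x * \<phi> x)"
      proof (rule Bochner_Integration.integrable_bound)
        show "integrable lborel (\<lambda>x. M * \<bar>f x\<bar>)" using fI by auto
        show "AE x in lborel. norm (f x * \<phi> x) \<le> norm (M * \<bar>f x\<bar>)"
          using M by (auto intro!: AE_I2 mult_right_mono simp: abs_mult mult.commute[of "\<bar>f _\<bar>"])
      qed measurable
      have eq: "?m * (f x * \<phi> x) = 2 * ?r x + f x * cube_sum \<phi> \<epsilon> x" for x
        by (simp add: f0_def algebra_simps)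
      have csI: "integrable lborel (\<lambda>x. f x * cube_sum \<phi> \<epsilon> x)"
      proof -
        have "(\<lambda>x. f x * cube_sum \<phi> \<epsilon> x) = (\<lambda>x. ?m * (f x * \<phi> x) - 2 * ?r x)"
          unfolding eq by simp
        moreover have "integrable lborel (\<lambda>x. ?m * (f x * \<phi> x) - 2 * ?r x)"
          by (intro Bochner_Integration.integrable_diff integrable_mult_right rI f\<phi>I)
        ultimately show ?thesis by (simp only:)
      qed
      have "?m * (LINT x|lborel. f x * \<phi> x) = (LINT x|lborel. ?m * (f x * \<phi> x))" by simp
      also have "\<dots> = 2 * (LINT x|lborel. ?r x) + (LINT x|lborel. f x * cube_sum \<phi> \<epsilon> x)"
        unfolding eq using rI csI by simp
      finally have split: "?m * (LINT x|lborel. f x * \<phi> x) = 2 * (LINT x|lborel. ?r x) + (LINT x|lborel. f x * cube_sum \<phi> \<epsilon> x)" .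
      have cs: "(LINT x|lborel. f x * cube_sum \<phi> \<epsilon> x) = (LINT x|lborel. \<phi> x * cube_sum f (- \<epsilon>) x)"
        by (rule cube_sum_adjoint[OF fI T(6) M(2)])
      have sup: "\<bar>cube_sum f (- \<epsilon>) x\<bar> \<le> \<eta>' / \<epsilon> ^ CARD('n)" if "x \<in> \<Omega>" for x
      proof -
        have a: "(x, \<epsilon>) \<in> closure \<Omega> \<times> {0..1}" using that \<epsilon> closure_subset[of \<Omega>] by auto
        have "\<epsilon> ^ CARD('n) * cube_sum f (- \<epsilon>) x = (LINT y|lborel. indicator (cube_at (x, \<epsilon>)) y * f y)"
          using \<epsilon> by (intro cube_sum_eq_cube_at[symmetric]) auto
        also have "\<dots> = F (k i) (x, \<epsilon>) - F (k j) (x, \<epsilon>)"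
          unfolding F_def f_def using Fi by (simp add: right_diff_distrib)
        finally have "\<bar>\<epsilon> ^ CARD('n) * cube_sum f (- \<epsilon>) x\<bar> \<le> \<eta>'"
          using N[OF i a] N[OF j a] unfolding real_norm_def by linarith
        then show ?thesis using \<epsilon>(1) by (simp add: abs_mult field_simps)
      qed
      \<comment> \<open>Interpolation at level 1 gives |\<phi>| <= 1 + |\<phi>|^q on
        \<open>\<Omega>\<close>, and \<open>\<phi>\<close> vanishes elsewhere.\<close>
      have \<phi>1: "(LINT x|lborel. \<bar>\<phi> x\<bar>) \<le> ?v + 1"
      proof -
        note TW = test_function_W1p[OF \<Omega>(1) \<phi> q0]
        have "\<bar>\<phi> x\<bar> \<le> indicator \<Omega> x + \<bar>\<phi> x\<bar> powr q" for x
          using powr_interpolate[of "\<bar>\<phi> x\<bar>" 1 1 q] q T(5)[of x] by (cases "x \<in> \<Omega>") auto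
        then have "(LINT x|lborel. \<bar>\<phi> x\<bar>) \<le> (LINT x|lborel. indicator \<Omega> x + \<bar>\<phi> x\<bar> powr q)"
          using T(11) \<Omega>I TW(4) by (intro integral_mono) auto
        also have "\<dots> = ?v + (LINT x|lborel. \<bar>\<phi> x\<bar> powr q)"
          using \<Omega>I TW(4) by simp
        also have "(LINT x|lborel. \<bar>\<phi> x\<bar> powr q) \<le> 1"
          using nrm(1) TW(4) by (simp add: nn_integral_eq_integral)
        finally show ?thesis by simp
      qed
      have "\<bar>LINT x|lborel. \<phi> x * cube_sum f (- \<epsilon>) x\<bar> \<le> (LINT x|lborel. \<bar>\<phi> x\<bar> * (\<eta>' / \<epsilon> ^ CARD('n)))"
      proof -
        have [measurable]: "cube_sum f (- \<epsilon>) \<in> borel_measurable borel" unfolding cube_sum_def[abs_def] by measurable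
        have ptw: "\<bar>\<phi> x * cube_sum f (- \<epsilon>) x\<bar> \<le> \<bar>\<phi> x\<bar> * (\<eta>' / \<epsilon> ^ CARD('n))" for x
        proof (cases "x \<in> \<Omega>")
          case True
          then show ?thesis unfolding abs_mult by (intro mult_left_mono sup) auto
        qed (simp add: T(5))
        have J: "integrable lborel (\<lambda>x. \<bar>\<phi> x\<bar> * (\<eta>' / \<epsilon> ^ CARD('n)))" using T(11) by (intro integrable_mult_left integrable_abs)
        have J2: "integrable lborel (\<lambda>x. \<phi> x * cube_sum f (- \<epsilon>) x)"
          by (rule Bochner_Integration.integrable_bound[OF J]) (measurable, rule AE_I2,
              use order_trans[OF ptw abs_ge_self] in \<open>simp only: real_norm_def\<close>)
        have "\<bar>LINT x|lborel. \<phi> x * cube_sum f (- \<epsilon>) x\<bar> \<le> (LINT x|lborel. \<bar>\<phi> x * cube_sum f (- \<epsilon>) x\<bar>)"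
          by (rule integral_abs_bound)
        also have "\<dots> \<le> (LINT x|lborel. \<bar>\<phi> x\<bar> * (\<eta>' / \<epsilon> ^ CARD('n)))"
          by (intro integral_mono integrable_abs J J2 ptw)
        finally show ?thesis .
      qed
      also have "\<dots> = (LINT x|lborel. \<bar>\<phi> x\<bar>) * (\<eta>' / \<epsilon> ^ CARD('n))" by simp
      also have "\<dots> \<le> (?v + 1) * (\<eta>' / \<epsilon> ^ CARD('n))"
        using \<phi>1 \<eta>' \<epsilon> by (intro mult_right_mono) auto
      also have "\<dots> = \<eta> * ?m / 2"
      proof -
        have "c * (a * e / (2 * c) / e) = a / 2" if "c \<noteq> 0" "e \<noteq> 0" for a c e :: real
          using that by simp
        note this[of "?v + 1" "\<epsilon> ^ CARD('n)" "\<eta> * ?m"]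
        moreover have "?v + 1 \<noteq> 0" using v by linarith
        moreover have "\<epsilon> ^ CARD('n) \<noteq> 0" using \<epsilon>(1) by simp
        ultimately show ?thesis unfolding \<eta>'_def by blast
      qed
      finally have B: "\<bar>LINT x|lborel. f x * cube_sum \<phi> \<epsilon> x\<bar> \<le> \<eta> * ?m / 2" unfolding cs .
      have "\<bar>?m * (LINT x|lborel. f x * \<phi> x)\<bar> \<le> \<eta> * ?m"
        using split R2 B \<epsilon>(3) by linarith
      then have "?m * \<bar>LINT x|lborel. f x * \<phi> x\<bar> \<le> ?m * \<eta>" using m by (simp add: abs_mult mult.commute)
      then show "\<bar>LINT x|lborel. (h (k i) x - h (k j) x) * \<phi> x\<bar> \<le> \<eta>"
        using m unfolding f_def by (rule mult_left_le_imp_le)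
    qed
  qed
qed

section \<open>Embeddings\<close>

lemma norm_powr_2: "norm (x :: real) powr 2 = x\<^sup>2"
  by (cases "x = 0") (simp_all add: powr_numeral)

lemma Lp_2_iff: "f \<in> Lp \<Omega> 2 \<longleftrightarrow> f \<in> borel_measurable (lebesgue_on \<Omega>) \<and> integrable (lebesgue_on \<Omega>) (\<lambda>x. (f x)\<^sup>2)"
  for f :: "real^'n \<Rightarrow> real"
  unfolding Lp_def norm_powr_2 by simp

lemma Lp_norm_2: "Lp_norm \<Omega> 2 f = sqrt (LINT x|lebesgue_on \<Omega>. (f x)\<^sup>2)"
  for f :: "real^'n \<Rightarrow> real"
  unfolding Lp_norm_def norm_powr_2 by (simp add: powr_half_sqrt)

text \<open>The cube estimates concern Borel functions on the whole space, so a Lebesgue measurable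
  function is exchanged for a Borel representative extended by zero.\<close>

lemma L2_borel_version:
  fixes h :: "real^'n \<Rightarrow> real"
  assumes \<Omega>: "open \<Omega>" and h: "h \<in> Lp \<Omega> 2"
  obtains h' where "h' \<in> borel_measurable borel" "\<And>x. x \<notin> \<Omega> \<Longrightarrow> h' x = 0" "AE x in lebesgue_on \<Omega>. h x = h' x"
    "integrable lborel (\<lambda>x. (h' x)\<^sup>2)" "(LINT x|lborel. (h' x)\<^sup>2) = (LINT x|lebesgue_on \<Omega>. (h x)\<^sup>2)"
proof -
  have hm: "h \<in> borel_measurable (lebesgue_on \<Omega>)" and hI: "integrable (lebesgue_on \<Omega>) (\<lambda>x. (h x)\<^sup>2)"
    using h by (auto simp: Lp_2_iff)
  have "(\<lambda>x. indicator \<Omega> x *\<^sub>R h x) \<in> borel_measurable lebesgue"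
    using hm \<Omega> by (subst (asm) borel_measurable_restrict_space_iff) auto
  then obtain h0 where h0: "h0 \<in> borel_measurable lborel" "AE x in lborel. indicator \<Omega> x *\<^sub>R h x = h0 x"
    using completion_ex_borel_measurable_real[of "\<lambda>x. indicator \<Omega> x *\<^sub>R h x" lborel] by auto
  define h' where "h' x = indicator \<Omega> x * h0 x" for x
  have [measurable]: "\<Omega> \<in> sets borel" using \<Omega> by auto
  have [measurable]: "h0 \<in> borel_measurable borel" using h0(1) by simp
  have h'm[measurable]: "h' \<in> borel_measurable borel" unfolding h'_def by measurable
  have "AE x in lebesgue. indicator \<Omega> x *\<^sub>R h x = h0 x" using h0(2) by (rule AE_completion)
  then have ae: "AE x in lebesgue_on \<Omega>. h x = h' x"
    unfolding AE_lebesgue_on_iff[OF \<Omega>] by eventually_elim (auto simp: h'_def)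
  have h'0: "x \<notin> \<Omega> \<Longrightarrow> h' x = 0" for x by (simp add: h'_def)
  have m': "h' \<in> borel_measurable (lebesgue_on \<Omega>)"
    by (intro measurable_restrict_space1 measurable_completion) simp
  have ae2: "AE x in lebesgue_on \<Omega>. (h x)\<^sup>2 = (h' x)\<^sup>2" using ae by eventually_elim simp
  have I': "integrable (lebesgue_on \<Omega>) (\<lambda>x. (h' x)\<^sup>2)"
    using hI integrable_cong_AE[OF _ _ ae2] hm m' by simp
  have "integrable lebesgue (\<lambda>x. indicator \<Omega> x *\<^sub>R (h' x)\<^sup>2)"
    using I' \<Omega> by (subst (asm) integrable_restrict_space) auto
  also have "(\<lambda>x. indicator \<Omega> x *\<^sub>R (h' x)\<^sup>2) = (\<lambda>x. (h' x)\<^sup>2)"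
    using h'0 by (auto simp: indicator_def fun_eq_iff)
  finally have "integrable lborel (\<lambda>x. (h' x)\<^sup>2)"
    by (subst (asm) integrable_completion) auto
  moreover have "(LINT x|lborel. (h' x)\<^sup>2) = (LINT x|lebesgue_on \<Omega>. (h x)\<^sup>2)"
    using integral_lebesgue_on_support[OF \<Omega>, of "\<lambda>x. (h' x)\<^sup>2"] h'0 integral_cong_AE[OF _ _ ae2] hm m' by simp
  ultimately show thesis using that[OF h'm h'0 ae] by blast
qed

text \<open>Convergence in the p-th mean yields an almost everywhere convergent subsequence;
  pointwise bounds for test functions can then pass to their closure.\<close>

lemma W01p_approx_AE:
  assumes \<Omega>: "open \<Omega>" and p: "1 \<le> p" and w: "w \<in> W01p \<Omega> p"
  obtains \<phi> where "\<And>n. \<phi> n \<in> test_functions \<Omega>" "(\<lambda>n. W1p_norm \<Omega> p (\<phi> n - w)) \<longlonglongrightarrow> 0"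
    "AE x in lebesgue_on \<Omega>. (\<lambda>n. \<phi> n x) \<longlonglongrightarrow> w x"
proof -
  have p0: "0 < p" using p by simp
  obtain \<phi> where \<phi>: "\<And>n. \<phi> n \<in> test_functions \<Omega>" "(\<lambda>n. W1p_norm \<Omega> p (\<phi> n - w)) \<longlonglongrightarrow> 0"
    using W01p_approx[OF w] by metis
  have d: "\<phi> n - w \<in> W1p \<Omega> p" for n
    by (rule W1p_diff(1)[OF \<Omega> p0 test_function_W1p(1)[OF \<Omega> \<phi>(1) p0] W01pD[OF w]])
  have "(\<lambda>n. W1p_norm \<Omega> p (\<phi> n - w) powr p) \<longlonglongrightarrow> 0 powr p"
    using \<phi>(2) p0 by (intro tendsto_powr') (auto simp: W1p_norm_nonneg)
  then have lim: "(\<lambda>n. W1p_norm \<Omega> p (\<phi> n - w) powr p) \<longlonglongrightarrow> 0" using p0 by simp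
  have "(\<lambda>n. LINT x|lebesgue_on \<Omega>. norm (\<bar>\<phi> n x - w x\<bar> powr p)) \<longlonglongrightarrow> 0"
  proof (rule tendsto_0_le_seq[OF lim])
    show "(LINT x|lebesgue_on \<Omega>. norm (\<bar>\<phi> n x - w x\<bar> powr p)) \<le> W1p_norm \<Omega> p (\<phi> n - w) powr p" for n
    proof -
      have "0 \<le> (LINT x|lebesgue_on \<Omega>. norm (weak_grad \<Omega> (\<phi> n - w) x) powr p)"
        by (rule Bochner_Integration.integral_nonneg) simp
      moreover have "W1p_norm \<Omega> p (\<phi> n - w) powr p = (LINT x|lebesgue_on \<Omega>. \<bar>\<phi> n x - w x\<bar> powr p) +
          (LINT x|lebesgue_on \<Omega>. norm (weak_grad \<Omega> (\<phi> n - w) x) powr p)"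
        using p0 W1p_pow_eq[of p \<Omega> "\<phi> n - w"] by (simp add: W1p_pow_def)
      ultimately show ?thesis by simp
    qed
  qed simp
  moreover have "integrable (lebesgue_on \<Omega>) (\<lambda>x. \<bar>\<phi> n x - w x\<bar> powr p)" for n
    using LpD(2)[OF W1pD(1)[OF \<Omega> d]] by simp
  ultimately obtain r where r: "strict_mono r" "AE x in lebesgue_on \<Omega>. (\<lambda>n. \<bar>\<phi> (r n) x - w x\<bar> powr p) \<longlonglongrightarrow> 0"
    using tendsto_L1_AE_subseq[of "lebesgue_on \<Omega>" "\<lambda>n x. \<bar>\<phi> n x - w x\<bar> powr p"] by auto
  have "AE x in lebesgue_on \<Omega>. (\<lambda>n. \<phi> (r n) x) \<longlonglongrightarrow> w x"
    using r(2)
  proof eventually_elim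
    case (elim x)
    then have "(\<lambda>n. (\<bar>\<phi> (r n) x - w x\<bar> powr p) powr (1 / p)) \<longlonglongrightarrow> 0 powr (1 / p)"
      using p0 by (intro tendsto_powr') auto
    then have "(\<lambda>n. \<bar>\<phi> (r n) x - w x\<bar>) \<longlonglongrightarrow> 0" using p0 by (simp add: powr_powr)
    then show ?case by (simp add: tendsto_rabs_zero_iff LIM_zero_iff)
  qed
  moreover have "(\<lambda>n. W1p_norm \<Omega> p (\<phi> (r n) - w)) \<longlonglongrightarrow> 0"
    using LIMSEQ_subseq_LIMSEQ[OF \<phi>(2) r(1)] by (simp add: o_def)
  ultimately show thesis using that[of "\<lambda>n. \<phi> (r n)"] \<phi>(1) by auto
qed

lemma W1p_norm_approx_le:
  assumes \<Omega>: "open \<Omega>" and p: "1 \<le> p" and w: "w \<in> W01p \<Omega> p" and \<phi>: "\<phi> \<in> test_functions \<Omega>"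
  shows "W1p_norm \<Omega> p \<phi> \<le> 4 * (W1p_norm \<Omega> p (\<phi> - w) + W1p_norm \<Omega> p w)"
proof -
  have p0: "0 < p" using p by simp
  have "\<phi> = (\<phi> - w) + w" by simp
  then show ?thesis
    using W1p_norm_add[OF \<Omega> p W1p_diff(1)[OF \<Omega> p0 test_function_W1p(1)[OF \<Omega> \<phi> p0] W01pD[OF w]] W01pD[OF w]] by simp
qed

lemma normalize_test_function:
  assumes \<Omega>: "open \<Omega>" and p: "1 \<le> p" and \<phi>: "\<phi> \<in> test_functions \<Omega>" and c: "0 < c" "W1p_norm \<Omega> p \<phi> \<le> c"
  shows "(1 / c) *\<^sub>R \<phi> \<in> test_functions \<Omega>" "W1p_pow \<Omega> p ((1 / c) *\<^sub>R \<phi>) \<le> 1"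
proof -
  have p0: "0 < p" using p by simp
  show "(1 / c) *\<^sub>R \<phi> \<in> test_functions \<Omega>" by (rule test_function_scaleR[OF \<phi>])
  have "W1p_norm \<Omega> p ((1 / c) *\<^sub>R \<phi>) \<le> 1"
    using c by (simp add: W1p_norm_scaleR[OF \<Omega> p0 test_function_W1p(1)[OF \<Omega> \<phi> p0]])
  then have "W1p_norm \<Omega> p ((1 / c) *\<^sub>R \<phi>) powr p \<le> 1 powr p"
    using p0 W1p_norm_nonneg by (intro powr_mono2) auto
  then show "W1p_pow \<Omega> p ((1 / c) *\<^sub>R \<phi>) \<le> 1" using p0 by (simp add: W1p_pow_eq)
qed

text \<open>The Morrey bound for normalised test functions is rescaled and passed to the limit. The
  final factor 4 comes from the quasi-triangle inequality applied to the approximating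
  functions.\<close>

lemma W01p_sup_bound:
  fixes \<Omega> :: "(real^'n) set"
  assumes \<Omega>: "open \<Omega>" and p: "real CARD('n) < p"
  obtains C where "0 < C" "\<And>w. w \<in> W01p \<Omega> p \<Longrightarrow> AE x in lebesgue_on \<Omega>. \<bar>w x\<bar> \<le> C * W1p_norm \<Omega> p w"
proof -
  let ?m = "cube_vol TYPE(real^'n)" and ?N = "real CARD('n)"
  have N: "1 \<le> ?N" by (simp add: Suc_le_eq)
  then have p1: "1 \<le> p" "0 < p" using p by linarith+
  define C0 where "C0 = (?m + 1) * (1 + ?N / (1 - ?N / p)) / ?m"
  have "0 < 1 - ?N / p" using p p1 by simp
  then have C0: "0 < C0"
    unfolding C0_def using cube_vol_pos[where 'n='n] by (intro divide_pos_pos mult_pos_pos add_pos_nonneg) auto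
  have bd: "\<bar>\<psi> x\<bar> \<le> C0" if "\<psi> \<in> test_functions \<Omega>" "W1p_pow \<Omega> p \<psi> \<le> 1" for \<psi> x
    unfolding C0_def by (rule test_function_sup_bound[OF \<Omega> that(1) p that(2)])
  have test: "\<bar>\<phi> x\<bar> \<le> C0 * W1p_norm \<Omega> p \<phi>" if \<phi>: "\<phi> \<in> test_functions \<Omega>" for \<phi> x
  proof (rule field_le_epsilon)
    fix e :: real assume e: "0 < e"
    \<comment> \<open>The second summand keeps the normalising constant positive when the norm
      vanishes, and costs exactly e in the end.\<close>
    let ?c = "W1p_norm \<Omega> p \<phi> + e / C0"
    have c: "0 < ?c" using e C0 W1p_norm_nonneg[of \<Omega> p \<phi>] by (simp add: add_nonneg_pos)
    have c2: "W1p_norm \<Omega> p \<phi> \<le> ?c" using e C0 by simp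
    have "\<bar>((1 / ?c) *\<^sub>R \<phi>) x\<bar> \<le> C0"
      by (rule bd[OF normalize_test_function[OF \<Omega> p1(1) \<phi> c c2]])
    then have "\<bar>\<phi> x\<bar> \<le> C0 * ?c" using c by (simp add: scaleR_fun_def abs_mult field_simps)
    then show "\<bar>\<phi> x\<bar> \<le> C0 * W1p_norm \<Omega> p \<phi> + e" using C0 by (simp add: distrib_left)
  qed
  show thesis
  proof (rule that[of "4 * C0"])
    fix w assume w: "w \<in> W01p \<Omega> p"
    obtain \<phi> where \<phi>: "\<And>n. \<phi> n \<in> test_functions \<Omega>" "(\<lambda>n. W1p_norm \<Omega> p (\<phi> n - w)) \<longlonglongrightarrow> 0"
      "AE x in lebesgue_on \<Omega>. (\<lambda>n. \<phi> n x) \<longlonglongrightarrow> w x"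
      using W01p_approx_AE[OF \<Omega> p1(1) w] by blast
    show "AE x in lebesgue_on \<Omega>. \<bar>w x\<bar> \<le> 4 * C0 * W1p_norm \<Omega> p w"
      using \<phi>(3)
    proof eventually_elim
      case (elim x)
      have "(\<lambda>n. C0 * (4 * (W1p_norm \<Omega> p (\<phi> n - w) + W1p_norm \<Omega> p w))) \<longlonglongrightarrow> C0 * (4 * (0 + W1p_norm \<Omega> p w))"
        by (intro tendsto_intros \<phi>)
      moreover have "(\<lambda>n. \<bar>\<phi> n x\<bar>) \<longlonglongrightarrow> \<bar>w x\<bar>" by (intro tendsto_intros elim)
      moreover have "\<bar>\<phi> n x\<bar> \<le> C0 * (4 * (W1p_norm \<Omega> p (\<phi> n - w) + W1p_norm \<Omega> p w))" for n
        using test[OF \<phi>(1)[of n], of x] mult_left_mono[OF W1p_norm_approx_le[OF \<Omega> p1(1) w \<phi>(1)[of n]], of C0] C0 by linarith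
      ultimately have "\<bar>w x\<bar> \<le> C0 * (4 * (0 + W1p_norm \<Omega> p w))"
        by (intro LIMSEQ_le) auto
      then show ?case by simp
    qed
  qed (use C0 in simp)
qed

text \<open>Fatou's lemma along approximating test functions, in nonnegative integrals, so that
  integrability is a result of the estimate. The slack e keeps both normalising constants positive
  and is then sent to zero.\<close>

lemma W01p_L2_pairing:
  fixes \<Omega> :: "(real^'n) set"
  assumes \<Omega>: "open \<Omega>" and q: "1 \<le> q" "q \<le> 2" "real CARD('n) * (1 / q - 1 / 2) < 1"
  obtains C where "0 < C" "\<And>h w. h \<in> Lp \<Omega> 2 \<Longrightarrow> w \<in> W01p \<Omega> q \<Longrightarrow> integrable (lebesgue_on \<Omega>) (\<lambda>x. h x * w x)"
    "\<And>h w. h \<in> Lp \<Omega> 2 \<Longrightarrow> w \<in> W01p \<Omega> q \<Longrightarrow> (LINT x|lebesgue_on \<Omega>. \<bar>h x * w x\<bar>) \<le> C * Lp_norm \<Omega> 2 h * W1p_norm \<Omega> q w"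
proof -
  let ?m = "cube_vol TYPE(real^'n)" and ?N = "real CARD('n)"
  define \<theta> where "\<theta> = ?N * (1 / q - 1 / 2)"
  define C0 where "C0 = (1 + (?m + 1)\<^sup>2 * ?m) * (?N / (1 - \<theta>) + 1) / ?m"
  have "0 < 1 - \<theta>" using q by (simp add: \<theta>_def)
  then have C0: "0 < C0"
    unfolding C0_def using cube_vol_pos[where 'n='n] by (intro divide_pos_pos mult_pos_pos add_pos_nonneg add_nonneg_pos) auto
  have q0: "0 < q" using q by simp
  have test: "(\<integral>\<^sup>+x. ennreal \<bar>h x * \<phi> x\<bar> \<partial>lebesgue_on \<Omega>) \<le> ennreal (C0 * (l * c))"
    if h: "h \<in> Lp \<Omega> 2" and \<phi>: "\<phi> \<in> test_functions \<Omega>" and l: "0 < l" "Lp_norm \<Omega> 2 h \<le> l"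
      and c: "0 < c" "W1p_norm \<Omega> q \<phi> \<le> c" for h \<phi> l c
  proof -
    obtain h' where h': "h' \<in> borel_measurable borel" "\<And>x. x \<notin> \<Omega> \<Longrightarrow> h' x = 0" "AE x in lebesgue_on \<Omega>. h x = h' x"
      "integrable lborel (\<lambda>x. (h' x)\<^sup>2)" "(LINT x|lborel. (h' x)\<^sup>2) = (LINT x|lebesgue_on \<Omega>. (h x)\<^sup>2)"
      using L2_borel_version[OF \<Omega> h] by blast
    note [measurable] = h'(1)
    have [measurable]: "\<phi> \<in> borel_measurable borel"
      by (auto intro!: borel_measurable_continuous_onI test_functionD[OF \<phi>])
    have "(\<integral>\<^sup>+x. ennreal ((h' x / l)\<^sup>2) \<partial>lborel) = ennreal (LINT x|lborel. (h' x / l)\<^sup>2)"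
      using h'(4) by (intro nn_integral_eq_integral) (auto simp: power_divide)
    also have "(LINT x|lborel. (h' x / l)\<^sup>2) = (Lp_norm \<Omega> 2 h)\<^sup>2 / l\<^sup>2"
      by (simp add: power_divide h'(5) Lp_norm_2)
    also have "\<dots> \<le> 1"
      using l power_mono[OF l(2), of 2] by (simp add: Lp_norm_2[of \<Omega> h] del: real_sqrt_pow2_iff)
    finally have n1: "(\<integral>\<^sup>+x. ennreal ((h' x / l)\<^sup>2) \<partial>lborel) \<le> 1" by (simp add: ennreal_leI)
    have T: "(\<integral>\<^sup>+x. ennreal (\<bar>h' x / l\<bar> * \<bar>((1 / c) *\<^sub>R \<phi>) x\<bar>) \<partial>lborel) \<le> ennreal C0"
      unfolding C0_def \<theta>_def
      using test_pairing_bound[OF \<Omega> normalize_test_function(1)[OF \<Omega> q(1) \<phi> c] q(1,2) _ n1 normalize_test_function(2)[OF \<Omega> q(1) \<phi> c]] q(3)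
      by simp
    have "(\<integral>\<^sup>+x. ennreal \<bar>h x * \<phi> x\<bar> \<partial>lebesgue_on \<Omega>) = (\<integral>\<^sup>+x. ennreal \<bar>h' x * \<phi> x\<bar> \<partial>lebesgue_on \<Omega>)"
      using h'(3) by (intro nn_integral_cong_AE) auto
    also have "\<dots> = (\<integral>\<^sup>+x. ennreal \<bar>h' x * \<phi> x\<bar> * indicator \<Omega> x \<partial>lebesgue)"
      using \<Omega> by (subst nn_integral_restrict_space) auto
    also have "\<dots> = (\<integral>\<^sup>+x. ennreal \<bar>h' x * \<phi> x\<bar> \<partial>lborel)"
      unfolding nn_integral_completion using h'(2) by (intro nn_integral_cong) (auto split: split_indicator)
    also have "\<dots> = (\<integral>\<^sup>+x. ennreal (l * c) * ennreal (\<bar>h' x / l\<bar> * \<bar>((1 / c) *\<^sub>R \<phi>) x\<bar>) \<partial>lborel)"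
      using l c by (intro nn_integral_cong) (simp add: ennreal_mult'[symmetric] abs_mult scaleR_fun_def)
    also have "\<dots> = ennreal (l * c) * (\<integral>\<^sup>+x. ennreal (\<bar>h' x / l\<bar> * \<bar>((1 / c) *\<^sub>R \<phi>) x\<bar>) \<partial>lborel)"
      by (rule nn_integral_cmult) (simp add: scaleR_fun_def)
    also have "\<dots> \<le> ennreal (l * c) * ennreal C0"
      using T by (rule mult_left_mono) simp
    also have "\<dots> = ennreal (C0 * (l * c))"
      using l c C0 by (simp add: ennreal_mult'[symmetric] mult_ac)
    finally show ?thesis .
  qed
  have gen: "(\<integral>\<^sup>+x. ennreal \<bar>h x * w x\<bar> \<partial>lebesgue_on \<Omega>) \<le> ennreal (C0 * ((Lp_norm \<Omega> 2 h + e) * (4 * (W1p_norm \<Omega> q w + e))))"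
    if h: "h \<in> Lp \<Omega> 2" and w: "w \<in> W01p \<Omega> q" and e: "0 < e" for h w e
  proof -
    obtain \<phi> where \<phi>: "\<And>n. \<phi> n \<in> test_functions \<Omega>" "(\<lambda>n. W1p_norm \<Omega> q (\<phi> n - w)) \<longlonglongrightarrow> 0"
      "AE x in lebesgue_on \<Omega>. (\<lambda>n. \<phi> n x) \<longlonglongrightarrow> w x"
      using W01p_approx_AE[OF \<Omega> q(1) w] by blast
    note [measurable] = LpD(1)[OF h] W1pD(4)[OF \<Omega> W01pD[OF w]] W1pD(4)[OF \<Omega> test_function_W1p(1)[OF \<Omega> \<phi>(1) q0]]
    have "(\<integral>\<^sup>+x. ennreal \<bar>h x * w x\<bar> \<partial>lebesgue_on \<Omega>) = (\<integral>\<^sup>+x. liminf (\<lambda>n. ennreal \<bar>h x * \<phi> n x\<bar>) \<partial>lebesgue_on \<Omega>)"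
    proof (rule nn_integral_cong_AE)
      show "AE x in lebesgue_on \<Omega>. ennreal \<bar>h x * w x\<bar> = liminf (\<lambda>n. ennreal \<bar>h x * \<phi> n x\<bar>)"
        using \<phi>(3)
      proof eventually_elim
        case (elim x)
        have "(\<lambda>n. ennreal \<bar>h x * \<phi> n x\<bar>) \<longlonglongrightarrow> ennreal \<bar>h x * w x\<bar>"
          by (intro tendsto_intros elim)
        then show ?case by (rule lim_imp_Liminf[symmetric, rotated]) simp
      qed
    qed
    also have "\<dots> \<le> liminf (\<lambda>n. \<integral>\<^sup>+x. ennreal \<bar>h x * \<phi> n x\<bar> \<partial>lebesgue_on \<Omega>)"
      by (rule nn_integral_liminf) measurable
    also have "\<dots> \<le> ennreal (C0 * ((Lp_norm \<Omega> 2 h + e) * (4 * (W1p_norm \<Omega> q w + e))))"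
    proof (rule Liminf_le)
      have ev: "\<forall>\<^sub>F n in sequentially. W1p_norm \<Omega> q (\<phi> n - w) < e"
        using \<phi>(2) e by (rule order_tendstoD)
      then show "\<forall>\<^sub>F n in sequentially. (\<integral>\<^sup>+x. ennreal \<bar>h x * \<phi> n x\<bar> \<partial>lebesgue_on \<Omega>) \<le>
         ennreal (C0 * ((Lp_norm \<Omega> 2 h + e) * (4 * (W1p_norm \<Omega> q w + e))))"
      proof eventually_elim
        case (elim n)
        have "W1p_norm \<Omega> q (\<phi> n) \<le> 4 * (W1p_norm \<Omega> q w + e)"
          using W1p_norm_approx_le[OF \<Omega> q(1) w \<phi>(1)[of n]] elim by simp
        moreover have "0 < 4 * (W1p_norm \<Omega> q w + e)" "0 < Lp_norm \<Omega> 2 h + e"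
          using e W1p_norm_nonneg[of \<Omega> q w] by (auto simp: Lp_norm_2 add_nonneg_pos)
        ultimately show ?case using e by (intro test h \<phi>) auto
      qed
    qed simp
    finally show ?thesis .
  qed
  have I: "integrable (lebesgue_on \<Omega>) (\<lambda>x. h x * w x)" if h: "h \<in> Lp \<Omega> 2" and w: "w \<in> W01p \<Omega> q" for h w
  proof (rule integrableI_bounded)
    show "(\<lambda>x. h x * w x) \<in> borel_measurable (lebesgue_on \<Omega>)"
      using LpD(1)[OF h] W1pD(4)[OF \<Omega> W01pD[OF w]] by measurable
    show "(\<integral>\<^sup>+x. ennreal (norm (h x * w x)) \<partial>lebesgue_on \<Omega>) < \<infinity>"
      using gen[OF h w, of 1] by (auto simp: le_less_trans[OF _ ennreal_less_top])
  qed
  show thesis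
  proof (rule that[of "4 * C0", OF _ I])
    fix h w :: "real^'n \<Rightarrow> real" assume h: "h \<in> Lp \<Omega> 2" and w: "w \<in> W01p \<Omega> q"
    let ?A = "LINT x|lebesgue_on \<Omega>. \<bar>h x * w x\<bar>" and ?l = "Lp_norm \<Omega> 2 h" and ?c = "W1p_norm \<Omega> q w"
    have l0: "0 \<le> ?l" "0 \<le> ?c" by (auto simp: Lp_norm_2 W1p_norm_nonneg)
    have A: "?A \<le> C0 * ((?l + e) * (4 * (?c + e)))" if e: "0 < e" for e
    proof -
      have "ennreal ?A = (\<integral>\<^sup>+x. ennreal \<bar>h x * w x\<bar> \<partial>lebesgue_on \<Omega>)"
        using I[OF h w] by (intro nn_integral_eq_integral[symmetric]) auto
      also note gen[OF h w e]
      finally show ?thesis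
        using C0 l0 e by (subst (asm) ennreal_le_iff) auto
    qed
    have "(\<lambda>n. C0 * ((?l + 1 / real (Suc n)) * (4 * (?c + 1 / real (Suc n))))) \<longlonglongrightarrow> C0 * ((?l + 0) * (4 * (?c + 0)))"
      by (intro tendsto_intros LIMSEQ_Suc[OF lim_1_over_n])
    then have "?A \<le> C0 * ((?l + 0) * (4 * (?c + 0)))"
      by (rule LIMSEQ_le_const) (intro exI[of _ 0] allI impI A, simp)
    then show "?A \<le> 4 * C0 * ?l * ?c" by simp
  qed (use C0 in simp)
qed

section \<open>Convex combinations in \<open>L\<^sup>2\<close>\<close>

definition L2 :: "'a measure \<Rightarrow> ('a \<Rightarrow> real) set"
  where "L2 M = {f \<in> borel_measurable M. integrable M (\<lambda>x. (f x)\<^sup>2)}"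

lemma Lp_2_eq_L2: "Lp \<Omega> 2 = L2 (lebesgue_on \<Omega>)"
  by (auto simp: L2_def Lp_2_iff)

lemma L2D: "f \<in> L2 M \<Longrightarrow> f \<in> borel_measurable M" "f \<in> L2 M \<Longrightarrow> integrable M (\<lambda>x. (f x)\<^sup>2)"
  by (auto simp: L2_def)

lemma L2_mult_integrable: "f \<in> L2 M \<Longrightarrow> g \<in> L2 M \<Longrightarrow> integrable M (\<lambda>x. f x * g x)"
  by (intro L2_Cauchy_Schwarz(1)) (auto dest: L2D)

lemma L2_lincomb:
  assumes "f \<in> L2 M" "g \<in> L2 M"
  shows "(\<lambda>x. a * f x + b * g x) \<in> L2 M"
    "(LINT x|M. (a * f x + b * g x)\<^sup>2) = a\<^sup>2 * (LINT x|M. (f x)\<^sup>2) + 2 * a * b * (LINT x|M. f x * g x) + b\<^sup>2 * (LINT x|M. (g x)\<^sup>2)"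
proof -
  note I = L2D[OF assms(1)] L2D[OF assms(2)] L2_mult_integrable[OF assms]
  have e: "(a * f x + b * g x)\<^sup>2 = a\<^sup>2 * (f x)\<^sup>2 + 2 * a * b * (f x * g x) + b\<^sup>2 * (g x)\<^sup>2" for x
    by (simp add: power2_eq_square algebra_simps)
  show "(\<lambda>x. a * f x + b * g x) \<in> L2 M"
    using I unfolding L2_def mem_Collect_eq e by auto
  show "(LINT x|M. (a * f x + b * g x)\<^sup>2) = a\<^sup>2 * (LINT x|M. (f x)\<^sup>2) + 2 * a * b * (LINT x|M. f x * g x) + b\<^sup>2 * (LINT x|M. (g x)\<^sup>2)"
    using I unfolding e by simp
qed

lemma L2_diff: "f \<in> L2 M \<Longrightarrow> g \<in> L2 M \<Longrightarrow> (\<lambda>x. f x - g x) \<in> L2 M"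
  using L2_lincomb(1)[of f M g 1 "-1"] by simp

lemma L2_scale: "f \<in> L2 M \<Longrightarrow> (\<lambda>x. c * f x) \<in> L2 M"
  using L2_lincomb(1)[of f M f c 0] by simp

lemma L2_convex_bound:
  assumes "f \<in> L2 M" "g \<in> L2 M" "0 \<le> a" "0 \<le> b" "a + b = 1"
  shows "(LINT x|M. (a * f x + b * g x)\<^sup>2) \<le> a * (LINT x|M. (f x)\<^sup>2) + b * (LINT x|M. (g x)\<^sup>2)"
proof -
  have pt: "(a * f x + b * g x)\<^sup>2 \<le> a * (f x)\<^sup>2 + b * (g x)\<^sup>2" for x
  proof -
    have "a * (f x)\<^sup>2 + b * (g x)\<^sup>2 - (a * f x + b * g x)\<^sup>2 = a * b * (f x - g x)\<^sup>2"
    proof -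
      have b: "b = 1 - a" using assms(5) by simp
      show ?thesis unfolding b by (simp add: power2_eq_square algebra_simps)
    qed
    moreover have "0 \<le> a * b * (f x - g x)\<^sup>2" using assms by simp
    ultimately show ?thesis by linarith
  qed
  have "(LINT x|M. (a * f x + b * g x)\<^sup>2) \<le> (LINT x|M. a * (f x)\<^sup>2 + b * (g x)\<^sup>2)"
    using L2D[OF L2_lincomb(1)[OF assms(1,2)]] L2D[OF assms(1)] L2D[OF assms(2)] pt by (intro integral_mono) auto
  then show ?thesis using L2D[OF assms(1)] L2D[OF assms(2)] by simp
qed

text \<open>The Riesz-Fischer argument. The almost everywhere convergent subsequence is part of the
  result because pointwise sign conditions will be read off from it.\<close>

lemma L2_complete:
  fixes f :: "nat \<Rightarrow> 'a \<Rightarrow> real"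
  assumes fin: "finite_measure M" and f: "\<And>n. f n \<in> L2 M"
    and cauchy: "\<And>e. 0 < e \<Longrightarrow> \<exists>N. \<forall>m\<ge>N. \<forall>n\<ge>N. (LINT x|M. (f m x - f n x)\<^sup>2) \<le> e"
  obtains g r where "g \<in> L2 M" "(\<lambda>n. LINT x|M. (f n x - g x)\<^sup>2) \<longlonglongrightarrow> 0" "strict_mono (r :: nat \<Rightarrow> nat)"
    "AE x in M. (\<lambda>k. f (r k) x) \<longlonglongrightarrow> g x"
proof -
  interpret finite_measure M by (rule fin)
  note [measurable] = L2D(1)[OF f]
  have "\<exists>N. \<forall>k. \<forall>m\<ge>N k. \<forall>n\<ge>N k. (LINT x|M. (f m x - f n x)\<^sup>2) \<le> (1 / 4) ^ k"
    by (intro choice allI cauchy) simp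
  then obtain N :: "nat \<Rightarrow> nat" where N: "\<And>k m n. m \<ge> N k \<Longrightarrow> n \<ge> N k \<Longrightarrow> (LINT x|M. (f m x - f n x)\<^sup>2) \<le> (1 / 4) ^ k"
    by blast
  \<comment> \<open>Summing the thresholds makes r strictly increasing and keeps \<open>r k\<close>
    beyond the threshold of index k.\<close>
  define r where "r k = (\<Sum>j\<le>k. N j) + k" for k
  have r: "strict_mono r" by (rule strict_monoI_Suc) (simp add: r_def)
  have rN: "N k \<le> r k" "N k \<le> r (Suc k)" for k
  proof -
    have "N k \<le> (\<Sum>j\<le>k. N j)" by (intro member_le_sum) auto
    then show "N k \<le> r k" "N k \<le> r (Suc k)" by (auto simp: r_def)
  qed
  define u where "u k x = \<bar>f (r (Suc k)) x - f (r k) x\<bar>" for k x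
  have [measurable]: "u k \<in> borel_measurable M" for k unfolding u_def[abs_def] by measurable
  have uk: "(\<integral>\<^sup>+x. ennreal (u k x) \<partial>M) \<le> ennreal ((measure M (space M) + 1) * (1 / 2) ^ k)" for k
  proof -
    have L: "(\<lambda>x. f (r (Suc k)) x - f (r k) x) \<in> L2 M" by (intro L2_diff f)
    \<comment> \<open>Young's inequality with weight 2^k: on a finite measure space it turns the
      bound 4^(-k) for the second moment into a summable bound of order 2^(-k) for the
      first.\<close>
    have "u k x \<le> (1 / 2) ^ k + 2 ^ k * (f (r (Suc k)) x - f (r k) x)\<^sup>2" for x
    proof -
      let ?b = "2 ^ k :: real"
      have "0 \<le> (?b * u k x - 1)\<^sup>2" by simp
      then have "2 * (?b * u k x) \<le> ?b\<^sup>2 * (u k x)\<^sup>2 + 1" by (simp add: power2_diff power_mult_distrib)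
      moreover have "0 \<le> ?b * u k x" by (simp add: u_def)
      ultimately have "?b * u k x \<le> ?b * ((1 / 2) ^ k + ?b * (u k x)\<^sup>2)"
        by (simp add: distrib_left power_divide power2_eq_square mult.assoc)
      then have "u k x \<le> (1 / 2) ^ k + ?b * (u k x)\<^sup>2" by simp
      then show ?thesis by (simp add: u_def)
    qed
    then have "(\<integral>\<^sup>+x. ennreal (u k x) \<partial>M) \<le> (\<integral>\<^sup>+x. ennreal ((1 / 2) ^ k + 2 ^ k * (f (r (Suc k)) x - f (r k) x)\<^sup>2) \<partial>M)"
      by (intro nn_integral_mono ennreal_leI)
    also have "\<dots> = ennreal (LINT x|M. (1 / 2) ^ k + 2 ^ k * (f (r (Suc k)) x - f (r k) x)\<^sup>2)"
      using L2D(2)[OF L] by (intro nn_integral_eq_integral) auto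
    also have "(LINT x|M. (1 / 2) ^ k + 2 ^ k * (f (r (Suc k)) x - f (r k) x)\<^sup>2) =
        measure M (space M) * (1 / 2) ^ k + 2 ^ k * (LINT x|M. (f (r (Suc k)) x - f (r k) x)\<^sup>2)"
      using L2D(2)[OF L] by simp
    also have "2 ^ k * (LINT x|M. (f (r (Suc k)) x - f (r k) x)\<^sup>2) \<le> 2 ^ k * (1 / 4) ^ k"
      by (intro mult_left_mono N rN) auto
    also have "2 ^ k * (1 / 4 :: real) ^ k = (1 / 2) ^ k"
      by (simp add: power_mult_distrib[symmetric])
    finally show ?thesis by (simp add: distrib_right ennreal_leI)
  qed
  have "(\<integral>\<^sup>+x. (\<Sum>k. ennreal (u k x)) \<partial>M) = (\<Sum>k. \<integral>\<^sup>+x. ennreal (u k x) \<partial>M)"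
    by (rule nn_integral_suminf) measurable
  also have "\<dots> \<le> (\<Sum>k. ennreal ((measure M (space M) + 1) * (1 / 2) ^ k))"
    by (intro suminf_le uk) auto
  also have "\<dots> = ennreal (\<Sum>k. (measure M (space M) + 1) * (1 / 2) ^ k)"
    by (intro suminf_ennreal2 summable_mult summable_geometric) auto
  also have "\<dots> < \<infinity>" by simp
  finally have "AE x in M. (\<Sum>k. ennreal (u k x)) \<noteq> \<infinity>"
    by (intro nn_integral_noteq_infinite) auto
  then have conv: "AE x in M. convergent (\<lambda>k. f (r k) x)"
  proof eventually_elim
    case (elim x)
    then have "summable (\<lambda>k. u k x)"
      by (intro summable_suminf_not_top) (auto simp: u_def)
    then have "summable (\<lambda>k. f (r (Suc k)) x - f (r k) x)"
      unfolding u_def by (rule summable_rabs_cancel)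
    then have "convergent (\<lambda>n. f (r n) x - f (r 0) x)"
      by (simp add: summable_iff_convergent sum_lessThan_telescope[of "\<lambda>k. f (r k) x"])
    from convergent_add[OF this convergent_const[of "f (r 0) x"]] show ?case by simp
  qed
  define g where "g x = lim (\<lambda>k. f (r k) x)" for x
  have [measurable]: "g \<in> borel_measurable M" unfolding g_def[abs_def] by measurable
  have gAE: "AE x in M. (\<lambda>k. f (r k) x) \<longlonglongrightarrow> g x"
    using conv by eventually_elim (simp add: g_def convergent_LIMSEQ_iff)
  have fat: "(\<integral>\<^sup>+x. ennreal ((f n x - g x)\<^sup>2) \<partial>M) \<le> ennreal e"
    if N: "\<forall>m\<ge>N. \<forall>n\<ge>N. (LINT x|M. (f m x - f n x)\<^sup>2) \<le> e" and n: "N \<le> n" for e N n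
  proof -
    have "(\<integral>\<^sup>+x. ennreal ((f n x - g x)\<^sup>2) \<partial>M) = (\<integral>\<^sup>+x. liminf (\<lambda>k. ennreal ((f n x - f (r k) x)\<^sup>2)) \<partial>M)"
    proof (rule nn_integral_cong_AE)
      show "AE x in M. ennreal ((f n x - g x)\<^sup>2) = liminf (\<lambda>k. ennreal ((f n x - f (r k) x)\<^sup>2))"
        using gAE
      proof eventually_elim
        case (elim x)
        have "(\<lambda>k. ennreal ((f n x - f (r k) x)\<^sup>2)) \<longlonglongrightarrow> ennreal ((f n x - g x)\<^sup>2)"
          by (intro tendsto_intros elim)
        then show ?case by (rule lim_imp_Liminf[symmetric, rotated]) simp
      qed
    qed
    also have "\<dots> \<le> liminf (\<lambda>k. \<integral>\<^sup>+x. ennreal ((f n x - f (r k) x)\<^sup>2) \<partial>M)"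
      by (rule nn_integral_liminf) measurable
    also have "\<dots> \<le> ennreal e"
    proof (rule Liminf_le)
      show "\<forall>\<^sub>F k in sequentially. (\<integral>\<^sup>+x. ennreal ((f n x - f (r k) x)\<^sup>2) \<partial>M) \<le> ennreal e"
        using eventually_ge_at_top[of N]
      proof eventually_elim
        case (elim k)
        then have "N \<le> r k" using seq_suble[OF r, of k] by linarith
        have "(\<integral>\<^sup>+x. ennreal ((f n x - f (r k) x)\<^sup>2) \<partial>M) = ennreal (LINT x|M. (f n x - f (r k) x)\<^sup>2)"
          using L2D(2)[OF L2_diff[OF f f]] by (intro nn_integral_eq_integral) auto
        also have "\<dots> \<le> ennreal e" using N n \<open>N \<le> r k\<close> by (intro ennreal_leI) auto
        finally show ?case .
      qed
    qed simp
    finally show ?thesis .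
  qed
  have diffL2: "\<exists>n. (\<lambda>x. f n x - g x) \<in> L2 M"
  proof -
    obtain N where N: "\<forall>m\<ge>N. \<forall>n\<ge>N. (LINT x|M. (f m x - f n x)\<^sup>2) \<le> 1" using cauchy[of 1] by auto
    have "integrable M (\<lambda>x. (f N x - g x)\<^sup>2)"
      using le_less_trans[OF fat[OF N order_refl] ennreal_less_top] by (intro integrableI_bounded) (simp_all add: infinity_ennreal_def)
    then show ?thesis by (auto simp: L2_def)
  qed
  then obtain n0 where n0: "(\<lambda>x. f n0 x - g x) \<in> L2 M" by auto
  have gL2: "g \<in> L2 M" using L2_diff[OF f[of n0] n0] by simp
  have "(\<lambda>n. LINT x|M. (f n x - g x)\<^sup>2) \<longlonglongrightarrow> 0"
  proof (rule LIMSEQ_I)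
    fix e :: real assume e: "0 < e"
    obtain N where N: "\<forall>m\<ge>N. \<forall>n\<ge>N. (LINT x|M. (f m x - f n x)\<^sup>2) \<le> e / 2" using cauchy[of "e / 2"] e by auto
    have "norm ((LINT x|M. (f n x - g x)\<^sup>2) - 0) < e" if "n \<ge> N" for n
    proof -
      have "ennreal (LINT x|M. (f n x - g x)\<^sup>2) = (\<integral>\<^sup>+x. ennreal ((f n x - g x)\<^sup>2) \<partial>M)"
        using L2D(2)[OF L2_diff[OF f gL2]] by (intro nn_integral_eq_integral[symmetric]) auto
      also have "\<dots> \<le> ennreal (e / 2)" by (rule fat[OF N that])
      finally have "(LINT x|M. (f n x - g x)\<^sup>2) \<le> e / 2" using e by (subst (asm) ennreal_le_iff) auto
      then show ?thesis using e by simp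
    qed
    then show "\<exists>N. \<forall>n\<ge>N. norm ((LINT x|M. (f n x - g x)\<^sup>2) - 0) < e" by blast
  qed
  then show thesis using that[OF gL2 _ r gAE] by blast
qed

text \<open>Nearly minimal elements of the convex hulls of the tails form a Cauchy sequence by the parallelogram
  identity; this replaces weak sequential compactness of the unit ball of \<open>L\<^sup>2\<close>.\<close>

lemma L2_convex_tails_Cauchy:
  fixes h :: "nat \<Rightarrow> 'a \<Rightarrow> real"
  assumes h: "\<And>n. h n \<in> L2 M" and h1: "\<And>n. (LINT x|M. (h n x)\<^sup>2) \<le> 1"
  obtains g where "\<And>n. g n \<in> convex hull (h ` {n..})" "\<And>n. g n \<in> L2 M" "\<And>n. (LINT x|M. (g n x)\<^sup>2) \<le> 1"
    "\<And>e. 0 < e \<Longrightarrow> \<exists>N. \<forall>m\<ge>N. \<forall>n\<ge>N. (LINT x|M. (g m x - g n x)\<^sup>2) \<le> e"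
proof -
  let ?H = "\<lambda>n. convex hull (h ` {n..})" and ?q = "\<lambda>f. LINT x|M. (f x)\<^sup>2"
  have H: "f \<in> L2 M" "?q f \<le> 1" if "f \<in> ?H n" for f n
  proof -
    let ?S = "{f \<in> L2 M. ?q f \<le> 1}"
    have "convex ?S"
    proof (rule convexI)
      fix f g :: "'a \<Rightarrow> real" and u v :: real
      assume fg: "f \<in> ?S" "g \<in> ?S" and uv: "0 \<le> u" "0 \<le> v" "u + v = 1"
      have e: "u *\<^sub>R f + v *\<^sub>R g = (\<lambda>x. u * f x + v * g x)" by (simp add: scaleR_fun_def fun_eq_iff)
      have "?q (\<lambda>x. u * f x + v * g x) \<le> u * ?q f + v * ?q g"
        using fg uv by (intro L2_convex_bound) auto
      also have "\<dots> \<le> u * 1 + v * 1" using fg uv by (intro add_mono mult_left_mono) auto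
      finally show "u *\<^sub>R f + v *\<^sub>R g \<in> ?S"
        unfolding e using fg uv L2_lincomb(1)[of f M g u v] by auto
    qed
    moreover have "h ` {n..} \<subseteq> ?S" using h h1 by auto
    ultimately have "?H n \<subseteq> ?S" by (intro hull_minimal) auto
    then show "f \<in> L2 M" "?q f \<le> 1" using that by auto
  qed
  \<comment> \<open>The least squared norm over the hull of the n-th tail. The hulls shrink, so d
    increases, and it is at most 1; hence it converges.\<close>
  define d where "d n = Inf (?q ` ?H n)" for n
  have ne: "?H n \<noteq> {}" for n by simp
  have bdd: "bdd_below (?q ` ?H n)" for n by (rule bdd_belowI[of _ 0]) auto
  have dle: "d n \<le> ?q f" if "f \<in> ?H n" for f n
    unfolding d_def using that bdd by (intro cInf_lower) auto
  have sub: "?H m \<subseteq> ?H n" if "n \<le> m" for m n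
    using that by (intro hull_mono image_mono) auto
  have dmono: "d n \<le> d m" if "n \<le> m" for m n
    unfolding d_def using sub[OF that] ne by (intro cInf_superset_mono bdd image_mono) auto
  have d1: "d n \<le> 1" for n
  proof -
    have "h n \<in> ?H n" by (intro hull_inc) auto
    then show ?thesis using dle[of "h n" n] h1[of n] by linarith
  qed
  have "\<exists>f. f \<in> ?H n \<and> ?q f < d n + 1 / real (Suc n)" for n
  proof -
    have "Inf (?q ` ?H n) < d n + 1 / real (Suc n)" by (simp add: d_def)
    from cInf_lessD[OF _ this] show ?thesis using ne by auto
  qed
  then obtain g where g: "\<And>n. g n \<in> ?H n" "\<And>n. ?q (g n) < d n + 1 / real (Suc n)" by metis
  have "incseq d" using dmono by (auto simp: incseq_def)
  then obtain D where D: "d \<longlonglongrightarrow> D" using incseq_convergent[of d 1] d1 by blast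
  have dist: "(LINT x|M. (g m x - g n x)\<^sup>2) \<le> 2 * (d m - d n) + 4 / real (Suc n)" if nm: "n \<le> m" for m n
  proof -
    have gm: "g m \<in> ?H n" using g(1) sub[OF nm] by blast
    have L: "g m \<in> L2 M" "g n \<in> L2 M" using H(1) g(1) by auto
    have "(1 / 2) *\<^sub>R g m + (1 / 2) *\<^sub>R g n \<in> ?H n"
      by (rule convexD[OF convex_convex_hull gm g(1)]) auto
    moreover have "(1 / 2) *\<^sub>R g m + (1 / 2) *\<^sub>R g n = (\<lambda>x. 1 / 2 * g m x + 1 / 2 * g n x)"
      by (simp add: scaleR_fun_def fun_eq_iff)
    ultimately have mid: "d n \<le> (LINT x|M. (1 / 2 * g m x + 1 / 2 * g n x)\<^sup>2)" using dle by auto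
    \<comment> \<open>The parallelogram identity. The midpoint lies in the hull of the earlier tail,
      so its squared norm is at least \<open>d n\<close>.\<close>
    have "(LINT x|M. (1 * g m x + (- 1) * g n x)\<^sup>2) + 4 * (LINT x|M. (1 / 2 * g m x + 1 / 2 * g n x)\<^sup>2) = 2 * ?q (g m) + 2 * ?q (g n)"
      unfolding L2_lincomb(2)[OF L] by (simp add: power2_eq_square)
    moreover have "1 / real (Suc m) \<le> 1 / real (Suc n)" using nm by (intro divide_left_mono) auto
    moreover have "X \<le> 2 * (b - a) + 4 * s" if "X + 4 * Y = 2 * P + 2 * Q" "s' \<le> s" "a \<le> Y" "P < b + s'" "Q < a + s"
      for X Y P Q a b s s' :: real using that by argo
    ultimately have "(LINT x|M. (1 * g m x + (- 1) * g n x)\<^sup>2) \<le> 2 * (d m - d n) + 4 * (1 / real (Suc n))"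
      using mid g(2)[of m] g(2)[of n] by blast
    then show ?thesis by simp
  qed
  show thesis
  proof (rule that[OF g(1)])
    show "g n \<in> L2 M" "(LINT x|M. (g n x)\<^sup>2) \<le> 1" for n by (rule H[OF g(1)])+
    fix e :: real assume e: "0 < e"
    have "Cauchy d" using D by (rule LIMSEQ_imp_Cauchy)
    then obtain N1 where N1: "\<And>m n. m \<ge> N1 \<Longrightarrow> n \<ge> N1 \<Longrightarrow> dist (d m) (d n) < e / 4"
      using e unfolding Cauchy_def by (meson zero_less_divide_iff zero_less_numeral)
    obtain N2 where N2: "\<And>n. n \<ge> N2 \<Longrightarrow> 1 / real (Suc n) < e / 8"
    proof -
      have "\<forall>\<^sub>F n in sequentially. 1 / real (Suc n) < e / 8"
        using LIMSEQ_Suc[OF lim_1_over_n] e by (intro order_tendstoD(2)[of _ 0]) auto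
      then show thesis using that by (auto simp: eventually_sequentially)
    qed
    have half: "(LINT x|M. (g m x - g n x)\<^sup>2) \<le> e" if "n \<le> m" "max N1 N2 \<le> n" for m n
    proof -
      have "dist (d m) (d n) < e / 4" using N1[of m n] that by auto
      then have "d m - d n < e / 4" unfolding dist_real_def by linarith
      moreover have "1 / real (Suc n) < e / 8" using N2 that by auto
      ultimately show ?thesis using dist[OF that(1)] by simp
    qed
    show "\<exists>N. \<forall>m\<ge>N. \<forall>n\<ge>N. (LINT x|M. (g m x - g n x)\<^sup>2) \<le> e"
    proof (intro exI[of _ "max N1 N2"] allI impI)
      fix m n assume mn: "max N1 N2 \<le> m" "max N1 N2 \<le> n"
      show "(LINT x|M. (g m x - g n x)\<^sup>2) \<le> e"
      proof (cases "n \<le> m")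
        case True then show ?thesis using half mn by auto
      next
        case False
        then have "(LINT x|M. (g n x - g m x)\<^sup>2) \<le> e" using half mn by auto
        then show ?thesis by (simp add: power2_commute)
      qed
    qed
  qed
qed

text \<open>Transfer from Borel functions and test functions to \<open>Lp \<Omega> 2\<close> and
  \<open>W01p\<close>. Late approximants of a function of norm at most 1 have norm at most 4 (1 + 1)
  = 8, whence the tolerance \<eta> / 8 and the rescaling by 8.\<close>

lemma L2_W01p_compact:
  fixes h :: "nat \<Rightarrow> real^'n \<Rightarrow> real"
  assumes \<Omega>: "open \<Omega>" "bounded \<Omega>" and q: "1 \<le> q" "q \<le> 2" "real CARD('n) * (1 / q - 1 / 2) < 1"
    and h: "\<And>n. h n \<in> Lp \<Omega> 2" and h1: "\<And>n. (LINT x|lebesgue_on \<Omega>. (h n x)\<^sup>2) \<le> 1"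
  obtains k :: "nat \<Rightarrow> nat" where "strict_mono k"
    "\<And>\<eta>. 0 < \<eta> \<Longrightarrow> \<exists>N. \<forall>i\<ge>N. \<forall>j\<ge>N. \<forall>w\<in>W01p \<Omega> q. W1p_norm \<Omega> q w \<le> 1 \<longrightarrow>
        \<bar>LINT x|lebesgue_on \<Omega>. (h (k i) x - h (k j) x) * w x\<bar> \<le> \<eta>"
proof -
  have q0: "0 < q" using q by simp
  obtain C where C: "0 < C" "\<And>h w. h \<in> Lp \<Omega> 2 \<Longrightarrow> w \<in> W01p \<Omega> q \<Longrightarrow> integrable (lebesgue_on \<Omega>) (\<lambda>x. h x * w x)"
    "\<And>h w. h \<in> Lp \<Omega> 2 \<Longrightarrow> w \<in> W01p \<Omega> q \<Longrightarrow> (LINT x|lebesgue_on \<Omega>. \<bar>h x * w x\<bar>) \<le> C * Lp_norm \<Omega> 2 h * W1p_norm \<Omega> q w"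
    using W01p_L2_pairing[OF \<Omega>(1) q] by blast
  have "\<forall>n. \<exists>h'. h' \<in> borel_measurable borel \<and> (\<forall>x. x \<notin> \<Omega> \<longrightarrow> h' x = 0) \<and> (AE x in lebesgue_on \<Omega>. h n x = h' x) \<and>
      integrable lborel (\<lambda>x. (h' x)\<^sup>2) \<and> (LINT x|lborel. (h' x)\<^sup>2) = (LINT x|lebesgue_on \<Omega>. (h n x)\<^sup>2)"
    using L2_borel_version[OF \<Omega>(1) h] by blast
  then obtain h' where h': "\<And>n. h' n \<in> borel_measurable borel" "\<And>n x. x \<notin> \<Omega> \<Longrightarrow> h' n x = 0" "\<And>n. AE x in lebesgue_on \<Omega>. h n x = h' n x"
      "\<And>n. integrable lborel (\<lambda>x. (h' n x)\<^sup>2)" "\<And>n. (LINT x|lborel. (h' n x)\<^sup>2) = (LINT x|lebesgue_on \<Omega>. (h n x)\<^sup>2)"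
    by (auto dest!: choice)
  obtain k :: "nat \<Rightarrow> nat" where k: "strict_mono k"
    "\<And>\<eta>. 0 < \<eta> \<Longrightarrow> \<exists>N. \<forall>i\<ge>N. \<forall>j\<ge>N. \<forall>\<phi>\<in>test_functions \<Omega>. W1p_pow \<Omega> q \<phi> \<le> 1 \<longrightarrow>
        \<bar>LINT x|lborel. (h' (k i) x - h' (k j) x) * \<phi> x\<bar> \<le> \<eta>"
  proof -
    have h'1: "(LINT x|lborel. (h' n x)\<^sup>2) \<le> 1" for n using h'(5) h1 by simp
    show thesis
      by (rule compact_pairing_borel[where h=h', OF \<Omega> q h'(1) h'(2) h'(4) h'1]) (assumption, rule that, assumption+)
  qed
  show thesis
  proof (rule that[OF k(1)])
    fix \<eta> :: real assume \<eta>: "0 < \<eta>"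
    obtain N where N: "\<And>i j \<phi>. i \<ge> N \<Longrightarrow> j \<ge> N \<Longrightarrow> \<phi> \<in> test_functions \<Omega> \<Longrightarrow> W1p_pow \<Omega> q \<phi> \<le> 1 \<Longrightarrow>
        \<bar>LINT x|lborel. (h' (k i) x - h' (k j) x) * \<phi> x\<bar> \<le> \<eta> / 8"
    proof -
      have "0 < \<eta> / 8" using \<eta> by simp
      then show thesis using k(2) that by blast
    qed
    show "\<exists>N. \<forall>i\<ge>N. \<forall>j\<ge>N. \<forall>w\<in>W01p \<Omega> q. W1p_norm \<Omega> q w \<le> 1 \<longrightarrow>
        \<bar>LINT x|lebesgue_on \<Omega>. (h (k i) x - h (k j) x) * w x\<bar> \<le> \<eta>"
    proof (intro exI[of _ N] allI ballI impI)
      fix i j w assume i: "N \<le> i" and j: "N \<le> j" and w: "w \<in> W01p \<Omega> q" and w1: "W1p_norm \<Omega> q w \<le> 1"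
      define f where "f x = h (k i) x - h (k j) x" for x
      have fL: "f \<in> Lp \<Omega> 2" unfolding f_def[abs_def] using L2_diff h unfolding Lp_2_eq_L2 by blast
      have test: "\<bar>LINT x|lebesgue_on \<Omega>. f x * \<phi> x\<bar> \<le> \<eta>" if \<phi>: "\<phi> \<in> test_functions \<Omega>" and n: "W1p_norm \<Omega> q \<phi> \<le> 8" for \<phi>
      proof -
        note T = normalize_test_function[OF \<Omega>(1) q(1) \<phi> _ n, simplified]
        have [measurable]: "\<phi> \<in> borel_measurable borel"
          by (auto intro!: borel_measurable_continuous_onI test_functionD[OF \<phi>])
        note [measurable] = h'(1)
        have "(LINT x|lebesgue_on \<Omega>. f x * \<phi> x) = (LINT x|lebesgue_on \<Omega>. (h' (k i) x - h' (k j) x) * \<phi> x)"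
        proof (rule integral_cong_AE)
          show "AE x in lebesgue_on \<Omega>. f x * \<phi> x = (h' (k i) x - h' (k j) x) * \<phi> x"
            using h'(3)[of "k i"] h'(3)[of "k j"] unfolding f_def by eventually_elim simp
          show "(\<lambda>x. f x * \<phi> x) \<in> borel_measurable (lebesgue_on \<Omega>)"
            using C(2)[OF fL test_function_W01p[OF \<Omega>(1) q0 \<phi>]] by (rule borel_measurable_integrable)
          show "(\<lambda>x. (h' (k i) x - h' (k j) x) * \<phi> x) \<in> borel_measurable (lebesgue_on \<Omega>)"
            by (intro measurable_restrict_space1 measurable_completion) measurable
        qed
        also have "\<dots> = (LINT x|lborel. (h' (k i) x - h' (k j) x) * \<phi> x)"
          by (rule integral_lebesgue_on_support[OF \<Omega>(1)]) (auto simp: h'(2))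
        also have "\<dots> = 8 * (LINT x|lborel. (h' (k i) x - h' (k j) x) * ((1 / 8) *\<^sub>R \<phi>) x)"
          by (simp add: scaleR_fun_def)
        finally show ?thesis using N[OF i j T] by simp
      qed
      obtain \<phi> where \<phi>: "\<And>n. \<phi> n \<in> test_functions \<Omega>" "(\<lambda>n. W1p_norm \<Omega> q (\<phi> n - w)) \<longlonglongrightarrow> 0"
        using W01p_approx[OF w] by blast
      have d: "\<phi> n - w \<in> W01p \<Omega> q" for n
        by (rule W01p_diff[OF \<Omega>(1) q(1) test_function_W01p[OF \<Omega>(1) q0 \<phi>(1)] w])
      have lim: "(\<lambda>n. \<eta> + C * Lp_norm \<Omega> 2 f * W1p_norm \<Omega> q (\<phi> n - w)) \<longlonglongrightarrow> \<eta> + C * Lp_norm \<Omega> 2 f * 0"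
        by (intro tendsto_intros \<phi>)
      have "\<forall>\<^sub>F n in sequentially. W1p_norm \<Omega> q (\<phi> n - w) < 1"
        using \<phi>(2) by (rule order_tendstoD) simp
      then have ev: "\<forall>\<^sub>F n in sequentially. \<bar>LINT x|lebesgue_on \<Omega>. f x * w x\<bar> \<le> \<eta> + C * Lp_norm \<Omega> 2 f * W1p_norm \<Omega> q (\<phi> n - w)"
      proof eventually_elim
        case (elim n)
        have "W1p_norm \<Omega> q (\<phi> n) \<le> 8"
        proof -
          have "4 * (W1p_norm \<Omega> q (\<phi> n - w) + W1p_norm \<Omega> q w) \<le> 4 * (1 + 1)"
            using elim w1 by (intro mult_left_mono add_mono) auto
          then show ?thesis using W1p_norm_approx_le[OF \<Omega>(1) q(1) w \<phi>(1)[of n]] by simp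
        qed
        then have A: "\<bar>LINT x|lebesgue_on \<Omega>. f x * \<phi> n x\<bar> \<le> \<eta>" by (rule test[OF \<phi>(1)])
        have "(LINT x|lebesgue_on \<Omega>. f x * (\<phi> n - w) x) = (LINT x|lebesgue_on \<Omega>. f x * \<phi> n x) - (LINT x|lebesgue_on \<Omega>. f x * w x)"
          using C(2)[OF fL w] C(2)[OF fL test_function_W01p[OF \<Omega>(1) q0 \<phi>(1)]] by (simp add: right_diff_distrib)
        moreover have "\<bar>LINT x|lebesgue_on \<Omega>. f x * (\<phi> n - w) x\<bar> \<le> C * Lp_norm \<Omega> 2 f * W1p_norm \<Omega> q (\<phi> n - w)"
          using C(3)[OF fL d[of n]] integral_abs_bound[of "lebesgue_on \<Omega>" "\<lambda>x. f x * (\<phi> n - w) x"] by linarith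
        ultimately show ?case using A by linarith
      qed
      have "\<bar>LINT x|lebesgue_on \<Omega>. f x * w x\<bar> \<le> \<eta> + C * Lp_norm \<Omega> 2 f * 0"
        by (rule tendsto_lowerbound[OF lim ev]) simp
      then show "\<bar>LINT x|lebesgue_on \<Omega>. (h (k i) x - h (k j) x) * w x\<bar> \<le> \<eta>" by (simp add: f_def)
    qed
  qed
qed

section \<open>Finitely piecewise \<open>C\<^sup>2\<close> functions\<close>

text \<open>The breakpoints to the left of a given point are those with indices 1, ..., i. Stating
  this for a predicate covers both the strict and the weak inequality; i = 0 means that there are
  none.\<close>

lemma down_closed_initial_segment:
  assumes "\<And>i j. 1 \<le> i \<Longrightarrow> i \<le> j \<Longrightarrow> j \<le> (K::nat) \<Longrightarrow> P j \<Longrightarrow> P i"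
  obtains i where "i \<le> K" "\<And>j. 1 \<le> j \<Longrightarrow> j \<le> K \<Longrightarrow> P j \<longleftrightarrow> j \<le> i"
proof -
  define i where "i = Max (insert 0 {j\<in>{1..K}. P j})"
  have fin: "finite (insert 0 {j\<in>{1..K}. P j})" by simp
  have "i \<in> insert 0 {j\<in>{1..K}. P j}" unfolding i_def by (rule Max_in[OF fin]) simp
  then have i: "i \<le> K" "1 \<le> i \<Longrightarrow> P i" by auto
  show thesis
  proof (rule that[OF i(1)])
    fix j assume j: "1 \<le> j" "j \<le> K"
    show "P j \<longleftrightarrow> j \<le> i"
    proof
      assume "P j"
      then show "j \<le> i" unfolding i_def using j by (intro Max_ge[OF fin]) auto
    next
      assume "j \<le> i"
      then show "P j" using assms[OF j(1) _ i(1)] i(2) j by simp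
    qed
  qed
qed

locale PC2_function =
  fixes K :: nat and t :: "nat \<Rightarrow> real" and ai :: "nat \<Rightarrow> real \<Rightarrow> real" and a :: "real \<Rightarrow> real"
  assumes PC2: "finitely_PC2 K t ai a"
begin

lemma t_Suc: "1 \<le> i \<Longrightarrow> i < K \<Longrightarrow> t i < t (Suc i)"
  using PC2 by (auto simp: finitely_PC2_def)

lemma t_mono: "1 \<le> i \<Longrightarrow> i \<le> j \<Longrightarrow> j \<le> K \<Longrightarrow> t i \<le> t j"
proof (induction j)
  case (Suc j)
  show ?case
  proof (cases "i = Suc j")
    case False
    then have "t i \<le> t j" using Suc by simp
    also have "t j < t (Suc j)" using Suc.prems False by (intro t_Suc) auto
    finally show ?thesis by simp
  qed simp
qed simp

lemma ai_C2: "i \<le> K \<Longrightarrow> C2_real (ai i)"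
  using PC2 by (auto simp: finitely_PC2_def)

lemma ai_deriv: "i \<le> K \<Longrightarrow> (ai i has_real_derivative deriv (ai i) s) (at s)"
  using ai_C2 by (auto simp: C2_real_def field_differentiable_derivI)

lemma ai_deriv2: "i \<le> K \<Longrightarrow> (deriv (ai i) has_real_derivative deriv (deriv (ai i)) s) (at s)"
  using ai_C2 by (auto simp: C2_real_def field_differentiable_derivI)

lemma ai_deriv_cont: "i \<le> K \<Longrightarrow> continuous_on S (deriv (ai i))"
  using ai_deriv2 by (meson DERIV_continuous_on has_field_derivative_at_within)

lemma ai_deriv2_cont: "i \<le> K \<Longrightarrow> continuous_on S (deriv (deriv (ai i)))"
  using ai_C2 by (auto simp: C2_real_def intro: continuous_on_subset)

lemma a_continuous: "continuous_on S a"
  using PC2 by (auto simp: finitely_PC2_def intro: continuous_on_subset)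

section \<open>Locating the piece at a point\<close>

lemma piece_index:
  obtains i where "i \<le> K" "\<And>j. j \<le> K \<Longrightarrow> s \<in> piece K t j \<longleftrightarrow> j = i"
proof -
  obtain i where i: "i \<le> K" "\<And>j. 1 \<le> j \<Longrightarrow> j \<le> K \<Longrightarrow> t j < s \<longleftrightarrow> j \<le> i"
    using down_closed_initial_segment[of K "\<lambda>j. t j < s"] t_mono by (metis order_le_less_trans)
  show thesis
  proof (rule that[OF i(1)])
    fix j assume j: "j \<le> K"
    have "s \<in> piece K t j \<longleftrightarrow> (1 \<le> j \<longrightarrow> j \<le> i) \<and> (j < K \<longrightarrow> \<not> j + 1 \<le> i)"
      unfolding piece_def using i(2)[of j] i(2)[of "j + 1"] j by auto
    then show "s \<in> piece K t j \<longleftrightarrow> j = i" using i(1) j by auto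
  qed
qed

lemma sum_piece:
  fixes f :: "nat \<Rightarrow> real"
  assumes "i \<le> K" "s \<in> piece K t i"
  shows "(\<Sum>j\<le>K. indicator (piece K t j) s * f j) = f i"
proof -
  obtain i' where i': "i' \<le> K" "\<And>j. j \<le> K \<Longrightarrow> s \<in> piece K t j \<longleftrightarrow> j = i'" using piece_index[of s] by blast
  have "i' = i" using assms i' by blast
  have "(\<Sum>j\<le>K. indicator (piece K t j) s * f j) = (\<Sum>j\<le>K. if j = i then f j else 0)"
    by (intro sum.cong) (use i'(2) \<open>i' = i\<close> in \<open>auto simp: indicator_def\<close>)
  also have "\<dots> = f i" using assms(1) by simp
  finally show ?thesis .
qed

text \<open>The left endpoint of a piece belongs to the previous half-open interval, but
  neighbouring pieces agree there, so each piece may be used on its closed interval.\<close>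

lemma a_eq_closed_piece:
  assumes "i \<le> K" "1 \<le> i \<longrightarrow> t i \<le> s" "i < K \<longrightarrow> s \<le> t (i + 1)"
  shows "a s = ai i s"
proof -
  have a: "a s = (\<Sum>i\<le>K. indicator (piece K t i) s * ai i s)" for s
    using PC2 by (auto simp: finitely_PC2_def)
  show ?thesis
  proof (cases "1 \<le> i \<and> s = t i")
    case True
    then have i: "1 \<le> i" "s = t i" by auto
    have "s \<in> piece K t (i - 1)" using i assms(1) t_Suc[of "i - 1"] by (auto simp: piece_def)
    then have "a s = ai (i - 1) s" unfolding a using assms(1) by (intro sum_piece) auto
    also have "\<dots> = ai i s" using PC2 i assms(1) by (auto simp: finitely_PC2_def)
    finally show ?thesis .
  next
    case False
    then have "s \<in> piece K t i" using assms by (auto simp: piece_def)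
    then show ?thesis unfolding a by (rule sum_piece[OF assms(1)])
  qed
qed

text \<open>At a kink the germ on the right belongs to the next piece, so the index counts the
  breakpoints with t j <= s; \<open>left_piece\<close> takes the half-open interval that contains s
  instead.\<close>

lemma right_piece:
  obtains i e where "i \<le> K" "0 < e" "\<And>r. s \<le> r \<Longrightarrow> r < s + e \<Longrightarrow> a r = ai i r"
proof -
  obtain i where i: "i \<le> K" "\<And>j. 1 \<le> j \<Longrightarrow> j \<le> K \<Longrightarrow> t j \<le> s \<longleftrightarrow> j \<le> i"
    using down_closed_initial_segment[of K "\<lambda>j. t j \<le> s"] t_mono by (metis order_trans)
  define e where "e = (if i < K then t (i + 1) - s else 1)"
  have "i < K \<Longrightarrow> s < t (i + 1)" using i(2)[of "i + 1"] by auto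
  then have "0 < e" by (auto simp: e_def)
  moreover have "a r = ai i r" if "s \<le> r" "r < s + e" for r
  proof (rule a_eq_closed_piece[OF i(1)])
    show "1 \<le> i \<longrightarrow> t i \<le> r" using i(2)[of i] i(1) that by auto
    show "i < K \<longrightarrow> r \<le> t (i + 1)" using that by (auto simp: e_def)
  qed
  ultimately show thesis using that i(1) by blast
qed

lemma left_piece:
  obtains i e where "i \<le> K" "0 < e" "\<And>r. s - e < r \<Longrightarrow> r \<le> s \<Longrightarrow> a r = ai i r"
proof -
  obtain i where i: "i \<le> K" "\<And>j. j \<le> K \<Longrightarrow> s \<in> piece K t j \<longleftrightarrow> j = i" using piece_index[of s] by blast
  then have "s \<in> piece K t i" by blast
  then have s: "1 \<le> i \<Longrightarrow> t i < s" "i < K \<Longrightarrow> s \<le> t (i + 1)" by (auto simp: piece_def)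
  define e where "e = (if 1 \<le> i then s - t i else 1)"
  have "0 < e" using s by (auto simp: e_def)
  moreover have "a r = ai i r" if "s - e < r" "r \<le> s" for r
    by (rule a_eq_closed_piece[OF i(1)]) (use that s in \<open>auto simp: e_def\<close>)
  ultimately show thesis using that i(1) by blast
qed

section \<open>Directional derivatives\<close>

lemma right_germ_tendsto:
  assumes "i \<le> K" "0 < e" "\<And>r. s \<le> r \<Longrightarrow> r < s + e \<Longrightarrow> a r = ai i r" "0 < h"
  shows "((\<lambda>r. (a (s + r * h) - a s) / r) \<longlongrightarrow> deriv (ai i) s * h) (at_right 0)"
proof -
  have D: "((\<lambda>r. ai i (s + r * h)) has_real_derivative deriv (ai i) (s + 0 * h) * h) (at 0)"
    by (rule DERIV_chain2[where g="\<lambda>r. s + r * h", OF ai_deriv[OF assms(1)]]) (auto intro!: derivative_eq_intros)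
  then have "((\<lambda>r. (ai i (s + r * h) - ai i s) / r) \<longlongrightarrow> deriv (ai i) s * h) (at 0)"
    unfolding DERIV_def by simp
  then have "((\<lambda>r. (ai i (s + r * h) - ai i s) / r) \<longlongrightarrow> deriv (ai i) s * h) (at_right 0)"
    by (rule filterlim_mono[OF _ order_refl]) (simp add: at_le)
  then show ?thesis
  proof (rule Lim_transform_eventually)
    show "\<forall>\<^sub>F r in at_right 0. (ai i (s + r * h) - ai i s) / r = (a (s + r * h) - a s) / r"
    proof (rule eventually_at_rightI[of 0 "e / h"])
      fix r assume "r \<in> {0<..<e / h}"
      then have "0 < r * h" "r * h < e" using assms(4) by (auto simp: field_simps)
      then show "(ai i (s + r * h) - ai i s) / r = (a (s + r * h) - a s) / r"
        using assms(2) assms(3)[of s] assms(3)[of "s + r * h"] by simp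
    qed (use assms in auto)
  qed
qed

lemma left_germ_tendsto:
  assumes "i \<le> K" "0 < e" "\<And>r. s - e < r \<Longrightarrow> r \<le> s \<Longrightarrow> a r = ai i r" "h < 0"
  shows "((\<lambda>r. (a (s + r * h) - a s) / r) \<longlongrightarrow> deriv (ai i) s * h) (at_right 0)"
proof -
  have D: "((\<lambda>r. ai i (s + r * h)) has_real_derivative deriv (ai i) (s + 0 * h) * h) (at 0)"
    by (rule DERIV_chain2[where g="\<lambda>r. s + r * h", OF ai_deriv[OF assms(1)]]) (auto intro!: derivative_eq_intros)
  then have "((\<lambda>r. (ai i (s + r * h) - ai i s) / r) \<longlongrightarrow> deriv (ai i) s * h) (at 0)"
    unfolding DERIV_def by simp
  then have "((\<lambda>r. (ai i (s + r * h) - ai i s) / r) \<longlongrightarrow> deriv (ai i) s * h) (at_right 0)"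
    by (rule filterlim_mono[OF _ order_refl]) (simp add: at_le)
  then show ?thesis
  proof (rule Lim_transform_eventually)
    show "\<forall>\<^sub>F r in at_right 0. (ai i (s + r * h) - ai i s) / r = (a (s + r * h) - a s) / r"
    proof (rule eventually_at_rightI[of 0 "e / (- h)"])
      fix r assume "r \<in> {0<..<e / (- h)}"
      then have r: "0 < r" "r * (- h) < e" using assms(4) by (auto simp: field_simps)
      then have "r * h < 0" using assms(4) by (intro mult_pos_neg)
      then show "(ai i (s + r * h) - ai i s) / r = (a (s + r * h) - a s) / r"
        using r assms(2) assms(3)[of s] assms(3)[of "s + r * h"] by simp
    qed (use assms in \<open>auto simp: divide_pos_neg\<close>)
  qed
qed

text \<open>\<open>dir_deriv\<close> is defined through \<open>Lim\<close>, which says nothing until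
  a limit is known to exist; the one-sided germs provide it for either sign of h.\<close>

lemma dir_deriv_tendsto: "((\<lambda>r. (a (s + r * h) - a s) / r) \<longlongrightarrow> dir_deriv a s h) (at_right 0)"
proof -
  have "\<exists>l. ((\<lambda>r. (a (s + r * h) - a s) / r) \<longlongrightarrow> l) (at_right 0)"
  proof -
    consider "0 < h" | "h = 0" | "h < 0" by linarith
    then show ?thesis
    proof cases
      case 1
      obtain i e where "i \<le> K" "0 < e" "\<And>r. s \<le> r \<Longrightarrow> r < s + e \<Longrightarrow> a r = ai i r" using right_piece[of s] by blast
      from right_germ_tendsto[OF this 1] show ?thesis by blast
    next
      case 3
      obtain i e where "i \<le> K" "0 < e" "\<And>r. s - e < r \<Longrightarrow> r \<le> s \<Longrightarrow> a r = ai i r" using left_piece[of s] by blast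
      from left_germ_tendsto[OF this 3] show ?thesis by blast
    qed (auto intro: tendsto_const)
  qed
  then obtain l where l: "((\<lambda>r. (a (s + r * h) - a s) / r) \<longlongrightarrow> l) (at_right 0)" by blast
  then have "dir_deriv a s h = l" unfolding dir_deriv_def by (intro tendsto_Lim) auto
  then show ?thesis using l by simp
qed

text \<open>Countably many step sizes exhibit the directional derivative as a limit of continuous
  functions of s and h, whence its measurability.\<close>

lemma dir_deriv_sequence: "(\<lambda>n. (a (s + (1 / real (Suc n)) * h) - a s) / (1 / real (Suc n))) \<longlonglongrightarrow> dir_deriv a s h"
proof (rule filterlim_compose[OF dir_deriv_tendsto])
  show "filterlim (\<lambda>n. 1 / real (Suc n)) (at_right 0) sequentially"
    unfolding filterlim_at using LIMSEQ_Suc[OF lim_1_over_n] by auto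
qed

lemma a_measurable [measurable]: "a \<in> borel_measurable borel"
  by (rule borel_measurable_continuous_onI[OF a_continuous])

lemma dir_deriv_measurable [measurable (raw)]:
  assumes [measurable]: "f \<in> borel_measurable M" "g \<in> borel_measurable M"
  shows "(\<lambda>x. dir_deriv a (f x) (g x)) \<in> borel_measurable M"
  by (rule borel_measurable_LIMSEQ_real[OF dir_deriv_sequence]) measurable

text \<open>The substitution of r c for r in the limit from the right, which needs c > 0; at a kink
  the slopes in opposite directions differ.\<close>

lemma dir_deriv_scale:
  assumes "0 < c"
  shows "dir_deriv a s (c * h) = c * dir_deriv a s h"
proof -
  have "filterlim (\<lambda>r. r * c) (at_right 0) (at_right 0)"
    unfolding filterlim_at
  proof
    show "((\<lambda>r. r * c) \<longlongrightarrow> 0) (at_right 0)" by (auto intro!: tendsto_eq_intros)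
    show "\<forall>\<^sub>F r in at_right 0. r * c \<in> {0<..} \<and> r * c \<noteq> 0"
      by (rule eventually_at_rightI[of 0 1]) (use assms in auto)
  qed
  from filterlim_compose[OF dir_deriv_tendsto[of s h] this]
  have "((\<lambda>r. c * ((a (s + r * c * h) - a s) / (r * c))) \<longlongrightarrow> c * dir_deriv a s h) (at_right 0)"
    by (rule tendsto_mult_left)
  moreover have "(\<lambda>r. c * ((a (s + r * c * h) - a s) / (r * c))) = (\<lambda>r. (a (s + r * (c * h)) - a s) / r)"
    using assms by (auto simp: fun_eq_iff mult.assoc)
  ultimately have "((\<lambda>r. (a (s + r * (c * h)) - a s) / r) \<longlongrightarrow> c * dir_deriv a s h) (at_right 0)" by simp
  from tendsto_unique[OF _ dir_deriv_tendsto this] show ?thesis by simp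
qed

lemma dir_deriv_0 [simp]: "dir_deriv a s 0 = 0"
proof -
  have "((\<lambda>r. (a (s + r * 0) - a s) / r) \<longlongrightarrow> 0) (at_right 0)" by simp
  from tendsto_unique[OF _ dir_deriv_tendsto this] show ?thesis by simp
qed

text \<open>Each piece has a bounded derivative on a bounded interval, and Lipschitz bounds on
  finitely many closed sets covering an interval glue together. The sum of the individual constants
  serves as a common one.\<close>

lemma a_lipschitz: "\<exists>L\<ge>0. L-lipschitz_on {- R..R} a"
proof -
  have "\<exists>B. \<forall>s\<in>{- R..R}. \<bar>deriv (ai i) s\<bar> \<le> B" if "i \<le> K" for i
  proof -
    have "compact (deriv (ai i) ` {- R..R})" by (intro compact_continuous_image ai_deriv_cont that) auto
    then show ?thesis using compact_imp_bounded bounded_iff by (metis imageI real_norm_def)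
  qed
  then obtain B where B: "\<And>i s. i \<le> K \<Longrightarrow> s \<in> {- R..R} \<Longrightarrow> \<bar>deriv (ai i) s\<bar> \<le> B i" by metis
  define L where "L = (\<Sum>i\<le>K. \<bar>B i\<bar>)"
  have L: "0 \<le> L" "i \<le> K \<Longrightarrow> B i \<le> L" for i
  proof -
    show "0 \<le> L" unfolding L_def by (intro sum_nonneg) auto
    show "B i \<le> L" if "i \<le> K"
    proof -
      have "\<bar>B i\<bar> \<le> L" unfolding L_def using that by (intro member_le_sum) auto
      then show ?thesis by linarith
    qed
  qed
  define U where "U i = {- R..R} \<inter> {s. (1 \<le> i \<longrightarrow> t i \<le> s) \<and> (i < K \<longrightarrow> s \<le> t (i + 1))}" for i
  have "L-lipschitz_on {- R..R} a"
  proof (rule lipschitz_on_closed_Union[of "{..K}" L U])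
    fix i assume "i \<in> {..K}"
    then have i: "i \<le> K" by simp
    show "closed (U i)"
    proof -
      have "U i = {- R..R} \<inter> (if 1 \<le> i then {t i..} else UNIV) \<inter> (if i < K then {..t (i + 1)} else UNIV)"
        by (auto simp: U_def)
      then show ?thesis by (auto intro!: closed_Int)
    qed
    show "L-lipschitz_on (U i) a"
    proof (rule lipschitz_onI[OF _ L(1)])
      fix x y assume x: "x \<in> U i" and y: "y \<in> U i"
      have "norm (ai i x - ai i y) \<le> L * norm (x - y)"
      proof (rule field_differentiable_bound[where S="{- R..R}" and f'="deriv (ai i)"])
        show "(ai i has_field_derivative deriv (ai i) z) (at z within {- R..R})" for z
          using ai_deriv[OF i] by (rule has_field_derivative_at_within)
        show "norm (deriv (ai i) z) \<le> L" if "z \<in> {- R..R}" for z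
          using B[OF i that] L(2)[OF i] by simp
      qed (use x y in \<open>auto simp: U_def\<close>)
      moreover have "a x = ai i x" "a y = ai i y"
        using x y by (auto intro!: a_eq_closed_piece[OF i] simp: U_def)
      ultimately show "dist (a x) (a y) \<le> L * dist x y" by (simp add: dist_norm)
    qed
  next
    show "{- R..R} \<subseteq> (\<Union>i\<in>{..K}. U i)"
    proof
      fix s assume s: "s \<in> {- R..R}"
      obtain i where i: "i \<le> K" "\<And>j. j \<le> K \<Longrightarrow> s \<in> piece K t j \<longleftrightarrow> j = i" using piece_index[of s] by blast
      then have "s \<in> piece K t i" by blast
      then have "s \<in> U i" using s by (auto simp: U_def piece_def)
      then show "s \<in> (\<Union>i\<in>{..K}. U i)" using i(1) by blast
    qed
  qed (use L in auto)
  then show ?thesis using L(1) by blast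
qed

text \<open>Difference quotients in two directions differ by at most L times the distance of the
  directions, and so do their limits. The margin 1 around [-R, R] leaves room for the increments r
  h.\<close>

lemma dir_deriv_lipschitz:
  assumes L: "L-lipschitz_on {- (R + 1)..R + 1} a" and s: "\<bar>s\<bar> \<le> R"
  shows "\<bar>dir_deriv a s h1 - dir_deriv a s h2\<bar> \<le> L * \<bar>h1 - h2\<bar>"
proof -
  have "((\<lambda>r. \<bar>(a (s + r * h1) - a s) / r - (a (s + r * h2) - a s) / r\<bar>) \<longlongrightarrow> \<bar>dir_deriv a s h1 - dir_deriv a s h2\<bar>) (at_right 0)"
    by (intro tendsto_intros dir_deriv_tendsto)
  moreover have "\<forall>\<^sub>F r in at_right 0. \<bar>(a (s + r * h1) - a s) / r - (a (s + r * h2) - a s) / r\<bar> \<le> L * \<bar>h1 - h2\<bar>"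
  proof (rule eventually_at_rightI[of 0 "1 / (\<bar>h1\<bar> + \<bar>h2\<bar> + 1)"])
    fix r assume r: "r \<in> {0<..<1 / (\<bar>h1\<bar> + \<bar>h2\<bar> + 1)}"
    then have r0: "0 < r" and r1: "r * (\<bar>h1\<bar> + \<bar>h2\<bar> + 1) < 1" by (auto simp: field_simps)
    have "\<bar>r * h1\<bar> \<le> 1" "\<bar>r * h2\<bar> \<le> 1"
    proof -
      have "\<bar>r * h1\<bar> \<le> r * (\<bar>h1\<bar> + \<bar>h2\<bar> + 1)" "\<bar>r * h2\<bar> \<le> r * (\<bar>h1\<bar> + \<bar>h2\<bar> + 1)"
        using r0 by (auto simp: abs_mult intro!: mult_left_mono)
      then show "\<bar>r * h1\<bar> \<le> 1" "\<bar>r * h2\<bar> \<le> 1" using r1 by linarith+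
    qed
    then have "s + r * h1 \<in> {- (R + 1)..R + 1}" "s + r * h2 \<in> {- (R + 1)..R + 1}" using s by (auto simp: abs_le_iff)
    then have "\<bar>a (s + r * h1) - a (s + r * h2)\<bar> \<le> L * \<bar>(s + r * h1) - (s + r * h2)\<bar>"
      using lipschitz_onD[OF L, of "s + r * h1" "s + r * h2"] by (simp add: dist_real_def)
    also have "\<bar>(s + r * h1) - (s + r * h2)\<bar> = r * \<bar>h1 - h2\<bar>"
    proof -
      have "(s + r * h1) - (s + r * h2) = r * (h1 - h2)" by (simp add: algebra_simps)
      then show ?thesis using r0 by (simp add: abs_mult)
    qed
    finally have "\<bar>a (s + r * h1) - a (s + r * h2)\<bar> / r \<le> L * \<bar>h1 - h2\<bar>" using r0 by (simp add: field_simps)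
    moreover have "(a (s + r * h1) - a s) / r - (a (s + r * h2) - a s) / r = (a (s + r * h1) - a (s + r * h2)) / r"
      by (simp add: diff_divide_distrib)
    ultimately show "\<bar>(a (s + r * h1) - a s) / r - (a (s + r * h2) - a s) / r\<bar> \<le> L * \<bar>h1 - h2\<bar>"
      using r0 by (simp add: abs_divide)
  qed (simp add: add_nonneg_pos)
  ultimately show ?thesis by (intro tendsto_upperbound) auto
qed

section \<open>Measurability and bounds of the second derivative\<close>

lemma piece_borel [measurable]: "piece K t i \<in> sets borel"
proof -
  have "piece K t i = (if 1 \<le> i then {t i<..} else UNIV) \<inter> (if i < K then {..t (i + 1)} else UNIV)"
    by (auto simp: piece_def)
  then show ?thesis by auto
qed

lemma kinks_borel [measurable]: "kinks K t \<in> sets borel"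
  by (intro borel_closed finite_imp_closed) (auto simp: kinks_def)

text \<open>Off the kinks \<open>a\<close> coincides with a single piece on an open neighbourhood,
  so the derivatives agree. The explicit formula is what makes measurability and local boundedness
  accessible.\<close>

lemma D2_eq: "D2 K t a s = (if s \<in> kinks K t then 0 else (\<Sum>j\<le>K. indicator (piece K t j) s * deriv (deriv (ai j)) s))"
proof (cases "s \<in> kinks K t")
  case False
  obtain i where i: "i \<le> K" "\<And>j. j \<le> K \<Longrightarrow> s \<in> piece K t j \<longleftrightarrow> j = i" using piece_index[of s] by blast
  then have "s \<in> piece K t i" by blast
  then have s: "1 \<le> i \<Longrightarrow> t i < s" "i < K \<Longrightarrow> s \<le> t (i + 1)" "s \<in> piece K t i" by (auto simp: piece_def)
  have "i < K \<Longrightarrow> s \<noteq> t (i + 1)" using False by (auto simp: kinks_def)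
  with s have s': "i < K \<Longrightarrow> s < t (i + 1)" by force
  let ?O = "(if 1 \<le> i then {t i<..} else UNIV) \<inter> (if i < K then {..<t (i + 1)} else UNIV)"
  have O: "open ?O" "s \<in> ?O" using s s' by auto
  have eq: "a r = ai i r" if "r \<in> ?O" for r
    by (rule a_eq_closed_piece[OF i(1)]) (use that in \<open>auto split: if_splits\<close>)
  have deq: "deriv a r = deriv (ai i) r" if r: "r \<in> ?O" for r
    by (rule deriv_cong_ev) (use eventually_nhds_in_open[OF O(1) r] eq in \<open>auto elim!: eventually_mono simp del: Int_iff\<close>)
  have "deriv (deriv a) s = deriv (deriv (ai i)) s"
    by (rule deriv_cong_ev) (use eventually_nhds_in_open[OF O] deq in \<open>auto elim!: eventually_mono simp del: Int_iff\<close>)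
  then show ?thesis using False sum_piece[OF i(1) s(3)] by (simp add: D2_def)
qed (simp add: D2_def)

lemma D2_measurable [measurable]: "D2 K t a \<in> borel_measurable borel"
proof -
  have [measurable]: "deriv (deriv (ai j)) \<in> borel_measurable borel" if "j \<le> K" for j
    by (rule borel_measurable_continuous_onI[OF ai_deriv2_cont[OF that]])
  have "(\<lambda>s. if s \<in> kinks K t then 0 else (\<Sum>j\<le>K. indicator (piece K t j) s * deriv (deriv (ai j)) s)) \<in> borel_measurable borel"
    by (intro measurable_If borel_measurable_sum borel_measurable_times) auto
  then show ?thesis using D2_eq by (subst measurable_cong) auto
qed

lemma D2_bounded: "\<exists>B\<ge>0. \<forall>s. \<bar>s\<bar> \<le> R \<longrightarrow> \<bar>D2 K t a s\<bar> \<le> B"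
proof -
  have "\<exists>B. \<forall>s\<in>{- R..R}. \<bar>deriv (deriv (ai i)) s\<bar> \<le> B" if "i \<le> K" for i
  proof -
    have "compact (deriv (deriv (ai i)) ` {- R..R})" by (intro compact_continuous_image ai_deriv2_cont that) auto
    then show ?thesis using compact_imp_bounded bounded_iff by (metis imageI real_norm_def)
  qed
  then obtain B where B: "\<And>i s. i \<le> K \<Longrightarrow> s \<in> {- R..R} \<Longrightarrow> \<bar>deriv (deriv (ai i)) s\<bar> \<le> B i" by metis
  show ?thesis
  proof (intro exI[of _ "\<Sum>i\<le>K. \<bar>B i\<bar>"] conjI allI impI)
    show "0 \<le> (\<Sum>i\<le>K. \<bar>B i\<bar>)" by (intro sum_nonneg) auto
    fix s assume "\<bar>s\<bar> \<le> R"
    then have s: "s \<in> {- R..R}" by (auto simp: abs_le_iff)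
    have "\<bar>\<Sum>j\<le>K. indicator (piece K t j) s * deriv (deriv (ai j)) s\<bar> \<le> (\<Sum>j\<le>K. \<bar>indicator (piece K t j) s * deriv (deriv (ai j)) s\<bar>)"
      by (rule sum_abs)
    also have "\<dots> \<le> (\<Sum>i\<le>K. \<bar>B i\<bar>)"
    proof (rule sum_mono)
      fix i assume "i \<in> {..K}"
      then have "\<bar>deriv (deriv (ai i)) s\<bar> \<le> B i" using B s by auto
      then show "\<bar>indicator (piece K t i) s * deriv (deriv (ai i)) s\<bar> \<le> \<bar>B i\<bar>"
        by (auto simp: indicator_def)
    qed
    finally show "\<bar>D2 K t a s\<bar> \<le> (\<Sum>i\<le>K. \<bar>B i\<bar>)"
      unfolding D2_eq by (auto intro: sum_nonneg)
  qed
qed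

section \<open>Dependence of the kink correction on the perturbed state\<close>

lemma jump_nonneg: "0 \<le> jump t ai i" by (simp add: jump_def)

text \<open>The jump-weighted indicator of punctured r-neighbourhoods of the kinks, that is, the
  weight of the gradient in \<open>jump_functional\<close> at scale r.\<close>

definition near_kinks :: "real \<Rightarrow> real \<Rightarrow> real"
  where "near_kinks r y = (\<Sum>i=1..K. jump t ai i * indicator {y. 0 < \<bar>y - t i\<bar> \<and> \<bar>y - t i\<bar> \<le> r} y)"

text \<open>While the perturbed values stay within r < \<delta> of y, the window bound \<tau> -
  \<delta> never binds, so the expression is the ramp c max(\<tau> - y', 0) and has no jump. It can
  be nonzero only if y is within r of \<tau> but different from it.\<close>

lemma truncated_ramp_lipschitz:
  fixes c y y1 y2 \<tau> r \<delta> :: real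
  assumes "\<bar>y1 - y\<bar> \<le> r" "\<bar>y2 - y\<bar> \<le> r" "r < \<delta>"
  shows "\<bar>(if y \<in> {\<tau><..<\<tau> + \<delta>} \<and> y1 \<in> {\<tau> - \<delta><..\<tau>} then c * (\<tau> - y1) else 0) -
      (if y \<in> {\<tau><..<\<tau> + \<delta>} \<and> y2 \<in> {\<tau> - \<delta><..\<tau>} then c * (\<tau> - y2) else 0)\<bar>
    \<le> \<bar>c\<bar> * indicator {y. 0 < \<bar>y - \<tau>\<bar> \<and> \<bar>y - \<tau>\<bar> \<le> r} y * \<bar>y1 - y2\<bar>"
proof (cases "y \<in> {\<tau><..<\<tau> + \<delta>} \<and> (y1 \<le> \<tau> \<or> y2 \<le> \<tau>)")
  case False
  then show ?thesis by auto
next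
  case True
  have mem: "y1 \<in> {\<tau> - \<delta><..\<tau>} \<longleftrightarrow> y1 \<le> \<tau>" "y2 \<in> {\<tau> - \<delta><..\<tau>} \<longleftrightarrow> y2 \<le> \<tau>"
    using True assms by auto
  have ind: "indicator {y. 0 < \<bar>y - \<tau>\<bar> \<and> \<bar>y - \<tau>\<bar> \<le> r} y = (1 :: real)"
    using True assms by (auto simp: indicator_def)
  have e: "(if y \<in> {\<tau><..<\<tau> + \<delta>} \<and> y' \<le> \<tau> then c * (\<tau> - y') else 0) = c * max (\<tau> - y') 0" for y'
    using True by (auto simp: max_def)
  have "c * max (\<tau> - y1) 0 - c * max (\<tau> - y2) 0 = c * (max (\<tau> - y1) 0 - max (\<tau> - y2) 0)"
    by (simp add: right_diff_distrib)
  moreover have "\<bar>max (\<tau> - y1) 0 - max (\<tau> - y2) 0\<bar> \<le> \<bar>y1 - y2\<bar>" by (auto simp: max_def)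
  ultimately show ?thesis unfolding mem e ind by (simp add: abs_mult mult_left_mono)
qed

lemma truncated_ramp_lipschitz':
  fixes c y y1 y2 \<tau> r \<delta> :: real
  assumes "\<bar>y1 - y\<bar> \<le> r" "\<bar>y2 - y\<bar> \<le> r" "r < \<delta>"
  shows "\<bar>(if y \<in> {\<tau> - \<delta><..<\<tau>} \<and> y1 \<in> {\<tau>..<\<tau> + \<delta>} then c * (\<tau> - y1) else 0) -
      (if y \<in> {\<tau> - \<delta><..<\<tau>} \<and> y2 \<in> {\<tau>..<\<tau> + \<delta>} then c * (\<tau> - y2) else 0)\<bar>
    \<le> \<bar>c\<bar> * indicator {y. 0 < \<bar>y - \<tau>\<bar> \<and> \<bar>y - \<tau>\<bar> \<le> r} y * \<bar>y1 - y2\<bar>"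
proof (cases "y \<in> {\<tau> - \<delta><..<\<tau>} \<and> (\<tau> \<le> y1 \<or> \<tau> \<le> y2)")
  case False
  then show ?thesis by auto
next
  case True
  have mem: "y1 \<in> {\<tau>..<\<tau> + \<delta>} \<longleftrightarrow> \<tau> \<le> y1" "y2 \<in> {\<tau>..<\<tau> + \<delta>} \<longleftrightarrow> \<tau> \<le> y2"
    using True assms by auto
  have ind: "indicator {y. 0 < \<bar>y - \<tau>\<bar> \<and> \<bar>y - \<tau>\<bar> \<le> r} y = (1 :: real)"
    using True assms by (auto simp: indicator_def)
  have e: "(if y \<in> {\<tau> - \<delta><..<\<tau>} \<and> \<tau> \<le> y' then c * (\<tau> - y') else 0) = c * min (\<tau> - y') 0" for y'
    using True by (auto simp: min_def)
  have "c * min (\<tau> - y1) 0 - c * min (\<tau> - y2) 0 = c * (min (\<tau> - y1) 0 - min (\<tau> - y2) 0)"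
    by (simp add: right_diff_distrib)
  moreover have "\<bar>min (\<tau> - y1) 0 - min (\<tau> - y2) 0\<bar> \<le> \<bar>y1 - y2\<bar>" by (auto simp: min_def)
  ultimately show ?thesis unfolding mem e ind by (simp add: abs_mult mult_left_mono)
qed

text \<open>Each kink is met twice, in the first term of \<open>zeta\<close> for the piece on its
  right and in the second term for the piece on its left; this is the factor 2.\<close>

lemma sum_zeta_lipschitz:
  assumes "\<bar>y1 - y\<bar> \<le> r" "\<bar>y2 - y\<bar> \<le> r" "r < \<delta>"
  shows "\<bar>(\<Sum>i\<le>K. zeta K t ai \<delta> i y y1) - (\<Sum>i\<le>K. zeta K t ai \<delta> i y y2)\<bar> \<le> 2 * near_kinks r y * \<bar>y1 - y2\<bar>"
proof -
  let ?J = "\<lambda>i. jump t ai i * indicator {y. 0 < \<bar>y - t i\<bar> \<and> \<bar>y - t i\<bar> \<le> r} y"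
  define A where "A i y' = (if 1 \<le> i \<and> y \<in> {t i<..<t i + \<delta>} \<and> y' \<in> {t i - \<delta><..t i}
      then (deriv (ai (i - 1)) (t i) - deriv (ai i) (t i)) * (t i - y') else 0)" for i y'
  define B where "B i y' = (if i < K \<and> y \<in> {t (i + 1) - \<delta><..<t (i + 1)} \<and> y' \<in> {t (i + 1)..<t (i + 1) + \<delta>}
      then (deriv (ai (i + 1)) (t (i + 1)) - deriv (ai i) (t (i + 1))) * (t (i + 1) - y') else 0)" for i y'
  have z: "zeta K t ai \<delta> i y y' = A i y' + B i y'" for i y' by (simp add: zeta_def A_def B_def)
  have A: "\<bar>A i y1 - A i y2\<bar> \<le> (if 1 \<le> i then ?J i * \<bar>y1 - y2\<bar> else 0)" for i
    using truncated_ramp_lipschitz[OF assms, of "t i" "deriv (ai (i - 1)) (t i) - deriv (ai i) (t i)"]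
    by (cases "1 \<le> i") (simp_all add: A_def jump_def)
  have B: "\<bar>B i y1 - B i y2\<bar> \<le> (if i < K then ?J (i + 1) * \<bar>y1 - y2\<bar> else 0)" for i
    using truncated_ramp_lipschitz'[OF assms, of "t (i + 1)" "deriv (ai (i + 1)) (t (i + 1)) - deriv (ai i) (t (i + 1))"]
    by (cases "i < K") (simp_all add: B_def jump_def abs_minus_commute)
  have "\<bar>(\<Sum>i\<le>K. zeta K t ai \<delta> i y y1) - (\<Sum>i\<le>K. zeta K t ai \<delta> i y y2)\<bar> =
      \<bar>\<Sum>i\<le>K. (A i y1 - A i y2) + (B i y1 - B i y2)\<bar>"
    unfolding z by (simp add: sum_subtractf[symmetric] algebra_simps)
  also have "\<dots> \<le> (\<Sum>i\<le>K. \<bar>(A i y1 - A i y2) + (B i y1 - B i y2)\<bar>)" by (rule sum_abs)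
  also have "\<dots> \<le> (\<Sum>i\<le>K. (if 1 \<le> i then ?J i * \<bar>y1 - y2\<bar> else 0) + (if i < K then ?J (i + 1) * \<bar>y1 - y2\<bar> else 0))"
  proof (rule sum_mono)
    fix i
    show "\<bar>(A i y1 - A i y2) + (B i y1 - B i y2)\<bar> \<le>
      (if 1 \<le> i then ?J i * \<bar>y1 - y2\<bar> else 0) + (if i < K then ?J (i + 1) * \<bar>y1 - y2\<bar> else 0)"
      using abs_triangle_ineq[of "A i y1 - A i y2" "B i y1 - B i y2"] add_mono[OF A[of i] B[of i]] by (rule order_trans)
  qed
  also have "\<dots> = (\<Sum>i\<le>K. if 1 \<le> i then ?J i * \<bar>y1 - y2\<bar> else 0) + (\<Sum>i\<le>K. if i < K then ?J (i + 1) * \<bar>y1 - y2\<bar> else 0)"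
    by (rule sum.distrib)
  also have "(\<Sum>i\<le>K. if 1 \<le> i then ?J i * \<bar>y1 - y2\<bar> else 0) = (\<Sum>i=1..K. ?J i * \<bar>y1 - y2\<bar>)"
    by (intro sum.mono_neutral_cong_right) auto
  also have "(\<Sum>i\<le>K. if i < K then ?J (i + 1) * \<bar>y1 - y2\<bar> else 0) = (\<Sum>i\<in>{..<K}. ?J (i + 1) * \<bar>y1 - y2\<bar>)"
    by (intro sum.mono_neutral_cong_right) auto
  also have "\<dots> = (\<Sum>i=1..K. ?J i * \<bar>y1 - y2\<bar>)"
    by (rule sum.reindex_bij_witness[of _ "\<lambda>i. i - 1" "\<lambda>i. i + 1"]) auto
  also have "(\<Sum>i=1..K. ?J i * \<bar>y1 - y2\<bar>) + (\<Sum>i=1..K. ?J i * \<bar>y1 - y2\<bar>) = 2 * near_kinks r y * \<bar>y1 - y2\<bar>"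
    unfolding near_kinks_def by (simp add: sum_distrib_right[symmetric])
  finally show ?thesis .
qed

lemma zeta_measurable [measurable (raw)]:
  assumes [measurable]: "f \<in> borel_measurable M" "g \<in> borel_measurable M"
  shows "(\<lambda>x. zeta K t ai \<delta> i (f x) (g x)) \<in> borel_measurable M"
  unfolding zeta_def by measurable

lemma zeta_bounded: "\<exists>B\<ge>0. \<forall>y y'. \<bar>zeta K t ai \<delta> i y y'\<bar> \<le> B"
proof -
  let ?c = "\<bar>deriv (ai (i - 1)) (t i) - deriv (ai i) (t i)\<bar>" and ?d = "\<bar>deriv (ai (i + 1)) (t (i + 1)) - deriv (ai i) (t (i + 1))\<bar>"
  show ?thesis
  proof (intro exI[of _ "?c * \<bar>\<delta>\<bar> + ?d * \<bar>\<delta>\<bar>"] conjI allI)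
    fix y y'

    have "\<bar>(if 1 \<le> i \<and> y \<in> {t i<..<t i + \<delta>} \<and> y' \<in> {t i - \<delta><..t i}
      then (deriv (ai (i - 1)) (t i) - deriv (ai i) (t i)) * (t i - y') else 0)\<bar> \<le> ?c * \<bar>\<delta>\<bar>"
      by (auto simp: abs_mult intro!: mult_left_mono)
    moreover have "\<bar>(if i < K \<and> y \<in> {t (i + 1) - \<delta><..<t (i + 1)} \<and> y' \<in> {t (i + 1)..<t (i + 1) + \<delta>}
      then (deriv (ai (i + 1)) (t (i + 1)) - deriv (ai i) (t (i + 1))) * (t (i + 1) - y') else 0)\<bar> \<le> ?d * \<bar>\<delta>\<bar>"
      by (auto simp: abs_mult intro!: mult_left_mono)
    ultimately show "\<bar>zeta K t ai \<delta> i y y'\<bar> \<le> ?c * \<bar>\<delta>\<bar> + ?d * \<bar>\<delta>\<bar>"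
      unfolding zeta_def by (intro order_trans[OF abs_triangle_ineq] add_mono)
  qed simp
qed

end

section \<open>Dual spaces\<close>

text \<open>On the real line the absolute value separates points, so linearity up to seminorm zero
  is genuine linearity.\<close>

lemma dual_space_iff:
  "F \<in> dual_space X nX \<longleftrightarrow> (\<forall>x\<in>X. \<forall>z\<in>X. F (x + z) = F x + F z) \<and>
     (\<forall>c. \<forall>x\<in>X. F (c *\<^sub>R x) = c * F x) \<and> (\<exists>C. \<forall>x\<in>X. \<bar>F x\<bar> \<le> C * nX x)"
proof -
  have "\<bar>u - v - w\<bar> = 0 \<longleftrightarrow> u = v + w" for u v w :: real by auto
  then show ?thesis by (simp add: dual_space_def bounded_linear_btw_def)
qed

text \<open>The constant 4 dispenses with Minkowski's inequality for the Sobolev norms.\<close>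

locale quasi_normed =
  fixes X :: "'a::real_vector set" and nX :: "'a \<Rightarrow> real"
  assumes zero: "0 \<in> X"
    and add: "x \<in> X \<Longrightarrow> y \<in> X \<Longrightarrow> x + y \<in> X"
    and scale: "x \<in> X \<Longrightarrow> c *\<^sub>R x \<in> X"
    and nonneg: "0 \<le> nX x"
    and hom: "x \<in> X \<Longrightarrow> nX (c *\<^sub>R x) = \<bar>c\<bar> * nX x"
    and tri: "x \<in> X \<Longrightarrow> y \<in> X \<Longrightarrow> nX (x + y) \<le> 4 * (nX x + nX y)"
begin

lemma diff: "x \<in> X \<Longrightarrow> y \<in> X \<Longrightarrow> x - y \<in> X"
  using add[of x "(-1) *\<^sub>R y"] scale[of y "-1"] by simp

lemma norm_zero: "nX 0 = 0"
  using hom[OF zero, of 0] by simp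

lemma dual_norm_le:
  assumes "\<And>w. w \<in> X \<Longrightarrow> nX w \<le> 1 \<Longrightarrow> \<bar>F w\<bar> \<le> c"
  shows "dual_norm X nX F \<le> c"
  unfolding dual_norm_def op_norm_def by (rule cSUP_least) (use assms zero norm_zero in force)+

lemma dual_bdd:
  assumes "\<And>x. x \<in> X \<Longrightarrow> \<bar>F x\<bar> \<le> C * nX x"
  shows "bdd_above ((\<lambda>w. \<bar>F w\<bar>) ` {w \<in> X. nX w \<le> 1})"
proof (rule bdd_aboveI)
  fix r assume "r \<in> (\<lambda>w. \<bar>F w\<bar>) ` {w \<in> X. nX w \<le> 1}"
  then obtain w where w: "r = \<bar>F w\<bar>" "w \<in> X" "nX w \<le> 1" by auto
  have "C * nX w \<le> \<bar>C\<bar> * 1" using w(3) nonneg[of w] by (intro mult_mono) auto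
  then show "r \<le> \<bar>C\<bar>" using assms[OF w(2)] w(1) by simp
qed

text \<open>Homogeneity reduces to the unit ball, except at norm zero, where boundedness of F forces
  the value zero.\<close>

lemma dual_bound:
  assumes F: "F \<in> dual_space X nX" and w: "w \<in> X"
  shows "\<bar>F w\<bar> \<le> dual_norm X nX F * nX w"
proof -
  obtain C where C: "\<And>x. x \<in> X \<Longrightarrow> \<bar>F x\<bar> \<le> C * nX x" using F unfolding dual_space_iff by blast
  show ?thesis
  proof (cases "nX w = 0")
    case True
    then show ?thesis using C[OF w] by simp
  next
    case False
    then have n: "0 < nX w" using nonneg[of w] by simp
    let ?v = "(1 / nX w) *\<^sub>R w"
    have v: "?v \<in> X" "nX ?v \<le> 1" using scale[OF w] hom[OF w] n by auto
    have "\<bar>F ?v\<bar> \<le> dual_norm X nX F"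
      unfolding dual_norm_def op_norm_def by (rule cSUP_upper) (use v dual_bdd[OF C] in auto)
    moreover have "F ?v = F w / nX w" using F w by (simp add: dual_space_iff)
    ultimately show ?thesis using n by (simp add: abs_divide field_simps)
  qed
qed

lemma dual_norm_nonneg: "F \<in> dual_space X nX \<Longrightarrow> 0 \<le> dual_norm X nX F"
proof -
  assume F: "F \<in> dual_space X nX"
  obtain C where C: "\<And>x. x \<in> X \<Longrightarrow> \<bar>F x\<bar> \<le> C * nX x" using F unfolding dual_space_iff by blast
  have "\<bar>F 0\<bar> \<le> dual_norm X nX F"
    unfolding dual_norm_def op_norm_def by (rule cSUP_upper) (use zero norm_zero dual_bdd[OF C] in auto)
  then show ?thesis by linarith
qed

lemma dual_add: "F \<in> dual_space X nX \<Longrightarrow> H \<in> dual_space X nX \<Longrightarrow> F + H \<in> dual_space X nX"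
proof -
  assume F: "F \<in> dual_space X nX" and H: "H \<in> dual_space X nX"
  obtain C D where "\<And>x. x \<in> X \<Longrightarrow> \<bar>F x\<bar> \<le> C * nX x" "\<And>x. x \<in> X \<Longrightarrow> \<bar>H x\<bar> \<le> D * nX x"
    using F H unfolding dual_space_iff by blast
  then have "\<bar>F x + H x\<bar> \<le> (C + D) * nX x" if "x \<in> X" for x
    using that abs_triangle_ineq[of "F x" "H x"] by (fastforce simp: distrib_right)
  then show ?thesis using F H unfolding dual_space_iff by (auto simp: distrib_left)
qed

lemma dual_scale: "F \<in> dual_space X nX \<Longrightarrow> c *\<^sub>R F \<in> dual_space X nX"
proof -
  assume F: "F \<in> dual_space X nX"
  obtain C where C: "\<And>x. x \<in> X \<Longrightarrow> \<bar>F x\<bar> \<le> C * nX x" using F unfolding dual_space_iff by blast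
  have "\<bar>c * F x\<bar> \<le> (\<bar>c\<bar> * C) * nX x" if "x \<in> X" for x
    using mult_left_mono[OF C[OF that], of "\<bar>c\<bar>"] by (simp add: abs_mult mult.assoc)
  then show ?thesis using F unfolding dual_space_iff by (auto simp: distrib_left scaleR_fun_def)
qed

lemma dual_diff: "F \<in> dual_space X nX \<Longrightarrow> H \<in> dual_space X nX \<Longrightarrow> F - H \<in> dual_space X nX"
  using dual_add[of F "(-1) *\<^sub>R H"] dual_scale[of H "-1"] by simp

lemma dual_norm_eq_0D:
  "F \<in> dual_space X nX \<Longrightarrow> dual_norm X nX F = 0 \<Longrightarrow> w \<in> X \<Longrightarrow> F w = 0"
  using dual_bound[of F w] by simp

lemma dual_norm_eq_0I:
  assumes "F \<in> dual_space X nX" "\<And>w. w \<in> X \<Longrightarrow> F w = 0"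
  shows "dual_norm X nX F = 0"
  using dual_norm_le[of F 0] dual_norm_nonneg[OF assms(1)] assms(2) by force

text \<open>Additivity holds only up to elements of norm zero, so D x - D z is split into such an
  element and D (x - z); the quasi-triangle inequality costs the factor 4. The absolute value is
  there because \<open>nZ\<close> is an arbitrary function.\<close>

lemma bounded_linear_diff:
  assumes D: "bounded_linear_btw Z nZ X nX D" and Z: "\<And>x z. x \<in> Z \<Longrightarrow> z \<in> Z \<Longrightarrow> x - z \<in> Z"
  obtains C where "0 < C" "\<And>x z. x \<in> Z \<Longrightarrow> z \<in> Z \<Longrightarrow> nX (D x - D z) \<le> C * \<bar>nZ (x - z)\<bar>"
proof -
  obtain C where C: "\<And>x. x \<in> Z \<Longrightarrow> nX (D x) \<le> C * nZ x" using D unfolding bounded_linear_btw_def by blast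
  show thesis
  proof (rule that[of "4 * (\<bar>C\<bar> + 1)"])
    fix x z assume x: "x \<in> Z" and z: "z \<in> Z"
    have xz: "x - z \<in> Z" by (rule Z[OF x z])
    have DX: "D x \<in> X" "D z \<in> X" "D (x - z) \<in> X" using D x z xz by (auto simp: bounded_linear_btw_def)
    have "nX (D ((x - z) + z) - D (x - z) - D z) = 0" using D xz z unfolding bounded_linear_btw_def by blast
    then have 0: "nX (D x - D (x - z) - D z) = 0" by simp
    have "D x - D z = (D x - D (x - z) - D z) + D (x - z)" by simp
    then have a: "nX (D x - D z) \<le> 4 * nX (D (x - z))"
      using tri[OF diff[OF diff[OF DX(1,3)] DX(2)] DX(3)] 0 by simp
    have "nX (D (x - z)) \<le> (\<bar>C\<bar> + 1) * \<bar>nZ (x - z)\<bar>"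
    proof -
      have "C * nZ (x - z) \<le> \<bar>C * nZ (x - z)\<bar>" by simp
      also have "\<dots> \<le> (\<bar>C\<bar> + 1) * \<bar>nZ (x - z)\<bar>" unfolding abs_mult by (intro mult_right_mono) auto
      finally show ?thesis using C[OF xz] by linarith
    qed
    then have "4 * nX (D (x - z)) \<le> 4 * ((\<bar>C\<bar> + 1) * \<bar>nZ (x - z)\<bar>)" by (rule mult_left_mono) simp
    then show "nX (D x - D z) \<le> 4 * (\<bar>C\<bar> + 1) * \<bar>nZ (x - z)\<bar>" using a by (simp only: mult.assoc)
  qed simp
qed

text \<open>A functional of dual norm zero vanishes on \<open>X\<close>, so additivity of
  \<open>B\<close> up to such functionals becomes exact on pairs from \<open>X\<close>.\<close>

lemma bounded_bilinear_form:
  assumes B: "bounded_linear_btw X nX (dual_space X nX) (dual_norm X nX) B"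
  shows "x \<in> X \<Longrightarrow> z \<in> X \<Longrightarrow> w \<in> X \<Longrightarrow> B (x + z) w = B x w + B z w"
    "x \<in> X \<Longrightarrow> w \<in> X \<Longrightarrow> B (c *\<^sub>R x) w = c * B x w"
    "x \<in> X \<Longrightarrow> z \<in> X \<Longrightarrow> w \<in> X \<Longrightarrow> B x (z + w) = B x z + B x w"
    "x \<in> X \<Longrightarrow> w \<in> X \<Longrightarrow> B x (c *\<^sub>R w) = c * B x w"
    "\<exists>C\<ge>0. \<forall>x\<in>X. \<forall>w\<in>X. \<bar>B x w\<bar> \<le> C * nX x * nX w"
proof -
  have Bd: "B x \<in> dual_space X nX" if "x \<in> X" for x using B that by (auto simp: bounded_linear_btw_def)
  show "B (x + z) w = B x w + B z w" if "x \<in> X" "z \<in> X" "w \<in> X" for x z w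
  proof -
    have "dual_norm X nX (B (x + z) - B x - B z) = 0" using B that by (auto simp: bounded_linear_btw_def)
    moreover have "B (x + z) - B x - B z \<in> dual_space X nX" using that by (intro dual_diff Bd add)
    ultimately have "(B (x + z) - B x - B z) w = 0" using that dual_norm_eq_0D by blast
    then show ?thesis by simp
  qed
  show "B (c *\<^sub>R x) w = c * B x w" if "x \<in> X" "w \<in> X" for x w c
  proof -
    have "dual_norm X nX (B (c *\<^sub>R x) - c *\<^sub>R B x) = 0" using B that by (auto simp: bounded_linear_btw_def)
    moreover have "B (c *\<^sub>R x) - c *\<^sub>R B x \<in> dual_space X nX" using that by (intro dual_diff Bd scale dual_scale)
    ultimately have "(B (c *\<^sub>R x) - c *\<^sub>R B x) w = 0" using that dual_norm_eq_0D by blast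
    then show ?thesis by (simp add: scaleR_fun_def)
  qed
  show "B x (z + w) = B x z + B x w" if "x \<in> X" "z \<in> X" "w \<in> X" for x z w
    using Bd[OF that(1)] that by (simp add: dual_space_iff)
  show "B x (c *\<^sub>R w) = c * B x w" if "x \<in> X" "w \<in> X" for x w c
    using Bd[OF that(1)] that by (simp add: dual_space_iff)
  obtain C where C: "\<And>x. x \<in> X \<Longrightarrow> dual_norm X nX (B x) \<le> C * nX x" using B unfolding bounded_linear_btw_def by blast
  show "\<exists>C\<ge>0. \<forall>x\<in>X. \<forall>w\<in>X. \<bar>B x w\<bar> \<le> C * nX x * nX w"
  proof (intro exI[of _ "\<bar>C\<bar>"] conjI ballI)
    fix x w assume x: "x \<in> X" and w: "w \<in> X"
    have "\<bar>B x w\<bar> \<le> dual_norm X nX (B x) * nX w" by (rule dual_bound[OF Bd[OF x] w])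
    also have "\<dots> \<le> (\<bar>C\<bar> * nX x) * nX w"
    proof (rule mult_right_mono[OF _ nonneg])
      have "C * nX x \<le> \<bar>C\<bar> * nX x" using nonneg[of x] by (intro mult_right_mono) auto
      then show "dual_norm X nX (B x) \<le> \<bar>C\<bar> * nX x" using C[OF x] by linarith
    qed
    finally show "\<bar>B x w\<bar> \<le> \<bar>C\<bar> * nX x * nX w" .
  qed simp
qed

end

lemma quasi_normed_W01p:
  assumes "open \<Omega>" "1 \<le> p"
  shows "quasi_normed (W01p \<Omega> p) (W1p_norm \<Omega> p)"
proof
  have p: "0 < p" using assms(2) by simp
  have "(0 :: real^'a \<Rightarrow> real) \<in> test_functions \<Omega>"
    using C_k_const[of _ 0] by (auto simp: test_functions_def zero_fun_def)
  then show "0 \<in> W01p \<Omega> p" by (rule test_function_W01p[OF assms(1) p])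
  show "W1p_norm \<Omega> p (x + y) \<le> 4 * (W1p_norm \<Omega> p x + W1p_norm \<Omega> p y)"
    if "x \<in> W01p \<Omega> p" "y \<in> W01p \<Omega> p" for x y
    by (rule W1p_norm_add[OF assms W01pD[OF that(1)] W01pD[OF that(2)]])
qed (use assms in \<open>auto intro: W01p_add W01p_scaleR W1p_norm_nonneg W1p_norm_scaleR W01pD\<close>)

section \<open>The control problem\<close>

locale control_problem = PC2_function K t ai a
  for K :: nat and t :: "nat \<Rightarrow> real" and ai :: "nat \<Rightarrow> real \<Rightarrow> real" and a :: "real \<Rightarrow> real" +
  fixes \<Omega> :: "(real^'n) set"
    and b ubar ybar phibar :: "real^'n \<Rightarrow> real"
    and \<nu> \<delta> p :: real
    and G :: "(real^'n \<Rightarrow> real) \<Rightarrow> real"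
    and G' :: "(real^'n \<Rightarrow> real) \<Rightarrow> (real^'n \<Rightarrow> real) \<Rightarrow> real"
    and G'' :: "(real^'n \<Rightarrow> real) \<Rightarrow> (real^'n \<Rightarrow> real) \<Rightarrow> (real^'n \<Rightarrow> real) \<Rightarrow> real"
    and S :: "((real^'n \<Rightarrow> real) \<Rightarrow> real) \<Rightarrow> real^'n \<Rightarrow> real"
    and S' :: "((real^'n \<Rightarrow> real) \<Rightarrow> real) \<Rightarrow> ((real^'n \<Rightarrow> real) \<Rightarrow> real) \<Rightarrow> real^'n \<Rightarrow> real"
  assumes dim: "CARD('n) \<in> {2, 3}"
    and domain: "open \<Omega>" "bounded \<Omega>"
    and G: "C2_functional (H10 \<Omega>) (H1_norm \<Omega>) G G' G''"
    and delta: "0 < \<delta>"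
    and p: "real CARD('n) < p" "p < 6"
    and S: "control_to_state \<Omega> b a p S"
    and S': "\<forall>F\<in>Wm1p \<Omega> p.
       has_frechet_derivative (Wm1p \<Omega> p) (Wm1p_norm \<Omega> p) (W01p \<Omega> p) (W1p_norm \<Omega> p) S (S' F) F"
    and ubar_Linf: "ubar \<in> Linf \<Omega>"
    and ybar: "ybar = S (fnl \<Omega> ubar)"
    and Sigma_finite: "jump_functional \<Omega> K t ai ybar < \<infinity>"
    and phibar: "phibar \<in> H10 \<Omega> \<inter> W1inf \<Omega>"
begin

abbreviation "M \<equiv> lebesgue_on \<Omega>"
abbreviation "q \<equiv> conj_exp p"
abbreviation "nm \<equiv> W1p_norm \<Omega> p"

section \<open>Exponents, pairings and the linearised state\<close>

lemma finite_M: "finite_measure M"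
  using domain by (rule finite_measure_lebesgue_on_bounded)

lemma p_gt_2: "2 < p"
  using p(1) dim by auto

lemma q_inverse: "1 / q = 1 - 1 / p"
  using p_gt_2 by (simp add: conj_exp_def field_simps)

text \<open>With 1/q = 1 - 1/p the last condition reads N (1/2 - 1/p) < 1. For N = 2 it always
  holds, and for N = 3 it is equivalent to p < 6.\<close>

lemma q_bounds: "1 \<le> q" "q \<le> 2" "real CARD('n) * (1 / q - 1 / 2) < 1"
proof -
  show "1 \<le> q" "q \<le> 2" using p_gt_2 by (simp_all add: conj_exp_def field_simps)
  have r: "1 / 6 < 1 / p" using p p_gt_2 by (simp add: field_simps)
  have "real CARD('n) = 2 \<or> real CARD('n) = 3" using dim by auto
  then show "real CARD('n) * (1 / q - 1 / 2) < 1"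
  proof
    assume N: "real CARD('n) = 2"
    show ?thesis unfolding q_inverse N using r by argo
  next
    assume N: "real CARD('n) = 3"
    show ?thesis unfolding q_inverse N using r by argo
  qed
qed

sublocale W: quasi_normed "W01p \<Omega> p" nm
  using p_gt_2 by (intro quasi_normed_W01p domain) simp

sublocale X: quasi_normed "W01p \<Omega> q" "W1p_norm \<Omega> q"
  using q_bounds by (intro quasi_normed_W01p domain) simp

sublocale H: quasi_normed "H10 \<Omega>" "H1_norm \<Omega>"
  by (intro quasi_normed_W01p domain) simp

lemma Wm1p_eq: "Wm1p \<Omega> p = dual_space (W01p \<Omega> q) (W1p_norm \<Omega> q)"
  "Wm1p_norm \<Omega> p = dual_norm (W01p \<Omega> q) (W1p_norm \<Omega> q)"
  by (simp_all add: Wm1p_def Wm1p_norm_def)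

lemma Linf_L2: "f \<in> Linf \<Omega> \<Longrightarrow> f \<in> L2 M" for f :: "real^'n \<Rightarrow> real"
proof -
  assume "f \<in> Linf \<Omega>"
  then obtain C where f: "f \<in> borel_measurable M" "AE x in M. norm (f x) \<le> C" by (auto simp: Linf_def)
  interpret finite_measure M by (rule finite_M)
  have "integrable M (\<lambda>x. (f x)\<^sup>2)"
  proof (rule integrable_const_bound)
    show "AE x in M. norm ((f x)\<^sup>2) \<le> C\<^sup>2"
      using f(2) by eventually_elim (simp add: power2_le_iff_abs_le abs_le_square_iff[symmetric])
  qed (use f in measurable)
  then show ?thesis using f(1) by (simp add: L2_def)
qed

lemma ubar_L2: "ubar \<in> L2 M" by (rule Linf_L2[OF ubar_Linf])

text \<open>A bound for the embedding of L^2 into \<open>Wm1p\<close>, fixed once so that it can be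
  named across lemmas.\<close>

definition pair_const :: real
  where "pair_const = (SOME C. 0 < C \<and> (\<forall>h\<in>L2 M. \<forall>w\<in>W01p \<Omega> q. integrable M (\<lambda>x. h x * w x) \<and>
     (LINT x|M. \<bar>h x * w x\<bar>) \<le> C * Lp_norm \<Omega> 2 h * W1p_norm \<Omega> q w))"

lemma pair_const: "0 < pair_const"
  "h \<in> L2 M \<Longrightarrow> w \<in> W01p \<Omega> q \<Longrightarrow> integrable M (\<lambda>x. h x * w x)"
  "h \<in> L2 M \<Longrightarrow> w \<in> W01p \<Omega> q \<Longrightarrow> (LINT x|M. \<bar>h x * w x\<bar>) \<le> pair_const * Lp_norm \<Omega> 2 h * W1p_norm \<Omega> q w"
proof -
  obtain C where C: "0 < C" "\<And>h w. h \<in> Lp \<Omega> 2 \<Longrightarrow> w \<in> W01p \<Omega> q \<Longrightarrow> integrable M (\<lambda>x. h x * w x)"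
    "\<And>h w. h \<in> Lp \<Omega> 2 \<Longrightarrow> w \<in> W01p \<Omega> q \<Longrightarrow> (LINT x|M. \<bar>h x * w x\<bar>) \<le> C * Lp_norm \<Omega> 2 h * W1p_norm \<Omega> q w"
    using W01p_L2_pairing[OF domain(1) q_bounds] by blast
  have "0 < C \<and> (\<forall>h\<in>L2 M. \<forall>w\<in>W01p \<Omega> q. integrable M (\<lambda>x. h x * w x) \<and>
     (LINT x|M. \<bar>h x * w x\<bar>) \<le> C * Lp_norm \<Omega> 2 h * W1p_norm \<Omega> q w)"
    using C unfolding Lp_2_eq_L2 by blast
  then have *: "0 < pair_const \<and> (\<forall>h\<in>L2 M. \<forall>w\<in>W01p \<Omega> q. integrable M (\<lambda>x. h x * w x) \<and>
     (LINT x|M. \<bar>h x * w x\<bar>) \<le> pair_const * Lp_norm \<Omega> 2 h * W1p_norm \<Omega> q w)"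
    unfolding pair_const_def by (rule someI)
  then show "0 < pair_const"
    "h \<in> L2 M \<Longrightarrow> w \<in> W01p \<Omega> q \<Longrightarrow> integrable M (\<lambda>x. h x * w x)"
    "h \<in> L2 M \<Longrightarrow> w \<in> W01p \<Omega> q \<Longrightarrow> (LINT x|M. \<bar>h x * w x\<bar>) \<le> pair_const * Lp_norm \<Omega> 2 h * W1p_norm \<Omega> q w"
    by blast+
qed

lemma fnl_bound:
  assumes "h \<in> L2 M" "w \<in> W01p \<Omega> q"
  shows "\<bar>fnl \<Omega> h w\<bar> \<le> pair_const * Lp_norm \<Omega> 2 h * W1p_norm \<Omega> q w"
  using pair_const(3)[OF assms] integral_abs_bound[of M "\<lambda>x. h x * w x"] unfolding fnl_def by linarith

lemma fnl_Wm1p: "h \<in> L2 M \<Longrightarrow> fnl \<Omega> h \<in> Wm1p \<Omega> p"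
proof -
  assume h: "h \<in> L2 M"
  have "fnl \<Omega> h (x + z) = fnl \<Omega> h x + fnl \<Omega> h z" if "x \<in> W01p \<Omega> q" "z \<in> W01p \<Omega> q" for x z
    using pair_const(2)[OF h that(1)] pair_const(2)[OF h that(2)] by (simp add: fnl_def distrib_left)
  moreover have "fnl \<Omega> h (c *\<^sub>R x) = c * fnl \<Omega> h x" for c x
    by (simp add: fnl_def scaleR_fun_def mult.left_commute)
  ultimately show ?thesis
    unfolding Wm1p_eq dual_space_iff using fnl_bound[OF h] by blast
qed

lemma fnl_diff: "h \<in> L2 M \<Longrightarrow> k \<in> L2 M \<Longrightarrow> w \<in> W01p \<Omega> q \<Longrightarrow> fnl \<Omega> (\<lambda>x. h x - k x) w = fnl \<Omega> h w - fnl \<Omega> k w"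
  using pair_const(2) by (simp add: fnl_def left_diff_distrib)

lemma fnl_scale: "fnl \<Omega> (c *\<^sub>R h) = c *\<^sub>R fnl \<Omega> h"
  by (simp add: fnl_def scaleR_fun_def fun_eq_iff mult.assoc)

lemma L2_lin: "h \<in> L2 M \<Longrightarrow> ubar + s *\<^sub>R h \<in> L2 M"
  using L2_lincomb(1)[OF ubar_L2, of h 1 s] by (simp add: plus_fun_def scaleR_fun_def)

definition F0 :: "(real^'n \<Rightarrow> real) \<Rightarrow> real" where "F0 = fnl \<Omega> ubar"
definition z :: "(real^'n \<Rightarrow> real) \<Rightarrow> real^'n \<Rightarrow> real" where "z h = S' F0 (fnl \<Omega> h)"

lemma F0_Wm1p: "F0 \<in> Wm1p \<Omega> p" unfolding F0_def by (rule fnl_Wm1p[OF ubar_L2])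

lemma S'_linear: "bounded_linear_btw (Wm1p \<Omega> p) (Wm1p_norm \<Omega> p) (W01p \<Omega> p) nm (S' F0)"
  using S' F0_Wm1p by (auto simp: has_frechet_derivative_def)

lemma S'_mem: "F \<in> Wm1p \<Omega> p \<Longrightarrow> S' F0 F \<in> W01p \<Omega> p"
  using S'_linear by (auto simp: bounded_linear_btw_def)

lemma z_mem: "h \<in> L2 M \<Longrightarrow> z h \<in> W01p \<Omega> p"
  unfolding z_def by (intro S'_mem fnl_Wm1p)

lemma S'_diff_bound:
  obtains C where "0 < C" "\<And>F H. F \<in> Wm1p \<Omega> p \<Longrightarrow> H \<in> Wm1p \<Omega> p \<Longrightarrow> nm (S' F0 F - S' F0 H) \<le> C * Wm1p_norm \<Omega> p (F - H)"
proof -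
  have "x - z \<in> Wm1p \<Omega> p" if "x \<in> Wm1p \<Omega> p" "z \<in> Wm1p \<Omega> p" for x z
    using that unfolding Wm1p_eq by (rule X.dual_diff)
  then obtain C where C: "0 < C" "\<And>F H. F \<in> Wm1p \<Omega> p \<Longrightarrow> H \<in> Wm1p \<Omega> p \<Longrightarrow> nm (S' F0 F - S' F0 H) \<le> C * \<bar>Wm1p_norm \<Omega> p (F - H)\<bar>"
    using W.bounded_linear_diff[OF S'_linear] by blast
  have "\<bar>Wm1p_norm \<Omega> p (F - H)\<bar> = Wm1p_norm \<Omega> p (F - H)" if "F \<in> Wm1p \<Omega> p" "H \<in> Wm1p \<Omega> p" for F H
    using that X.dual_norm_nonneg[OF X.dual_diff, of F H] unfolding Wm1p_eq by simp
  with C show thesis using that by metis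
qed

text \<open>Continuity of \<open>S'\<close>, in the form that meets the compactness lemma: closeness
  of pairings over the unit ball of \<open>W01p \<Omega> q\<close> is closeness in the dual
  norm.\<close>

lemma z_diff_bound:
  obtains C where "0 < C" "\<And>h k e. h \<in> L2 M \<Longrightarrow> k \<in> L2 M \<Longrightarrow>
     (\<And>w. w \<in> W01p \<Omega> q \<Longrightarrow> W1p_norm \<Omega> q w \<le> 1 \<Longrightarrow> \<bar>LINT x|M. (h x - k x) * w x\<bar> \<le> e) \<Longrightarrow> nm (z h - z k) \<le> C * e"
proof -
  obtain C where C: "0 < C" "\<And>F H. F \<in> Wm1p \<Omega> p \<Longrightarrow> H \<in> Wm1p \<Omega> p \<Longrightarrow> nm (S' F0 F - S' F0 H) \<le> C * Wm1p_norm \<Omega> p (F - H)"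
    using S'_diff_bound by blast
  show thesis
  proof (rule that[OF C(1)])
    fix h k e assume h: "h \<in> L2 M" and k: "k \<in> L2 M"
      and e: "\<And>w. w \<in> W01p \<Omega> q \<Longrightarrow> W1p_norm \<Omega> q w \<le> 1 \<Longrightarrow> \<bar>LINT x|M. (h x - k x) * w x\<bar> \<le> e"
    have "Wm1p_norm \<Omega> p (fnl \<Omega> h - fnl \<Omega> k) \<le> e"
      unfolding Wm1p_eq
    proof (rule X.dual_norm_le)
      fix w assume w: "w \<in> W01p \<Omega> q" "W1p_norm \<Omega> q w \<le> 1"
      show "\<bar>(fnl \<Omega> h - fnl \<Omega> k) w\<bar> \<le> e"
        using e[OF w] fnl_diff[OF h k w(1)] by (simp add: fnl_def)
    qed
    then have "C * Wm1p_norm \<Omega> p (fnl \<Omega> h - fnl \<Omega> k) \<le> C * e" using C(1) by simp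
    then show "nm (z h - z k) \<le> C * e"
      unfolding z_def using C(2)[OF fnl_Wm1p[OF h] fnl_Wm1p[OF k]] by linarith
  qed
qed

text \<open>Equality is asserted only up to seminorm zero, since \<open>S'\<close> may choose
  unrelated representatives for a functional and its multiple.\<close>

lemma z_scale:
  assumes h: "h \<in> L2 M"
  shows "nm (z (c *\<^sub>R h) - c *\<^sub>R z h) = 0"
  using S'_linear fnl_Wm1p[OF h] unfolding z_def fnl_scale bounded_linear_btw_def by blast

definition sup_const :: real
  where "sup_const = (SOME C. 0 < C \<and> (\<forall>w\<in>W01p \<Omega> p. AE x in M. \<bar>w x\<bar> \<le> C * nm w))"

lemma sup_const: "0 < sup_const" "w \<in> W01p \<Omega> p \<Longrightarrow> AE x in M. \<bar>w x\<bar> \<le> sup_const * nm w"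
proof -
  obtain C where "0 < C" "\<And>w. w \<in> W01p \<Omega> p \<Longrightarrow> AE x in M. \<bar>w x\<bar> \<le> C * nm w"
    using W01p_sup_bound[OF domain(1) p(1)] by blast
  then have "0 < C \<and> (\<forall>w\<in>W01p \<Omega> p. AE x in M. \<bar>w x\<bar> \<le> C * nm w)" by blast
  then have "0 < sup_const \<and> (\<forall>w\<in>W01p \<Omega> p. AE x in M. \<bar>w x\<bar> \<le> sup_const * nm w)"
    unfolding sup_const_def by (rule someI)
  then show "0 < sup_const" "w \<in> W01p \<Omega> p \<Longrightarrow> AE x in M. \<bar>w x\<bar> \<le> sup_const * nm w" by blast+
qed

lemma S_mem: "F \<in> Wm1p \<Omega> p \<Longrightarrow> S F \<in> W01p \<Omega> p"
  using S by (auto simp: control_to_state_def weak_state_solution_def)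

lemma ybar_mem: "ybar \<in> W01p \<Omega> p"
  unfolding ybar by (intro S_mem fnl_Wm1p ubar_L2)

lemma W_measurable: "w \<in> W01p \<Omega> p \<Longrightarrow> w \<in> borel_measurable M" "w \<in> W01p \<Omega> p \<Longrightarrow> weak_grad \<Omega> w \<in> borel_measurable M"
  using W1pD(4,5)[OF domain(1) W01pD] by auto

lemma phibar_W1p: "phibar \<in> W1p \<Omega> 2"
  using phibar W01pD by auto

lemma phibar_measurable: "weak_grad \<Omega> phibar \<in> borel_measurable M"
  using W1pD(5)[OF domain(1) phibar_W1p] .

lemma phibar_grad_bounded:
  obtains B where "0 < B" "AE x in M. norm (weak_grad \<Omega> phibar x) \<le> B"
proof -
  obtain g where g: "g \<in> Linf \<Omega>" "has_weak_grad \<Omega> phibar g" using phibar by (auto simp: W1inf_def)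
  obtain C where "AE x in M. norm (g x) \<le> C" using g by (auto simp: Linf_def)
  then have "AE x in M. norm (weak_grad \<Omega> phibar x) \<le> \<bar>C\<bar> + 1"
    using weak_grad_AE[OF domain(1) g(2)] by eventually_elim simp
  then show thesis using that[of "\<bar>C\<bar> + 1"] by simp
qed

text \<open>On a bounded domain the p-norm controls the L^1 norm of the gradient, which suffices
  wherever the other factors of an integrand are bounded.\<close>

lemma grad_L1:
  obtains C where "0 < C" "\<And>w. w \<in> W01p \<Omega> p \<Longrightarrow> integrable M (\<lambda>x. norm (weak_grad \<Omega> w x))"
    "\<And>w. w \<in> W01p \<Omega> p \<Longrightarrow> (LINT x|M. norm (weak_grad \<Omega> w x)) \<le> C * nm w"
proof
  let ?C = "2 * measure lebesgue \<Omega> + 1"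
  show "0 < ?C" by (simp add: add_nonneg_pos)
  fix w assume w: "w \<in> W01p \<Omega> p"
  have r: "0 < (1::real)" "1 \<le> p" using p_gt_2 by auto
  note Wm = W1p_mono[OF domain r W01pD[OF w]]
  show I: "integrable M (\<lambda>x. norm (weak_grad \<Omega> w x))"
    using LpD(2)[OF W1pD(2)[OF domain(1) Wm(1)]] by simp
  have "0 \<le> (LINT x|M. \<bar>w x\<bar>)" by simp
  moreover have "0 \<le> (LINT x|M. norm (weak_grad \<Omega> w x))" by simp
  ultimately have "(LINT x|M. norm (weak_grad \<Omega> w x)) \<le> W1p_norm \<Omega> 1 w"
    by (simp add: W1p_norm_def)
  then show "(LINT x|M. norm (weak_grad \<Omega> w x)) \<le> ?C * nm w"
    using Wm(2) by simp
qed

lemma W01p_H10: "w \<in> W01p \<Omega> p \<Longrightarrow> w \<in> H10 \<Omega>"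
  using W01p_mono[OF domain, of 2 p w] p_gt_2 by simp

lemma H1_le:
  obtains C where "0 < C" "\<And>w. w \<in> W01p \<Omega> p \<Longrightarrow> H1_norm \<Omega> w \<le> C * nm w"
proof
  have "0 < 2 * measure lebesgue \<Omega> + 1" by (simp add: add_nonneg_pos)
  then show "0 < (2 * measure lebesgue \<Omega> + 1) powr (1 / 2)" by (metis less_irrefl powr_gt_zero)
  show "H1_norm \<Omega> w \<le> (2 * measure lebesgue \<Omega> + 1) powr (1 / 2) * nm w" if "w \<in> W01p \<Omega> p" for w
    using W1p_mono(2)[OF domain, of 2 p w] p_gt_2 W01pD[OF that] by simp
qed

subsection \<open>The curvature without \<open>Q\<^sub>2\<close>\<close>

definition dot :: "real^'n \<Rightarrow> real"
  where "dot x = weak_grad \<Omega> ybar x \<bullet> weak_grad \<Omega> phibar x"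

definition smooth_term :: "(real^'n \<Rightarrow> real) \<Rightarrow> real"
  where "smooth_term w = (LINT x|M. D2 K t a (ybar x) * w x * w x * dot x)"

definition kink_term :: "(real^'n \<Rightarrow> real) \<Rightarrow> real"
  where "kink_term w = (LINT x|M. dir_deriv a (ybar x) (w x) * (weak_grad \<Omega> w x \<bullet> weak_grad \<Omega> phibar x))"

text \<open>\<open>Q_s\<close> plus \<open>Q_1\<close> on the diagonal, without the Tikhonov term
  and as a function of the linearised state; on the diagonal the two summands of \<open>Q_1\<close>
  coincide and absorb the factor 1/2.\<close>

definition curvature :: "(real^'n \<Rightarrow> real) \<Rightarrow> real"
  where "curvature w = 1 / 2 * G'' ybar w w - 1 / 2 * smooth_term w - kink_term w"

lemma Q_s_Q_1_eq:
  "Q_s \<Omega> K t a \<nu> G'' S' ubar ybar phibar h h + Q_1 \<Omega> a S' ubar ybar phibar h h =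
     curvature (z h) + \<nu> / 2 * (LINT x|M. (h x)\<^sup>2)"
proof -
  have e: "(dir_deriv a (ybar x) (w x) *\<^sub>R weak_grad \<Omega> w x + dir_deriv a (ybar x) (w x) *\<^sub>R weak_grad \<Omega> w x) \<bullet> weak_grad \<Omega> phibar x =
     2 * (dir_deriv a (ybar x) (w x) * (weak_grad \<Omega> w x \<bullet> weak_grad \<Omega> phibar x))" for w x
    by (simp only: inner_add_left inner_scaleR_left)
  have "Q_1 \<Omega> a S' ubar ybar phibar h h = - kink_term (z h)"
    unfolding Q_1_def kink_term_def z_def F0_def Let_def e by simp
  moreover have "Q_s \<Omega> K t a \<nu> G'' S' ubar ybar phibar h h =
      1 / 2 * G'' ybar (z h) (z h) + \<nu> / 2 * (LINT x|M. (h x)\<^sup>2) - 1 / 2 * smooth_term (z h)"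
    by (simp add: Q_s_def smooth_term_def z_def F0_def dot_def Let_def power2_eq_square)
  ultimately show ?thesis by (simp add: curvature_def)
qed

lemma ybar_bounded:
  obtains R where "0 < R" "AE x in M. \<bar>ybar x\<bar> \<le> R"
proof
  show "0 < sup_const * nm ybar + 1" using sup_const(1) W.nonneg[of ybar] by (simp add: add_nonneg_pos)
  show "AE x in M. \<bar>ybar x\<bar> \<le> sup_const * nm ybar + 1"
    using sup_const(2)[OF ybar_mem] by eventually_elim simp
qed

lemma dot_measurable [measurable]: "dot \<in> borel_measurable M"
  unfolding dot_def[abs_def] using W_measurable(2)[OF ybar_mem] phibar_measurable by measurable

lemma G''_form:
  "bounded_linear_btw (H10 \<Omega>) (H1_norm \<Omega>) (dual_space (H10 \<Omega>) (H1_norm \<Omega>)) (dual_norm (H10 \<Omega>) (H1_norm \<Omega>)) (G'' ybar)"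
  using G W01p_H10[OF ybar_mem] by (auto simp: C2_functional_def has_frechet_derivative_def)

text \<open>From B(v,v) - B(w,w) = B(v-w,v) + B(w,v-w), by bilinearity alone. The product form of
  the bound recurs for every term of the curvature.\<close>

lemma G''_lipschitz:
  obtains C where "0 < C" "\<And>v w. v \<in> W01p \<Omega> p \<Longrightarrow> w \<in> W01p \<Omega> p \<Longrightarrow>
    \<bar>G'' ybar v v - G'' ybar w w\<bar> \<le> C * nm (v - w) * (nm v + nm w)"
proof -
  note B = H.bounded_bilinear_form[OF G''_form]
  obtain C where C: "0 \<le> C" "\<And>v w. v \<in> H10 \<Omega> \<Longrightarrow> w \<in> H10 \<Omega> \<Longrightarrow> \<bar>G'' ybar v w\<bar> \<le> C * H1_norm \<Omega> v * H1_norm \<Omega> w"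
    using B(5) by blast
  obtain D where D: "0 < D" "\<And>w. w \<in> W01p \<Omega> p \<Longrightarrow> H1_norm \<Omega> w \<le> D * nm w" using H1_le by blast
  have bd: "\<bar>G'' ybar v w\<bar> \<le> C * D * D * (nm v * nm w)" if v: "v \<in> W01p \<Omega> p" and w: "w \<in> W01p \<Omega> p" for v w
  proof -
    have "\<bar>G'' ybar v w\<bar> \<le> C * (H1_norm \<Omega> v * H1_norm \<Omega> w)"
      using C(2)[OF W01p_H10[OF v] W01p_H10[OF w]] by (simp only: mult.assoc)
    also have "\<dots> \<le> C * ((D * nm v) * (D * nm w))"
      using C(1) D(1) D(2)[OF v] D(2)[OF w] H.nonneg W.nonneg by (intro mult_left_mono mult_mono) auto
    finally show ?thesis by (simp add: mult_ac)
  qed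
  show thesis
  proof (rule that[of "C * D * D + 1"])
    show "0 < C * D * D + 1" using C(1) D(1) by (simp add: add_nonneg_pos)
    fix v w assume v: "v \<in> W01p \<Omega> p" and w: "w \<in> W01p \<Omega> p"
    have d: "v - w \<in> W01p \<Omega> p" by (rule W.diff[OF v w])
    note h = W01p_H10[OF v] W01p_H10[OF w] W01p_H10[OF d]
    have "G'' ybar v v = G'' ybar (v - w) v + G'' ybar w v" using B(1)[OF h(3,2,1)] by simp
    moreover have "G'' ybar w v = G'' ybar w (v - w) + G'' ybar w w" using B(3)[OF h(2,3,2)] by simp
    ultimately have "\<bar>G'' ybar v v - G'' ybar w w\<bar> \<le> C * D * D * (nm (v - w) * nm v) + C * D * D * (nm w * nm (v - w))"
      using bd[OF d v] bd[OF w d] by linarith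
    also have "\<dots> = C * D * D * (nm (v - w) * (nm v + nm w))" by (simp add: distrib_left mult_ac)
    also have "\<dots> \<le> (C * D * D + 1) * (nm (v - w) * (nm v + nm w))"
      using W.nonneg by (intro mult_right_mono) auto
    finally show "\<bar>G'' ybar v v - G'' ybar w w\<bar> \<le> (C * D * D + 1) * nm (v - w) * (nm v + nm w)" by (simp only: mult.assoc)
  qed
qed

text \<open>Since v^2 - w^2 = (v - w)(v + w) and both factors are uniformly bounded through
  \<open>sup_const\<close>, only the gradient of \<open>ybar\<close> has to be integrated.\<close>

lemma smooth_term_lipschitz:
  obtains C where "0 < C" "\<And>v w. v \<in> W01p \<Omega> p \<Longrightarrow> w \<in> W01p \<Omega> p \<Longrightarrow>
    \<bar>smooth_term v - smooth_term w\<bar> \<le> C * nm (v - w) * (nm v + nm w)"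
proof -
  obtain R where R: "0 < R" "AE x in M. \<bar>ybar x\<bar> \<le> R" using ybar_bounded by blast
  obtain B where B: "0 \<le> B" "\<And>s. \<bar>s\<bar> \<le> R \<Longrightarrow> \<bar>D2 K t a s\<bar> \<le> B" using D2_bounded by blast
  obtain Bp where Bp: "0 < Bp" "AE x in M. norm (weak_grad \<Omega> phibar x) \<le> Bp" using phibar_grad_bounded by blast
  obtain C1 where C1: "0 < C1" "\<And>w. w \<in> W01p \<Omega> p \<Longrightarrow> integrable M (\<lambda>x. norm (weak_grad \<Omega> w x))"
    "\<And>w. w \<in> W01p \<Omega> p \<Longrightarrow> (LINT x|M. norm (weak_grad \<Omega> w x)) \<le> C1 * nm w" using grad_L1 by blast
  let ?g = "\<lambda>x. norm (weak_grad \<Omega> ybar x)"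
  let ?k = sup_const
  note [measurable] = W_measurable(1)[OF ybar_mem] D2_measurable
  have ptw: "AE x in M. \<bar>D2 K t a (ybar x) * dot x\<bar> \<le> B * Bp * ?g x"
    using R(2) Bp(2)
  proof eventually_elim
    case (elim x)
    have "\<bar>dot x\<bar> \<le> ?g x * norm (weak_grad \<Omega> phibar x)" unfolding dot_def by (rule Cauchy_Schwarz_ineq2)
    also have "\<dots> \<le> ?g x * Bp" using elim by (intro mult_left_mono) auto
    finally have "\<bar>D2 K t a (ybar x)\<bar> * \<bar>dot x\<bar> \<le> B * (?g x * Bp)"
      using B elim Bp(1) by (intro mult_mono) auto
    then show ?case by (simp add: abs_mult mult_ac)
  qed
  have I: "integrable M (\<lambda>x. D2 K t a (ybar x) * w x * w x * dot x)" if w: "w \<in> W01p \<Omega> p" for w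
  proof (rule Bochner_Integration.integrable_bound)
    note [measurable] = W_measurable(1)[OF w]
    let ?m = "?k * nm w"
    show "integrable M (\<lambda>x. ?m\<^sup>2 * (B * Bp * ?g x))" using C1(2)[OF ybar_mem] by auto
    show "(\<lambda>x. D2 K t a (ybar x) * w x * w x * dot x) \<in> borel_measurable M" by measurable
    show "AE x in M. norm (D2 K t a (ybar x) * w x * w x * dot x) \<le> norm (?m\<^sup>2 * (B * Bp * ?g x))"
      using ptw sup_const(2)[OF w]
    proof eventually_elim
      case (elim x)
      have "\<bar>w x\<bar>\<^sup>2 * \<bar>D2 K t a (ybar x) * dot x\<bar> \<le> ?m\<^sup>2 * (B * Bp * ?g x)"
        using elim by (intro mult_mono power_mono) auto
      moreover have "\<bar>D2 K t a (ybar x) * w x * w x * dot x\<bar> = \<bar>w x\<bar>\<^sup>2 * \<bar>D2 K t a (ybar x) * dot x\<bar>"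
        by (simp add: abs_mult power2_eq_square mult_ac)
      ultimately show ?case by simp
    qed
  qed
  define C where "C = ?k * ?k * (B * Bp * (C1 * nm ybar)) + 1"
  show thesis
  proof (rule that[of C])
    show "0 < C" unfolding C_def using sup_const(1) B(1) Bp(1) C1(1) W.nonneg[of ybar] by (simp add: add_nonneg_pos)
    fix v w assume v: "v \<in> W01p \<Omega> p" and w: "w \<in> W01p \<Omega> p"
    have d: "v - w \<in> W01p \<Omega> p" by (rule W.diff[OF v w])
    let ?c = "(?k * nm (v - w)) * (?k * (nm v + nm w))"
    have c0: "0 \<le> ?c" using sup_const(1) W.nonneg by (intro mult_nonneg_nonneg add_nonneg_nonneg) auto
    have "\<bar>smooth_term v - smooth_term w\<bar> = \<bar>LINT x|M. D2 K t a (ybar x) * v x * v x * dot x - D2 K t a (ybar x) * w x * w x * dot x\<bar>"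
      unfolding smooth_term_def using I[OF v] I[OF w] by simp
    also have "\<dots> \<le> (LINT x|M. \<bar>D2 K t a (ybar x) * v x * v x * dot x - D2 K t a (ybar x) * w x * w x * dot x\<bar>)"
      by (rule integral_abs_bound)
    also have "\<dots> \<le> (LINT x|M. ?c * (B * Bp * ?g x))"
    proof (rule integral_mono_AE)
      show "integrable M (\<lambda>x. \<bar>D2 K t a (ybar x) * v x * v x * dot x - D2 K t a (ybar x) * w x * w x * dot x\<bar>)"
        using I[OF v] I[OF w] by auto
      show "integrable M (\<lambda>x. ?c * (B * Bp * ?g x))" using C1(2)[OF ybar_mem] by auto
      show "AE x in M. \<bar>D2 K t a (ybar x) * v x * v x * dot x - D2 K t a (ybar x) * w x * w x * dot x\<bar> \<le> ?c * (B * Bp * ?g x)"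
        using ptw sup_const(2)[OF v] sup_const(2)[OF w] sup_const(2)[OF d]
      proof eventually_elim
        case (elim x)
        have "D2 K t a (ybar x) * v x * v x * dot x - D2 K t a (ybar x) * w x * w x * dot x =
            ((v x - w x) * (v x + w x)) * (D2 K t a (ybar x) * dot x)" by (simp add: algebra_simps)
        moreover have "\<bar>v x + w x\<bar> \<le> ?k * (nm v + nm w)" using elim(2,3) abs_triangle_ineq[of "v x" "w x"] by (simp add: distrib_left)
        then have "\<bar>v x - w x\<bar> * \<bar>v x + w x\<bar> \<le> ?c"
          using elim(4) by (intro mult_mono) auto
        then have "\<bar>v x - w x\<bar> * \<bar>v x + w x\<bar> * \<bar>D2 K t a (ybar x) * dot x\<bar> \<le> ?c * (B * Bp * ?g x)"
          by (rule mult_mono[OF _ elim(1) c0 abs_ge_zero])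
        ultimately show ?case by (simp only: abs_mult)
      qed
    qed
    also have "\<dots> = ?c * (B * Bp * (LINT x|M. ?g x))" by simp
    also have "\<dots> \<le> ?c * (B * Bp * (C1 * nm ybar))"
      using C1(3)[OF ybar_mem] c0 B(1) Bp(1) by (intro mult_left_mono) auto
    also have "\<dots> = (?k * ?k * (B * Bp * (C1 * nm ybar))) * (nm (v - w) * (nm v + nm w))" by (simp only: mult_ac)
    also have "\<dots> \<le> C * (nm (v - w) * (nm v + nm w))"
      unfolding C_def using W.nonneg by (intro mult_right_mono) auto
    finally show "\<bar>smooth_term v - smooth_term w\<bar> \<le> C * nm (v - w) * (nm v + nm w)" by (simp only: mult.assoc)
  qed
qed

text \<open>One difference falls on the directional derivative, Lipschitz in the direction, the
  other on the gradient. Comparison with direction zero bounds the directional derivative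
  itself.\<close>

lemma kink_term_lipschitz:
  obtains C where "0 < C" "\<And>v w. v \<in> W01p \<Omega> p \<Longrightarrow> w \<in> W01p \<Omega> p \<Longrightarrow>
    \<bar>kink_term v - kink_term w\<bar> \<le> C * nm (v - w) * (nm v + nm w)"
proof -
  obtain R where R: "0 < R" "AE x in M. \<bar>ybar x\<bar> \<le> R" using ybar_bounded by blast
  obtain L where L: "0 \<le> L" "L-lipschitz_on {- (R + 1)..R + 1} a" using a_lipschitz by blast
  obtain Bp where Bp: "0 < Bp" "AE x in M. norm (weak_grad \<Omega> phibar x) \<le> Bp" using phibar_grad_bounded by blast
  obtain C1 where C1: "0 < C1" "\<And>w. w \<in> W01p \<Omega> p \<Longrightarrow> integrable M (\<lambda>x. norm (weak_grad \<Omega> w x))"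
    "\<And>w. w \<in> W01p \<Omega> p \<Longrightarrow> (LINT x|M. norm (weak_grad \<Omega> w x)) \<le> C1 * nm w" using grad_L1 by blast
  let ?k = sup_const and ?P = "weak_grad \<Omega> phibar"
  note [measurable] = W_measurable(1)[OF ybar_mem] phibar_measurable
  have I: "integrable M (\<lambda>x. dir_deriv a (ybar x) (w x) * (weak_grad \<Omega> w x \<bullet> ?P x))" if w: "w \<in> W01p \<Omega> p" for w
  proof (rule Bochner_Integration.integrable_bound)
    note [measurable] = W_measurable[OF w]
    show "integrable M (\<lambda>x. (L * (?k * nm w)) * (norm (weak_grad \<Omega> w x) * Bp))" using C1(2)[OF w] by auto
    show "(\<lambda>x. dir_deriv a (ybar x) (w x) * (weak_grad \<Omega> w x \<bullet> ?P x)) \<in> borel_measurable M" by measurable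
    show "AE x in M. norm (dir_deriv a (ybar x) (w x) * (weak_grad \<Omega> w x \<bullet> ?P x)) \<le> norm ((L * (?k * nm w)) * (norm (weak_grad \<Omega> w x) * Bp))"
      using R(2) Bp(2) sup_const(2)[OF w]
    proof eventually_elim
      case (elim x)
      have "\<bar>dir_deriv a (ybar x) (w x)\<bar> \<le> L * \<bar>w x\<bar>" using dir_deriv_lipschitz[OF L(2) elim(1), of "w x" 0] by simp
      also have "\<dots> \<le> L * (?k * nm w)" using elim(3) L(1) by (intro mult_left_mono) auto
      finally have 1: "\<bar>dir_deriv a (ybar x) (w x)\<bar> \<le> L * (?k * nm w)" .
      have "\<bar>weak_grad \<Omega> w x \<bullet> ?P x\<bar> \<le> norm (weak_grad \<Omega> w x) * norm (?P x)" by (rule Cauchy_Schwarz_ineq2)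
      also have "\<dots> \<le> norm (weak_grad \<Omega> w x) * Bp" using elim by (intro mult_left_mono) auto
      finally have "\<bar>dir_deriv a (ybar x) (w x)\<bar> * \<bar>weak_grad \<Omega> w x \<bullet> ?P x\<bar> \<le> (L * (?k * nm w)) * (norm (weak_grad \<Omega> w x) * Bp)"
        using 1 by (intro mult_mono) auto
      then show ?case by (simp only: real_norm_def abs_mult[of "dir_deriv a (ybar x) (w x)"])
    qed
  qed
  define C where "C = L * ?k * Bp * C1 + 1"
  show thesis
  proof (rule that[of C])
    show "0 < C" unfolding C_def using sup_const(1) L(1) Bp(1) C1(1) by (simp add: add_nonneg_pos)
    fix v w assume v: "v \<in> W01p \<Omega> p" and w: "w \<in> W01p \<Omega> p"
    have d: "v - w \<in> W01p \<Omega> p" by (rule W.diff[OF v w])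
    have p0: "0 < p" using p_gt_2 by simp
    note gd = W1p_diff(2)[OF domain(1) p0 W01pD[OF v] W01pD[OF w]]
    let ?gv = "\<lambda>x. norm (weak_grad \<Omega> v x)" and ?gd = "\<lambda>x. norm (weak_grad \<Omega> (v - w) x)"
    let ?A = "L * (?k * nm (v - w)) * Bp" and ?B = "L * (?k * nm w) * Bp"
    have AB: "0 \<le> ?A" "0 \<le> ?B" using L(1) sup_const(1) W.nonneg Bp(1) by auto
    let ?D = "\<lambda>x. dir_deriv a (ybar x) (v x) * (weak_grad \<Omega> v x \<bullet> ?P x) - dir_deriv a (ybar x) (w x) * (weak_grad \<Omega> w x \<bullet> ?P x)"
    have "\<bar>kink_term v - kink_term w\<bar> = \<bar>LINT x|M. ?D x\<bar>"
      unfolding kink_term_def using I[OF v] I[OF w] by simp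
    also have "\<dots> \<le> (LINT x|M. \<bar>?D x\<bar>)" by (rule integral_abs_bound)
    also have "\<dots> \<le> (LINT x|M. ?A * ?gv x + ?B * ?gd x)"
    proof (rule integral_mono_AE)
      show "integrable M (\<lambda>x. \<bar>?D x\<bar>)" using I[OF v] I[OF w] by auto
      show "integrable M (\<lambda>x. ?A * ?gv x + ?B * ?gd x)" using C1(2)[OF v] C1(2)[OF d] by auto
      show "AE x in M. \<bar>?D x\<bar> \<le> ?A * ?gv x + ?B * ?gd x"
        using R(2) Bp(2) sup_const(2)[OF w] sup_const(2)[OF d] gd
      proof eventually_elim
        case (elim x)
        let ?a = "dir_deriv a (ybar x) (v x)" and ?b = "dir_deriv a (ybar x) (w x)"
        have cs: "\<bar>u \<bullet> ?P x\<bar> \<le> norm u * Bp" for u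
          using Cauchy_Schwarz_ineq2[of u "?P x"] mult_left_mono[OF elim(2), of "norm u"] by simp
        have "\<bar>?a - ?b\<bar> \<le> L * \<bar>v x - w x\<bar>" by (rule dir_deriv_lipschitz[OF L(2) elim(1)])
        also have "\<dots> \<le> L * (?k * nm (v - w))" using elim(4) L(1) by (intro mult_left_mono) auto
        finally have 1: "\<bar>?a - ?b\<bar> \<le> L * (?k * nm (v - w))" .
        have "\<bar>?b\<bar> \<le> L * \<bar>w x\<bar>" using dir_deriv_lipschitz[OF L(2) elim(1), of "w x" 0] by simp
        also have "\<dots> \<le> L * (?k * nm w)" using elim(3) L(1) by (intro mult_left_mono) auto
        finally have 2: "\<bar>?b\<bar> \<le> L * (?k * nm w)" .
        have e: "?D x = (?a - ?b) * (weak_grad \<Omega> v x \<bullet> ?P x) + ?b * (weak_grad \<Omega> (v - w) x \<bullet> ?P x)"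
          by (simp only: elim(5) inner_diff_left) (simp add: algebra_simps)
        have "\<bar>?D x\<bar> \<le> \<bar>?a - ?b\<bar> * \<bar>weak_grad \<Omega> v x \<bullet> ?P x\<bar> + \<bar>?b\<bar> * \<bar>weak_grad \<Omega> (v - w) x \<bullet> ?P x\<bar>"
          unfolding e abs_mult[symmetric] by (rule abs_triangle_ineq)
        also have "\<dots> \<le> (L * (?k * nm (v - w))) * (?gv x * Bp) + (L * (?k * nm w)) * (?gd x * Bp)"
          using 1 2 cs by (intro add_mono mult_mono) auto
        finally show ?case by (simp only: mult_ac)
      qed
    qed
    also have "\<dots> = ?A * (LINT x|M. ?gv x) + ?B * (LINT x|M. ?gd x)" using C1(2)[OF v] C1(2)[OF d] by simp
    also have "\<dots> \<le> ?A * (C1 * nm v) + ?B * (C1 * nm (v - w))"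
      using AB C1(3)[OF v] C1(3)[OF d] by (intro add_mono mult_left_mono) auto
    also have "\<dots> = (L * ?k * Bp * C1) * (nm (v - w) * (nm v + nm w))" by (simp add: algebra_simps)
    also have "\<dots> \<le> C * (nm (v - w) * (nm v + nm w))"
      unfolding C_def using W.nonneg by (intro mult_right_mono) auto
    finally show "\<bar>kink_term v - kink_term w\<bar> \<le> C * nm (v - w) * (nm v + nm w)" by (simp only: mult.assoc)
  qed
qed

lemma curvature_lipschitz:
  obtains C where "0 < C" "\<And>v w. v \<in> W01p \<Omega> p \<Longrightarrow> w \<in> W01p \<Omega> p \<Longrightarrow>
    \<bar>curvature v - curvature w\<bar> \<le> C * nm (v - w) * (nm v + nm w)"
proof -
  obtain A where A: "0 < A" "\<And>v w. v \<in> W01p \<Omega> p \<Longrightarrow> w \<in> W01p \<Omega> p \<Longrightarrow>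
    \<bar>G'' ybar v v - G'' ybar w w\<bar> \<le> A * nm (v - w) * (nm v + nm w)" using G''_lipschitz by blast
  obtain B where B: "0 < B" "\<And>v w. v \<in> W01p \<Omega> p \<Longrightarrow> w \<in> W01p \<Omega> p \<Longrightarrow>
    \<bar>smooth_term v - smooth_term w\<bar> \<le> B * nm (v - w) * (nm v + nm w)" using smooth_term_lipschitz by blast
  obtain C where C: "0 < C" "\<And>v w. v \<in> W01p \<Omega> p \<Longrightarrow> w \<in> W01p \<Omega> p \<Longrightarrow>
    \<bar>kink_term v - kink_term w\<bar> \<le> C * nm (v - w) * (nm v + nm w)" using kink_term_lipschitz by blast
  show thesis
  proof (rule that[of "1 / 2 * A + 1 / 2 * B + C"])
    fix v w assume vw: "v \<in> W01p \<Omega> p" "w \<in> W01p \<Omega> p"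
    let ?N = "nm (v - w) * (nm v + nm w)"
    have "\<bar>G'' ybar v v - G'' ybar w w\<bar> \<le> A * ?N" "\<bar>smooth_term v - smooth_term w\<bar> \<le> B * ?N" "\<bar>kink_term v - kink_term w\<bar> \<le> C * ?N"
      using A(2)[OF vw] B(2)[OF vw] C(2)[OF vw] by (simp_all only: mult.assoc)
    then have "\<bar>curvature v - curvature w\<bar> \<le> 1 / 2 * (A * ?N) + 1 / 2 * (B * ?N) + C * ?N"
      unfolding curvature_def by linarith
    then show "\<bar>curvature v - curvature w\<bar> \<le> (1 / 2 * A + 1 / 2 * B + C) * nm (v - w) * (nm v + nm w)"
      by (simp add: algebra_simps add_divide_distrib)
  qed (use A B C in simp)
qed

text \<open>The directional derivative is only positively homogeneous, hence c > 0; multiplied by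
  the gradient, which is linear in w, it scales by c^2.\<close>

lemma curvature_scale:
  assumes w: "w \<in> W01p \<Omega> p" and c: "0 < c"
  shows "curvature (c *\<^sub>R w) = c\<^sup>2 * curvature w"
proof -
  note B = H.bounded_bilinear_form[OF G''_form]
  have "G'' ybar (c *\<^sub>R w) (c *\<^sub>R w) = c\<^sup>2 * G'' ybar w w"
    using B(2)[OF W01p_H10[OF w] W01p_H10[OF W.scale[OF w]]] B(4)[OF W01p_H10[OF w] W01p_H10[OF w]]
    by (simp add: power2_eq_square)
  moreover have "smooth_term (c *\<^sub>R w) = c\<^sup>2 * smooth_term w"
  proof -
    have "D2 K t a (ybar x) * (c *\<^sub>R w) x * (c *\<^sub>R w) x * dot x = c\<^sup>2 * (D2 K t a (ybar x) * w x * w x * dot x)" for x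
      by (simp add: scaleR_fun_def power2_eq_square mult_ac)
    then show ?thesis unfolding smooth_term_def by (simp only: integral_mult_right_zero)
  qed
  moreover have "kink_term (c *\<^sub>R w) = c\<^sup>2 * kink_term w"
  proof -
    note [measurable] = W_measurable[OF w] W_measurable[OF W.scale[OF w]] W_measurable(1)[OF ybar_mem] phibar_measurable
    have "kink_term (c *\<^sub>R w) = (LINT x|M. c\<^sup>2 * (dir_deriv a (ybar x) (w x) * (weak_grad \<Omega> w x \<bullet> weak_grad \<Omega> phibar x)))"
      unfolding kink_term_def
    proof (rule integral_cong_AE)
      show "AE x in M. dir_deriv a (ybar x) ((c *\<^sub>R w) x) * (weak_grad \<Omega> (c *\<^sub>R w) x \<bullet> weak_grad \<Omega> phibar x) =
         c\<^sup>2 * (dir_deriv a (ybar x) (w x) * (weak_grad \<Omega> w x \<bullet> weak_grad \<Omega> phibar x))"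
        using W1p_scaleR(2)[OF domain(1) W01pD[OF w], of c]
        by eventually_elim (simp add: scaleR_fun_def dir_deriv_scale[OF c] power2_eq_square mult_ac)
    qed measurable
    then show ?thesis by (simp add: kink_term_def)
  qed
  ultimately show ?thesis unfolding curvature_def by (simp add: algebra_simps)
qed

subsection \<open>The functional \<open>Q\<^sub>2\<close>\<close>

text \<open>Frechet differentiability gives the expansion in \<open>W01p\<close>, and the supremum
  bound makes it uniform in x.\<close>

lemma S_expansion:
  assumes h: "h \<in> L2 M" and \<eta>: "0 < \<eta>"
  obtains s0 where "0 < s0" "\<And>s. 0 < s \<Longrightarrow> s < s0 \<Longrightarrow>
    AE x in M. \<bar>S (fnl \<Omega> (ubar + s *\<^sub>R h)) x - ybar x - s * z h x\<bar> \<le> \<eta> * s"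
proof -
  define N where "N = pair_const * Lp_norm \<Omega> 2 h + 1"
  have N: "0 < N" using pair_const(1) by (simp add: N_def Lp_norm_2 add_nonneg_pos)
  \<comment> \<open>Compensates three factors: 4 from the quasi-triangle inequality,
    \<open>N\<close> bounding the dual norm of h, and \<open>sup_const\<close> from the passage to
    the supremum.\<close>
  define \<epsilon> where "\<epsilon> = \<eta> / (4 * N * sup_const)"
  have \<epsilon>: "0 < \<epsilon>" using \<eta> N sup_const(1) by (simp add: \<epsilon>_def)
  obtain C where C: "0 < C" "\<And>F H. F \<in> Wm1p \<Omega> p \<Longrightarrow> H \<in> Wm1p \<Omega> p \<Longrightarrow> nm (S' F0 F - S' F0 H) \<le> C * Wm1p_norm \<Omega> p (F - H)"
    using S'_diff_bound by blast
  have "\<exists>\<rho>>0. \<forall>H\<in>Wm1p \<Omega> p. Wm1p_norm \<Omega> p H < \<rho> \<longrightarrow> nm (S (F0 + H) - S F0 - S' F0 H) \<le> \<epsilon> * Wm1p_norm \<Omega> p H"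
    using S' F0_Wm1p \<epsilon> unfolding has_frechet_derivative_def by blast
  then obtain \<rho> where \<rho>: "0 < \<rho>" "\<And>H. H \<in> Wm1p \<Omega> p \<Longrightarrow> Wm1p_norm \<Omega> p H < \<rho> \<Longrightarrow> nm (S (F0 + H) - S F0 - S' F0 H) \<le> \<epsilon> * Wm1p_norm \<Omega> p H"
    by blast
  show thesis
  proof (rule that[of "\<rho> / N"])
    show "0 < \<rho> / N" using \<rho> N by simp
    fix s assume s: "0 < s" "s < \<rho> / N"
    \<comment> \<open>The increment agrees with \<open>s *\<^sub>R fnl \<Omega> h\<close> on
      \<open>W01p \<Omega> q\<close>, but not necessarily at every argument; hence the detour
      through distances of seminorm zero.\<close>
    define H where "H = fnl \<Omega> (ubar + s *\<^sub>R h) - F0"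
    have mem: "fnl \<Omega> (ubar + s *\<^sub>R h) \<in> Wm1p \<Omega> p" by (rule fnl_Wm1p[OF L2_lin[OF h]])
    have H: "H \<in> Wm1p \<Omega> p" unfolding H_def using mem F0_Wm1p unfolding Wm1p_eq by (rule X.dual_diff)
    have sF: "s *\<^sub>R fnl \<Omega> h \<in> Wm1p \<Omega> p" using fnl_Wm1p[OF h] unfolding Wm1p_eq by (rule X.dual_scale)
    have Hw: "H w = s * fnl \<Omega> h w" if w: "w \<in> W01p \<Omega> q" for w
    proof -
      have "fnl \<Omega> (ubar + s *\<^sub>R h) w = (LINT x|M. ubar x * w x + s * (h x * w x))"
        by (simp add: fnl_def scaleR_fun_def distrib_right mult.assoc)
      also have "\<dots> = fnl \<Omega> ubar w + s * fnl \<Omega> h w"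
        using pair_const(2)[OF ubar_L2 w] pair_const(2)[OF h w] by (simp add: fnl_def)
      finally show ?thesis by (simp add: H_def F0_def)
    qed
    have Hn: "Wm1p_norm \<Omega> p H \<le> s * N"
      unfolding Wm1p_eq
    proof (rule X.dual_norm_le)
      fix w assume w: "w \<in> W01p \<Omega> q" "W1p_norm \<Omega> q w \<le> 1"
      have l0: "0 \<le> pair_const * Lp_norm \<Omega> 2 h" using pair_const(1) by (simp add: Lp_norm_2)
      have "\<bar>fnl \<Omega> h w\<bar> \<le> pair_const * Lp_norm \<Omega> 2 h * W1p_norm \<Omega> q w" by (rule fnl_bound[OF h w(1)])
      also have "\<dots> \<le> pair_const * Lp_norm \<Omega> 2 h * 1" using w(2) l0 by (rule mult_left_mono)
      also have "\<dots> \<le> N" by (simp add: N_def)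
      finally show "\<bar>H w\<bar> \<le> s * N" using s(1) by (simp add: Hw[OF w(1)] abs_mult)
    qed
    have "s * N < \<rho>" using s N by (simp add: field_simps)
    then have "nm (S (F0 + H) - S F0 - S' F0 H) \<le> \<epsilon> * Wm1p_norm \<Omega> p H" using Hn by (intro \<rho>(2)[OF H]) simp
    also have "\<dots> \<le> \<epsilon> * (s * N)" using Hn \<epsilon> by simp
    finally have 1: "nm (S (F0 + H) - S F0 - S' F0 H) \<le> \<epsilon> * (s * N)" .
    have "Wm1p_norm \<Omega> p (H - s *\<^sub>R fnl \<Omega> h) = 0"
      using H sF Hw unfolding Wm1p_eq by (intro X.dual_norm_eq_0I X.dual_diff) (auto simp: scaleR_fun_def)
    then have 2: "nm (S' F0 H - S' F0 (s *\<^sub>R fnl \<Omega> h)) = 0"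
      using C(2)[OF H sF] W.nonneg[of "S' F0 H - S' F0 (s *\<^sub>R fnl \<Omega> h)"] by simp
    have 3: "nm (S' F0 (s *\<^sub>R fnl \<Omega> h) - s *\<^sub>R z h) = 0"
      using z_scale[OF h, of s] unfolding z_def fnl_scale .
    have F0H: "F0 + H = fnl \<Omega> (ubar + s *\<^sub>R h)" by (simp add: H_def)
    let ?w = "S (fnl \<Omega> (ubar + s *\<^sub>R h)) - ybar - s *\<^sub>R z h"
    have m: "S (fnl \<Omega> (ubar + s *\<^sub>R h)) \<in> W01p \<Omega> p" "S F0 \<in> W01p \<Omega> p" "S' F0 H \<in> W01p \<Omega> p" "S' F0 (s *\<^sub>R fnl \<Omega> h) \<in> W01p \<Omega> p" "s *\<^sub>R z h \<in> W01p \<Omega> p"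
      by (intro S_mem mem F0_Wm1p S'_mem H sF W.scale z_mem h)+
    have e: "?w = (S (F0 + H) - S F0 - S' F0 H) + ((S' F0 H - S' F0 (s *\<^sub>R fnl \<Omega> h)) + (S' F0 (s *\<^sub>R fnl \<Omega> h) - s *\<^sub>R z h))"
      by (simp add: F0H ybar flip: F0_def)
    have "nm ?w \<le> 4 * (nm (S (F0 + H) - S F0 - S' F0 H) + nm ((S' F0 H - S' F0 (s *\<^sub>R fnl \<Omega> h)) + (S' F0 (s *\<^sub>R fnl \<Omega> h) - s *\<^sub>R z h)))"
      unfolding e F0H by (intro W.tri W.diff W.add m)
    also have "\<dots> \<le> 4 * (\<epsilon> * (s * N) + 0)"
    proof (intro mult_left_mono add_mono 1)
      show "nm ((S' F0 H - S' F0 (s *\<^sub>R fnl \<Omega> h)) + (S' F0 (s *\<^sub>R fnl \<Omega> h) - s *\<^sub>R z h)) \<le> 0"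
        using W.tri[OF W.diff[OF m(3,4)] W.diff[OF m(4,5)]] 2 3 by simp
    qed simp
    finally have nw: "nm ?w \<le> 4 * (\<epsilon> * (s * N))" by simp
    have wm: "?w \<in> W01p \<Omega> p" unfolding F0_def[symmetric] by (intro W.diff m ybar_mem)
    have "sup_const * nm ?w \<le> sup_const * (4 * (\<epsilon> * (s * N)))" using nw sup_const(1) by simp
    also have "\<dots> = \<eta> * s" using N sup_const(1) by (simp add: \<epsilon>_def)
    finally have le: "sup_const * nm ?w \<le> \<eta> * s" .
    show "AE x in M. \<bar>S (fnl \<Omega> (ubar + s *\<^sub>R h)) x - ybar x - s * z h x\<bar> \<le> \<eta> * s"
      using sup_const(2)[OF wm]
    proof eventually_elim
      case (elim x)
      then show ?case using le by (simp add: scaleR_fun_def)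
    qed
  qed
qed

text \<open>A finite upper limit of f(r)/r means f(r) <= c r for small r. The Euclidean norm of the
  gradient is bounded by the sum of its components, the form used in
  \<open>jump_functional\<close>.\<close>

lemma Sigma_bound:
  obtains C r0 where "0 < C" "0 < r0" "\<And>r. 0 < r \<Longrightarrow> r < r0 \<Longrightarrow>
    (\<integral>\<^sup>+x. ennreal (near_kinks r (ybar x) * norm (weak_grad \<Omega> ybar x)) \<partial>M) \<le> ennreal (C * r)"
proof -
  define f where "f r = (\<Sum>m\<in>(UNIV::'n set). \<Sum>i=1..K. ennreal (jump t ai i) *
          (\<integral>\<^sup>+x. ennreal (indicator {x. 0 < \<bar>ybar x - t i\<bar> \<and> \<bar>ybar x - t i\<bar> \<le> r} x * \<bar>weak_grad \<Omega> ybar x $ m\<bar>) \<partial>M))" for r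
  note [measurable] = W_measurable[OF ybar_mem]
  obtain c where c: "Limsup (at_right 0) (\<lambda>r. ennreal (1 / r) * f r) < ennreal c" "0 < c"
  proof -
    obtain L where L: "Limsup (at_right 0) (\<lambda>r. ennreal (1 / r) * f r) = ennreal L" "0 \<le> L"
      using Sigma_finite unfolding jump_functional_def f_def
      by (cases "Limsup (at_right 0) (\<lambda>r. ennreal (1 / r) * f r)" rule: ennreal_cases) (auto simp: f_def)
    then have "Limsup (at_right 0) (\<lambda>r. ennreal (1 / r) * f r) < ennreal (L + 1)" by (simp add: ennreal_less_iff del: ennreal_plus)
    then show thesis using that[of "L + 1"] L(2) by simp
  qed
  from Limsup_lessD[OF c(1)] obtain r0 where r0: "0 < r0" "\<And>r. 0 < r \<Longrightarrow> r < r0 \<Longrightarrow> ennreal (1 / r) * f r < ennreal c"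
    by (auto simp: eventually_at_right_field)
  show thesis
  proof (rule that[OF c(2) r0(1)])
    fix r assume r: "0 < r" "r < r0"
    let ?h = "\<lambda>m i x. indicator {x. 0 < \<bar>ybar x - t i\<bar> \<and> \<bar>ybar x - t i\<bar> \<le> r} x * \<bar>weak_grad \<Omega> ybar x $ m\<bar>"
    have hm: "(\<lambda>x. ?h m i x) \<in> borel_measurable M" for m i
    proof -
      have [measurable]: "(\<lambda>x. weak_grad \<Omega> ybar x $ m) \<in> borel_measurable M"
        using borel_measurable_inner[OF W_measurable(2)[OF ybar_mem] borel_measurable_const[of "axis m 1"]]
        by (simp add: inner_axis)
      have "(\<lambda>x. indicator {y. 0 < \<bar>y - t i\<bar> \<and> \<bar>y - t i\<bar> \<le> r} (ybar x) * \<bar>weak_grad \<Omega> ybar x $ m\<bar>) \<in> borel_measurable M"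
        by measurable
      then show ?thesis by (simp add: indicator_def)
    qed
    have he: "(\<lambda>x. ennreal (?h m i x)) \<in> borel_measurable M" for m i
      by (rule measurable_compose[OF hm measurable_ennreal])
    have "(\<integral>\<^sup>+x. ennreal (near_kinks r (ybar x) * norm (weak_grad \<Omega> ybar x)) \<partial>M) \<le>
        (\<integral>\<^sup>+x. (\<Sum>m\<in>(UNIV::'n set). \<Sum>i=1..K. ennreal (jump t ai i) * ennreal (?h m i x)) \<partial>M)"
    proof (rule nn_integral_mono)
      fix x
      have nk: "0 \<le> near_kinks r (ybar x)"
        unfolding near_kinks_def by (intro sum_nonneg mult_nonneg_nonneg jump_nonneg) auto
      have "near_kinks r (ybar x) * norm (weak_grad \<Omega> ybar x) \<le> near_kinks r (ybar x) * (\<Sum>m\<in>UNIV. \<bar>weak_grad \<Omega> ybar x $ m\<bar>)"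
        by (intro mult_left_mono norm_le_l1_cart nk)
      also have "\<dots> = (\<Sum>m\<in>UNIV. \<Sum>i=1..K. jump t ai i * ?h m i x)"
        unfolding near_kinks_def sum_distrib_left sum_distrib_right
        by (intro sum.cong refl) (simp add: indicator_def)
      finally have "ennreal (near_kinks r (ybar x) * norm (weak_grad \<Omega> ybar x)) \<le> ennreal (\<Sum>m\<in>UNIV. \<Sum>i=1..K. jump t ai i * ?h m i x)"
        by (rule ennreal_leI)
      also have "\<dots> = (\<Sum>m\<in>UNIV. \<Sum>i=1..K. ennreal (jump t ai i * ?h m i x))"
        using jump_nonneg by (subst sum_ennreal[symmetric], simp add: sum_nonneg, intro sum.cong refl sum_ennreal[symmetric]) simp
      also have "\<dots> = (\<Sum>m\<in>UNIV. \<Sum>i=1..K. ennreal (jump t ai i) * ennreal (?h m i x))"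
        using jump_nonneg by (intro sum.cong refl ennreal_mult') 
      finally show "ennreal (near_kinks r (ybar x) * norm (weak_grad \<Omega> ybar x)) \<le>
         (\<Sum>m\<in>UNIV. \<Sum>i=1..K. ennreal (jump t ai i) * ennreal (?h m i x))" .
    qed
    also have "\<dots> = f r"
    proof -
      have "(\<integral>\<^sup>+x. (\<Sum>m\<in>(UNIV::'n set). \<Sum>i=1..K. ennreal (jump t ai i) * ennreal (?h m i x)) \<partial>M) =
          (\<Sum>m\<in>(UNIV::'n set). \<integral>\<^sup>+x. (\<Sum>i=1..K. ennreal (jump t ai i) * ennreal (?h m i x)) \<partial>M)"
        by (rule nn_integral_sum) (intro borel_measurable_sum borel_measurable_times_ennreal borel_measurable_const he)
      also have "\<dots> = (\<Sum>m\<in>(UNIV::'n set). \<Sum>i=1..K. \<integral>\<^sup>+x. ennreal (jump t ai i) * ennreal (?h m i x) \<partial>M)"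
        by (intro sum.cong refl nn_integral_sum borel_measurable_times_ennreal borel_measurable_const he)
      also have "\<dots> = f r"
        unfolding f_def by (intro sum.cong refl nn_integral_cmult he)
      finally show ?thesis .
    qed
    also have "f r = ennreal r * (ennreal (1 / r) * f r)"
    proof -
      have "ennreal r * ennreal (1 / r) = 1" using r(1) by (simp add: ennreal_mult'[symmetric])
      then show ?thesis by (simp add: mult.assoc[symmetric])
    qed
    also have "\<dots> \<le> ennreal r * ennreal c" using r0(2)[OF r] by (intro mult_left_mono) auto
    also have "\<dots> = ennreal (c * r)" using r(1) ennreal_mult'[of r c] by (simp add: mult.commute[of c r])
    finally show "(\<integral>\<^sup>+x. ennreal (near_kinks r (ybar x) * norm (weak_grad \<Omega> ybar x)) \<partial>M) \<le> ennreal (c * r)" .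
  qed
qed

section \<open>Finiteness and Lipschitz continuity of the kink functional\<close>

text \<open>The integral whose second-order quotient defines \<open>Q_tilde\<close>. It depends on s
  and h only through \<open>s *\<^sub>R h\<close>, which will give the scaling law.\<close>

definition zeta_int :: "real \<Rightarrow> (real^'n \<Rightarrow> real) \<Rightarrow> real"
  where "zeta_int s h = (LINT x|M. (\<Sum>i\<le>K. zeta K t ai \<delta> i (ybar x) (S (fnl \<Omega> (ubar + s *\<^sub>R h)) x)) * dot x)"

abbreviation "Q2 \<equiv> Q_2 \<Omega> K t ai \<delta> S ubar ybar phibar"
abbreviation "Qt \<equiv> Q_tilde \<Omega> K t ai \<delta> S ubar ybar phibar"

lemma Qt_eq: "Qt s h = liminf (\<lambda>n. ereal (1 / (s n)\<^sup>2 * zeta_int (s n) h))"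
  by (simp add: Q_tilde_def zeta_int_def dot_def)

lemma dot_integrable: "integrable M dot"
proof -
  obtain Bp where Bp: "0 < Bp" "AE x in M. norm (weak_grad \<Omega> phibar x) \<le> Bp" using phibar_grad_bounded by blast
  have C1: "integrable M (\<lambda>x. norm (weak_grad \<Omega> ybar x))"
    by (rule grad_L1) (use ybar_mem in simp)
  show ?thesis
  proof (rule Bochner_Integration.integrable_bound)
    show "integrable M (\<lambda>x. norm (weak_grad \<Omega> ybar x) * Bp)" using C1 by auto
    show "AE x in M. norm (dot x) \<le> norm (norm (weak_grad \<Omega> ybar x) * Bp)"
      using Bp(2)
    proof eventually_elim
      case (elim x)
      have "\<bar>dot x\<bar> \<le> norm (weak_grad \<Omega> ybar x) * norm (weak_grad \<Omega> phibar x)" unfolding dot_def by (rule Cauchy_Schwarz_ineq2)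
      also have "\<dots> \<le> norm (weak_grad \<Omega> ybar x) * Bp" using elim by (intro mult_left_mono) auto
      finally show ?case using Bp(1) by simp
    qed
  qed measurable
qed

text \<open>\<open>zeta\<close> is bounded by virtue of its windows of width \<delta>, and
  \<open>dot\<close> is integrable.\<close>

lemma zeta_int_integrable:
  assumes h: "h \<in> L2 M"
  shows "integrable M (\<lambda>x. (\<Sum>i\<le>K. zeta K t ai \<delta> i (ybar x) (S (fnl \<Omega> (ubar + s *\<^sub>R h)) x)) * dot x)"
proof -
  define B where "B i = (SOME B. \<forall>y y'. \<bar>zeta K t ai \<delta> i y y'\<bar> \<le> B)" for i
  have B: "\<bar>zeta K t ai \<delta> i y y'\<bar> \<le> B i" for i y y'
  proof -
    have "\<exists>B. \<forall>y y'. \<bar>zeta K t ai \<delta> i y y'\<bar> \<le> B" using zeta_bounded[of \<delta> i] by blast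
    from someI_ex[OF this] show ?thesis by (simp add: B_def)
  qed
  note [measurable] = W_measurable(1)[OF ybar_mem] W_measurable(1)[OF S_mem[OF fnl_Wm1p[OF L2_lin[OF h]]]]
  show ?thesis
  proof (rule Bochner_Integration.integrable_bound)
    show "integrable M (\<lambda>x. (\<Sum>i\<le>K. B i) * dot x)" using dot_integrable by auto
    show "AE x in M. norm ((\<Sum>i\<le>K. zeta K t ai \<delta> i (ybar x) (S (fnl \<Omega> (ubar + s *\<^sub>R h)) x)) * dot x) \<le> norm ((\<Sum>i\<le>K. B i) * dot x)"
    proof (rule AE_I2)
      fix x
      have "\<bar>\<Sum>i\<le>K. zeta K t ai \<delta> i (ybar x) (S (fnl \<Omega> (ubar + s *\<^sub>R h)) x)\<bar> \<le> (\<Sum>i\<le>K. B i)"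
        by (rule order_trans[OF sum_abs sum_mono]) (rule B)
      then have "\<bar>\<Sum>i\<le>K. zeta K t ai \<delta> i (ybar x) (S (fnl \<Omega> (ubar + s *\<^sub>R h)) x)\<bar> * \<bar>dot x\<bar> \<le> \<bar>\<Sum>i\<le>K. B i\<bar> * \<bar>dot x\<bar>"
        by (intro mult_right_mono) auto
      then show "norm ((\<Sum>i\<le>K. zeta K t ai \<delta> i (ybar x) (S (fnl \<Omega> (ubar + s *\<^sub>R h)) x)) * dot x) \<le> norm ((\<Sum>i\<le>K. B i) * dot x)"
        by (simp only: real_norm_def abs_mult)
    qed
  qed measurable
qed

text \<open>Only points with \<open>0 < \<bar>y - t\<^sub>i\<bar> \<le> O(s)\<close> contribute, and there the integrand is Lipschitz in the perturbed
  state, which is \<open>O(s)\<close>-close to \<open>y\<close>; finiteness of the jump functional supplies the second factor \<open>s\<close>.\<close>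

lemma zeta_int_lipschitz:
  "\<exists>C>0. \<forall>h k m \<rho> \<eta>. h \<in> L2 M \<longrightarrow> k \<in> L2 M \<longrightarrow> 0 \<le> m \<longrightarrow> 0 \<le> \<rho> \<longrightarrow> 0 < \<eta> \<longrightarrow>
    (AE x in M. \<bar>z h x\<bar> \<le> m) \<longrightarrow> (AE x in M. \<bar>z k x\<bar> \<le> m) \<longrightarrow> (AE x in M. \<bar>z h x - z k x\<bar> \<le> \<rho>) \<longrightarrow>
    (\<exists>s0>0. \<forall>s. 0 < s \<and> s < s0 \<longrightarrow> \<bar>1 / s\<^sup>2 * zeta_int s h - 1 / s\<^sup>2 * zeta_int s k\<bar> \<le> C * (m + \<eta>) * (\<rho> + 2 * \<eta>))"
proof -
  obtain C0 r0 where C0: "0 < C0" "0 < r0" "\<And>r. 0 < r \<Longrightarrow> r < r0 \<Longrightarrow>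
    (\<integral>\<^sup>+x. ennreal (near_kinks r (ybar x) * norm (weak_grad \<Omega> ybar x)) \<partial>M) \<le> ennreal (C0 * r)" using Sigma_bound by blast
  obtain Bp where Bp: "0 < Bp" "AE x in M. norm (weak_grad \<Omega> phibar x) \<le> Bp" using phibar_grad_bounded by blast
  show ?thesis
  proof (rule exI[of _ "2 * Bp * C0"], intro conjI allI impI)
    show "0 < 2 * Bp * C0" using C0 Bp by simp
    fix h k :: "real^'n \<Rightarrow> real" and m \<rho> \<eta> :: real
    assume h: "h \<in> L2 M" and k: "k \<in> L2 M" and m: "0 \<le> m" and \<rho>: "0 \<le> \<rho>" and \<eta>: "0 < \<eta>"
      and zh: "AE x in M. \<bar>z h x\<bar> \<le> m" and zk: "AE x in M. \<bar>z k x\<bar> \<le> m" and zd: "AE x in M. \<bar>z h x - z k x\<bar> \<le> \<rho>"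
    obtain s1 where s1: "0 < s1" "\<And>s. 0 < s \<Longrightarrow> s < s1 \<Longrightarrow>
      AE x in M. \<bar>S (fnl \<Omega> (ubar + s *\<^sub>R h)) x - ybar x - s * z h x\<bar> \<le> \<eta> * s" using S_expansion[OF h \<eta>] by blast
    obtain s2 where s2: "0 < s2" "\<And>s. 0 < s \<Longrightarrow> s < s2 \<Longrightarrow>
      AE x in M. \<bar>S (fnl \<Omega> (ubar + s *\<^sub>R k)) x - ybar x - s * z k x\<bar> \<le> \<eta> * s" using S_expansion[OF k \<eta>] by blast
    have me: "0 < m + \<eta>" using m \<eta> by simp
    \<comment> \<open>Below \<open>s0\<close> both expansions of the state hold, s (m + \<eta>) <
      \<delta> keeps the cut-offs in \<open>zeta\<close> inactive, and s (m + \<eta>) < r0 puts the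
      linear bound on the jump integral into force.\<close>
    define s0 where "s0 = min (min s1 s2) (min (\<delta> / (m + \<eta>)) (r0 / (m + \<eta>)))"
    show "\<exists>s0>0. \<forall>s. 0 < s \<and> s < s0 \<longrightarrow> \<bar>1 / s\<^sup>2 * zeta_int s h - 1 / s\<^sup>2 * zeta_int s k\<bar> \<le> 2 * Bp * C0 * (m + \<eta>) * (\<rho> + 2 * \<eta>)"
    proof (intro exI[of _ s0] conjI allI impI)
      show "0 < s0" using s1 s2 me delta C0 by (simp add: s0_def)
      fix s assume s: "0 < s \<and> s < s0"
      then have s': "0 < s" "s < s1" "s < s2" "s * (m + \<eta>) < \<delta>" "s * (m + \<eta>) < r0"
        using me by (auto simp: s0_def pos_less_divide_eq)
      \<comment> \<open>\<open>?r\<close> bounds the distance of both perturbed states from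
        \<open>ybar\<close>, and \<open>?\<rho>\<close> their mutual distance.\<close>
      let ?r = "s * (m + \<eta>)" and ?\<rho> = "s * (\<rho> + 2 * \<eta>)"
      let ?yh = "S (fnl \<Omega> (ubar + s *\<^sub>R h))" and ?yk = "S (fnl \<Omega> (ubar + s *\<^sub>R k))"
      let ?Z = "\<lambda>y x. \<Sum>i\<le>K. zeta K t ai \<delta> i (ybar x) (y x)"
      have r: "0 < ?r" "0 \<le> ?\<rho>" using s' me \<rho> \<eta> by auto
      have ptw: "AE x in M. \<bar>?Z ?yh x * dot x - ?Z ?yk x * dot x\<bar> \<le> 2 * ?\<rho> * Bp * (near_kinks ?r (ybar x) * norm (weak_grad \<Omega> ybar x))"
        using s1(2)[OF s'(1,2)] s2(2)[OF s'(1,3)] zh zk zd Bp(2)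
      proof eventually_elim
        case (elim x)
        have b: "\<bar>s * z h x\<bar> \<le> s * m" "\<bar>s * z k x\<bar> \<le> s * m" "\<bar>s * z h x - s * z k x\<bar> \<le> s * \<rho>"
          using elim s'(1) by (simp_all add: abs_mult right_diff_distrib[symmetric])
        have yh: "\<bar>?yh x - ybar x\<bar> \<le> ?r" and yk: "\<bar>?yk x - ybar x\<bar> \<le> ?r"
          using b(1,2) elim(1,2) by (simp_all add: distrib_left mult.commute[of \<eta>])
        have yd: "\<bar>?yh x - ?yk x\<bar> \<le> ?\<rho>"
        proof -
          have "\<bar>?yh x - ?yk x\<bar> \<le> s * \<rho> + \<eta> * s + \<eta> * s" using b(3) elim(1,2) by linarith
          then show ?thesis by (simp add: algebra_simps)
        qed
        have nk: "0 \<le> near_kinks ?r (ybar x)"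
          unfolding near_kinks_def by (intro sum_nonneg mult_nonneg_nonneg jump_nonneg) auto
        have "\<bar>?Z ?yh x - ?Z ?yk x\<bar> \<le> 2 * near_kinks ?r (ybar x) * \<bar>?yh x - ?yk x\<bar>"
          by (rule sum_zeta_lipschitz[OF yh yk s'(4)])
        also have "\<dots> \<le> 2 * near_kinks ?r (ybar x) * ?\<rho>" using yd nk by (intro mult_left_mono) auto
        finally have A: "\<bar>?Z ?yh x - ?Z ?yk x\<bar> \<le> 2 * near_kinks ?r (ybar x) * ?\<rho>" .
        have "\<bar>dot x\<bar> \<le> norm (weak_grad \<Omega> ybar x) * norm (weak_grad \<Omega> phibar x)" unfolding dot_def by (rule Cauchy_Schwarz_ineq2)
        also have "\<dots> \<le> norm (weak_grad \<Omega> ybar x) * Bp" using elim(6) by (intro mult_left_mono) auto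
        finally have "\<bar>?Z ?yh x - ?Z ?yk x\<bar> * \<bar>dot x\<bar> \<le> (2 * near_kinks ?r (ybar x) * ?\<rho>) * (norm (weak_grad \<Omega> ybar x) * Bp)"
          using A nk r by (intro mult_mono) auto
        then show ?case unfolding left_diff_distrib[symmetric] abs_mult by (simp only: mult_ac)
      qed
      have I: "integrable M (\<lambda>x. ?Z ?yh x * dot x - ?Z ?yk x * dot x)"
        by (intro Bochner_Integration.integrable_diff zeta_int_integrable h k)
      note [measurable] = W_measurable[OF ybar_mem]
      have [measurable]: "near_kinks ?r \<in> borel_measurable borel"
        unfolding near_kinks_def[abs_def] by measurable
      have "ennreal \<bar>zeta_int s h - zeta_int s k\<bar> = ennreal (norm (LINT x|M. ?Z ?yh x * dot x - ?Z ?yk x * dot x))"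
        unfolding zeta_int_def using zeta_int_integrable[OF h] zeta_int_integrable[OF k] by simp
      also have "\<dots> \<le> (\<integral>\<^sup>+x. ennreal (norm (?Z ?yh x * dot x - ?Z ?yk x * dot x)) \<partial>M)"
        by (rule integral_norm_bound_ennreal[OF I])
      also have "\<dots> \<le> (\<integral>\<^sup>+x. ennreal (2 * ?\<rho> * Bp) * ennreal (near_kinks ?r (ybar x) * norm (weak_grad \<Omega> ybar x)) \<partial>M)"
      proof (rule nn_integral_mono_AE)
        show "AE x in M. ennreal (norm (?Z ?yh x * dot x - ?Z ?yk x * dot x)) \<le> ennreal (2 * ?\<rho> * Bp) * ennreal (near_kinks ?r (ybar x) * norm (weak_grad \<Omega> ybar x))"
          using ptw
        proof eventually_elim
          case (elim x)
          have "0 \<le> 2 * ?\<rho> * Bp" using r Bp(1) by simp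
          from ennreal_leI[OF elim] show ?case unfolding ennreal_mult'[OF \<open>0 \<le> 2 * ?\<rho> * Bp\<close>] real_norm_def .
        qed
      qed
      also have "\<dots> = ennreal (2 * ?\<rho> * Bp) * (\<integral>\<^sup>+x. ennreal (near_kinks ?r (ybar x) * norm (weak_grad \<Omega> ybar x)) \<partial>M)"
        by (rule nn_integral_cmult) measurable
      also have "\<dots> \<le> ennreal (2 * ?\<rho> * Bp) * ennreal (C0 * ?r)"
        by (intro mult_left_mono C0(3) r s') auto
      also have "\<dots> = ennreal (2 * ?\<rho> * Bp * (C0 * ?r))" using r Bp(1) by (intro ennreal_mult'[symmetric]) auto
      finally have "\<bar>zeta_int s h - zeta_int s k\<bar> \<le> 2 * ?\<rho> * Bp * (C0 * ?r)"
        using r Bp(1) C0(1) by (subst (asm) ennreal_le_iff) auto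
      also have "\<dots> = s\<^sup>2 * (2 * Bp * C0 * (m + \<eta>) * (\<rho> + 2 * \<eta>))" by (simp only: power2_eq_square mult_ac)
      finally have "\<bar>zeta_int s h - zeta_int s k\<bar> / s\<^sup>2 \<le> 2 * Bp * C0 * (m + \<eta>) * (\<rho> + 2 * \<eta>)"
        using s'(1) by (simp add: pos_divide_le_eq mult.commute)
      then show "\<bar>1 / s\<^sup>2 * zeta_int s h - 1 / s\<^sup>2 * zeta_int s k\<bar> \<le> 2 * Bp * C0 * (m + \<eta>) * (\<rho> + 2 * \<eta>)"
        by (simp add: diff_divide_distrib[symmetric] abs_divide)
    qed
  qed
qed

text \<open>A bound valid for all small s passes to the lower limit along each null sequence and
  then to the infimum, so nothing has to be known about minimising sequences.\<close>

lemma Q2_le: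
  assumes C: "\<exists>s0>0. \<forall>s. 0 < s \<and> s < s0 \<longrightarrow> \<bar>1 / s\<^sup>2 * zeta_int s h - 1 / s\<^sup>2 * zeta_int s k\<bar> \<le> c"
  shows "Q2 h \<le> Q2 k + ereal c"
proof -
  obtain s0 where s0: "0 < s0" "\<And>s. 0 < s \<Longrightarrow> s < s0 \<Longrightarrow> \<bar>1 / s\<^sup>2 * zeta_int s h - 1 / s\<^sup>2 * zeta_int s k\<bar> \<le> c"
    using C by blast
  have "Q2 h - ereal c \<le> Q2 k"
    unfolding Q_2_def[where h=k]
  proof (rule INF_greatest)
    fix s :: "nat \<Rightarrow> real" assume "s \<in> {s. (\<forall>n. 0 < s n) \<and> s \<longlonglongrightarrow> 0}"
    then have s: "\<And>n. 0 < s n" "s \<longlonglongrightarrow> 0" by auto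
    have "Q2 h \<le> Qt s h" unfolding Q_2_def using s by (intro INF_lower) auto
    also have "Qt s h \<le> liminf (\<lambda>n. ereal (1 / (s n)\<^sup>2 * zeta_int (s n) k) + ereal c)"
      unfolding Qt_eq
    proof (rule Liminf_mono)
      have "\<forall>\<^sub>F n in sequentially. s n < s0" using s(2) s0(1) by (rule order_tendstoD)
      then show "\<forall>\<^sub>F n in sequentially. ereal (1 / (s n)\<^sup>2 * zeta_int (s n) h) \<le> ereal (1 / (s n)\<^sup>2 * zeta_int (s n) k) + ereal c"
      proof eventually_elim
        case (elim n)
        have "1 / (s n)\<^sup>2 * zeta_int (s n) h \<le> 1 / (s n)\<^sup>2 * zeta_int (s n) k + c"
          using s0(2)[OF s(1) elim] unfolding abs_le_iff by linarith
        then show ?case unfolding plus_ereal.simps ereal_less_eq .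
      qed
    qed
    also have "\<dots> = Qt s k + ereal c"
      unfolding Qt_eq by (rule Liminf_add_ereal_right) auto
    finally show "Q2 h - ereal c \<le> Qt s k" by (simp add: ereal_minus_le)
  qed
  then show ?thesis by (simp add: ereal_minus_le)
qed

text \<open>The perturbed state is then \<open>ybar\<close> itself, and a value cannot lie strictly
  on one side of a kink and weakly on the other. This anchors the finiteness of
  \<open>Q_2\<close>.\<close>

lemma Q2_zero: "Q2 0 = 0"
proof -
  have y: "S (fnl \<Omega> (ubar + s *\<^sub>R 0)) = ybar" for s by (simp add: ybar)
  have "zeta K t ai \<delta> i y y = 0" for i y using delta by (auto simp: zeta_def)
  then have "zeta_int s 0 = 0" for s unfolding zeta_int_def y by simp
  then have "Qt s 0 = 0" for s unfolding Qt_eq by (simp add: Liminf_const)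
  moreover have mem: "(\<lambda>n. 1 / real (Suc n)) \<in> {s. (\<forall>n. 0 < s n) \<and> s \<longlonglongrightarrow> 0}"
    using LIMSEQ_Suc[OF lim_1_over_n] by auto
  have "{s :: nat \<Rightarrow> real. (\<forall>n. 0 < s n) \<and> s \<longlonglongrightarrow> 0} \<noteq> {}"
    using mem by (rule ex_in_conv[THEN iffD1, OF exI])
  ultimately show ?thesis unfolding Q_2_def by simp
qed

lemma zero_L2: "0 \<in> L2 M"
  by (simp add: L2_def zero_fun_def)

text \<open>The bounds m and \<rho> are supplied by the supremum estimate for the linearised states.
  A positive \<eta> remains because the expansion of the state has an error at every scale.\<close>

lemma Q2_lipschitz_ereal:
  obtains C where "0 < C" "\<And>h k \<eta>. h \<in> L2 M \<Longrightarrow> k \<in> L2 M \<Longrightarrow> 0 < \<eta> \<Longrightarrow>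
     Q2 h \<le> Q2 k + ereal (C * (sup_const * (nm (z h) + nm (z k)) + \<eta>) * (sup_const * nm (z h - z k) + 2 * \<eta>))"
proof -
  obtain C where C0: "0 < C" "\<forall>h k m \<rho> \<eta>. h \<in> L2 M \<longrightarrow> k \<in> L2 M \<longrightarrow> 0 \<le> m \<longrightarrow> 0 \<le> \<rho> \<longrightarrow> 0 < \<eta> \<longrightarrow>
    (AE x in M. \<bar>z h x\<bar> \<le> m) \<longrightarrow> (AE x in M. \<bar>z k x\<bar> \<le> m) \<longrightarrow> (AE x in M. \<bar>z h x - z k x\<bar> \<le> \<rho>) \<longrightarrow>
    (\<exists>s0>0. \<forall>s. 0 < s \<and> s < s0 \<longrightarrow> \<bar>1 / s\<^sup>2 * zeta_int s h - 1 / s\<^sup>2 * zeta_int s k\<bar> \<le> C * (m + \<eta>) * (\<rho> + 2 * \<eta>))"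
    using zeta_int_lipschitz by (elim exE conjE) (rule that)
  note C = C0(1) C0(2)[rule_format]
  show thesis
  proof (rule that[OF C(1)])
    fix h k \<eta> assume h: "h \<in> L2 M" and k: "k \<in> L2 M" and \<eta>: "0 < (\<eta>::real)"
    note zh = sup_const(2)[OF z_mem[OF h]] and zk = sup_const(2)[OF z_mem[OF k]]
      and zd = sup_const(2)[OF W.diff[OF z_mem[OF h] z_mem[OF k]]]
    have n: "0 \<le> sup_const * nm (z h)" "0 \<le> sup_const * nm (z k)" "0 \<le> sup_const * nm (z h - z k)"
      using sup_const(1) W.nonneg by auto
    show "Q2 h \<le> Q2 k + ereal (C * (sup_const * (nm (z h) + nm (z k)) + \<eta>) * (sup_const * nm (z h - z k) + 2 * \<eta>))"
    proof (intro Q2_le C(2) h k \<eta> n(3))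
      show "0 \<le> sup_const * (nm (z h) + nm (z k))" using n by (simp add: distrib_left)
      show "AE x in M. \<bar>z h x\<bar> \<le> sup_const * (nm (z h) + nm (z k))"
        using zh by eventually_elim (use n in \<open>simp add: distrib_left\<close>)
      show "AE x in M. \<bar>z k x\<bar> \<le> sup_const * (nm (z h) + nm (z k))"
        using zk by eventually_elim (use n in \<open>simp add: distrib_left\<close>)
      show "AE x in M. \<bar>z h x - z k x\<bar> \<le> sup_const * nm (z h - z k)"
        using zd by eventually_elim simp
    qed
  qed
qed

definition q2 :: "(real^'n \<Rightarrow> real) \<Rightarrow> real"
  where "q2 h = real_of_ereal (Q2 h)"

text \<open>Comparison with \<open>Q2 0 = 0\<close> in both directions excludes both
  infinities.\<close>

lemma Q2_real: "h \<in> L2 M \<Longrightarrow> Q2 h = ereal (q2 h)"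
proof -
  assume h: "h \<in> L2 M"
  obtain C where C: "0 < C" "\<And>h k \<eta>. h \<in> L2 M \<Longrightarrow> k \<in> L2 M \<Longrightarrow> 0 < \<eta> \<Longrightarrow>
     Q2 h \<le> Q2 k + ereal (C * (sup_const * (nm (z h) + nm (z k)) + \<eta>) * (sup_const * nm (z h - z k) + 2 * \<eta>))"
    using Q2_lipschitz_ereal by blast
  have "Q2 h \<noteq> \<infinity>" using C(2)[OF h zero_L2, of 1] unfolding Q2_zero by auto
  moreover have "Q2 h \<noteq> - \<infinity>" using C(2)[OF zero_L2 h, of 1] unfolding Q2_zero by auto
  ultimately show ?thesis unfolding q2_def by (cases "Q2 h") auto
qed

text \<open>The slack \<eta> is sent to zero, now that both values are real; exchanging h and k
  gives the absolute value.\<close>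

lemma q2_lipschitz:
  obtains C where "0 < C" "\<And>h k. h \<in> L2 M \<Longrightarrow> k \<in> L2 M \<Longrightarrow> \<bar>q2 h - q2 k\<bar> \<le> C * nm (z h - z k) * (nm (z h) + nm (z k))"
proof -
  obtain C where C: "0 < C" "\<And>h k \<eta>. h \<in> L2 M \<Longrightarrow> k \<in> L2 M \<Longrightarrow> 0 < \<eta> \<Longrightarrow>
     Q2 h \<le> Q2 k + ereal (C * (sup_const * (nm (z h) + nm (z k)) + \<eta>) * (sup_const * nm (z h - z k) + 2 * \<eta>))"
    using Q2_lipschitz_ereal by blast
  have one: "q2 h - q2 k \<le> C * (sup_const * (nm (z h) + nm (z k))) * (sup_const * nm (z h - z k))"
    if h: "h \<in> L2 M" and k: "k \<in> L2 M" for h k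
  proof -
    have E: "q2 h - q2 k \<le> C * (sup_const * (nm (z h) + nm (z k)) + \<eta>) * (sup_const * nm (z h - z k) + 2 * \<eta>)" if "0 < \<eta>" for \<eta>
      using C(2)[OF h k that] unfolding Q2_real[OF h] Q2_real[OF k] by simp
    have "q2 h - q2 k \<le> C * (sup_const * (nm (z h) + nm (z k)) + 1 / real (Suc n)) * (sup_const * nm (z h - z k) + 2 * (1 / real (Suc n)))" for n
      by (rule E) simp
    moreover have "(\<lambda>n. C * (sup_const * (nm (z h) + nm (z k)) + 1 / real (Suc n)) * (sup_const * nm (z h - z k) + 2 * (1 / real (Suc n))))
       \<longlonglongrightarrow> C * (sup_const * (nm (z h) + nm (z k)) + 0) * (sup_const * nm (z h - z k) + 2 * 0)"
      by (intro tendsto_intros LIMSEQ_Suc[OF lim_1_over_n])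
    ultimately have "q2 h - q2 k \<le> C * (sup_const * (nm (z h) + nm (z k)) + 0) * (sup_const * nm (z h - z k) + 2 * 0)"
      by (intro LIMSEQ_le_const) auto
    then show ?thesis by simp
  qed
  have p0: "0 < p" using p_gt_2 by simp
  show thesis
  proof (rule that[of "C * sup_const * sup_const"])
    show "0 < C * sup_const * sup_const" using C(1) sup_const(1) by simp
    fix h k assume h: "h \<in> L2 M" and k: "k \<in> L2 M"
    have "nm (z k - z h) = nm (z h - z k)"
      using W1p_norm_minus_commute[OF domain(1) p0 W01pD[OF z_mem[OF k]] W01pD[OF z_mem[OF h]]] .
    then have "q2 k - q2 h \<le> C * (sup_const * (nm (z h) + nm (z k))) * (sup_const * nm (z h - z k))"
      using one[OF k h] by (simp add: add.commute)
    moreover have "C * (sup_const * (nm (z h) + nm (z k))) * (sup_const * nm (z h - z k)) =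
       C * sup_const * sup_const * nm (z h - z k) * (nm (z h) + nm (z k))" by (simp only: mult_ac)
    ultimately show "\<bar>q2 h - q2 k\<bar> \<le> C * sup_const * sup_const * nm (z h - z k) * (nm (z h) + nm (z k))"
      using one[OF h k] by (simp only: abs_le_iff minus_diff_eq)
  qed
qed

section \<open>Homogeneity and the total energy\<close>

lemma L2_scaleR: "h \<in> L2 M \<Longrightarrow> c *\<^sub>R h \<in> L2 M"
  using L2_scale[of h M c] by (simp add: scaleR_fun_def)

text \<open>Null sequences stay null sequences under multiplication by c, and u + s (c h) = u + (c
  s) h. The reverse inequality will follow from the factor 1/c.\<close>

lemma q2_scale_le:
  assumes h: "h \<in> L2 M" and c: "0 < c"
  shows "c\<^sup>2 * q2 h \<le> q2 (c *\<^sub>R h)"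
proof -
  have "ereal (c\<^sup>2 * q2 h) \<le> Q2 (c *\<^sub>R h)"
    unfolding Q_2_def[where h="c *\<^sub>R h"]
  proof (rule INF_greatest)
    fix s :: "nat \<Rightarrow> real" assume "s \<in> {s. (\<forall>n. 0 < s n) \<and> s \<longlonglongrightarrow> 0}"
    then have s: "\<And>n. 0 < s n" "s \<longlonglongrightarrow> 0" by auto
    have "(\<lambda>n. c * s n) \<in> {s. (\<forall>n. 0 < s n) \<and> s \<longlonglongrightarrow> 0}"
      using s c tendsto_mult_left[OF s(2), of c] by auto
    then have "Q2 h \<le> Qt (\<lambda>n. c * s n) h" unfolding Q_2_def by (rule INF_lower)
    then have "ereal (c\<^sup>2) * Q2 h \<le> ereal (c\<^sup>2) * Qt (\<lambda>n. c * s n) h"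
      using c by (intro ereal_mult_left_mono) auto
    also have "\<dots> = liminf (\<lambda>n. ereal (c\<^sup>2) * ereal (1 / (c * s n)\<^sup>2 * zeta_int (c * s n) h))"
      unfolding Qt_eq by (rule Liminf_ereal_mult_left[symmetric]) auto
    also have "(\<lambda>n. ereal (c\<^sup>2) * ereal (1 / (c * s n)\<^sup>2 * zeta_int (c * s n) h)) = (\<lambda>n. ereal (1 / (s n)\<^sup>2 * zeta_int (s n) (c *\<^sub>R h)))"
    proof
      fix n
      have "zeta_int (c * s n) h = zeta_int (s n) (c *\<^sub>R h)"
        unfolding zeta_int_def by (simp add: mult.commute)
      then show "ereal (c\<^sup>2) * ereal (1 / (c * s n)\<^sup>2 * zeta_int (c * s n) h) = ereal (1 / (s n)\<^sup>2 * zeta_int (s n) (c *\<^sub>R h))"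
        using c s(1)[of n] by (simp add: power_mult_distrib)
    qed
    finally show "ereal (c\<^sup>2 * q2 h) \<le> Qt s (c *\<^sub>R h)"
      unfolding Qt_eq Q2_real[OF h] by simp
  qed
  then show ?thesis unfolding Q2_real[OF L2_scaleR[OF h]] by simp
qed

lemma q2_scale:
  assumes h: "h \<in> L2 M" and c: "0 < c"
  shows "q2 (c *\<^sub>R h) = c\<^sup>2 * q2 h"
proof (rule antisym)
  have "(1 / c)\<^sup>2 * q2 (c *\<^sub>R h) \<le> q2 h"
    using q2_scale_le[OF L2_scaleR[OF h, of c], of "1 / c"] c by simp
  then show "q2 (c *\<^sub>R h) \<le> c\<^sup>2 * q2 h" using c by (simp add: power_divide field_simps)
qed (rule q2_scale_le[OF h c])

text \<open>The total curvature without its Tikhonov part: the part that is continuous with respect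
  to the linearised state.\<close>

definition energy :: "(real^'n \<Rightarrow> real) \<Rightarrow> real"
  where "energy h = curvature (z h) + q2 h"

lemma energy_lipschitz:
  obtains C where "0 < C" "\<And>h k. h \<in> L2 M \<Longrightarrow> k \<in> L2 M \<Longrightarrow> \<bar>energy h - energy k\<bar> \<le> C * nm (z h - z k) * (nm (z h) + nm (z k))"
proof -
  obtain A where A: "0 < A" "\<And>v w. v \<in> W01p \<Omega> p \<Longrightarrow> w \<in> W01p \<Omega> p \<Longrightarrow>
    \<bar>curvature v - curvature w\<bar> \<le> A * nm (v - w) * (nm v + nm w)" using curvature_lipschitz by blast
  obtain B where B: "0 < B" "\<And>h k. h \<in> L2 M \<Longrightarrow> k \<in> L2 M \<Longrightarrow> \<bar>q2 h - q2 k\<bar> \<le> B * nm (z h - z k) * (nm (z h) + nm (z k))"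
    using q2_lipschitz by blast
  show thesis
  proof (rule that[of "A + B"])
    fix h k assume h: "h \<in> L2 M" and k: "k \<in> L2 M"
    let ?N = "nm (z h - z k) * (nm (z h) + nm (z k))"
    have "\<bar>curvature (z h) - curvature (z k)\<bar> \<le> A * ?N" "\<bar>q2 h - q2 k\<bar> \<le> B * ?N"
      using A(2)[OF z_mem[OF h] z_mem[OF k]] B(2)[OF h k] by (simp_all only: mult.assoc)
    then have "\<bar>energy h - energy k\<bar> \<le> A * ?N + B * ?N" unfolding energy_def by linarith
    then show "\<bar>energy h - energy k\<bar> \<le> (A + B) * nm (z h - z k) * (nm (z h) + nm (z k))"
      by (simp only: mult.assoc distrib_right)
  qed (use A B in simp)
qed

lemma energy_scale:
  assumes h: "h \<in> L2 M" and c: "0 < c"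
  shows "energy (c *\<^sub>R h) = c\<^sup>2 * energy h"
proof -
  obtain A where A: "0 < A" "\<And>v w. v \<in> W01p \<Omega> p \<Longrightarrow> w \<in> W01p \<Omega> p \<Longrightarrow>
    \<bar>curvature v - curvature w\<bar> \<le> A * nm (v - w) * (nm v + nm w)" using curvature_lipschitz by blast
  have "\<bar>curvature (z (c *\<^sub>R h)) - curvature (c *\<^sub>R z h)\<bar> \<le> 0"
    using A(2)[OF z_mem[OF L2_scaleR[OF h]] W.scale[OF z_mem[OF h]], of c c] z_scale[OF h, of c] by simp
  then have "curvature (z (c *\<^sub>R h)) = c\<^sup>2 * curvature (z h)" using curvature_scale[OF z_mem[OF h] c] by simp
  then show ?thesis unfolding energy_def q2_scale[OF h c] by (simp add: distrib_left)
qed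

lemma total_eq:
  assumes h: "h \<in> L2 M"
  shows "ereal (Q_s \<Omega> K t a \<nu> G'' S' ubar ybar phibar h h) + ereal (Q_1 \<Omega> a S' ubar ybar phibar h h) + Q2 h =
     ereal (energy h + \<nu> / 2 * (LINT x|M. (h x)\<^sup>2))"
  unfolding Q2_real[OF h] using Q_s_Q_1_eq[of h] by (simp add: energy_def)

text \<open>A null function represents the zero functional, so the Lipschitz bound identifies its
  energy with that of 0.\<close>

lemma energy_null:
  assumes h: "h \<in> L2 M" and ae: "AE x in M. h x = 0"
  shows "energy h = 0"
proof -
  obtain C where C: "0 < C" "\<And>h k. h \<in> L2 M \<Longrightarrow> k \<in> L2 M \<Longrightarrow> \<bar>energy h - energy k\<bar> \<le> C * nm (z h - z k) * (nm (z h) + nm (z k))"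
    using energy_lipschitz by blast
  \<comment> \<open>Homogeneity with the factor 2: multiplying 0 by 2 leaves it unchanged and
    multiplies its energy by 4.\<close>
  have "energy (0 :: real^'n \<Rightarrow> real) = 4 * energy (0 :: real^'n \<Rightarrow> real)" using energy_scale[OF zero_L2, of 2] by simp
  then have e0: "energy (0 :: real^'n \<Rightarrow> real) = 0" by simp
  obtain D where D: "0 < D" "\<And>h k e. h \<in> L2 M \<Longrightarrow> k \<in> L2 M \<Longrightarrow>
     (\<And>w. w \<in> W01p \<Omega> q \<Longrightarrow> W1p_norm \<Omega> q w \<le> 1 \<Longrightarrow> \<bar>LINT x|M. (h x - k x) * w x\<bar> \<le> e) \<Longrightarrow> nm (z h - z k) \<le> D * e"
    using z_diff_bound by blast
  have "nm (z h - z 0) \<le> D * 0"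
  proof (rule D(2)[OF h zero_L2])
    fix w
    have "(LINT x|M. (h x - 0 x) * w x) = 0" by (rule integral_eq_zero_AE) (use ae in eventually_elim, simp)
    then show "\<bar>LINT x|M. (h x - 0 x) * w x\<bar> \<le> 0" by simp
  qed
  then have "nm (z h - z 0) = 0" using W.nonneg[of "z h - z 0"] by simp
  then show ?thesis using C(2)[OF h zero_L2] e0 by simp
qed

end

section \<open>Cones and coercivity\<close>

locale stationary_point = control_problem K t ai a \<Omega> b ubar ybar phibar \<nu> \<delta> p G G' G'' S S'
  for K t ai a and \<Omega> :: "(real^'n) set" and b ubar ybar phibar \<nu> \<delta> p G G' G'' S S' +
  fixes \<alpha> \<beta> :: "real^'n \<Rightarrow> real" and \<gamma> :: real
  assumes nu: "0 < \<nu>"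
    and bounds: "\<alpha> \<in> Linf \<Omega>" "\<beta> \<in> Linf \<Omega>" "0 < \<gamma>" "AE x in lebesgue_on \<Omega>. \<gamma> \<le> \<beta> x - \<alpha> x"
    and feasible: "ubar \<in> Uad \<Omega> \<alpha> \<beta>"
    and variational_ineq: "\<forall>u\<in>Uad \<Omega> \<alpha> \<beta>.
       0 \<le> (LINT x|lebesgue_on \<Omega>. (phibar x + \<nu> * ubar x) * (u x - ubar x))"
begin

abbreviation "U \<equiv> Uad \<Omega> \<alpha> \<beta>"
abbreviation "d \<equiv> phibar + \<nu> *\<^sub>R ubar"
abbreviation "E \<equiv> extended_critical_cone \<Omega> \<alpha> \<beta> ubar d"
abbreviation "sq h \<equiv> (LINT x|M. (h x)\<^sup>2)"

section \<open>Sign conditions and the tangent cone\<close>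

lemma d_L2: "d \<in> L2 M"
proof -
  have "phibar \<in> L2 M" using W1pD(1)[OF domain(1) phibar_W1p] by (simp add: Lp_2_eq_L2)
  from L2_lincomb(1)[OF this ubar_L2, of 1 \<nu>] show ?thesis by (simp add: plus_fun_def scaleR_fun_def)
qed

lemma d_apply: "d x = phibar x + \<nu> * ubar x"
  by (simp add: scaleR_fun_def)

lemma ubar_between: "AE x in M. \<alpha> x \<le> ubar x \<and> ubar x \<le> \<beta> x"
  using feasible by (simp add: Uad_def)

lemma alpha_less_beta: "AE x in M. \<alpha> x < \<beta> x"
  using bounds(4) by eventually_elim (use bounds(3) in simp)

lemma measurable_bounds: "\<alpha> \<in> borel_measurable M" "\<beta> \<in> borel_measurable M" "ubar \<in> borel_measurable M"
  "d \<in> borel_measurable M"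
  using bounds(1,2) ubar_Linf L2D(1)[OF d_L2] by (auto simp: Linf_def)

lemma Linf_between:
  assumes "v \<in> borel_measurable M" "AE x in M. \<alpha> x \<le> v x \<and> v x \<le> \<beta> x"
  shows "v \<in> U"
proof -
  obtain A where A: "AE x in M. norm (\<alpha> x) \<le> A" using bounds(1) by (auto simp: Linf_def)
  obtain B where B: "AE x in M. norm (\<beta> x) \<le> B" using bounds(2) by (auto simp: Linf_def)
  have "AE x in M. norm (v x) \<le> \<bar>A\<bar> + \<bar>B\<bar>"
    using A B assms(2) by eventually_elim auto
  then show ?thesis using assms by (auto simp: Uad_def Linf_def)
qed

text \<open>The variational inequality is tested with the pointwise minimiser of the integrand:
  \<alpha> where d > 0, \<beta> where d < 0. The integrand is then at most 0 while its integral is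
  at least 0.\<close>

lemma d_sign: "AE x in M. (0 < d x \<longrightarrow> ubar x = \<alpha> x) \<and> (d x < 0 \<longrightarrow> ubar x = \<beta> x)"
proof -
  note [measurable] = measurable_bounds
  define v where "v x = (if 0 < d x then \<alpha> x else if d x < 0 then \<beta> x else ubar x)" for x
  have [measurable]: "v \<in> borel_measurable M" unfolding v_def[abs_def] by measurable
  have v: "v \<in> U"
  proof (rule Linf_between)
    show "AE x in M. \<alpha> x \<le> v x \<and> v x \<le> \<beta> x"
      using ubar_between alpha_less_beta by eventually_elim (auto simp: v_def)
  qed measurable
  let ?f = "\<lambda>x. d x * (v x - ubar x)"
  have "(\<lambda>x. v x - ubar x) \<in> L2 M" using v by (intro L2_diff ubar_L2 Linf_L2) (simp add: Uad_def)
  then have I: "integrable M ?f" by (rule L2_mult_integrable[OF d_L2])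
  have np: "AE x in M. 0 \<le> - ?f x"
    using ubar_between
  proof eventually_elim
    case (elim x)
    consider "0 < d x" | "d x < 0" | "d x = 0" by linarith
    then show ?case
    proof cases
      case 1
      then have "d x * (v x - ubar x) \<le> 0" using elim by (intro mult_nonneg_nonpos) (auto simp: v_def)
      then show ?thesis by simp
    next
      case 2
      then have "d x * (v x - ubar x) \<le> 0" using elim by (intro mult_nonpos_nonneg) (auto simp: v_def)
      then show ?thesis by simp
    qed simp
  qed
  have "0 \<le> (LINT x|M. ?f x)" using variational_ineq v by (simp only: d_apply)
  moreover have "0 \<le> (LINT x|M. - ?f x)" using np by (rule integral_nonneg_AE)
  moreover have "(LINT x|M. - ?f x) = - (LINT x|M. ?f x)" by (rule integral_minus)
  ultimately have "(LINT x|M. - ?f x) = 0" by linarith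
  then have "AE x in M. - ?f x = 0"
    using integral_nonneg_eq_0_iff_AE[OF integrable_minus[OF I] np] by simp
  then show ?thesis by eventually_elim (auto simp: v_def)
qed

lemma E_iff: "h \<in> E \<tau> \<longleftrightarrow> h \<in> L2 M \<and> (AE x in M.
     (ubar x = \<alpha> x \<longrightarrow> 0 \<le> h x) \<and> (ubar x = \<beta> x \<longrightarrow> h x \<le> 0) \<and> (\<bar>d x\<bar> > \<tau> \<longrightarrow> h x = 0))"
  by (simp add: extended_critical_cone_def Lp_2_eq_L2)

text \<open>A subsequence of the approximating directions converges almost everywhere, and dividing
  the active constraints by s leaves closed sign conditions.\<close>

lemma tangent_sign:
  assumes "h \<in> tangent_cone \<Omega> U ubar"
  shows "AE x in M. (ubar x = \<alpha> x \<longrightarrow> 0 \<le> h x) \<and> (ubar x = \<beta> x \<longrightarrow> h x \<le> 0)"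
proof -
  obtain s :: "nat \<Rightarrow> real" and v where h: "h \<in> L2 M" and s: "\<And>n. 0 < s n" "\<And>n. v n \<in> L2 M"
    "(\<lambda>n. Lp_norm \<Omega> 2 (v n - h)) \<longlonglongrightarrow> 0" "\<And>n. ubar + s n *\<^sub>R v n \<in> U"
    using assms by (auto simp: tangent_cone_def Lp_2_eq_L2)
  have vh: "(\<lambda>x. v n x - h x) \<in> L2 M" for n by (rule L2_diff[OF s(2) h])
  have "(\<lambda>n. (Lp_norm \<Omega> 2 (v n - h))\<^sup>2) \<longlonglongrightarrow> 0\<^sup>2" by (intro tendsto_intros s)
  then have "(\<lambda>n. LINT x|M. norm ((v n x - h x)\<^sup>2)) \<longlonglongrightarrow> 0" by (simp add: Lp_norm_2)
  then obtain r :: "nat \<Rightarrow> nat" where r: "AE x in M. (\<lambda>n. (v (r n) x - h x)\<^sup>2) \<longlonglongrightarrow> 0"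
    using tendsto_L1_AE_subseq[of M "\<lambda>n x. (v n x - h x)\<^sup>2", OF L2D(2)[OF vh]] by blast
  have "AE x in M. \<alpha> x \<le> ubar x + s n * v n x \<and> ubar x + s n * v n x \<le> \<beta> x" for n
    using s(4)[of n] by (simp add: Uad_def scaleR_fun_def)
  then have "AE x in M. \<forall>n. \<alpha> x \<le> ubar x + s n * v n x \<and> ubar x + s n * v n x \<le> \<beta> x"
    by (simp add: AE_all_countable)
  then show ?thesis using r
  proof eventually_elim
    case (elim x)
    have "(\<lambda>n. sqrt ((v (r n) x - h x)\<^sup>2)) \<longlonglongrightarrow> sqrt 0" by (intro tendsto_intros elim)
    then have lim: "(\<lambda>n. v (r n) x) \<longlonglongrightarrow> h x" by (simp add: tendsto_rabs_zero_iff LIM_zero_iff)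
    show ?case
    proof (intro conjI impI)
      assume "ubar x = \<alpha> x"
      then have "s n * 0 \<le> s n * v n x" for n using elim(1)[rule_format, of n] by simp
      then have "0 \<le> v n x" for n by (rule mult_left_le_imp_le[OF _ s(1)])
      then show "0 \<le> h x" by (intro LIMSEQ_le_const[OF lim]) auto
    next
      assume "ubar x = \<beta> x"
      then have "s n * v n x \<le> s n * 0" for n using elim(1)[rule_format, of n] by simp
      then have "v n x \<le> 0" for n by (rule mult_left_le_imp_le[OF _ s(1)])
      then show "h x \<le> 0" by (intro LIMSEQ_le_const2[OF lim]) auto
    qed
  qed
qed

text \<open>Feasible approximations come from clamping \<open>ubar\<close> + s h to
  [\<alpha>, \<beta>]. Strictly inside a bound the clamp is idle for small s, and at a bound the
  sign of h keeps it idle; so the quotients are eventually equal to h at each point, and |h|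
  dominates them.\<close>

lemma sign_tangent:
  assumes h: "h \<in> L2 M" and sign: "AE x in M. (ubar x = \<alpha> x \<longrightarrow> 0 \<le> h x) \<and> (ubar x = \<beta> x \<longrightarrow> h x \<le> 0)"
  shows "h \<in> tangent_cone \<Omega> U ubar"
proof -
  note [measurable] = measurable_bounds L2D(1)[OF h]
  define s where "s n = 1 / real (Suc n)" for n
  have s: "0 < s n" "s \<longlonglongrightarrow> 0" for n
    unfolding s_def using LIMSEQ_Suc[OF lim_1_over_n] by auto
  define c where "c n x = max (\<alpha> x) (min (\<beta> x) (ubar x + s n * h x))" for n x
  define v where "v n x = (c n x - ubar x) / s n" for n x
  have [measurable]: "c n \<in> borel_measurable M" "v n \<in> borel_measurable M" for n
    unfolding c_def[abs_def] v_def[abs_def] by measurable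
  have bd: "AE x in M. \<bar>v n x\<bar> \<le> \<bar>h x\<bar>" for n
    using ubar_between
  proof eventually_elim
    case (elim x)
    have "\<bar>c n x - ubar x\<bar> \<le> \<bar>s n * h x\<bar>" using elim by (auto simp: c_def max_def min_def)
    then show ?case using s(1)[of n] by (simp add: v_def abs_divide abs_mult field_simps)
  qed
  have vL2: "v n \<in> L2 M" for n
  proof -
    have "integrable M (\<lambda>x. (v n x)\<^sup>2)"
    proof (rule Bochner_Integration.integrable_bound[OF L2D(2)[OF h]])
      show "AE x in M. norm ((v n x)\<^sup>2) \<le> norm ((h x)\<^sup>2)"
        using bd[of n] by eventually_elim (simp add: abs_le_square_iff)
    qed measurable
    then show ?thesis by (simp add: L2_def)
  qed
  have "(\<lambda>n. LINT x|M. (v n x - h x)\<^sup>2) \<longlonglongrightarrow> (LINT x|M. 0)"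
  proof (rule integral_dominated_convergence[where w="\<lambda>x. 4 * (h x)\<^sup>2"])
    show "integrable M (\<lambda>x. 4 * (h x)\<^sup>2)" using L2D(2)[OF h] by auto
    show "AE x in M. norm ((v n x - h x)\<^sup>2) \<le> 4 * (h x)\<^sup>2" for n
      using bd[of n]
    proof eventually_elim
      case (elim x)
      have "\<bar>v n x - h x\<bar> \<le> \<bar>2 * h x\<bar>" using elim by linarith
      then have "(v n x - h x)\<^sup>2 \<le> (2 * h x)\<^sup>2" by (simp only: abs_le_square_iff)
      then show ?case by (simp add: power_mult_distrib)
    qed
    show "AE x in M. (\<lambda>n. (v n x - h x)\<^sup>2) \<longlonglongrightarrow> 0"
      using ubar_between alpha_less_beta sign
    proof eventually_elim
      case (elim x)
      have lim: "(\<lambda>n. ubar x + s n * h x) \<longlonglongrightarrow> ubar x"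
        using tendsto_add[OF tendsto_const tendsto_mult_right[OF s(2)], of "ubar x" "h x"] by simp
      have lo: "\<forall>\<^sub>F n in sequentially. \<alpha> x \<le> ubar x + s n * h x"
      proof (cases "ubar x = \<alpha> x")
        case True
        then show ?thesis using elim(3) s(1) by (auto intro!: always_eventually simp: less_imp_le)
      next
        case False
        then have "\<alpha> x < ubar x" using elim(1) by simp
        from order_tendstoD(1)[OF lim this] show ?thesis by eventually_elim simp
      qed
      have up: "\<forall>\<^sub>F n in sequentially. ubar x + s n * h x \<le> \<beta> x"
      proof (cases "ubar x = \<beta> x")
        case True
        then have "s n * h x \<le> 0" for n using elim(3) s(1)[of n] by (intro mult_nonneg_nonpos) auto
        then show ?thesis using True by (auto intro!: always_eventually)
      next
        case False
        then have "ubar x < \<beta> x" using elim(1) by simp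
        from order_tendstoD(2)[OF lim this] show ?thesis by eventually_elim simp
      qed
      have "\<forall>\<^sub>F n in sequentially. (v n x - h x)\<^sup>2 = 0"
        using lo up
      proof eventually_elim
        case (elim n)
        then show ?case using s(1)[of n] by (simp add: v_def c_def)
      qed
      then show ?case by (rule tendsto_eventually)
    qed
  qed measurable
  then have "(\<lambda>n. sqrt (LINT x|M. (v n x - h x)\<^sup>2)) \<longlonglongrightarrow> sqrt 0" by (intro tendsto_intros) simp
  then have "(\<lambda>n. Lp_norm \<Omega> 2 (v n - h)) \<longlonglongrightarrow> 0" by (simp add: Lp_norm_2)
  moreover have "ubar + s n *\<^sub>R v n \<in> U" for n
  proof -
    have "ubar + s n *\<^sub>R v n = c n" using s(1)[of n] by (simp add: v_def scaleR_fun_def fun_eq_iff)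
    moreover have "c n \<in> U"
    proof (rule Linf_between)
      show "AE x in M. \<alpha> x \<le> c n x \<and> c n x \<le> \<beta> x"
        using alpha_less_beta by eventually_elim (auto simp: c_def)
    qed measurable
    ultimately show ?thesis by simp
  qed
  ultimately show ?thesis
    unfolding tangent_cone_def Lp_2_eq_L2 using h s vL2 by blast
qed

text \<open>For a critical h the product d h is nonnegative by the two sign conditions and has
  integral zero, so h vanishes wherever d is nonzero; this is the condition for all thresholds at
  once.\<close>

lemma critical_subset: "critical_cone \<Omega> U ubar d \<subseteq> E \<tau>" if "0 < \<tau>"
proof
  fix h assume "h \<in> critical_cone \<Omega> U ubar d"
  then have T: "h \<in> tangent_cone \<Omega> U ubar" and 0: "(LINT x|M. d x * h x) = 0" by (auto simp: critical_cone_def)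
  have h: "h \<in> L2 M" using T by (simp add: tangent_cone_def Lp_2_eq_L2)
  note S = tangent_sign[OF T]
  have np: "AE x in M. 0 \<le> d x * h x"
    using S d_sign
  proof eventually_elim
    case (elim x)
    consider "0 < d x" | "d x < 0" | "d x = 0" by linarith
    then show ?case by cases (use elim in \<open>auto intro: mult_nonneg_nonneg mult_nonpos_nonpos simp del: plus_fun_apply\<close>)
  qed
  have "AE x in M. d x * h x = 0"
    using 0 integral_nonneg_eq_0_iff_AE[OF L2_mult_integrable[OF d_L2 h] np] by simp
  then have "AE x in M. (ubar x = \<alpha> x \<longrightarrow> 0 \<le> h x) \<and> (ubar x = \<beta> x \<longrightarrow> h x \<le> 0) \<and> (\<bar>d x\<bar> > \<tau> \<longrightarrow> h x = 0)"
    using S by eventually_elim (use that in auto)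
  then show "h \<in> E \<tau>" using h by (simp add: E_iff)
qed

section \<open>Algebra of the enlarged cones\<close>

lemma E_L2: "h \<in> E \<tau> \<Longrightarrow> h \<in> L2 M"
  by (simp add: E_iff)

lemma E_mono: "\<tau> \<le> \<tau>' \<Longrightarrow> E \<tau> \<subseteq> E \<tau>'"
  unfolding E_iff subset_iff by (intro allI impI conjI, simp, elim conjE eventually_mono) auto

lemma E_scale:
  assumes "h \<in> E \<tau>" "0 < c"
  shows "c *\<^sub>R h \<in> E \<tau>"
proof -
  have "AE x in M. (ubar x = \<alpha> x \<longrightarrow> 0 \<le> h x) \<and> (ubar x = \<beta> x \<longrightarrow> h x \<le> 0) \<and> (\<bar>d x\<bar> > \<tau> \<longrightarrow> h x = 0)"
    using assms by (simp add: E_iff)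
  then have "AE x in M. (ubar x = \<alpha> x \<longrightarrow> 0 \<le> (c *\<^sub>R h) x) \<and> (ubar x = \<beta> x \<longrightarrow> (c *\<^sub>R h) x \<le> 0) \<and> (\<bar>d x\<bar> > \<tau> \<longrightarrow> (c *\<^sub>R h) x = 0)"
    by eventually_elim (use assms(2) in \<open>auto simp: scaleR_fun_def mult_nonneg_nonpos\<close>)
  then show ?thesis using L2_scaleR[OF E_L2[OF assms(1)], of c] by (simp add: E_iff)
qed

lemma E_convex: "convex (E \<tau>)"
proof (rule convexI)
  fix f g and a b :: real assume f: "f \<in> E \<tau>" and g: "g \<in> E \<tau>" and ab: "0 \<le> a" "0 \<le> b" "a + b = 1"
  have "AE x in M. (ubar x = \<alpha> x \<longrightarrow> 0 \<le> f x) \<and> (ubar x = \<beta> x \<longrightarrow> f x \<le> 0) \<and> (\<bar>d x\<bar> > \<tau> \<longrightarrow> f x = 0)"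
    "AE x in M. (ubar x = \<alpha> x \<longrightarrow> 0 \<le> g x) \<and> (ubar x = \<beta> x \<longrightarrow> g x \<le> 0) \<and> (\<bar>d x\<bar> > \<tau> \<longrightarrow> g x = 0)"
    using f g by (simp_all add: E_iff)
  then have "AE x in M. (ubar x = \<alpha> x \<longrightarrow> 0 \<le> a * f x + b * g x) \<and> (ubar x = \<beta> x \<longrightarrow> a * f x + b * g x \<le> 0) \<and> (\<bar>d x\<bar> > \<tau> \<longrightarrow> a * f x + b * g x = 0)"
    by eventually_elim (use ab in \<open>auto intro: add_nonneg_nonneg add_nonpos_nonpos mult_nonneg_nonpos\<close>)
  moreover have "a *\<^sub>R f + b *\<^sub>R g = (\<lambda>x. a * f x + b * g x)" by (simp add: scaleR_fun_def fun_eq_iff)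
  ultimately show "a *\<^sub>R f + b *\<^sub>R g \<in> E \<tau>"
    using L2_lincomb(1)[OF E_L2[OF f] E_L2[OF g], of a b] by (simp only: E_iff simp_thms)
qed

lemma Lp_norm_sq: "(Lp_norm \<Omega> 2 h)\<^sup>2 = sq h" for h :: "real^'n \<Rightarrow> real"
  by (simp add: Lp_norm_2)

lemma sq_scale: "sq (c *\<^sub>R h) = c\<^sup>2 * sq h" for h :: "real^'n \<Rightarrow> real"
  by (simp add: scaleR_fun_def power_mult_distrib)

lemma sq_eq_0_iff: "h \<in> L2 M \<Longrightarrow> sq h = 0 \<longleftrightarrow> (AE x in M. h x = 0)"
  using integral_nonneg_eq_0_iff_AE[OF L2D(2), of h M] by simp

section \<open>Passage to the limit and the two implications\<close>

text \<open>The functions whose pairing with w is close to that of \<open>e n\<close> form a convex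
  set. It contains the hull of a tail and, up to a vanishing error, the limit g. So the linearised
  states of the original sequence converge, although in L^2 only the convex combinations are known
  to do so.\<close>

lemma z_convergence:
  assumes e: "\<And>n. e n \<in> L2 M"
    and cauchy: "\<And>\<eta>. 0 < \<eta> \<Longrightarrow> \<exists>N. \<forall>i\<ge>N. \<forall>j\<ge>N. \<forall>w\<in>W01p \<Omega> q. W1p_norm \<Omega> q w \<le> 1 \<longrightarrow>
        \<bar>LINT x|M. (e i x - e j x) * w x\<bar> \<le> \<eta>"
    and f: "\<And>n. f n \<in> convex hull (e ` {n..})" "\<And>n. f n \<in> L2 M"
    and g: "g \<in> L2 M" "(\<lambda>n. LINT x|M. (f n x - g x)\<^sup>2) \<longlonglongrightarrow> 0"
  shows "(\<lambda>n. nm (z (e n) - z g)) \<longlonglongrightarrow> 0"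
proof -
  obtain D where D: "0 < D" "\<And>h k e. h \<in> L2 M \<Longrightarrow> k \<in> L2 M \<Longrightarrow>
     (\<And>w. w \<in> W01p \<Omega> q \<Longrightarrow> W1p_norm \<Omega> q w \<le> 1 \<Longrightarrow> \<bar>LINT x|M. (h x - k x) * w x\<bar> \<le> e) \<Longrightarrow> nm (z h - z k) \<le> D * e"
    using z_diff_bound by blast
  show ?thesis
  proof (rule LIMSEQ_I)
    fix \<eta> :: real assume \<eta>: "0 < \<eta>"
    define \<eta>' where "\<eta>' = \<eta> / (2 * D)"
    have \<eta>': "0 < \<eta>'" using \<eta> D(1) by (simp add: \<eta>'_def)
    obtain N where N: "\<And>i j w. N \<le> i \<Longrightarrow> N \<le> j \<Longrightarrow> w \<in> W01p \<Omega> q \<Longrightarrow> W1p_norm \<Omega> q w \<le> 1 \<Longrightarrow> \<bar>LINT x|M. (e i x - e j x) * w x\<bar> \<le> \<eta>'"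
      using cauchy[OF \<eta>'] by blast
    have "norm (nm (z (e n) - z g) - 0) < \<eta>" if n: "N \<le> n" for n
    proof -
      have key: "\<bar>LINT x|M. (e n x - g x) * w x\<bar> \<le> \<eta>'" if w: "w \<in> W01p \<Omega> q" "W1p_norm \<Omega> q w \<le> 1" for w
      proof -
        note I = pair_const(2)[OF _ w(1)]
        let ?S = "{h \<in> L2 M. \<bar>LINT x|M. (e n x - h x) * w x\<bar> \<le> \<eta>'}"
        have "convex ?S"
        proof (rule convexI)
          fix h k and a b :: real assume hk: "h \<in> ?S" "k \<in> ?S" and ab: "0 \<le> a" "0 \<le> b" "a + b = 1"
          then have hk': "h \<in> L2 M" "k \<in> L2 M" by auto
          have eq: "a *\<^sub>R h + b *\<^sub>R k = (\<lambda>x. a * h x + b * k x)" by (simp add: scaleR_fun_def fun_eq_iff)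
          have "(e n x - (a * h x + b * k x)) * w x = a * ((e n x - h x) * w x) + b * ((e n x - k x) * w x)" for x
          proof -
            have "e n x = a * e n x + b * e n x" using ab(3) by (simp add: distrib_right[symmetric])
            then have "e n x - (a * h x + b * k x) = a * (e n x - h x) + b * (e n x - k x)" by (simp add: right_diff_distrib)
            then show ?thesis by (simp add: distrib_right mult.assoc)
          qed
          then have "(LINT x|M. (e n x - (a * h x + b * k x)) * w x) = a * (LINT x|M. (e n x - h x) * w x) + b * (LINT x|M. (e n x - k x) * w x)"
            using I[OF L2_diff[OF e hk'(1)]] I[OF L2_diff[OF e hk'(2)]] by simp
          also have "\<bar>\<dots>\<bar> \<le> a * \<bar>LINT x|M. (e n x - h x) * w x\<bar> + b * \<bar>LINT x|M. (e n x - k x) * w x\<bar>"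
            using abs_triangle_ineq[of "a * (LINT x|M. (e n x - h x) * w x)" "b * (LINT x|M. (e n x - k x) * w x)"] ab by (simp add: abs_mult)
          also have "\<dots> \<le> a * \<eta>' + b * \<eta>'" using hk ab by (intro add_mono mult_left_mono) auto
          also have "\<dots> = \<eta>'" using ab(3) by (simp add: distrib_right[symmetric])
          finally show "a *\<^sub>R h + b *\<^sub>R k \<in> ?S" unfolding eq using L2_lincomb(1)[OF hk', of a b] by simp
        qed
        moreover have "e ` {N..} \<subseteq> ?S" using N[OF n _ w] e by auto
        ultimately have hull: "convex hull (e ` {N..}) \<subseteq> ?S" by (intro hull_minimal)
        have fm: "\<bar>LINT x|M. (e n x - f m x) * w x\<bar> \<le> \<eta>'" if "N \<le> m" for m
        proof -
          have "convex hull (e ` {m..}) \<subseteq> convex hull (e ` {N..})" using that by (intro hull_mono image_mono) auto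
          then show ?thesis using f(1)[of m] hull by blast
        qed
        have le: "\<bar>LINT x|M. (e n x - g x) * w x\<bar> \<le> \<eta>' + pair_const * sqrt (LINT x|M. (f m x - g x)\<^sup>2)" if m: "N \<le> m" for m
        proof -
          have "(LINT x|M. (e n x - g x) * w x) = (LINT x|M. (e n x - f m x) * w x) + (LINT x|M. (f m x - g x) * w x)"
            using I[OF L2_diff[OF e f(2)]] I[OF L2_diff[OF f(2) g(1)]] by (subst Bochner_Integration.integral_add[symmetric]) (auto simp: algebra_simps)
          moreover have "\<bar>LINT x|M. (f m x - g x) * w x\<bar> \<le> pair_const * sqrt (LINT x|M. (f m x - g x)\<^sup>2) * W1p_norm \<Omega> q w"
            using fnl_bound[OF L2_diff[OF f(2) g(1)] w(1)] by (simp add: fnl_def Lp_norm_2)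
          moreover have "pair_const * sqrt (LINT x|M. (f m x - g x)\<^sup>2) * W1p_norm \<Omega> q w \<le> pair_const * sqrt (LINT x|M. (f m x - g x)\<^sup>2) * 1"
            using w(2) pair_const(1) by (intro mult_left_mono) auto
          ultimately show ?thesis using fm[OF m] by linarith
        qed
        have "(\<lambda>m. \<eta>' + pair_const * sqrt (LINT x|M. (f m x - g x)\<^sup>2)) \<longlonglongrightarrow> \<eta>' + pair_const * sqrt 0"
          by (intro tendsto_intros g)
        then have "\<bar>LINT x|M. (e n x - g x) * w x\<bar> \<le> \<eta>' + pair_const * sqrt 0"
          by (rule LIMSEQ_le_const) (use le in blast)
        then show ?thesis by simp
      qed
      have "nm (z (e n) - z g) \<le> D * \<eta>'" by (rule D(2)[OF e g(1) key])
      also have "\<dots> = \<eta> / 2" using D(1) by (simp add: \<eta>'_def)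
      also have "\<dots> < \<eta>" using \<eta> by simp
      finally show ?thesis using W.nonneg[of "z (e n) - z g"] by simp
    qed
    then show "\<exists>N. \<forall>n\<ge>N. norm (nm (z (e n) - z g) - 0) < \<eta>" by blast
  qed
qed

text \<open>A convergent sequence is bounded in the quasi-norm, so the Lipschitz bound tends to
  zero.\<close>

lemma energy_convergence:
  assumes e: "\<And>n. e n \<in> L2 M" and g: "g \<in> L2 M" and lim: "(\<lambda>n. nm (z (e n) - z g)) \<longlonglongrightarrow> 0"
  shows "(\<lambda>n. energy (e n)) \<longlonglongrightarrow> energy g"
proof -
  obtain C where C: "0 < C" "\<And>h k. h \<in> L2 M \<Longrightarrow> k \<in> L2 M \<Longrightarrow> \<bar>energy h - energy k\<bar> \<le> C * nm (z h - z k) * (nm (z h) + nm (z k))"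
    using energy_lipschitz by blast
  have le: "\<bar>energy (e n) - energy g\<bar> \<le> C * nm (z (e n) - z g) * (4 * (nm (z (e n) - z g) + nm (z g)) + nm (z g))" for n
  proof -
    have "nm (z (e n)) \<le> 4 * (nm (z (e n) - z g) + nm (z g))"
      using W.tri[OF W.diff[OF z_mem[OF e] z_mem[OF g]] z_mem[OF g], of n] by simp
    then have "C * nm (z (e n) - z g) * (nm (z (e n)) + nm (z g)) \<le> C * nm (z (e n) - z g) * (4 * (nm (z (e n) - z g) + nm (z g)) + nm (z g))"
      using C(1) W.nonneg by (intro mult_left_mono add_right_mono) auto
    then show ?thesis using C(2)[OF e[of n] g] by linarith
  qed
  have "(\<lambda>n. C * nm (z (e n) - z g) * (4 * (nm (z (e n) - z g) + nm (z g)) + nm (z g))) \<longlonglongrightarrow> C * 0 * (4 * (0 + nm (z g)) + nm (z g))"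
    by (intro tendsto_intros lim)
  then have lim0: "(\<lambda>n. C * nm (z (e n) - z g) * (4 * (nm (z (e n) - z g) + nm (z g)) + nm (z g))) \<longlonglongrightarrow> 0" by simp
  have "(\<lambda>n. \<bar>energy (e n) - energy g\<bar>) \<longlonglongrightarrow> 0"
    by (rule tendsto_0_le_seq[OF lim0 abs_ge_zero le])
  then show ?thesis by (simp add: tendsto_rabs_zero_iff LIM_zero_iff)
qed

lemma coercivity:
  assumes pos: "\<And>h. h \<in> critical_cone \<Omega> U ubar d \<Longrightarrow> \<not> (AE x in M. h x = 0) \<Longrightarrow> 0 < energy h + \<nu> / 2 * sq h"
  shows "\<exists>c0>0. \<exists>\<tau>>0. \<forall>h\<in>E \<tau>. c0 * sq h \<le> energy h + \<nu> / 2 * sq h"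
proof (rule ccontr)
  assume neg: "\<not> ?thesis"
  have "\<exists>f. f \<in> E (1 / real (Suc n)) \<and> sq f = 1 \<and> energy f < 1 / real (Suc n) - \<nu> / 2" for n
  proof -
    have "0 < 1 / real (Suc n)" by simp
    then obtain h where h: "h \<in> E (1 / real (Suc n))" "\<not> 1 / real (Suc n) * sq h \<le> energy h + \<nu> / 2 * sq h"
      using neg by blast
    note hL = E_L2[OF h(1)]
    have "sq h \<noteq> 0"
    proof
      assume 0: "sq h = 0"
      then have "AE x in M. h x = 0" using sq_eq_0_iff[OF hL] by simp
      then have "energy h = 0" by (rule energy_null[OF hL])
      then show False using h(2) 0 by simp
    qed
    moreover have "0 \<le> sq h" by simp
    ultimately have sp: "0 < sq h" by linarith
    \<comment> \<open>Energy and squared norm both scale by c^2, so the violated inequality survives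
      normalisation.\<close>
    define c where "c = 1 / sqrt (sq h)"
    have c: "0 < c" "c\<^sup>2 * sq h = 1" using sp by (simp_all add: c_def power_divide)
    have "energy (c *\<^sub>R h) < 1 / real (Suc n) - \<nu> / 2"
    proof -
      have "energy h < (1 / real (Suc n) - \<nu> / 2) * sq h" using h(2) by (simp add: left_diff_distrib)
      then have "c\<^sup>2 * energy h < c\<^sup>2 * ((1 / real (Suc n) - \<nu> / 2) * sq h)" using c(1) by (intro mult_strict_left_mono) auto
      also have "\<dots> = (1 / real (Suc n) - \<nu> / 2) * (c\<^sup>2 * sq h)" by (simp only: mult_ac)
      finally show ?thesis using energy_scale[OF hL c(1)] c(2) by simp
    qed
    moreover have "sq (c *\<^sub>R h) = 1" using c(2) by (simp only: sq_scale)
    ultimately show ?thesis using E_scale[OF h(1) c(1)] by blast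
  qed
  then obtain f where f: "\<And>n. f n \<in> E (1 / real (Suc n))" "\<And>n. sq (f n) = 1" "\<And>n. energy (f n) < 1 / real (Suc n) - \<nu> / 2"
    by metis
  have fL: "f n \<in> L2 M" for n by (rule E_L2[OF f(1)])
  obtain k :: "nat \<Rightarrow> nat" where k: "strict_mono k"
    "\<And>\<eta>. 0 < \<eta> \<Longrightarrow> \<exists>N. \<forall>i\<ge>N. \<forall>j\<ge>N. \<forall>w\<in>W01p \<Omega> q. W1p_norm \<Omega> q w \<le> 1 \<longrightarrow>
        \<bar>LINT x|M. (f (k i) x - f (k j) x) * w x\<bar> \<le> \<eta>"
  proof (rule L2_W01p_compact[OF domain q_bounds, of f])
    show "f n \<in> Lp \<Omega> 2" for n using fL by (simp add: Lp_2_eq_L2)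
    show "sq (f n) \<le> 1" for n using f(2) by simp
  qed (rule that)
  define e where "e n = f (k n)" for n
  have kn: "1 / real (Suc (k n)) \<le> 1 / real (Suc n)" for n
    using seq_suble[OF k(1), of n] by (intro divide_left_mono) auto
  have eE: "e n \<in> E (1 / real (Suc n))" for n using f(1)[of "k n"] E_mono[OF kn] by (auto simp: e_def)
  have eL: "e n \<in> L2 M" and e1: "sq (e n) \<le> 1" for n using fL f(2) by (simp_all add: e_def)
  have een: "energy (e n) \<le> 1 / real (Suc n) - \<nu> / 2" for n using f(3)[of "k n"] kn[of n] unfolding e_def by linarith
  obtain G where G: "\<And>n. G n \<in> convex hull (e ` {n..})" "\<And>n. G n \<in> L2 M" "\<And>n. sq (G n) \<le> 1"
    "\<And>\<epsilon>. 0 < \<epsilon> \<Longrightarrow> \<exists>N. \<forall>m\<ge>N. \<forall>n\<ge>N. (LINT x|M. (G m x - G n x)\<^sup>2) \<le> \<epsilon>"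
    by (rule L2_convex_tails_Cauchy[OF eL e1]) (rule that)
  obtain g r where g: "g \<in> L2 M" "(\<lambda>n. LINT x|M. (G n x - g x)\<^sup>2) \<longlonglongrightarrow> 0" "strict_mono (r :: nat \<Rightarrow> nat)"
    "AE x in M. (\<lambda>k. G (r k) x) \<longlonglongrightarrow> g x"
    using L2_complete[OF finite_M G(2) G(4)] by blast
  have "(\<lambda>n. nm (z (e n) - z g)) \<longlonglongrightarrow> 0"
    by (rule z_convergence[OF eL _ G(1,2) g(1,2)]) (use k(2) in \<open>simp add: e_def\<close>)
  then have "(\<lambda>n. energy (e n)) \<longlonglongrightarrow> energy g" by (rule energy_convergence[OF eL g(1)])
  moreover have "(\<lambda>n. 1 / real (Suc n) - \<nu> / 2) \<longlonglongrightarrow> 0 - \<nu> / 2"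
    by (intro tendsto_intros LIMSEQ_Suc[OF lim_1_over_n])
  ultimately have "energy g \<le> 0 - \<nu> / 2" by (rule LIMSEQ_le) (use een in blast)
  then have eg: "energy g \<le> - (\<nu> / 2)" by simp
  \<comment> \<open>Fatou's lemma along the almost everywhere convergent subsequence; an upper bound
    for the norm of g is what the conclusion calls for.\<close>
  have sg: "sq g \<le> 1"
  proof -
    note [measurable] = L2D(1)[OF G(2)] L2D(1)[OF g(1)]
    have "ennreal (sq g) = (\<integral>\<^sup>+x. ennreal ((g x)\<^sup>2) \<partial>M)"
      using L2D(2)[OF g(1)] by (intro nn_integral_eq_integral[symmetric]) auto
    also have "\<dots> = (\<integral>\<^sup>+x. liminf (\<lambda>k. ennreal ((G (r k) x)\<^sup>2)) \<partial>M)"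
    proof (rule nn_integral_cong_AE)
      show "AE x in M. ennreal ((g x)\<^sup>2) = liminf (\<lambda>k. ennreal ((G (r k) x)\<^sup>2))"
        using g(4)
      proof eventually_elim
        case (elim x)
        have "(\<lambda>k. ennreal ((G (r k) x)\<^sup>2)) \<longlonglongrightarrow> ennreal ((g x)\<^sup>2)" by (intro tendsto_intros elim)
        then show ?case by (rule lim_imp_Liminf[symmetric, rotated]) simp
      qed
    qed
    also have "\<dots> \<le> liminf (\<lambda>k. \<integral>\<^sup>+x. ennreal ((G (r k) x)\<^sup>2) \<partial>M)"
      by (rule nn_integral_liminf) measurable
    also have "\<dots> \<le> ennreal 1"
    proof (rule Liminf_le)
      have "(\<integral>\<^sup>+x. ennreal ((G (r k) x)\<^sup>2) \<partial>M) \<le> ennreal 1" for k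
      proof -
        have "(\<integral>\<^sup>+x. ennreal ((G (r k) x)\<^sup>2) \<partial>M) = ennreal (sq (G (r k)))"
          using L2D(2)[OF G(2)] by (intro nn_integral_eq_integral) auto
        then show ?thesis using ennreal_leI[OF G(3)[of "r k"]] by simp
      qed
      then show "\<forall>\<^sub>F k in sequentially. (\<integral>\<^sup>+x. ennreal ((G (r k) x)\<^sup>2) \<partial>M) \<le> ennreal 1" by simp
    qed simp
    finally show ?thesis by (subst (asm) ennreal_le_iff) auto
  qed
  \<comment> \<open>A tail of the sequence lies in one convex cone, so its hull does as well;
    letting n grow then forces g = 0 wherever d is nonzero.\<close>
  have hull: "G m \<in> E (1 / real (Suc n))" if "n \<le> m" for m n
  proof -
    have "e ` {m..} \<subseteq> E (1 / real (Suc n))"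
    proof (rule image_subsetI)
      fix i assume i: "i \<in> {m..}"
      have "1 / real (Suc i) \<le> 1 / real (Suc n)" using i that by (intro divide_left_mono) auto
      then show "e i \<in> E (1 / real (Suc n))" using eE E_mono by blast
    qed
    then have "convex hull (e ` {m..}) \<subseteq> E (1 / real (Suc n))" by (intro hull_minimal E_convex)
    then show ?thesis using G(1) by blast
  qed
  have "AE x in M. n \<le> m \<longrightarrow> (ubar x = \<alpha> x \<longrightarrow> 0 \<le> G m x) \<and> (ubar x = \<beta> x \<longrightarrow> G m x \<le> 0) \<and> (\<bar>d x\<bar> > 1 / real (Suc n) \<longrightarrow> G m x = 0)" for m n
    using hull[of n m] by (cases "n \<le> m") (simp_all add: E_iff)
  then have "AE x in M. \<forall>m n. n \<le> m \<longrightarrow> (ubar x = \<alpha> x \<longrightarrow> 0 \<le> G m x) \<and> (ubar x = \<beta> x \<longrightarrow> G m x \<le> 0) \<and> (\<bar>d x\<bar> > 1 / real (Suc n) \<longrightarrow> G m x = 0)"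
    unfolding AE_all_countable by blast
  then have lim: "AE x in M. (ubar x = \<alpha> x \<longrightarrow> 0 \<le> g x) \<and> (ubar x = \<beta> x \<longrightarrow> g x \<le> 0) \<and> (d x \<noteq> 0 \<longrightarrow> g x = 0)"
    using g(4)
  proof eventually_elim
    case (elim x)
    show ?case
    proof (intro conjI impI)
      assume "ubar x = \<alpha> x"
      then have "0 \<le> G (r k) x" for k using elim(1)[rule_format, of "r k" "r k"] by simp
      then show "0 \<le> g x" by (intro LIMSEQ_le_const[OF elim(2)]) auto
    next
      assume "ubar x = \<beta> x"
      then have "G (r k) x \<le> 0" for k using elim(1)[rule_format, of "r k" "r k"] by simp
      then show "g x \<le> 0" by (intro LIMSEQ_le_const2[OF elim(2)]) auto
    next
      assume "d x \<noteq> 0"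
      then have "0 < \<bar>d x\<bar>" unfolding zero_less_abs_iff .
      then obtain n where n: "1 / real (Suc n) < \<bar>d x\<bar>" using nat_approx_posE by blast
      have "\<forall>\<^sub>F k in sequentially. G (r k) x = 0"
        using eventually_ge_at_top[of n]
      proof eventually_elim
        case (elim k)
        then have "n \<le> r k" using seq_suble[OF g(3), of k] by linarith
        then show ?case using \<open>\<forall>m n. n \<le> m \<longrightarrow> _\<close> n by blast
      qed
      then have "(\<lambda>k. G (r k) x) \<longlonglongrightarrow> 0" by (rule tendsto_eventually)
      from LIMSEQ_unique[OF elim(2) this] show "g x = 0" .
    qed
  qed
  have "g \<in> tangent_cone \<Omega> U ubar"
    by (rule sign_tangent[OF g(1)]) (use lim in eventually_elim, simp)
  moreover have "(LINT x|M. d x * g x) = 0"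
    by (rule integral_eq_zero_AE) (use lim in \<open>eventually_elim, auto\<close>)
  ultimately have gc: "g \<in> critical_cone \<Omega> U ubar d" by (simp add: critical_cone_def)
  \<comment> \<open>With \<open>sq g\<close> at most 1 the Tikhonov term is at most \<nu>/2, which
    is exactly what the bound on the energy of g takes away.\<close>
  have "energy g + \<nu> / 2 * sq g \<le> - (\<nu> / 2) + \<nu> / 2 * 1"
    using eg sg nu by (intro add_mono mult_left_mono) auto
  then have "\<not> 0 < energy g + \<nu> / 2 * sq g" by simp
  then have "AE x in M. g x = 0" using pos[OF gc] by blast
  then have "energy g = 0" by (rule energy_null[OF g(1)])
  then show False using eg nu by simp
qed

text \<open>Critical directions lie in every enlarged cone, so coercivity on one of these cones
  reaches them; a direction that is not null has positive norm.\<close>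

lemma positivity:
  assumes c0: "0 < c0" and \<tau>: "0 < \<tau>" and coercive: "\<And>h. h \<in> E \<tau> \<Longrightarrow> c0 * sq h \<le> energy h + \<nu> / 2 * sq h"
    and h: "h \<in> critical_cone \<Omega> U ubar d" "\<not> (AE x in M. h x = 0)"
  shows "0 < energy h + \<nu> / 2 * sq h"
proof -
  have hE: "h \<in> E \<tau>" using critical_subset[OF \<tau>] h(1) by blast
  have "sq h \<noteq> 0" using sq_eq_0_iff[OF E_L2[OF hE]] h(2) by simp
  moreover have "0 \<le> sq h" by simp
  ultimately have "0 < c0 * sq h" using c0 by (intro mult_pos_pos) linarith+
  then show ?thesis using coercive[OF hE] by linarith
qed

text \<open>All three terms are finite for square-integrable h, so the sums of extended reals reduce
  to inequalities between real numbers.\<close>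

lemma second_order_equivalence:
  "(\<forall>h\<in>critical_cone \<Omega> U ubar d. \<not> (AE x in M. h x = 0) \<longrightarrow>
      ereal (Q_s \<Omega> K t a \<nu> G'' S' ubar ybar phibar h h) + ereal (Q_1 \<Omega> a S' ubar ybar phibar h h) + Q2 h > 0) \<longleftrightarrow>
   (\<exists>c0>0. \<exists>\<tau>>0. \<forall>h\<in>E \<tau>.
      ereal (Q_s \<Omega> K t a \<nu> G'' S' ubar ybar phibar h h) + ereal (Q_1 \<Omega> a S' ubar ybar phibar h h) + Q2 h
        \<ge> ereal (c0 * (Lp_norm \<Omega> 2 h)\<^sup>2))" (is "?L \<longleftrightarrow> ?R")
proof -
  have cL: "h \<in> L2 M" if "h \<in> critical_cone \<Omega> U ubar d" for h
    using that by (simp add: critical_cone_def tangent_cone_def Lp_2_eq_L2)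
  have L: "?L \<longleftrightarrow> (\<forall>h\<in>critical_cone \<Omega> U ubar d. \<not> (AE x in M. h x = 0) \<longrightarrow> 0 < energy h + \<nu> / 2 * sq h)"
    by (rule ball_cong[OF refl]) (simp only: total_eq[OF cL] ereal_less(5) zero_ereal_def ereal_less_eq less_ereal.simps)
  have R: "?R \<longleftrightarrow> (\<exists>c0>0. \<exists>\<tau>>0. \<forall>h\<in>E \<tau>. c0 * sq h \<le> energy h + \<nu> / 2 * sq h)"
  proof -
    have "(\<forall>h\<in>E \<tau>. ereal (Q_s \<Omega> K t a \<nu> G'' S' ubar ybar phibar h h) + ereal (Q_1 \<Omega> a S' ubar ybar phibar h h) + Q2 h
        \<ge> ereal (c0 * (Lp_norm \<Omega> 2 h)\<^sup>2)) \<longleftrightarrow> (\<forall>h\<in>E \<tau>. c0 * sq h \<le> energy h + \<nu> / 2 * sq h)" for c0 \<tau>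
      by (rule ball_cong[OF refl]) (simp only: total_eq[OF E_L2] ereal_less_eq Lp_norm_sq)
    then show ?thesis by simp
  qed
  show ?thesis
    unfolding L R
  proof
    assume "\<forall>h\<in>critical_cone \<Omega> U ubar d. \<not> (AE x in M. h x = 0) \<longrightarrow> 0 < energy h + \<nu> / 2 * sq h"
    then show "\<exists>c0>0. \<exists>\<tau>>0. \<forall>h\<in>E \<tau>. c0 * sq h \<le> energy h + \<nu> / 2 * sq h" by (intro coercivity) blast
  next
    assume "\<exists>c0>0. \<exists>\<tau>>0. \<forall>h\<in>E \<tau>. c0 * sq h \<le> energy h + \<nu> / 2 * sq h"
    then show "\<forall>h\<in>critical_cone \<Omega> U ubar d. \<not> (AE x in M. h x = 0) \<longrightarrow> 0 < energy h + \<nu> / 2 * sq h"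
      using positivity by blast
  qed
qed

end

theorem proposition5p11:
  fixes \<Omega> :: "(real^'n) set"
    and b \<alpha> \<beta> ubar ybar phibar :: "real^'n \<Rightarrow> real"
    and bmin \<gamma> \<nu> \<delta> p pbar :: real
    and K :: nat and t :: "nat \<Rightarrow> real" and ai :: "nat \<Rightarrow> real \<Rightarrow> real" and a :: "real \<Rightarrow> real"
    and G :: "(real^'n \<Rightarrow> real) \<Rightarrow> real"
    and G' :: "(real^'n \<Rightarrow> real) \<Rightarrow> (real^'n \<Rightarrow> real) \<Rightarrow> real"
    and G'' :: "(real^'n \<Rightarrow> real) \<Rightarrow> (real^'n \<Rightarrow> real) \<Rightarrow> (real^'n \<Rightarrow> real) \<Rightarrow> real"
    and S :: "((real^'n \<Rightarrow> real) \<Rightarrow> real) \<Rightarrow> real^'n \<Rightarrow> real"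
    and S' :: "((real^'n \<Rightarrow> real) \<Rightarrow> real) \<Rightarrow> ((real^'n \<Rightarrow> real) \<Rightarrow> real) \<Rightarrow> real^'n \<Rightarrow> real"
  assumes dim: "CARD('n) \<in> {2, 3}"
    and domain: "open \<Omega>" "convex \<Omega>" "bounded \<Omega>" "\<Omega> \<noteq> {}"
    and b: "\<exists>L. L-lipschitz_on (closure \<Omega>) b" "0 < bmin" "\<forall>x\<in>closure \<Omega>. bmin \<le> b x"
    and a: "finitely_PC2 K t ai a"
    and G: "C2_functional (H10 \<Omega>) (H1_norm \<Omega>) G G' G''"
    and nu: "0 < \<nu>"
    and bounds: "\<alpha> \<in> Linf \<Omega>" "\<beta> \<in> Linf \<Omega>" "0 < \<gamma>" "AE x in lebesgue_on \<Omega>. \<gamma> \<le> \<beta> x - \<alpha> x"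
    and delta: "0 < \<delta>" "\<forall>i\<in>{1..<K}. \<delta> \<le> (t (i + 1) - t i) / 2"
    and p: "real CARD('n) < p" "p < 6"
    and S: "control_to_state \<Omega> b a p S"
    and S': "\<forall>F\<in>Wm1p \<Omega> p.
       has_frechet_derivative (Wm1p \<Omega> p) (Wm1p_norm \<Omega> p) (W01p \<Omega> p) (W1p_norm \<Omega> p) S (S' F) F"
    and feasible: "ubar \<in> Uad \<Omega> \<alpha> \<beta>"
    and ybar: "ybar = S (fnl \<Omega> ubar)"
    and G'_regular: "real CARD('n) < pbar"
       "\<exists>g\<in>Lp \<Omega> pbar. \<forall>w\<in>H10 \<Omega>. G' ybar w = fnl \<Omega> g w"
    and Sigma_finite: "jump_functional \<Omega> K t ai ybar < \<infinity>"
    and phibar: "phibar \<in> H10 \<Omega> \<inter> W1inf \<Omega>"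
    and adjoint: "weak_adjoint_solution \<Omega> b K t a ybar (G' ybar) phibar"
    and variational_ineq: "\<forall>u\<in>Uad \<Omega> \<alpha> \<beta>.
       0 \<le> (LINT x|lebesgue_on \<Omega>. (phibar x + \<nu> * ubar x) * (u x - ubar x))"
  shows "(\<forall>h\<in>critical_cone \<Omega> (Uad \<Omega> \<alpha> \<beta>) ubar (phibar + \<nu> *\<^sub>R ubar).
            \<not> (AE x in lebesgue_on \<Omega>. h x = 0) \<longrightarrow>
            ereal (Q_s \<Omega> K t a \<nu> G'' S' ubar ybar phibar h h) +
            ereal (Q_1 \<Omega> a S' ubar ybar phibar h h) +
            Q_2 \<Omega> K t ai \<delta> S ubar ybar phibar h > 0) \<longleftrightarrow>
         (\<exists>c0>0. \<exists>\<tau>>0.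
            \<forall>h\<in>extended_critical_cone \<Omega> \<alpha> \<beta> ubar (phibar + \<nu> *\<^sub>R ubar) \<tau>.
              ereal (Q_s \<Omega> K t a \<nu> G'' S' ubar ybar phibar h h) +
              ereal (Q_1 \<Omega> a S' ubar ybar phibar h h) +
              Q_2 \<Omega> K t ai \<delta> S ubar ybar phibar h \<ge> ereal (c0 * (Lp_norm \<Omega> 2 h)\<^sup>2))"
proof -
  have ubar: "ubar \<in> Linf \<Omega>" using feasible by (simp add: Uad_def)
  interpret stationary_point K t ai a \<Omega> b ubar ybar phibar \<nu> \<delta> p G G' G'' S S' \<alpha> \<beta> \<gamma>
    by unfold_locales (fact a dim domain G delta(1) p S S' ubar ybar Sigma_finite phibar nu bounds feasible variational_ineq)+
  show ?thesis by (rule second_order_equivalence)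
qed

end
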